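(* Let $\Omega\subset\mathbb{R}^4$ be a smooth bounded domain, $a>0$, $p\in(2,4)$, and $b>S^{-2}$. Let $\lambda_0>0$ be such that $$\sup_{n\in\mathbb{N}}\ \inf_{u\in W_0^{1,2}(\Omega)} I_{\lambda,n}(u)<0\quad\text{for each }\lambda>\lambda_0$$ (such a $\lambda_0$ exists). Then, for each $\lambda>\lambda_0$, the problem $$-\Big(a+b\int_\Omega|\nabla u|^2dx\Big)\Delta u=u^3+\lambda u^{p-1}\ \text{in }\Omega,\qquad u>0\ \text{in }\Omega,\qquad u=0\ \text{on }\partial\Omega$$ has at least one (weak) solution which is a global minimizer of $I_\lambda$ on $W_0^{1,2}(\Omega)$.
   Context: Notation: $\|u\|_m=(\int_\Omega|u|^m dx)^{1/m}$ for $m\in[1,4]$, $\|u\|=\|\nabla u\|_2$, and $S=\inf\{\int_\Omega|\nabla u|^2dx: u\in W_0^{1,2}(\Omega),\ \int_\Omega u^4dx=1\}$. For $\lambda>0$, the energy functional $I_\lambda:W_0^{1,2}(\Omega)\to\mathbb{R}$ is $I_\lambda(u)=\frac a2\|u\|^2+\frac b4\|u\|^4-\frac14\|u\|_4^4-\frac\lambda p\|u\|_p^p$. A sequence $\{\sigma_n\}_{n\in\mathbb{N}}\subset(0,4-p)$ with $\sigma_n\to0$ is fixed, and $I_{\lambda,n}(u)=\frac a2\|u\|^2+\frac{b}{4-\sigma_n}\|u\|^{4-\sigma_n}-\frac1{4-\sigma_n}\|u\|_{4-\sigma_n}^{4-\sigma_n}-\frac\lambda p\|u\|_p^p$ for $u\in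 W_0^{1,2}(\Omega)$. A (weak) solution of the problem is a function $u\in W_0^{1,2}(\Omega)$, $u>0$ in $\Omega$, such that $(a+b\int_\Omega|\nabla u|^2dx)\int_\Omega\nabla u\nabla v\,dx-\int_\Omega u^3v\,dx-\lambda\int_\Omega u^{p-1}v\,dx=0$ for all $v\in W_0^{1,2}(\Omega)$. *)

theory Defs
  imports "HOL-Analysis.Analysis"
begin

text \<open>Functions of class \<open>C\<^sup>k\<close> on an open set \<open>S\<close>. The recursion runs over all directional
  derivatives, which in finite dimension gives the usual notion.\<close>

fun Ck_on :: "nat \<Rightarrow> 'a::euclidean_space set \<Rightarrow> ('a \<Rightarrow> real) \<Rightarrow> bool" where
  "Ck_on 0 S f \<longleftrightarrow> continuous_on S f"
| "Ck_on (Suc k) S f \<longleftrightarrow>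
     (\<forall>x\<in>S. f differentiable (at x)) \<and>
     (\<forall>v. Ck_on k S (\<lambda>x. frechet_derivative f (at x) v))"

definition smooth_on :: "'a::euclidean_space set \<Rightarrow> ('a \<Rightarrow> real) \<Rightarrow> bool" where
  "smooth_on S f \<longleftrightarrow> (\<forall>k. Ck_on k S f)"

text \<open>Near each boundary point, after a choice of orthonormal axes with last axis \<open>e\<close>, the
  domain is the region strictly above the graph of a smooth function of the remaining
  coordinates; \<open>x - (x \<bullet> e) *\<^sub>R e\<close> is the projection of \<open>x\<close> to the hyperplane of these
  coordinates, so only the values of \<open>\<gamma>\<close> on that hyperplane matter.\<close>

definition smooth_boundary :: "'a::euclidean_space set \<Rightarrow> bool" where
  "smooth_boundary \<Omega> \<longleftrightarrow>
     (\<forall>x0\<in>frontier \<Omega>. \<exists>r>0. \<exists>e \<gamma>. norm e = 1 \<and> smooth_on UNIV \<gamma> \<and>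
        \<Omega> \<inter> ball x0 r = {x \<in> ball x0 r. x \<bullet> e > \<gamma> (x - (x \<bullet> e) *\<^sub>R e)})"

definition smooth_bounded_domain :: "'a::euclidean_space set \<Rightarrow> bool" where
  "smooth_bounded_domain \<Omega> \<longleftrightarrow>
     open \<Omega> \<and> connected \<Omega> \<and> \<Omega> \<noteq> {} \<and> bounded \<Omega> \<and> smooth_boundary \<Omega>"

definition test_functions :: "'a::euclidean_space set \<Rightarrow> ('a \<Rightarrow> real) set" where
  "test_functions \<Omega> =
     {\<phi>. smooth_on UNIV \<phi> \<and> (\<exists>K. compact K \<and> K \<subseteq> \<Omega> \<and> (\<forall>x. x \<notin> K \<longrightarrow> \<phi> x = 0))}"

text \<open>Elements of Lebesgue and Sobolev spaces are represented by functions on the whole space;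
  only their restrictions to \<open>\<Omega>\<close>, up to null sets, are relevant.\<close>

definition in_Lp ::
    "'a::euclidean_space set \<Rightarrow> real \<Rightarrow> ('a \<Rightarrow> 'b::euclidean_space) \<Rightarrow> bool" where
  "in_Lp \<Omega> m f \<longleftrightarrow> f \<in> borel_measurable (lebesgue_on \<Omega>) \<and>
     integrable (lebesgue_on \<Omega>) (\<lambda>x. norm (f x) powr m)"

definition Lnorm ::
    "'a::euclidean_space set \<Rightarrow> real \<Rightarrow> ('a \<Rightarrow> 'b::euclidean_space) \<Rightarrow> real" where
  "Lnorm \<Omega> m f = (LINT x|lebesgue_on \<Omega>. norm (f x) powr m) powr (1 / m)"

definition locally_integrable_on ::
    "'a::euclidean_space set \<Rightarrow> ('a \<Rightarrow> 'b::euclidean_space) \<Rightarrow> bool" where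
  "locally_integrable_on \<Omega> f \<longleftrightarrow>
     (\<forall>K. compact K \<and> K \<subseteq> \<Omega> \<longrightarrow> integrable (lebesgue_on K) f)"

definition has_weak_gradient ::
    "'a::euclidean_space set \<Rightarrow> ('a \<Rightarrow> real) \<Rightarrow> ('a \<Rightarrow> 'a) \<Rightarrow> bool" where
  "has_weak_gradient \<Omega> u G \<longleftrightarrow>
     locally_integrable_on \<Omega> u \<and> locally_integrable_on \<Omega> G \<and>
     (\<forall>\<phi>\<in>test_functions \<Omega>. \<forall>i\<in>Basis.
        (LINT x|lebesgue_on \<Omega>. u x * frechet_derivative \<phi> (at x) i) =
        - (LINT x|lebesgue_on \<Omega>. (G x \<bullet> i) * \<phi> x))"

text \<open>The weak gradient is unique up to null sets of \<open>\<Omega>\<close>, so the choice is immaterial.\<close>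

definition wgrad :: "'a::euclidean_space set \<Rightarrow> ('a \<Rightarrow> real) \<Rightarrow> 'a \<Rightarrow> 'a" where
  "wgrad \<Omega> u = (SOME G. has_weak_gradient \<Omega> u G)"

definition W12 :: "'a::euclidean_space set \<Rightarrow> ('a \<Rightarrow> real) set" where
  "W12 \<Omega> = {u. in_Lp \<Omega> 2 u \<and> (\<exists>G. has_weak_gradient \<Omega> u G \<and> in_Lp \<Omega> 2 G)}"

definition W12_norm :: "'a::euclidean_space set \<Rightarrow> ('a \<Rightarrow> real) \<Rightarrow> real" where
  "W12_norm \<Omega> u = sqrt ((Lnorm \<Omega> 2 u)\<^sup>2 + (Lnorm \<Omega> 2 (wgrad \<Omega> u))\<^sup>2)"

definition W012 :: "'a::euclidean_space set \<Rightarrow> ('a \<Rightarrow> real) set" where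
  "W012 \<Omega> = {u \<in> W12 \<Omega>. \<exists>\<phi>. (\<forall>n::nat. \<phi> n \<in> test_functions \<Omega>) \<and>
     (\<lambda>n. W12_norm \<Omega> (\<lambda>x. u x - \<phi> n x)) \<longlonglongrightarrow> 0}"

definition Dnorm :: "'a::euclidean_space set \<Rightarrow> ('a \<Rightarrow> real) \<Rightarrow> real" where
  "Dnorm \<Omega> u = Lnorm \<Omega> 2 (wgrad \<Omega> u)"

definition Sobolev_const :: "'a::euclidean_space set \<Rightarrow> real" where
  "Sobolev_const \<Omega> = Inf {(LINT x|lebesgue_on \<Omega>. (norm (wgrad \<Omega> u x))\<^sup>2) | u.
     u \<in> W012 \<Omega> \<and> (LINT x|lebesgue_on \<Omega>. u x ^ 4) = 1}"

definition energy ::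
    "'a::euclidean_space set \<Rightarrow> real \<Rightarrow> real \<Rightarrow> real \<Rightarrow> real \<Rightarrow> ('a \<Rightarrow> real) \<Rightarrow> real" where
  "energy \<Omega> a b p lam u =
     a / 2 * Dnorm \<Omega> u ^ 2 + b / 4 * Dnorm \<Omega> u ^ 4
     - 1 / 4 * Lnorm \<Omega> 4 u ^ 4 - lam / p * Lnorm \<Omega> p u powr p"

definition energy_approx ::
    "'a::euclidean_space set \<Rightarrow> real \<Rightarrow> real \<Rightarrow> real \<Rightarrow> (nat \<Rightarrow> real) \<Rightarrow> real \<Rightarrow> nat
      \<Rightarrow> ('a \<Rightarrow> real) \<Rightarrow> real" where
  "energy_approx \<Omega> a b p \<sigma> lam n u =
     a / 2 * Dnorm \<Omega> u ^ 2 + b / (4 - \<sigma> n) * Dnorm \<Omega> u powr (4 - \<sigma> n)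
     - 1 / (4 - \<sigma> n) * Lnorm \<Omega> (4 - \<sigma> n) u powr (4 - \<sigma> n)
     - lam / p * Lnorm \<Omega> p u powr p"

text \<open>Infimum and supremum are taken in the extended reals, as the approximating functionals
  need not be bounded below for every \<open>n\<close>.\<close>

definition negative_threshold ::
    "'a::euclidean_space set \<Rightarrow> real \<Rightarrow> real \<Rightarrow> real \<Rightarrow> (nat \<Rightarrow> real) \<Rightarrow> real \<Rightarrow> bool" where
  "negative_threshold \<Omega> a b p \<sigma> lam0 \<longleftrightarrow> lam0 > 0 \<and>
     (\<forall>lam>lam0. (SUP n. INF u\<in>W012 \<Omega>. ereal (energy_approx \<Omega> a b p \<sigma> lam n u)) < 0)"

text \<open>Positivity is understood almost everywhere, as usual for Sobolev functions; the zero
  boundary condition is membership in \<open>W012\<close>.\<close>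

definition weak_solution ::
    "'a::euclidean_space set \<Rightarrow> real \<Rightarrow> real \<Rightarrow> real \<Rightarrow> real \<Rightarrow> ('a \<Rightarrow> real) \<Rightarrow> bool" where
  "weak_solution \<Omega> a b p lam u \<longleftrightarrow>
     u \<in> W012 \<Omega> \<and> (AE x in lebesgue_on \<Omega>. u x > 0) \<and>
     (\<forall>v\<in>W012 \<Omega>.
        (a + b * (LINT x|lebesgue_on \<Omega>. (norm (wgrad \<Omega> u x))\<^sup>2))
          * (LINT x|lebesgue_on \<Omega>. wgrad \<Omega> u x \<bullet> wgrad \<Omega> v x)
        - (LINT x|lebesgue_on \<Omega>. u x ^ 3 * v x)
        - lam * (LINT x|lebesgue_on \<Omega>. u x powr (p - 1) * v x) = 0)"

end

theory Submission imports Defs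
begin

text \<open>
  Since \<open>b > S\<^sup>-\<^sup>2\<close>, the nonlocal term \<open>b |u|\<^sup>4 / 4\<close> dominates the critical term, so \<open>I\<^sub>\<lambda>\<close> itself is
  coercive and lower semicontinuous along bounded sequences that converge almost everywhere, and it
  can be minimized directly. Replacing \<open>\<phi>\<close> by \<open>sqrt (\<phi>\<^sup>2 + \<epsilon>\<^sup>2) - \<epsilon>\<close> yields a minimizing sequence of
  nonnegative test functions, and Rellich's theorem provides the limit. The approximating functionals
  only serve to show that the minimum is negative, so that the minimizer is not zero. By the
  Euler--Lagrange equation the minimizer is weakly superharmonic, and the monotonicity of its radial
  averages makes it positive. The Sobolev inequality, which gives \<open>S > 0\<close>, comes from the
  Loomis--Whitney inequality.
\<close>

subsection \<open>Square-integrable functions\<close>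

text \<open>In dimension four the exponent 4 is critical: \<open>W012\<close> embeds into L^4, but
  not compactly, so a minimizing sequence may lose part of its quartic integral in the limit. The
  nonlocal term has the same degree four and pays for the loss: a lost amount of that integral
  carries at least \<open>S\<^sup>2\<close> times as much in the fourth power of the gradient norm,
  and \<open>b * S\<^sup>2 > 1\<close> makes the exchange unfavourable. The power p < 4 is of lower
  order and can be absorbed at an arbitrarily small cost. As \<open>W012\<close> is a closure of
  test functions, inequalities are proved for test functions and carried over along an a.e.
  convergent subsequence by Fatou's lemma. Neither weak compactness nor differentiability of the
  energy is invoked: weak limits come from a penalised minimum problem, and convexity of the
  nonlinear terms gives the first variation from one-sided bounds.\<close>

definition sqint :: "'a measure \<Rightarrow> ('a \<Rightarrow> 'b::euclidean_space) \<Rightarrow> bool" where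
  "sqint M f \<longleftrightarrow> f \<in> borel_measurable M \<and> integrable M (\<lambda>x. (norm (f x))\<^sup>2)"

text \<open>\<open>Lnorm\<close> at exponent 2 over an arbitrary measure: the same lemmas then serve
  \<open>lborel\<close> and \<open>lebesgue_on \<Omega>\<close>, functions and gradients.\<close>

definition l2 :: "'a measure \<Rightarrow> ('a \<Rightarrow> 'b::euclidean_space) \<Rightarrow> real" where
  "l2 M f = sqrt (LINT x|M. (norm (f x))\<^sup>2)"

lemma sqint_measurable: "sqint M f \<Longrightarrow> f \<in> borel_measurable M"
  and sqint_integrable: "sqint M f \<Longrightarrow> integrable M (\<lambda>x. (norm (f x))\<^sup>2)"
  by (auto simp: sqint_def)

lemma l2_nonneg [simp]: "0 \<le> l2 M f"
  by (simp add: l2_def)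

lemma l2_sq: "(l2 M f)\<^sup>2 = (LINT x|M. (norm (f x))\<^sup>2)"
  by (simp add: l2_def)

lemma norm_add_sq_le:
  fixes a b :: "'a::real_inner"
  shows "(norm (a + b))\<^sup>2 \<le> 2 * (norm a)\<^sup>2 + 2 * (norm b)\<^sup>2"
proof -
  have "0 \<le> (norm (a - b))\<^sup>2" by simp
  then show ?thesis
    by (simp add: power2_norm_eq_inner inner_simps inner_commute)
qed

lemma sqint_dominated:
  assumes "f \<in> borel_measurable M" "integrable M g" "\<And>x. (norm (f x))\<^sup>2 \<le> g x"
  shows "sqint M f"
  unfolding sqint_def
proof (intro conjI assms(1) Bochner_Integration.integrable_bound[OF assms(2)])
  show "(\<lambda>x. (norm (f x))\<^sup>2) \<in> borel_measurable M"
    using assms(1) by measurable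
  show "AE x in M. norm ((norm (f x))\<^sup>2) \<le> norm (g x)"
  proof (intro AE_I2)
    fix x
    show "norm ((norm (f x))\<^sup>2) \<le> norm (g x)" using assms(3)[of x] by simp
  qed
qed

lemma sqint_add:
  assumes "sqint M f" "sqint M g"
  shows "sqint M (\<lambda>x. f x + g x)"
proof (rule sqint_dominated)
  show "(\<lambda>x. f x + g x) \<in> borel_measurable M"
    using assms by (auto simp: sqint_def)
  show "integrable M (\<lambda>x. 2 * (norm (f x))\<^sup>2 + 2 * (norm (g x))\<^sup>2)"
    using assms by (auto simp: sqint_def)
qed (rule norm_add_sq_le)

lemma sqint_scaleR:
  assumes "sqint M f"
  shows "sqint M (\<lambda>x. c *\<^sub>R f x)"
  using assms by (auto simp: sqint_def power_mult_distrib)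

lemma sqint_uminus:
  assumes "sqint M f"
  shows "sqint M (\<lambda>x. - f x)"
  using assms by (auto simp: sqint_def)

lemma sqint_diff:
  assumes "sqint M f" "sqint M g"
  shows "sqint M (\<lambda>x. f x - g x)"
  using sqint_add[OF assms(1) sqint_uminus[OF assms(2)]] by simp

lemma sqint_norm:
  assumes "sqint M f"
  shows "sqint M (\<lambda>x. norm (f x))"
  using assms by (auto simp: sqint_def)

lemma sqint_zero [simp]: "sqint M (\<lambda>x. 0)"
  by (simp add: sqint_def)

lemma sqint_cong_AE:
  assumes "sqint M f" "g \<in> borel_measurable M" "AE x in M. f x = g x"
  shows "sqint M g"
proof -
  have "integrable M (\<lambda>x. (norm (f x))\<^sup>2) \<longleftrightarrow> integrable M (\<lambda>x. (norm (g x))\<^sup>2)"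
    using assms by (intro integrable_cong_AE) (auto simp: sqint_def)
  then show ?thesis using assms by (auto simp: sqint_def)
qed

lemma l2_cong_AE:
  assumes "f \<in> borel_measurable M" "g \<in> borel_measurable M" "AE x in M. f x = g x"
  shows "l2 M f = l2 M g"
  unfolding l2_def using assms by (intro arg_cong[where f=sqrt] integral_cong_AE) auto

lemma sqint_integrable_inner:
  assumes "sqint M f" "sqint M g"
  shows "integrable M (\<lambda>x. f x \<bullet> g x)"
proof (rule Bochner_Integration.integrable_bound)
  show "integrable M (\<lambda>x. (norm (f x))\<^sup>2 + (norm (g x))\<^sup>2)"
    using assms by (auto simp: sqint_def)
  show "(\<lambda>x. f x \<bullet> g x) \<in> borel_measurable M"
    using assms by (auto simp: sqint_def)
  have "\<bar>f x \<bullet> g x\<bar> \<le> (norm (f x))\<^sup>2 + (norm (g x))\<^sup>2" for x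
  proof -
    have "\<bar>f x \<bullet> g x\<bar> \<le> norm (f x) * norm (g x)" by (rule Cauchy_Schwarz_ineq2)
    also have "\<dots> \<le> (norm (f x))\<^sup>2 + (norm (g x))\<^sup>2"
    proof -
      have "2 * norm (f x) * norm (g x) \<le> (norm (f x))\<^sup>2 + (norm (g x))\<^sup>2" by (rule sum_squares_bound)
      moreover have "0 \<le> norm (f x) * norm (g x)" by simp
      ultimately show ?thesis by linarith
    qed
    finally show ?thesis .
  qed
  then show "AE x in M. norm (f x \<bullet> g x) \<le> norm ((norm (f x))\<^sup>2 + (norm (g x))\<^sup>2)"
    by (intro AE_I2) simp
qed

lemma sqint_integrable_mult:
  fixes f g :: "'a \<Rightarrow> real"
  assumes "sqint M f" "sqint M g"
  shows "integrable M (\<lambda>x. f x * g x)"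
  using sqint_integrable_inner[OF assms] by simp

text \<open>Keeping \<open>c\<close> free makes the square a quadratic polynomial: its sign gives
  Cauchy-Schwarz, the values 1 and -1 the triangle and parallelogram laws, and a variable
  \<open>c\<close> the first variation of the energy.\<close>

lemma l2_sq_add:
  assumes "sqint M f" "sqint M g"
  shows "(l2 M (\<lambda>x. f x + c *\<^sub>R g x))\<^sup>2 =
    (l2 M f)\<^sup>2 + 2 * c * (LINT x|M. f x \<bullet> g x) + c\<^sup>2 * (l2 M g)\<^sup>2"
proof -
  have eq: "(norm (f x + c *\<^sub>R g x))\<^sup>2 = (norm (f x))\<^sup>2 + (2 * c) * (f x \<bullet> g x) + c\<^sup>2 * (norm (g x))\<^sup>2" for x
    unfolding power2_norm_eq_inner
    by (simp add: inner_simps inner_commute power2_eq_square algebra_simps)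
  show ?thesis
    unfolding l2_sq eq
    using sqint_integrable[OF assms(1)] sqint_integrable[OF assms(2)] sqint_integrable_inner[OF assms]
    by simp
qed

lemma l2_Cauchy_Schwarz:
  assumes "sqint M f" "sqint M g"
  shows "\<bar>LINT x|M. f x \<bullet> g x\<bar> \<le> l2 M f * l2 M g"
proof -
  define A B C where "A = (l2 M f)\<^sup>2" and "B = (LINT x|M. f x \<bullet> g x)" and "C = (l2 M g)\<^sup>2"
  have pos: "0 \<le> A + 2 * c * B + c\<^sup>2 * C" for c
    using l2_sq_add[OF assms, of c] by (simp add: A_def B_def C_def) (metis zero_le_power2)
  have "A \<ge> 0" "C \<ge> 0" by (auto simp: A_def C_def)
  have "B\<^sup>2 \<le> A * C"
  proof (cases "C = 0")
    case True
    have "B = 0"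
    proof (rule ccontr)
      \<comment> \<open>With \<open>C = 0\<close> the polynomial is affine in \<open>c\<close>; a
        nonzero slope would let it reach the value -1.\<close>
      assume "B \<noteq> 0"
      then have "A + 2 * (- (A + 1) / (2 * B)) * B = - 1" by (simp add: field_simps)
      then show False using pos[of "- (A + 1) / (2 * B)"] True by simp
    qed
    then show ?thesis using True by simp
  next
    case False
    then have "C > 0" using \<open>C \<ge> 0\<close> by simp
    have "0 \<le> A + 2 * (- B / C) * B + (- B / C)\<^sup>2 * C" by (rule pos)
    also have "\<dots> = A - B\<^sup>2 / C" using \<open>C > 0\<close> by (simp add: field_simps power2_eq_square)
    finally show ?thesis using \<open>C > 0\<close> by (simp add: field_simps)
  qed
  then have "B\<^sup>2 \<le> (l2 M f * l2 M g)\<^sup>2" by (simp add: A_def C_def power_mult_distrib)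
  then show ?thesis unfolding B_def
    using abs_le_square_iff by (metis abs_of_nonneg l2_nonneg mult_nonneg_nonneg)
qed

lemma l2_Cauchy_Schwarz_mult:
  fixes f g :: "'a \<Rightarrow> real"
  assumes "sqint M f" "sqint M g"
  shows "\<bar>LINT x|M. f x * g x\<bar> \<le> l2 M f * l2 M g"
  using l2_Cauchy_Schwarz[OF assms] by simp

lemma l2_triangle:
  assumes "sqint M f" "sqint M g"
  shows "l2 M (\<lambda>x. f x + g x) \<le> l2 M f + l2 M g"
proof (rule power2_le_imp_le)
  show "(l2 M (\<lambda>x. f x + g x))\<^sup>2 \<le> (l2 M f + l2 M g)\<^sup>2"
    using l2_sq_add[OF assms, of 1] l2_Cauchy_Schwarz[OF assms] by (simp add: power2_sum)
qed simp

lemma l2_uminus [simp]: "l2 M (\<lambda>x. - f x) = l2 M f"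
  by (simp add: l2_def)

lemma l2_minus_commute: "l2 M (\<lambda>x. f x - g x) = l2 M (\<lambda>x. g x - f x)"
  by (simp add: l2_def norm_minus_commute)

lemma l2_scaleR: "l2 M (\<lambda>x. c *\<^sub>R f x) = \<bar>c\<bar> * l2 M f"
  by (simp add: l2_def power_mult_distrib real_sqrt_mult)

lemma l2_triangle_diff:
  assumes "sqint M f" "sqint M g" "sqint M k"
  shows "l2 M (\<lambda>x. f x - k x) \<le> l2 M (\<lambda>x. f x - g x) + l2 M (\<lambda>x. g x - k x)"
  using l2_triangle[OF sqint_diff[OF assms(1,2)] sqint_diff[OF assms(2,3)]] by simp

lemma l2_diff_le:
  assumes "sqint M f" "sqint M g"
  shows "\<bar>l2 M f - l2 M g\<bar> \<le> l2 M (\<lambda>x. f x - g x)"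
  using l2_triangle_diff[OF assms sqint_zero] l2_triangle_diff[OF assms(2,1) sqint_zero]
  by (simp add: l2_minus_commute[of M g f])

lemma l2_tendsto:
  assumes "\<And>n. sqint M (f n)" "sqint M g" "(\<lambda>n. l2 M (\<lambda>x. f n x - g x)) \<longlonglongrightarrow> 0"
  shows "(\<lambda>n. l2 M (f n)) \<longlonglongrightarrow> l2 M g"
proof (rule LIM_zero_cancel, rule Lim_null_comparison[OF _ assms(3)])
  show "\<forall>\<^sub>F n in sequentially. norm (l2 M (f n) - l2 M g) \<le> l2 M (\<lambda>x. f n x - g x)"
    using l2_diff_le[OF assms(1,2)] by (intro always_eventually) auto
qed

lemma l2_inner_tendsto:
  assumes "\<And>n. sqint M (f n)" "sqint M g" "sqint M k"
    and "(\<lambda>n. l2 M (\<lambda>x. f n x - g x)) \<longlonglongrightarrow> 0"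
  shows "(\<lambda>n. LINT x|M. f n x \<bullet> k x) \<longlonglongrightarrow> (LINT x|M. g x \<bullet> k x)"
proof (rule LIM_zero_cancel, rule Lim_null_comparison)
  have "norm ((LINT x|M. f n x \<bullet> k x) - (LINT x|M. g x \<bullet> k x)) \<le> l2 M (\<lambda>x. f n x - g x) * l2 M k" for n
  proof -
    have "(LINT x|M. f n x \<bullet> k x) - (LINT x|M. g x \<bullet> k x) = (LINT x|M. (f n x - g x) \<bullet> k x)"
      using sqint_integrable_inner[OF assms(1,3)] sqint_integrable_inner[OF assms(2,3)]
      by (simp add: inner_diff_left)
    then show ?thesis
      using l2_Cauchy_Schwarz[OF sqint_diff[OF assms(1,2)] assms(3), of n] by simp
  qed
  then show "\<forall>\<^sub>F n in sequentially. norm ((LINT x|M. f n x \<bullet> k x) - (LINT x|M. g x \<bullet> k x))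
      \<le> l2 M (\<lambda>x. f n x - g x) * l2 M k"
    by simp
  show "(\<lambda>n. l2 M (\<lambda>x. f n x - g x) * l2 M k) \<longlonglongrightarrow> 0"
    using tendsto_mult_left_zero[OF assms(4)] by simp
qed

text \<open>The bound \<open>B\<close> may depend on n, so an energy inequality along a sequence
  passes to the limit although the integrals themselves need not converge.\<close>

lemma Fatou_real:
  fixes f :: "nat \<Rightarrow> 'a \<Rightarrow> real"
  assumes "\<And>n. integrable M (f n)" "g \<in> borel_measurable M"
    and "\<And>n. AE x in M. 0 \<le> f n x"
    and lim: "AE x in M. (\<lambda>n. f n x) \<longlonglongrightarrow> g x"
    and le: "\<And>n. (LINT x|M. f n x) \<le> B n" and B: "B \<longlonglongrightarrow> b"
  shows "integrable M g" "(LINT x|M. g x) \<le> b"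
proof -
  have nn: "(\<integral>\<^sup>+x. ennreal (f n x) \<partial>M) = ennreal (LINT x|M. f n x)" for n
    using assms(1,3) by (intro nn_integral_eq_integral) auto
  have b0: "0 \<le> B n" for n
    using le[of n] integral_nonneg_AE[OF assms(3)] by (metis order_trans)
  have AEall: "AE x in M. \<forall>n. 0 \<le> f n x" using assms(3) by (simp add: AE_all_countable)
  have g0: "AE x in M. 0 \<le> g x"
    using AEall lim by eventually_elim (auto intro: LIMSEQ_le_const)
  have "(\<integral>\<^sup>+x. ennreal (g x) \<partial>M) = (\<integral>\<^sup>+x. liminf (\<lambda>n. ennreal (f n x)) \<partial>M)"
  proof (rule nn_integral_cong_AE)
    show "AE x in M. ennreal (g x) = liminf (\<lambda>n. ennreal (f n x))"
      using lim
    proof eventually_elim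
      case (elim x)
      then have "(\<lambda>n. ennreal (f n x)) \<longlonglongrightarrow> ennreal (g x)" by (rule tendsto_ennrealI)
      then show ?case by (simp add: lim_imp_Liminf)
    qed
  qed
  also have "\<dots> \<le> liminf (\<lambda>n. \<integral>\<^sup>+x. ennreal (f n x) \<partial>M)"
    using assms(1) by (intro nn_integral_liminf) auto
  also have "\<dots> \<le> liminf (\<lambda>n. ennreal (B n))"
    by (intro Liminf_mono always_eventually allI) (auto simp: nn intro!: ennreal_leI le)
  also have "\<dots> = ennreal b"
    using tendsto_ennrealI[OF B] by (simp add: lim_imp_Liminf)
  finally have *: "(\<integral>\<^sup>+x. ennreal (g x) \<partial>M) \<le> ennreal b" .
  show int: "integrable M g"
    using * g0 assms(2) by (intro integrableI_nonneg) (auto intro: le_less_trans)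
  have "b \<ge> 0" using LIMSEQ_le_const[OF B] b0 by blast
  with * show "(LINT x|M. g x) \<le> b"
    using nn_integral_eq_integral[OF int g0] by (simp add: ennreal_le_iff)
qed

section \<open>Completeness of the space of square-integrable functions\<close>

lemma ennreal_le_suminf:
  fixes f :: "nat \<Rightarrow> ennreal"
  shows "f k \<le> suminf f"
  using sum_le_suminf[OF summableI, of "{k}" f] by simp

text \<open>The weight \<open>2^k\<close> is affordable since \<open>2^k * (1/8)^k\<close> is
  summable. Hence the weighted series is finite a.e., the squared k-th increment is at most a
  constant times \<open>(1/2)^k\<close>, and the telescoping series converges absolutely.\<close>

lemma AE_tendsto_of_fast:
  fixes f :: "nat \<Rightarrow> 'a \<Rightarrow> 'b::euclidean_space"
  assumes sq: "\<And>n. sqint M (f n)" and fast: "\<And>k. (l2 M (\<lambda>x. f (Suc k) x - f k x))\<^sup>2 \<le> (1/8)^k"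
  shows "AE x in M. convergent (\<lambda>n. f n x)"
proof -
  have meas [measurable]: "\<And>n. f n \<in> borel_measurable M" using sq by (auto simp: sqint_def)
  let ?d = "\<lambda>k x. (norm (f (Suc k) x - f k x))\<^sup>2"
  have "(\<integral>\<^sup>+x. (\<Sum>k. ennreal (2^k * ?d k x)) \<partial>M) = (\<Sum>k. \<integral>\<^sup>+x. ennreal (2^k * ?d k x) \<partial>M)"
    by (rule nn_integral_suminf) measurable
  also have "\<dots> \<le> (\<Sum>k. ennreal ((1/4)^k))"
  proof (intro suminf_le)
    fix k
    have "(\<integral>\<^sup>+x. ennreal (2^k * ?d k x) \<partial>M) = ennreal (2^k * (l2 M (\<lambda>x. f (Suc k) x - f k x))\<^sup>2)"
      unfolding l2_sq using sqint_integrable[OF sqint_diff[OF sq[of "Suc k"] sq[of k]]]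
      by (subst nn_integral_eq_integral) auto
    also have "\<dots> \<le> ennreal (2^k * (1/8)^k)"
      using fast[of k] by (intro ennreal_leI mult_left_mono) auto
    also have "(2::real)^k * (1/8)^k = (1/4)^k" by (simp add: power_mult_distrib[symmetric])
    finally show "(\<integral>\<^sup>+x. ennreal (2^k * ?d k x) \<partial>M) \<le> ennreal ((1/4)^k)" .
  qed auto
  also have "\<dots> < \<infinity>"
  proof -
    have "summable (\<lambda>k. (1/4::real)^k)" by (simp add: summable_geometric)
    then show ?thesis by (subst suminf_ennreal2) auto
  qed
  finally have "AE x in M. (\<Sum>k. ennreal (2^k * ?d k x)) \<noteq> \<infinity>"
    by (intro nn_integral_noteq_infinite) auto
  then show ?thesis
  proof eventually_elim
    case (elim x)
    define C where "C = enn2real (\<Sum>k. ennreal (2^k * ?d k x))"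
    have C: "(\<Sum>k. ennreal (2^k * ?d k x)) = ennreal C" "C \<ge> 0"
      using elim by (auto simp: C_def less_top)
    have le: "2^k * ?d k x \<le> C" for k
    proof -
      have "ennreal (2^k * ?d k x) \<le> (\<Sum>k. ennreal (2^k * ?d k x))"
        by (rule ennreal_le_suminf)
      then show ?thesis unfolding C(1) using C(2) by (simp add: ennreal_le_iff)
    qed
    define q :: real where "q = sqrt (1/2)"
    have q: "0 \<le> q" "q < 1" "q\<^sup>2 = 1/2" 
      by (simp_all add: q_def real_less_lsqrt)
    have "norm (f (Suc k) x - f k x) \<le> sqrt C * q ^ k" for k
    proof (rule power2_le_imp_le)
      have "?d k x \<le> C * (1/2)^k" using le[of k] by (simp add: field_simps)
      also have "\<dots> = (sqrt C * q ^ k)\<^sup>2"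
        using C(2) unfolding q(3)[symmetric] by (simp add: power_mult_distrib power_mult[symmetric] mult.commute)
      finally show "?d k x \<le> (sqrt C * q ^ k)\<^sup>2" .
      show "0 \<le> sqrt C * q ^ k" using C(2) q(1) by (intro mult_nonneg_nonneg zero_le_power) simp_all
    qed
    moreover have "summable (\<lambda>k. sqrt C * q ^ k)"
      using q by (intro summable_mult summable_geometric) simp
    ultimately have "summable (\<lambda>k. f (Suc k) x - f k x)"
      by (rule summable_comparison_test'[where N=0, rotated])
    then have "(\<lambda>n. \<Sum>k<n. f (Suc k) x - f k x) \<longlonglongrightarrow> (\<Sum>k. f (Suc k) x - f k x)"
      by (rule summable_LIMSEQ)
    then have "(\<lambda>n. f n x - f 0 x) \<longlonglongrightarrow> (\<Sum>k. f (Suc k) x - f k x)"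
      unfolding sum_lessThan_telescope[of "\<lambda>k. f k x"] .
    then have "(\<lambda>n. (f n x - f 0 x) + f 0 x) \<longlonglongrightarrow> (\<Sum>k. f (Suc k) x - f k x) + f 0 x"
      by (intro tendsto_intros)
    then show ?case by (auto simp: convergent_def)
  qed
qed

text \<open>Riesz-Fischer. Norm convergence of the whole sequence and a.e. convergence of a
  subsequence are delivered together, because the limit of a minimizing sequence needs both.\<close>

lemma l2_complete:
  fixes f :: "nat \<Rightarrow> 'a \<Rightarrow> 'b::euclidean_space"
  assumes sq: "\<And>n. sqint M (f n)"
    and cauchy: "\<And>e. e > 0 \<Longrightarrow> \<exists>N. \<forall>m\<ge>N. \<forall>n\<ge>N. l2 M (\<lambda>x. f m x - f n x) < e"
  obtains g r where "strict_mono r" "sqint M g" "AE x in M. (\<lambda>k. f (r k) x) \<longlonglongrightarrow> g x"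
    "(\<lambda>n. l2 M (\<lambda>x. f n x - g x)) \<longlonglongrightarrow> 0"
proof -
  have meas [measurable]: "\<And>n. f n \<in> borel_measurable M" using sq by (auto simp: sqint_def)
  have "\<exists>r. strict_mono r \<and> (\<forall>k. (l2 M (\<lambda>x. f (r (Suc k)) x - f (r k) x))\<^sup>2 \<le> (1/8)^k)"
  proof -
    have "\<forall>k. \<exists>N. \<forall>m\<ge>N. \<forall>n\<ge>N. l2 M (\<lambda>x. f m x - f n x) < sqrt ((1/8)^k)"
      using cauchy by simp
    then obtain N where N: "\<And>k m n. m \<ge> N k \<Longrightarrow> n \<ge> N k \<Longrightarrow> l2 M (\<lambda>x. f m x - f n x) < sqrt ((1/8)^k)"
      by metis
    \<comment> \<open>The partial sums of \<open>N\<close> give \<open>r k \<ge> N k\<close>, and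
      the summand \<open>k\<close> makes \<open>r\<close> strictly increasing.\<close>
    define r where "r k = k + (\<Sum>j\<le>k. N j)" for k
    have "strict_mono r" by (rule strict_mono_Suc_iff[THEN iffD2]) (simp add: r_def)
    moreover have "(l2 M (\<lambda>x. f (r (Suc k)) x - f (r k) x))\<^sup>2 \<le> (1/8)^k" for k
    proof -
      have "r k \<ge> N k" "r (Suc k) \<ge> N k" 
        using member_le_sum[of k "{..k}" N] by (auto simp: r_def)
      then have "l2 M (\<lambda>x. f (r (Suc k)) x - f (r k) x) < sqrt ((1/8)^k)" by (intro N)
      then have "(l2 M (\<lambda>x. f (r (Suc k)) x - f (r k) x))\<^sup>2 \<le> (sqrt ((1/8)^k))\<^sup>2"
        by (intro power_mono) auto
      then show ?thesis by simp
    qed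
    ultimately show ?thesis by blast
  qed
  then obtain r where r: "strict_mono r"
    and fast: "\<And>k. (l2 M (\<lambda>x. f (r (Suc k)) x - f (r k) x))\<^sup>2 \<le> (1/8)^k" by blast
  \<comment> \<open>\<open>lim\<close> is defined at every point, which makes \<open>g\<close>
    measurable; its value off the set of convergence is arbitrary.\<close>
  define g where "g x = lim (\<lambda>k. f (r k) x)" for x
  have [measurable]: "g \<in> borel_measurable M"
    unfolding g_def by measurable
  have AE: "AE x in M. (\<lambda>k. f (r k) x) \<longlonglongrightarrow> g x"
    using AE_tendsto_of_fast[of M "\<lambda>k. f (r k)", OF sq fast]
    by eventually_elim (simp add: g_def convergent_LIMSEQ_iff)
  \<comment> \<open>Fatou along the subsequence turns the Cauchy estimate between \<open>f n\<close>
    and later terms into an estimate between \<open>f n\<close> and the limit.\<close>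
  have bound: "integrable M (\<lambda>x. (norm (f n x - g x))\<^sup>2) \<and> l2 M (\<lambda>x. f n x - g x) \<le> e"
    if "e > 0" and n: "\<forall>m\<ge>n. l2 M (\<lambda>x. f n x - f m x) < e" for n e
  proof -
    have rn: "r (n + k) \<ge> n" for k
      using strict_mono_imp_increasing[OF r, of "n + k"] by simp
    have le: "(LINT x|M. (norm (f n x - f (r (n + k)) x))\<^sup>2) \<le> e\<^sup>2" for k
      using n rn[of k] \<open>e > 0\<close> unfolding l2_sq[symmetric]
      by (meson l2_nonneg less_imp_le power_mono)
    have lim: "AE x in M. (\<lambda>k. (norm (f n x - f (r (n + k)) x))\<^sup>2) \<longlonglongrightarrow> (norm (f n x - g x))\<^sup>2"
      using AE
    proof eventually_elim
      case (elim x)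
      then have "(\<lambda>k. f (r (n + k)) x) \<longlonglongrightarrow> g x"
        using LIMSEQ_ignore_initial_segment[of "\<lambda>k. f (r k) x" "g x" n] by (simp add: add.commute)
      then show ?case by (intro tendsto_intros)
    qed
    have *: "integrable M (\<lambda>x. (norm (f n x - g x))\<^sup>2)"
      "(LINT x|M. (norm (f n x - g x))\<^sup>2) \<le> e\<^sup>2"
      using Fatou_real[where B="\<lambda>_. e\<^sup>2", OF sqint_integrable[OF sqint_diff[OF sq sq]] _ _ lim le]
      by auto
    then show ?thesis
      using \<open>e > 0\<close> by (auto simp: l2_def intro: real_le_lsqrt)
  qed
  have "sqint M g"
  proof -
    obtain N where "\<forall>m\<ge>N. \<forall>n\<ge>N. l2 M (\<lambda>x. f m x - f n x) < 1" using cauchy[of 1] by auto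
    then have "sqint M (\<lambda>x. f N x - g x)" using bound[of 1 N] by (simp add: sqint_def)
    from sqint_diff[OF sq[of N] this] show ?thesis by simp
  qed
  moreover have "(\<lambda>n. l2 M (\<lambda>x. f n x - g x)) \<longlonglongrightarrow> 0"
  proof (rule LIMSEQ_I)
    fix e :: real assume "e > 0"
    then obtain N where N: "\<forall>m\<ge>N. \<forall>n\<ge>N. l2 M (\<lambda>x. f m x - f n x) < e / 2"
      using cauchy[of "e/2"] by auto
    have "l2 M (\<lambda>x. f n x - g x) \<le> e / 2" if "n \<ge> N" for n
      using bound[of "e/2" n] N that \<open>e > 0\<close> by force
    then show "\<exists>N. \<forall>n\<ge>N. norm (l2 M (\<lambda>x. f n x - g x) - 0) < e"
      using \<open>e > 0\<close> by (intro exI[of _ N]) force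
  qed
  ultimately show thesis using that r AE by blast
qed

lemma l2_eq_0_AE:
  assumes "sqint M f" "l2 M f = 0"
  shows "AE x in M. f x = 0"
proof -
  have "(LINT x|M. (norm (f x))\<^sup>2) = 0" using l2_sq[of M f] assms(2) by simp
  then have "AE x in M. (norm (f x))\<^sup>2 = 0"
    using integral_nonneg_eq_0_iff_AE[OF sqint_integrable[OF assms(1)]] by simp
  then show ?thesis by simp
qed

lemma l2_limit_unique:
  assumes "\<And>n. sqint M (f n)" "sqint M g" "sqint M k"
    and "(\<lambda>n. l2 M (\<lambda>x. f n x - g x)) \<longlonglongrightarrow> 0" "(\<lambda>n. l2 M (\<lambda>x. f n x - k x)) \<longlonglongrightarrow> 0"
  shows "AE x in M. g x = k x"
proof -
  have "l2 M (\<lambda>x. g x - k x) \<le> l2 M (\<lambda>x. f n x - g x) + l2 M (\<lambda>x. f n x - k x)" for n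
    using l2_triangle_diff[OF assms(2) assms(1) assms(3), of n] by (simp only: l2_minus_commute[of M g "f n"])
  moreover have "(\<lambda>n. l2 M (\<lambda>x. f n x - g x) + l2 M (\<lambda>x. f n x - k x)) \<longlonglongrightarrow> 0 + 0"
    using assms by (intro tendsto_add)
  ultimately have "l2 M (\<lambda>x. g x - k x) \<le> 0"
    by (intro LIMSEQ_le_const[where X="\<lambda>n. l2 M (\<lambda>x. f n x - g x) + l2 M (\<lambda>x. f n x - k x)"]) auto
  then have "AE x in M. g x - k x = 0"
    by (intro l2_eq_0_AE sqint_diff assms antisym l2_nonneg)
  then show ?thesis by simp
qed

lemma l2_convergent_Cauchy:
  assumes "\<And>n. sqint M (f n)" "sqint M g"
    and "(\<lambda>n. l2 M (\<lambda>x. f n x - g x)) \<longlonglongrightarrow> 0" "e > 0"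
  shows "\<exists>N. \<forall>m\<ge>N. \<forall>n\<ge>N. l2 M (\<lambda>x. f m x - f n x) < e"
proof -
  obtain N where N: "\<And>n. n \<ge> N \<Longrightarrow> l2 M (\<lambda>x. f n x - g x) < e / 2"
    using LIMSEQ_D[OF assms(3), of "e/2"] \<open>e > 0\<close> by auto
  have "l2 M (\<lambda>x. f m x - f n x) < e" if "m \<ge> N" "n \<ge> N" for m n
    using l2_triangle_diff[OF assms(1)[of m] assms(2) assms(1)[of n]] N[OF that(1)] N[OF that(2)]
    by (simp add: l2_minus_commute[of M g "f n"])
  then show ?thesis by blast
qed

lemma l2_AE_subseq:
  fixes f :: "nat \<Rightarrow> 'a \<Rightarrow> 'b::euclidean_space"
  assumes "\<And>n. sqint M (f n)" "sqint M g"
    and "(\<lambda>n. l2 M (\<lambda>x. f n x - g x)) \<longlonglongrightarrow> 0"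
  obtains r where "strict_mono r" "AE x in M. (\<lambda>k. f (r k) x) \<longlonglongrightarrow> g x"
proof -
  obtain g' r where *: "strict_mono r" "sqint M g'" "AE x in M. (\<lambda>k. f (r k) x) \<longlonglongrightarrow> g' x"
    "(\<lambda>n. l2 M (\<lambda>x. f n x - g' x)) \<longlonglongrightarrow> 0"
    using l2_complete[OF assms(1) l2_convergent_Cauchy[OF assms]] by blast
  have "AE x in M. g x = g' x" by (rule l2_limit_unique[OF assms(1,2) *(2) assms(3) *(4)])
  then have "AE x in M. (\<lambda>k. f (r k) x) \<longlonglongrightarrow> g x" using *(3) by eventually_elim simp
  then show thesis using that *(1) by blast
qed

subsection \<open>Smooth functions and test functions\<close>

abbreviation smooth :: "('a::euclidean_space \<Rightarrow> real) \<Rightarrow> bool" where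
  "smooth f \<equiv> smooth_on UNIV f"

lemma Ck_SucI:
  assumes "\<And>x. (f has_derivative f' x) (at x)" "\<And>v. Ck_on k UNIV (\<lambda>x. f' x v)"
  shows "Ck_on (Suc k) UNIV f"
proof -
  have "frechet_derivative f (at x) = f' x" for x
    using frechet_derivative_at[OF assms(1)] by simp
  then show ?thesis using assms by (auto simp: differentiable_def)
qed

lemma Ck_SucD:
  assumes "Ck_on (Suc k) UNIV f"
  shows "(f has_derivative frechet_derivative f (at x)) (at x)"
    and "Ck_on k UNIV (\<lambda>x. frechet_derivative f (at x) v)"
  using assms by (auto simp: frechet_derivative_works)

lemma Ck_Suc_imp: "Ck_on (Suc k) UNIV f \<Longrightarrow> Ck_on k UNIV f"
proof (induction k arbitrary: f)
  case 0
  then show ?case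
    using has_derivative_continuous[OF Ck_SucD(1)[OF 0]] by (simp add: continuous_on_eq_continuous_at)
next
  case (Suc k)
  show ?case
    by (rule Ck_SucI[OF Ck_SucD(1)[OF Suc.prems]]) (intro Suc.IH Ck_SucD(2)[OF Suc.prems])
qed

lemma Ck_const: "Ck_on k UNIV (\<lambda>x. c)"
proof (induction k arbitrary: c)
  case (Suc k)
  show ?case by (rule Ck_SucI[where f'="\<lambda>x v. 0"]) (auto intro: Suc)
qed simp

lemma Ck_add: "Ck_on k UNIV f \<Longrightarrow> Ck_on k UNIV g \<Longrightarrow> Ck_on k UNIV (\<lambda>x. f x + g x)"
proof (induction k arbitrary: f g)
  case (Suc k)
  show ?case
    by (rule Ck_SucI[OF has_derivative_add[OF Ck_SucD(1)[OF Suc.prems(1)] Ck_SucD(1)[OF Suc.prems(2)]]])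
      (intro Suc.IH Ck_SucD(2)[OF Suc.prems(1)] Ck_SucD(2)[OF Suc.prems(2)])
qed (auto intro: continuous_on_add)

lemma Ck_mult: "Ck_on k UNIV f \<Longrightarrow> Ck_on k UNIV g \<Longrightarrow> Ck_on k UNIV (\<lambda>x. f x * g x)"
proof (induction k arbitrary: f g)
  case (Suc k)
  show ?case
    by (rule Ck_SucI[OF has_derivative_mult[OF Ck_SucD(1)[OF Suc.prems(1)] Ck_SucD(1)[OF Suc.prems(2)]]])
      (intro Suc.IH Ck_add Ck_SucD(2)[OF Suc.prems(1)] Ck_SucD(2)[OF Suc.prems(2)]
        Ck_Suc_imp[OF Suc.prems(1)] Ck_Suc_imp[OF Suc.prems(2)])
qed (auto intro: continuous_on_mult)

lemma Ck_linear:
  assumes "bounded_linear f" shows "Ck_on k UNIV f"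
proof (cases k)
  case 0
  then show ?thesis using assms by (simp add: linear_continuous_on)
next
  case (Suc n)
  show ?thesis unfolding Suc
    by (rule Ck_SucI[OF bounded_linear_imp_has_derivative[OF assms]]) (rule Ck_const)
qed

lemma smooth_const [simp]: "smooth (\<lambda>x. c)"
  by (simp add: smooth_on_def Ck_const)

lemma smooth_add: "smooth f \<Longrightarrow> smooth g \<Longrightarrow> smooth (\<lambda>x. f x + g x)"
  by (simp add: smooth_on_def Ck_add)

lemma smooth_mult: "smooth f \<Longrightarrow> smooth g \<Longrightarrow> smooth (\<lambda>x. f x * g x)"
  by (simp add: smooth_on_def Ck_mult)

lemma smooth_cmult: "smooth f \<Longrightarrow> smooth (\<lambda>x. c * f x)"
  by (rule smooth_mult) auto

lemma smooth_diff: "smooth f \<Longrightarrow> smooth g \<Longrightarrow> smooth (\<lambda>x. f x - g x)"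
  using smooth_add[of f "\<lambda>x. -1 * g x"] smooth_cmult[of g "-1"] by simp

lemma smooth_power: "smooth f \<Longrightarrow> smooth (\<lambda>x. f x ^ n)"
  by (induction n) (auto intro: smooth_mult)

lemma smooth_inner: "smooth (\<lambda>x. x \<bullet> c)"
  by (simp add: smooth_on_def Ck_linear bounded_linear_inner_left)

lemma smooth_sum:
  assumes "\<And>i. i \<in> I \<Longrightarrow> smooth (f i)" shows "smooth (\<lambda>x. \<Sum>i\<in>I. f i x)"
  using assms by (induction I rule: infinite_finite_induct) (auto intro: smooth_add)

lemma smooth_prod:
  assumes "\<And>i. i \<in> I \<Longrightarrow> smooth (f i)" shows "smooth (\<lambda>x. \<Prod>i\<in>I. f i x)"
  using assms by (induction I rule: infinite_finite_induct) (auto intro: smooth_mult)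

lemma smooth_derivative:
  "smooth f \<Longrightarrow> smooth (\<lambda>x. frechet_derivative f (at x) v)"
  unfolding smooth_on_def using Ck_SucD(2) by blast

lemma smooth_norm_sq: "smooth (\<lambda>x. (norm (x - c))\<^sup>2)"
proof -
  have "(norm (x - c))\<^sup>2 = (\<Sum>i\<in>Basis. (x \<bullet> i - c \<bullet> i)\<^sup>2)" for x
    unfolding power2_norm_eq_inner
    by (subst euclidean_inner) (simp add: power2_eq_square inner_diff_left)
  then show ?thesis
    by (simp only:) (intro smooth_sum smooth_power smooth_diff smooth_inner smooth_const)
qed

text \<open>Differentiation lowers the exponent by one, so the induction runs over all exponents
  \<open>s\<close> at once; positivity of \<open>f\<close> keeps \<open>powr\<close> away from its
  singularity at 0.\<close>

lemma smooth_powr_comp: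
  assumes "smooth f" "\<And>x. f x > 0"
  shows "smooth (\<lambda>x. f x powr s)"
proof -
  have C: "Ck_on k UNIV f" for k using assms(1) by (simp add: smooth_on_def)
  have "Ck_on k UNIV (\<lambda>x. f x powr s)" for k s
  proof (induction k arbitrary: s)
    case 0
    have "continuous_on UNIV f" using C[of 0] by simp
    moreover have "f x \<noteq> 0" for x using assms(2)[of x] by simp
    ultimately show ?case by (auto intro: continuous_on_powr)
  next
    case (Suc k)
    show ?case
    proof (rule Ck_SucI)
      fix x
      have "((\<lambda>y. y powr s) has_derivative (\<lambda>h. s * f x powr (s - 1) * h)) (at (f x))"
        using has_real_derivative_powr[OF assms(2)[of x], of s]
        by (simp add: has_field_derivative_def)
      from has_derivative_compose[OF Ck_SucD(1)[OF C] this]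
      show "((\<lambda>x. f x powr s) has_derivative
          (\<lambda>v. s * f x powr (s - 1) * frechet_derivative f (at x) v)) (at x)" .
    next
      fix v
      show "Ck_on k UNIV (\<lambda>x. s * f x powr (s - 1) * frechet_derivative f (at x) v)"
        by (intro Ck_mult Ck_const Suc.IH Ck_SucD(2)[OF C])
    qed
  qed
  then show ?thesis by (simp add: smooth_on_def)
qed

text \<open>The factor \<open>(1/t)^n\<close> closes the family under differentiation.\<close>

definition bump :: "nat \<Rightarrow> real \<Rightarrow> real" where
  "bump n t = (if t > 0 then (1/t)^n * exp (- (1/t)) else 0)"

lemma power_le_fact_exp:
  fixes z :: real assumes "z \<ge> 0" shows "z ^ k \<le> fact k * exp z"
proof -
  have "(\<Sum>n\<in>{k}. z^n /\<^sub>R fact n) \<le> (\<Sum>n. z^n /\<^sub>R fact n)"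
    using assms by (intro sum_le_suminf summable_exp_generic) auto
  then have "z^k / fact k \<le> exp z" by (simp add: exp_def divide_inverse_commute)
  then show ?thesis by (simp add: field_simps)
qed

lemma bump_nonneg [simp]: "0 \<le> bump n t"
  by (simp add: bump_def)

text \<open>\<open>m\<close> is free: the value 0 bounds \<open>bump n\<close> by a factorial, and
  the value 2 makes the difference quotient at the origin tend to 0.\<close>

lemma bump_le:
  assumes "t \<ge> 0" shows "bump n t \<le> fact (n + m) * t ^ m"
proof (cases "t = 0")
  case False
  then have t: "t > 0" using assms by simp
  have "(1/t)^(n+m) \<le> fact (n+m) * exp (1/t)" using t by (intro power_le_fact_exp) simp
  then have "(1/t)^n * (1/t)^m * exp (-(1/t)) \<le> fact (n+m) * exp (1/t) * exp (-(1/t))"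
    by (intro mult_right_mono) (simp_all add: power_add)
  also have "\<dots> = fact (n+m)" by (simp add: mult_exp_exp mult.assoc)
  finally have "((1/t)^n * exp (-(1/t))) * (1/t)^m \<le> fact (n+m)" by (simp add: mult_ac)
  then have "((1/t)^n * exp (-(1/t))) * (1/t)^m * t^m \<le> fact (n+m) * t^m"
    using t by (intro mult_right_mono) auto
  also have "((1/t)^n * exp (-(1/t))) * (1/t)^m * t^m = (1/t)^n * exp (-(1/t))"
    using t by (simp add: power_divide)
  finally show ?thesis using t by (simp add: bump_def)
qed (simp add: bump_def)

lemma bump_le_fact: "bump n t \<le> fact n"
  using bump_le[of t n 0] by (cases "t \<ge> 0") (auto simp: bump_def)

lemma bump_has_derivative:
  "(bump n has_field_derivative (bump (n+2) t - real n * bump (n+1) t)) (at t)"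
proof -
  consider "t > 0" | "t < 0" | "t = 0" by linarith
  then show ?thesis
  proof cases
    case 1
    have "((\<lambda>t. (1/t)^n * exp (- (1/t))) has_field_derivative
        (bump (n+2) t - real n * bump (n+1) t)) (at t)"
    proof -
      define u where "u = 1 / t"
      have i: "((\<lambda>t. 1/t) has_field_derivative (- (u * u))) (at t)"
        using 1 by (auto intro!: derivative_eq_intros simp: u_def)
      have "((\<lambda>t. exp (- (1/t))) has_field_derivative exp (- u) * (u * u)) (at t)"
        using 1 by (auto intro!: derivative_eq_intros simp: u_def)
      from DERIV_mult[OF DERIV_power[OF i, of n] this]
      have "((\<lambda>t. (1/t)^n * exp (- (1/t))) has_field_derivative
          real n * ((- (u * u)) * u ^ (n - Suc 0)) * exp (- u) + exp (- u) * (u * u) * u ^ n) (at t)"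
        by (simp add: u_def)
      moreover have "real n * ((- (u * u)) * u ^ (n - Suc 0)) * exp (- u) + exp (- u) * (u * u) * u ^ n
          = bump (n+2) t - real n * bump (n+1) t"
        using 1 by (cases n) (simp_all add: bump_def u_def[symmetric] algebra_simps)
      ultimately show ?thesis by simp
    qed
    then show ?thesis
      by (rule has_field_derivative_transform_within_open[where S="{0<..}"]) (use 1 in \<open>auto simp: bump_def\<close>)
  next
    case 2
    have "((\<lambda>t. 0) has_field_derivative 0) (at t)" by simp
    then have "(bump n has_field_derivative 0) (at t)"
      by (rule has_field_derivative_transform_within_open[where S="{..<0}"]) (use 2 in \<open>auto simp: bump_def\<close>)
    then show ?thesis using 2 by (simp add: bump_def)
  next
    case 3
    \<comment> \<open>At the origin the quadratic bound on \<open>bump n h\<close> makes the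
      quotient of order \<open>h\<close>.\<close>
    have "((\<lambda>h. (bump n (0 + h) - bump n 0) / h) \<longlongrightarrow> 0) (at 0)"
    proof (rule Lim_null_comparison)
      have "norm ((bump n (0 + h) - bump n 0) / h) \<le> fact (n+2) * \<bar>h\<bar>" for h
      proof (cases "h > 0")
        case True
        then show ?thesis using bump_le[of h n 2]
          by (simp add: bump_def[of n 0] power2_eq_square divide_le_eq)
      next
        case False
        have "(0::real) \<le> fact (n+2) * \<bar>h\<bar>" by (intro mult_nonneg_nonneg) auto
        moreover have "bump n h = 0" "bump n 0 = 0" using False by (simp_all add: bump_def)
        ultimately show ?thesis by simp
      qed
      then show "\<forall>\<^sub>F h in at 0. norm ((bump n (0 + h) - bump n 0) / h) \<le> fact (n+2) * \<bar>h\<bar>" by simp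
      show "((\<lambda>h::real. fact (n+2) * \<bar>h\<bar>) \<longlongrightarrow> 0) (at 0)"
        by (auto intro!: tendsto_eq_intros)
    qed
    then show ?thesis using 3 by (simp add: DERIV_def bump_def)
  qed
qed

lemma continuous_bump: "continuous_on S (bump n)"
  using bump_has_derivative DERIV_isCont continuous_at_imp_continuous_on by blast

lemma smooth_bump_comp:
  assumes "smooth f" shows "smooth (\<lambda>x. bump n (f x))"
proof -
  have C: "Ck_on k UNIV f" for k using assms(1) by (simp add: smooth_on_def)
  have "Ck_on k UNIV (\<lambda>x. bump n (f x))" for k n
  proof (induction k arbitrary: n)
    case 0
    then show ?case using C[of 0] by (auto intro: continuous_on_compose2[OF continuous_bump])
  next
    case (Suc k)
    show ?case
    proof (rule Ck_SucI)
      fix x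
      have "(bump n has_derivative (\<lambda>h. (bump (n+2) (f x) - real n * bump (n+1) (f x)) * h)) (at (f x))"
        using bump_has_derivative[of n "f x"] by (simp add: has_field_derivative_def)
      from has_derivative_compose[OF Ck_SucD(1)[OF C] this]
      show "((\<lambda>x. bump n (f x)) has_derivative
          (\<lambda>v. (bump (n+2) (f x) + (- real n) * bump (n+1) (f x)) * frechet_derivative f (at x) v)) (at x)"
        by simp
    next
      fix v
      show "Ck_on k UNIV (\<lambda>x. (bump (n+2) (f x) + (- real n) * bump (n+1) (f x)) * frechet_derivative f (at x) v)"
        by (intro Ck_mult Ck_add Ck_const Suc.IH Ck_SucD(2)[OF C])
    qed
  qed
  then show ?thesis by (simp add: smooth_on_def)
qed

section \<open>Gradients of smooth functions\<close>

definition grad :: "('a::euclidean_space \<Rightarrow> real) \<Rightarrow> 'a \<Rightarrow> 'a" where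
  "grad f x = (\<Sum>i\<in>Basis. frechet_derivative f (at x) i *\<^sub>R i)"

lemma grad_has_derivative:
  assumes "f differentiable (at x)"
  shows "(f has_derivative (\<lambda>v. grad f x \<bullet> v)) (at x)"
proof -
  have D: "(f has_derivative frechet_derivative f (at x)) (at x)"
    using assms by (simp add: frechet_derivative_works)
  then have lin: "linear (frechet_derivative f (at x))" by (rule has_derivative_linear)
  have "frechet_derivative f (at x) v = grad f x \<bullet> v" for v
  proof -
    have "frechet_derivative f (at x) v = frechet_derivative f (at x) (\<Sum>i\<in>Basis. (v \<bullet> i) *\<^sub>R i)"
      by (simp add: euclidean_representation)
    also have "\<dots> = (\<Sum>i\<in>Basis. (v \<bullet> i) * frechet_derivative f (at x) i)"
      using lin by (simp add: linear_sum linear_cmul)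
    also have "\<dots> = grad f x \<bullet> v"
      by (simp add: grad_def inner_sum_left inner_commute[of v] mult.commute)
    finally show ?thesis .
  qed
  then show ?thesis using D by presburger
qed

lemma frechet_eq_grad:
  assumes "f differentiable (at x)"
  shows "frechet_derivative f (at x) v = grad f x \<bullet> v"
  using fun_cong[OF frechet_derivative_at[OF grad_has_derivative[OF assms]], of v] by simp

lemma grad_eqI:
  assumes "(f has_derivative (\<lambda>v. g \<bullet> v)) (at x)"
  shows "grad f x = g"
proof -
  have "frechet_derivative f (at x) = (\<lambda>v. g \<bullet> v)"
    using frechet_derivative_at[OF assms] by simp
  then show ?thesis by (simp add: grad_def euclidean_representation)
qed

lemma smooth_differentiable: "smooth f \<Longrightarrow> f differentiable (at x)"
  unfolding smooth_on_def using Ck_SucD(1) differentiable_def by blast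

lemma smooth_continuous: "smooth f \<Longrightarrow> continuous_on S f"
  unfolding smooth_on_def using Ck_on.simps(1) continuous_on_subset subset_UNIV by blast

lemma smooth_grad_inner: "smooth f \<Longrightarrow> smooth (\<lambda>x. grad f x \<bullet> v)"
  using smooth_derivative[of f v] by (simp add: frechet_eq_grad smooth_differentiable)

lemma smooth_continuous_grad: "smooth f \<Longrightarrow> continuous_on S (grad f)"
  unfolding grad_def
  by (intro continuous_on_sum continuous_on_scaleR continuous_on_const smooth_continuous smooth_derivative)

lemma smooth_has_derivative: "smooth f \<Longrightarrow> (f has_derivative (\<lambda>v. grad f x \<bullet> v)) (at x)"
  by (simp add: grad_has_derivative smooth_differentiable)

lemma grad_add: "smooth f \<Longrightarrow> smooth g \<Longrightarrow> grad (\<lambda>x. f x + g x) x = grad f x + grad g x"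
  by (rule grad_eqI) (auto intro!: derivative_eq_intros smooth_has_derivative simp: inner_simps)

lemma grad_diff: "smooth f \<Longrightarrow> smooth g \<Longrightarrow> grad (\<lambda>x. f x - g x) x = grad f x - grad g x"
  by (rule grad_eqI) (auto intro!: derivative_eq_intros smooth_has_derivative simp: inner_simps)

lemma grad_cmult: "smooth f \<Longrightarrow> grad (\<lambda>x. c * f x) x = c *\<^sub>R grad f x"
  by (rule grad_eqI) (auto intro!: derivative_eq_intros smooth_has_derivative simp: inner_simps)

lemma grad_mult: "smooth f \<Longrightarrow> smooth g \<Longrightarrow> grad (\<lambda>x. f x * g x) x = f x *\<^sub>R grad g x + g x *\<^sub>R grad f x"
  by (rule grad_eqI) (auto intro!: derivative_eq_intros smooth_has_derivative simp: inner_simps)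

section \<open>Algebra of test functions\<close>

lemma test_smooth: "\<phi> \<in> test_functions \<Omega> \<Longrightarrow> smooth \<phi>"
  by (simp add: test_functions_def)

lemma grad_zero_outside:
  assumes "compact K" "\<And>x. x \<notin> K \<Longrightarrow> \<phi> x = 0" "x \<notin> K"
  shows "grad \<phi> x = 0"
proof (rule grad_eqI)
  have "((\<lambda>x. 0) has_derivative (\<lambda>v. 0 \<bullet> v)) (at x)" by simp
  then show "(\<phi> has_derivative (\<lambda>v. 0 \<bullet> v)) (at x)"
    by (rule has_derivative_transform_within_open[where s="-K"])
      (use assms compact_imp_closed in \<open>auto simp: open_Compl\<close>)
qed

lemma test_support:
  assumes "\<phi> \<in> test_functions \<Omega>"
  obtains K where "compact K" "K \<subseteq> \<Omega>" "\<And>x. x \<notin> K \<Longrightarrow> \<phi> x = 0" "\<And>x. x \<notin> K \<Longrightarrow> grad \<phi> x = 0"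
proof -
  obtain K where K: "compact K" "K \<subseteq> \<Omega>" "\<forall>x. x \<notin> K \<longrightarrow> \<phi> x = 0"
    using assms unfolding test_functions_def by blast
  show thesis
    by (rule that[OF K(1,2)]) (use K(3) grad_zero_outside[OF K(1), of \<phi>] in auto)
qed

lemma test_zero_outside: "\<phi> \<in> test_functions \<Omega> \<Longrightarrow> x \<notin> \<Omega> \<Longrightarrow> \<phi> x = 0"
  and grad_test_zero_outside: "\<phi> \<in> test_functions \<Omega> \<Longrightarrow> x \<notin> \<Omega> \<Longrightarrow> grad \<phi> x = 0"
  by (meson subsetD test_support)+

lemma test_add:
  assumes "\<phi> \<in> test_functions \<Omega>" "\<psi> \<in> test_functions \<Omega>"
  shows "(\<lambda>x. \<phi> x + \<psi> x) \<in> test_functions \<Omega>"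
proof -
  obtain K L where "compact K" "K \<subseteq> \<Omega>" "\<And>x. x \<notin> K \<Longrightarrow> \<phi> x = 0"
    "compact L" "L \<subseteq> \<Omega>" "\<And>x. x \<notin> L \<Longrightarrow> \<psi> x = 0"
    using assms by (meson test_support)
  then have "compact (K \<union> L) \<and> K \<union> L \<subseteq> \<Omega> \<and> (\<forall>x. x \<notin> K \<union> L \<longrightarrow> \<phi> x + \<psi> x = 0)" by auto
  then show ?thesis
    using smooth_add[OF test_smooth[OF assms(1)] test_smooth[OF assms(2)]]
    unfolding test_functions_def by blast
qed

lemma test_mult:
  assumes "\<phi> \<in> test_functions \<Omega>" "smooth \<psi>"
  shows "(\<lambda>x. \<psi> x * \<phi> x) \<in> test_functions \<Omega>"
proof -
  obtain K where "compact K" "K \<subseteq> \<Omega>" "\<And>x. x \<notin> K \<Longrightarrow> \<phi> x = 0"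
    using assms by (meson test_support)
  then have "compact K \<and> K \<subseteq> \<Omega> \<and> (\<forall>x. x \<notin> K \<longrightarrow> \<psi> x * \<phi> x = 0)" by auto
  then show ?thesis
    using smooth_mult[OF assms(2) test_smooth[OF assms(1)]] unfolding test_functions_def by blast
qed

lemma test_cmult: "\<phi> \<in> test_functions \<Omega> \<Longrightarrow> (\<lambda>x. c * \<phi> x) \<in> test_functions \<Omega>"
  by (rule test_mult) auto

lemma test_diff:
  assumes "\<phi> \<in> test_functions \<Omega>" "\<psi> \<in> test_functions \<Omega>"
  shows "(\<lambda>x. \<phi> x - \<psi> x) \<in> test_functions \<Omega>"
  using test_add[OF assms(1) test_cmult[OF assms(2), of "-1"]] by simp

lemma test_grad_inner:
  assumes "\<phi> \<in> test_functions \<Omega>"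
  shows "(\<lambda>x. grad \<phi> x \<bullet> v) \<in> test_functions \<Omega>"
proof -
  obtain K where "compact K" "K \<subseteq> \<Omega>" "\<And>x. x \<notin> K \<Longrightarrow> grad \<phi> x = 0"
    using assms by (meson test_support)
  then show ?thesis
    unfolding test_functions_def using smooth_grad_inner[OF test_smooth[OF assms]] by auto
qed

lemma test_zero: "(\<lambda>x. 0) \<in> test_functions \<Omega>"
  unfolding test_functions_def by (auto intro!: exI[of _ "{}"])

section \<open>Translation invariance and integrals of derivatives\<close>

lemma nn_integral_translate:
  fixes f :: "'a::euclidean_space \<Rightarrow> ennreal"
  assumes "f \<in> borel_measurable borel"
  shows "(\<integral>\<^sup>+x. f (h + x) \<partial>lborel) = (\<integral>\<^sup>+x. f x \<partial>lborel)"
proof -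
  have "(\<integral>\<^sup>+x. f x \<partial>lborel) = (\<integral>\<^sup>+x. f x \<partial>distr lborel borel ((+) h))"
    by (simp add: lborel_distr_plus)
  also have "\<dots> = (\<integral>\<^sup>+x. f (h + x) \<partial>lborel)"
    using assms by (subst nn_integral_distr) auto
  finally show ?thesis by simp
qed

lemma integral_translate:
  fixes f :: "'a::euclidean_space \<Rightarrow> 'b::euclidean_space"
  assumes "f \<in> borel_measurable borel"
  shows "(LINT x|lborel. f (h + x)) = (LINT x|lborel. f x)"
proof -
  have "(LINT x|lborel. f x) = (LINT x|distr lborel borel ((+) h). f x)"
    by (simp add: lborel_distr_plus)
  also have "\<dots> = (LINT x|lborel. f (h + x))"
    using assms by (subst integral_distr) auto
  finally show ?thesis by simp
qed

lemma integrable_translate: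
  fixes f :: "'a::euclidean_space \<Rightarrow> 'b::euclidean_space"
  assumes "integrable lborel f"
  shows "integrable lborel (\<lambda>x. f (h + x))"
proof -
  have m: "f \<in> borel_measurable borel" using borel_measurable_integrable[OF assms] by simp
  have "integrable (distr lborel borel ((+) h)) f" using assms by (simp add: lborel_distr_plus)
  then show ?thesis using m by (subst (asm) integrable_distr_eq) auto
qed

lemma integrable_compact_support:
  fixes f :: "'a::euclidean_space \<Rightarrow> 'b::euclidean_space"
  assumes "continuous_on UNIV f" "compact K" "\<And>x. x \<notin> K \<Longrightarrow> f x = 0"
  shows "integrable lborel f"
proof -
  have "integrable lborel (\<lambda>x. indicator K x *\<^sub>R f x)"
    by (rule borel_integrable_compact[OF assms(2)]) (use assms(1) continuous_on_subset in blast)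
  moreover have "(\<lambda>x. indicator K x *\<^sub>R f x) = f"
    using assms(3) by (auto simp: indicator_def fun_eq_iff)
  ultimately show ?thesis by simp
qed

lemma compact_support_bounded:
  fixes f :: "'a::euclidean_space \<Rightarrow> 'b::euclidean_space"
  assumes "continuous_on UNIV f" "compact K" "\<And>x. x \<notin> K \<Longrightarrow> f x = 0"
  obtains B where "B > 0" "\<And>x. norm (f x) \<le> B"
proof -
  have "compact (f ` K)" using assms by (meson compact_continuous_image continuous_on_subset subset_UNIV)
  then obtain B where "B > 0" "\<And>y. y \<in> f ` K \<Longrightarrow> norm y \<le> B"
    using compact_imp_bounded bounded_pos by metis
  then have "norm (f x) \<le> B" for x using assms(3)[of x] by (cases "x \<in> K") auto
  then show thesis using that \<open>B > 0\<close> by blast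
qed

text \<open>Difference quotients integrate to zero by translation invariance, and they converge
  dominatedly to the directional derivative.\<close>

lemma integral_derivative_zero:
  fixes \<phi> :: "'a::euclidean_space \<Rightarrow> real"
  assumes der: "\<And>x. (\<phi> has_derivative (\<lambda>v. g x \<bullet> v)) (at x)" and g: "continuous_on UNIV g"
    and K: "compact K" "\<And>x. x \<notin> K \<Longrightarrow> \<phi> x = 0" "\<And>x. x \<notin> K \<Longrightarrow> g x = 0"
  shows "(LINT x|lborel. g x \<bullet> h) = 0"
proof -
  have cont: "continuous_on UNIV \<phi>"
    using has_derivative_continuous[OF der] by (simp add: continuous_on_eq_continuous_at)
  have [measurable]: "\<phi> \<in> borel_measurable borel" "g \<in> borel_measurable borel"
    using cont g by (auto intro: borel_measurable_continuous_onI)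
  obtain B where B: "B > 0" "\<And>x. norm (g x) \<le> B"
    using compact_support_bounded[OF g K(1,3)] by blast
  obtain R where R: "R > 0" "\<And>x. x \<in> K \<Longrightarrow> norm x \<le> R"
    using K(1) compact_imp_bounded bounded_pos by metis
  let ?q = "\<lambda>n x. real (Suc n) * (\<phi> ((1 / real (Suc n)) *\<^sub>R h + x) - \<phi> x)"
  have int: "integrable lborel \<phi>" by (rule integrable_compact_support[OF cont K(1,2)])
  have zero: "(LINT x|lborel. ?q n x) = 0" for n
    using int integrable_translate[OF int] integral_translate[of \<phi>] by simp
  have Lip: "\<bar>\<phi> y - \<phi> x\<bar> \<le> B * norm (y - x)" for x y
  proof -
    have "onorm (\<lambda>v. g x \<bullet> v) \<le> B" for x
    proof (rule onorm_le)
      fix v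
      have "norm (g x \<bullet> v) \<le> norm (g x) * norm v" using Cauchy_Schwarz_ineq2 by simp
      also have "\<dots> \<le> B * norm v" using B by (intro mult_right_mono) auto
      finally show "norm (g x \<bullet> v) \<le> B * norm v" .
    qed
    then show ?thesis
      using differentiable_bound[of UNIV \<phi> "\<lambda>x v. g x \<bullet> v" B y x] der by auto
  qed
  have "(\<lambda>n. LINT x|lborel. ?q n x) \<longlonglongrightarrow> (LINT x|lborel. g x \<bullet> h)"
  \<comment> \<open>The Lipschitz bound dominates the quotients by \<open>B * norm h\<close>; they
    vanish outside the ball, since a shift by at most \<open>norm h\<close> cannot reach
    \<open>K\<close> from there.\<close>
  proof (rule integral_dominated_convergence[where w="\<lambda>x. (B * norm h) * indicator (cball 0 (R + norm h)) x"])
    show "integrable lborel (\<lambda>x::'a. (B * norm h) * indicator (cball 0 (R + norm h)) x)"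
      by (intro integrable_mult_right integrable_real_indicator) (use emeasure_lborel_cball_finite in \<open>auto simp: less_top\<close>)
    show "AE x in lborel. (\<lambda>n. ?q n x) \<longlonglongrightarrow> g x \<bullet> h"
    proof (intro AE_I2)
      fix x
      have lin: "((\<lambda>t. x + t *\<^sub>R h) has_derivative (\<lambda>t. t *\<^sub>R h)) (at 0)"
        by (auto intro!: derivative_eq_intros)
      have "(\<phi> has_derivative (\<lambda>v. g x \<bullet> v)) (at (x + 0 *\<^sub>R h))" using der[of x] by simp
      from has_derivative_compose[OF lin this]
      have "((\<lambda>t. \<phi> (x + t *\<^sub>R h)) has_derivative (\<lambda>t. g x \<bullet> (t *\<^sub>R h))) (at 0)" .
      then have "((\<lambda>t. \<phi> (x + t *\<^sub>R h)) has_field_derivative (g x \<bullet> h)) (at 0)"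
        unfolding has_field_derivative_def by (rule has_derivative_eq_rhs) (auto simp: fun_eq_iff)
      then have "((\<lambda>t. (\<phi> (x + t *\<^sub>R h) - \<phi> x) / t) \<longlongrightarrow> g x \<bullet> h) (at 0)"
        by (simp add: DERIV_def)
      moreover have "filterlim (\<lambda>n. 1 / real (Suc n)) (at 0) sequentially"
        unfolding filterlim_at using LIMSEQ_inverse_real_of_nat by (simp add: inverse_eq_divide)
      ultimately have "(\<lambda>n. (\<phi> (x + (1 / real (Suc n)) *\<^sub>R h) - \<phi> x) / (1 / real (Suc n))) \<longlonglongrightarrow> g x \<bullet> h"
        by (rule filterlim_compose)
      then show "(\<lambda>n. ?q n x) \<longlonglongrightarrow> g x \<bullet> h" by (simp add: add.commute mult.commute)
    qed
    show "AE x in lborel. norm (?q n x) \<le> (B * norm h) * indicator (cball 0 (R + norm h)) x" for n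
    proof (intro AE_I2)
      fix x
      let ?y = "(1 / real (Suc n)) *\<^sub>R h"
      have small: "norm ?y \<le> norm h" by (simp add: divide_le_eq distrib_left)
      show "norm (?q n x) \<le> (B * norm h) * indicator (cball 0 (R + norm h)) x"
      proof (cases "x \<in> cball 0 (R + norm h)")
        case True
        have "norm (?q n x) = real (Suc n) * \<bar>\<phi> (?y + x) - \<phi> x\<bar>"
          by (simp add: abs_mult del: of_nat_Suc)
        also have "\<dots> \<le> real (Suc n) * (B * norm (?y + x - x))"
          by (intro mult_left_mono Lip) simp
        also have "\<dots> = B * norm h" by (simp del: of_nat_Suc)
        finally show ?thesis using True by simp
      next
        case False
        then have "norm x > R + norm h" by simp
        moreover have "norm x \<le> norm (?y + x) + norm ?y" by (metis add_diff_cancel_left' norm_triangle_ineq4 add.commute)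
        ultimately have "norm (?y + x) > R" "norm x > R" using small norm_ge_zero[of h] by linarith+
        then have "?y + x \<notin> K" "x \<notin> K" using R by force+
        then show ?thesis using False K(2) by simp
      qed
    qed
  qed measurable
  then show ?thesis unfolding zero using LIMSEQ_unique[OF tendsto_const] by fastforce
qed

subsection \<open>Weak gradients\<close>

text \<open>The factor \<open>Suc k\<close> sharpens the walls: \<open>bump 0\<close> vanishes at
  nonpositive arguments and tends to 1 at infinity, so these test functions converge boundedly to
  the indicator of the open box.\<close>

definition box_bump :: "'a::euclidean_space \<Rightarrow> 'a \<Rightarrow> nat \<Rightarrow> 'a \<Rightarrow> real" where
  "box_bump c d k x = (\<Prod>i\<in>Basis. bump 0 (real (Suc k) * (x \<bullet> i - c \<bullet> i)) * bump 0 (real (Suc k) * (d \<bullet> i - x \<bullet> i)))"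

lemma box_bump_test:
  assumes "cbox c d \<subseteq> \<Omega>" shows "box_bump c d k \<in> test_functions \<Omega>"
proof -
  have "smooth (box_bump c d k)"
    unfolding box_bump_def
    by (intro smooth_prod smooth_mult smooth_bump_comp smooth_diff smooth_const smooth_inner)
  moreover have "box_bump c d k x = 0" if "x \<notin> cbox c d" for x
  proof -
    have "\<exists>i\<in>Basis. x \<bullet> i < c \<bullet> i \<or> d \<bullet> i < x \<bullet> i"
      using that by (auto simp: mem_box not_le)
    then obtain i where i: "i \<in> Basis" "x \<bullet> i < c \<bullet> i \<or> d \<bullet> i < x \<bullet> i" by blast
    then have "bump 0 (real (Suc k) * (x \<bullet> i - c \<bullet> i)) * bump 0 (real (Suc k) * (d \<bullet> i - x \<bullet> i)) = 0"
      by (auto simp: bump_def zero_less_mult_iff simp del: of_nat_Suc)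
    then show ?thesis using i(1) unfolding box_bump_def by (intro prod_zero) auto
  qed
  ultimately show ?thesis
    unfolding test_functions_def using assms compact_cbox[of c d] by blast
qed

lemma box_bump_bounds: "0 \<le> box_bump c d k x" "box_bump c d k x \<le> 1"
proof -
  have "bump 0 t \<le> 1" for t using bump_le_fact[of 0 t] by simp
  then have *: "0 \<le> bump 0 s * bump 0 t \<and> bump 0 s * bump 0 t \<le> 1" for s t
    by (simp add: mult_le_one)
  show "0 \<le> box_bump c d k x" "box_bump c d k x \<le> 1"
    unfolding box_bump_def using * by (auto intro!: prod_nonneg prod_le_1)
qed

lemma bump_scaled_tendsto: "(\<lambda>k. bump 0 (real (Suc k) * t)) \<longlonglongrightarrow> (if t > 0 then 1 else 0)"
proof (cases "t > 0")
  case True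
  have "(\<lambda>k. exp (- ((1 / t) * inverse (real (Suc k))))) \<longlonglongrightarrow> exp (- ((1 / t) * 0))"
    by (intro tendsto_intros LIMSEQ_inverse_real_of_nat)
  then show ?thesis using True by (simp add: bump_def divide_inverse mult.commute)
next
  case False
  then have "bump 0 (real (Suc k) * t) = 0" for k
    by (auto simp: bump_def zero_less_mult_iff simp del: of_nat_Suc)
  then show ?thesis using False by simp
qed

lemma box_bump_tendsto: "(\<lambda>k. box_bump c d k x) \<longlonglongrightarrow> indicator (box c d) x"
proof -
  have "(\<lambda>k. box_bump c d k x) \<longlonglongrightarrow>
    (\<Prod>i\<in>Basis. (if x \<bullet> i - c \<bullet> i > 0 then 1 else 0) * (if d \<bullet> i - x \<bullet> i > 0 then 1 else 0))"
    unfolding box_bump_def by (intro tendsto_prod tendsto_mult bump_scaled_tendsto)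
  also have "(\<Prod>i\<in>Basis. (if x \<bullet> i - c \<bullet> i > 0 then 1 else 0) * (if d \<bullet> i - x \<bullet> i > 0 then 1 else 0))
      = (indicator (box c d) x :: real)"
    by (auto simp: indicator_def mem_box intro!: prod.neutral prod_zero)
  finally show ?thesis .
qed

text \<open>\<open>ennreal\<close> cuts off negative values, so the two densities are the positive
  and negative parts of \<open>H\<close>. They agree on boxes, an intersection-stable generator of
  the Borel sets, hence as measures, and densities are unique a.e.\<close>

lemma AE_zero_of_box_integrals:
  fixes H :: "'a::euclidean_space \<Rightarrow> real"
  assumes int: "integrable lborel H" and zero: "\<And>c d. (LINT x|lborel. H x * indicator (box c d) x) = 0"
  shows "AE x in lborel. H x = 0"
proof -
  have [measurable]: "H \<in> borel_measurable borel" using borel_measurable_integrable[OF int] by simp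
  let ?P = "density lborel (\<lambda>x. ennreal (H x))" and ?N = "density lborel (\<lambda>x. ennreal (- H x))"
  let ?E = "range (\<lambda>(a, b). box a b::'a set)"
  let ?A = "\<lambda>n::nat. box (- (real n *\<^sub>R One)) (real n *\<^sub>R One) :: 'a set"
  have eqP: "emeasure (density lborel (\<lambda>x. ennreal (F x))) (box c d)
      = ennreal (LINT x|lborel. max 0 (F x) * indicator (box c d) x)"
    if F: "integrable lborel F" for F :: "'a \<Rightarrow> real" and c d
  proof -
    have [measurable]: "F \<in> borel_measurable borel" using borel_measurable_integrable[OF F] by simp
    have "emeasure (density lborel (\<lambda>x. ennreal (F x))) (box c d)
        = (\<integral>\<^sup>+x. ennreal (F x) * indicator (box c d) x \<partial>lborel)"
      by (subst emeasure_density) auto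
    also have "\<dots> = (\<integral>\<^sup>+x. ennreal (max 0 (F x) * indicator (box c d) x) \<partial>lborel)"
      by (intro nn_integral_cong) (auto simp: indicator_def max_def ennreal_neg)
    also have "\<dots> = ennreal (LINT x|lborel. max 0 (F x) * indicator (box c d) x)"
    proof (rule nn_integral_eq_integral)
      show "integrable lborel (\<lambda>x. max 0 (F x) * indicator (box c d) x)"
        by (rule Bochner_Integration.integrable_bound[OF F]) (auto simp: indicator_def)
    qed (auto simp: indicator_def)
    finally show ?thesis .
  qed
  have int': "integrable lborel (\<lambda>x. - H x)" using int by simp
  have "?P = ?N"
  proof (rule measure_eqI_generator_eq)
    show "Int_stable ?E" by (auto simp: Int_stable_def box_Int_box)
    show "?E \<subseteq> Pow UNIV" "sets ?P = sigma_sets UNIV ?E" "sets ?N = sigma_sets UNIV ?E"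
      by (simp_all add: borel_eq_box)
    show "range ?A \<subseteq> ?E" "(\<Union>i. ?A i) = UNIV"
      unfolding UN_box_eq_UNIV by auto
    show "emeasure ?P (?A i) \<noteq> \<infinity>" for i by (simp add: eqP[OF int])
    show "emeasure ?P X = emeasure ?N X" if "X \<in> ?E" for X
    proof -
      obtain c d where X: "X = box c d" using \<open>X \<in> ?E\<close> by auto
      have i: "integrable lborel (\<lambda>x. max 0 (F x) * indicator (box c d) x)"
        if F: "integrable lborel F" for F :: "'a \<Rightarrow> real"
      proof (rule Bochner_Integration.integrable_bound[OF F])
        show "(\<lambda>x. max 0 (F x) * indicator (box c d) x) \<in> borel_measurable lborel"
          using borel_measurable_integrable[OF F] by measurable
      qed (auto simp: indicator_def)
      have "(LINT x|lborel. max 0 (H x) * indicator (box c d) x) - (LINT x|lborel. max 0 (- H x) * indicator (box c d) x)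
          = (LINT x|lborel. max 0 (H x) * indicator (box c d) x - max 0 (- H x) * indicator (box c d) x)"
        using i[OF int] i[OF int'] by simp
      also have "\<dots> = (LINT x|lborel. H x * indicator (box c d) x)"
        by (intro Bochner_Integration.integral_cong) (auto simp: indicator_def max_def)
      also have "\<dots> = 0" by (rule zero)
      finally show ?thesis unfolding X eqP[OF int] eqP[OF int'] by simp
    qed
  qed
  then have "AE x in lborel. ennreal (H x) = ennreal (- H x)"
    by (intro sigma_finite_measure.density_unique[OF sigma_finite_lborel]) auto
  then show ?thesis
  proof eventually_elim
    case (elim x)
    then show ?case by (cases "H x \<ge> 0") (auto simp: ennreal_neg ennreal_eq_0_iff not_le)
  qed
qed

text \<open>The bridge between the definitions, which integrate over
  \<open>lebesgue_on \<Omega>\<close>, and translation or Tonelli arguments, which live on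
  \<open>lborel\<close>.\<close>

lemma lebesgue_on_integral_eq:
  fixes f :: "'a::euclidean_space \<Rightarrow> 'b::euclidean_space"
  assumes "f \<in> borel_measurable borel" "\<Omega> \<in> sets borel" "\<And>x. x \<notin> \<Omega> \<Longrightarrow> f x = 0"
  shows "integrable (lebesgue_on \<Omega>) f \<longleftrightarrow> integrable lborel f"
    and "(LINT x|lebesgue_on \<Omega>. f x) = (LINT x|lborel. f x)"
proof -
  have eq: "(\<lambda>x. if x \<in> \<Omega> then f x else 0) = f" using assms(3) by auto
  have \<Omega>: "\<Omega> \<in> sets lebesgue" using assms(2) by auto
  show "integrable (lebesgue_on \<Omega>) f \<longleftrightarrow> integrable lborel f"
    using Lebesgue_Measure.integrable_restrict_UNIV[OF \<Omega>, of f] integrable_completion[of f lborel] assms(1)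
    by (simp add: eq)
  show "(LINT x|lebesgue_on \<Omega>. f x) = (LINT x|lborel. f x)"
    using Lebesgue_Measure.integral_restrict_UNIV[OF \<Omega>, of f] integral_completion[of f lborel] assms(1)
    by (simp add: eq)
qed

text \<open>Du Bois-Reymond's lemma. As \<open>G\<close> is integrable only locally, the argument is
  made on each closed box inside \<open>\<Omega>\<close>: bumps converging to indicators of smaller
  boxes show that all box integrals vanish, and countably many closed boxes exhaust
  \<open>\<Omega>\<close>.\<close>

lemma fundamental_lemma:
  fixes G :: "'a::euclidean_space \<Rightarrow> real"
  assumes "open \<Omega>" and loc: "locally_integrable_on \<Omega> G"
    and zero: "\<And>\<phi>. \<phi> \<in> test_functions \<Omega> \<Longrightarrow> (LINT x|lebesgue_on \<Omega>. G x * \<phi> x) = 0"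
  shows "AE x in lebesgue_on \<Omega>. G x = 0"
proof -
  have \<Omega>: "\<Omega> \<in> sets lebesgue" using \<open>open \<Omega>\<close> by auto
  have box: "AE x in lebesgue. x \<in> cbox a b \<longrightarrow> G x = 0" if ab: "cbox a b \<subseteq> \<Omega>" for a b
  proof -
    let ?H = "\<lambda>x. if x \<in> cbox a b then G x else 0"
    have int: "integrable lebesgue ?H"
      using loc ab Lebesgue_Measure.integrable_restrict_UNIV[of "cbox a b" G]
      by (simp add: locally_integrable_on_def)
    \<comment> \<open>\<open>AE_zero_of_box_integrals\<close> speaks of \<open>lborel\<close>;
      \<open>H\<close> is a Borel version of the restricted \<open>G\<close>.\<close>
    obtain H where Hm: "H \<in> borel_measurable lborel" and HA: "AE x in lborel. ?H x = H x"
      using completion_ex_borel_measurable_real[OF borel_measurable_integrable[OF int]] by auto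
    have HA': "AE x in lebesgue. ?H x = H x" using HA by (rule AE_completion)
    have [measurable]: "H \<in> borel_measurable borel" using Hm by simp
    have Hint': "integrable lebesgue H"
      using integrable_cong_AE_imp[OF int _ HA'] measurable_completion[OF Hm] by simp
    then have Hint: "integrable lborel H" using integrable_completion[OF Hm] by simp
    have "AE x in lborel. H x = 0"
    proof (rule AE_zero_of_box_integrals[OF Hint])
      fix c d
      \<comment> \<open>Shrinking the test box into \<open>box a b\<close> puts the supports of the
        bumps where \<open>H\<close> agrees with \<open>G\<close> a.e.\<close>
      obtain c' d' where cd: "box c d \<inter> box a b = box c' d'" using box_Int_box[of c d a b] by blast
      have ae: "AE x in lborel. H x * indicator (box c d) x = H x * indicator (box c' d') x"
      proof -
        have "AE x in lborel. x \<notin> cbox a b - box a b"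
          using null_sets_cbox_Diff_box by (rule AE_not_in)
        with HA show ?thesis
        proof eventually_elim
          case (elim x)
          then show ?case unfolding cd[symmetric] by (auto simp: indicator_def split: if_splits)
        qed
      qed
      have "(LINT x|lborel. H x * indicator (box c d) x) = (LINT x|lborel. H x * indicator (box c' d') x)"
        by (rule integral_cong_AE[OF _ _ ae]) measurable
      also have "\<dots> = 0"
      proof (cases "box c' d' = {}")
        case False
        have sub: "cbox c' d' \<subseteq> cbox a b"
        proof -
          have "closure (box c' d') \<subseteq> closure (box a b)" using cd by (intro closure_mono) blast
          moreover have "box a b \<noteq> {}" using False cd by blast
          ultimately show ?thesis using False by (simp add: closure_box)
        qed
        have cont: "continuous_on UNIV (box_bump c' d' k)" for k
          using smooth_continuous[OF test_smooth[OF box_bump_test[OF order_trans[OF sub ab]]]] .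
        have [measurable]: "box_bump c' d' k \<in> borel_measurable borel" for k
          using cont by (rule borel_measurable_continuous_onI)
        have lim: "(\<lambda>k. LINT x|lborel. H x * box_bump c' d' k x) \<longlonglongrightarrow> (LINT x|lborel. H x * indicator (box c' d') x)"
        proof (rule integral_dominated_convergence[where w="\<lambda>x. norm (H x)"])
          show "AE x in lborel. (\<lambda>k. H x * box_bump c' d' k x) \<longlonglongrightarrow> H x * indicator (box c' d') x"
            by (intro AE_I2 tendsto_mult tendsto_const box_bump_tendsto)
          show "AE x in lborel. norm (H x * box_bump c' d' k x) \<le> norm (H x)" for k
            using box_bump_bounds[of c' d' k]
            by (intro AE_I2) (simp add: abs_mult mult_left_le)
        qed (use Hint in auto)
        have "(LINT x|lborel. H x * box_bump c' d' k x) = 0" for k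
        proof -
          have t: "box_bump c' d' k \<in> test_functions \<Omega>" using box_bump_test sub ab by blast
          have t': "box_bump c' d' k \<in> test_functions (cbox a b)" using box_bump_test sub by blast
          have "(LINT x|lborel. H x * box_bump c' d' k x) = (LINT x|lebesgue. H x * box_bump c' d' k x)"
            by (subst integral_completion) auto
          also have "\<dots> = (LINT x|lebesgue. (if x \<in> \<Omega> then G x * box_bump c' d' k x else 0))"
          proof (rule integral_cong_AE)
            show bm: "(\<lambda>x. H x * box_bump c' d' k x) \<in> borel_measurable lebesgue"
              by (intro measurable_completion) measurable
            show ae: "AE x in lebesgue. H x * box_bump c' d' k x = (if x \<in> \<Omega> then G x * box_bump c' d' k x else 0)"
              using HA'
            proof eventually_elim
              case (elim x)
              then show ?case using test_zero_outside[OF t', of x] ab by (auto split: if_splits)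
            qed
            show "(\<lambda>x. if x \<in> \<Omega> then G x * box_bump c' d' k x else 0) \<in> borel_measurable lebesgue"
              by (rule borel_measurable_AE[OF bm ae])
          qed
          also have "\<dots> = (LINT x|lebesgue_on \<Omega>. G x * box_bump c' d' k x)"
            by (rule Lebesgue_Measure.integral_restrict_UNIV[OF \<Omega>])
          also have "\<dots> = 0" by (rule zero[OF t])
          finally show ?thesis .
        qed
        with lim show ?thesis using LIMSEQ_unique[OF tendsto_const] by fastforce
      qed simp
      finally show "(LINT x|lborel. H x * indicator (box c d) x) = 0" .
    qed
    then have "AE x in lebesgue. H x = 0" by (rule AE_completion)
    with HA' show ?thesis by eventually_elim (auto split: if_splits)
  qed
  obtain \<D> where \<D>: "countable \<D>" "\<D> \<subseteq> Pow \<Omega>" "\<And>X. X \<in> \<D> \<Longrightarrow> \<exists>a b. X = cbox a b" "\<Union>\<D> = \<Omega>"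
    using open_countable_Union_open_cbox[OF \<open>open \<Omega>\<close>] by metis
  have "AE x in lebesgue. \<forall>X\<in>\<D>. x \<in> X \<longrightarrow> G x = 0"
    unfolding AE_ball_countable[OF \<D>(1)]
  proof
    fix X assume "X \<in> \<D>"
    then obtain a b where "X = cbox a b" "cbox a b \<subseteq> \<Omega>" using \<D>(2,3) by blast
    then show "AE x in lebesgue. x \<in> X \<longrightarrow> G x = 0" using box by simp
  qed
  then have "AE x in lebesgue. x \<in> \<Omega> \<longrightarrow> G x = 0"
    by eventually_elim (use \<D>(4) in blast)
  then show ?thesis using \<Omega> by (simp add: AE_restrict_space_iff)
qed

section \<open>Integration by parts for test functions\<close>

lemma test_integrable:
  assumes "\<phi> \<in> test_functions \<Omega>"
  shows "continuous_on UNIV \<phi>" "\<phi> \<in> borel_measurable borel" "integrable lborel \<phi>"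
    "continuous_on UNIV (grad \<phi>)" "grad \<phi> \<in> borel_measurable borel" "sqint lborel \<phi>" "sqint lborel (grad \<phi>)"
proof -
  obtain K where K: "compact K" "K \<subseteq> \<Omega>" "\<And>x. x \<notin> K \<Longrightarrow> \<phi> x = 0" "\<And>x. x \<notin> K \<Longrightarrow> grad \<phi> x = 0"
    using assms by (meson test_support)
  show c: "continuous_on UNIV \<phi>" "continuous_on UNIV (grad \<phi>)"
    using smooth_continuous smooth_continuous_grad test_smooth[OF assms] by blast+
  then show m: "\<phi> \<in> borel_measurable borel" "grad \<phi> \<in> borel_measurable borel"
    by (auto intro: borel_measurable_continuous_onI)
  show "integrable lborel \<phi>" by (rule integrable_compact_support[OF c(1) K(1,3)])
  have "integrable lborel (\<lambda>x. (norm (\<phi> x))\<^sup>2)"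
    by (rule integrable_compact_support[OF _ K(1)]) (use c K in \<open>auto intro!: continuous_intros\<close>)
  then show "sqint lborel \<phi>" using m by (simp add: sqint_def)
  have "integrable lborel (\<lambda>x. (norm (grad \<phi> x))\<^sup>2)"
    by (rule integrable_compact_support[OF _ K(1)]) (use c K in \<open>auto intro!: continuous_intros\<close>)
  then show "sqint lborel (grad \<phi>)" using m by (simp add: sqint_def)
qed

lemma borel_measurable_lebesgue_on:
  fixes f :: "'a::euclidean_space \<Rightarrow> 'b::euclidean_space"
  assumes "f \<in> borel_measurable borel"
  shows "f \<in> borel_measurable (lebesgue_on S)"
  by (intro measurable_restrict_space1 measurable_completion) (use assms in simp)

lemma sqint_lebesgue_on_eq:
  fixes f :: "'a::euclidean_space \<Rightarrow> 'b::euclidean_space"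
  assumes "f \<in> borel_measurable borel" "\<Omega> \<in> sets borel" "\<And>x. x \<notin> \<Omega> \<Longrightarrow> f x = 0"
  shows "sqint (lebesgue_on \<Omega>) f \<longleftrightarrow> sqint lborel f" "l2 (lebesgue_on \<Omega>) f = l2 lborel f"
proof -
  have m: "(\<lambda>x. (norm (f x))\<^sup>2) \<in> borel_measurable borel" using assms(1) by measurable
  show "sqint (lebesgue_on \<Omega>) f \<longleftrightarrow> sqint lborel f"
    using lebesgue_on_integral_eq(1)[OF m assms(2)] assms borel_measurable_lebesgue_on[OF assms(1)]
    by (simp add: sqint_def)
  show "l2 (lebesgue_on \<Omega>) f = l2 lborel f"
    using lebesgue_on_integral_eq(2)[OF m assms(2)] assms by (simp add: l2_def)
qed

lemma test_sqint:
  assumes "\<phi> \<in> test_functions \<Omega>" "open \<Omega>"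
  shows "sqint (lebesgue_on \<Omega>) \<phi>" "sqint (lebesgue_on \<Omega>) (grad \<phi>)"
    "l2 (lebesgue_on \<Omega>) \<phi> = l2 lborel \<phi>" "l2 (lebesgue_on \<Omega>) (grad \<phi>) = l2 lborel (grad \<phi>)"
  using sqint_lebesgue_on_eq[of \<phi> \<Omega>] sqint_lebesgue_on_eq[of "grad \<phi>" \<Omega>] test_integrable[OF assms(1)]
    test_zero_outside[OF assms(1)] grad_test_zero_outside[OF assms(1)] assms(2) by auto

text \<open>\<open>norm (f x) \<le> 1 + (norm (f x))\<^sup>2\<close>, and the constant 1 is
  integrable over a compact set.\<close>

lemma sqint_locally_integrable:
  fixes f :: "'a::euclidean_space \<Rightarrow> 'b::euclidean_space"
  assumes "sqint (lebesgue_on \<Omega>) f" "open \<Omega>"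
  shows "locally_integrable_on \<Omega> f"
  unfolding locally_integrable_on_def
proof (intro allI impI)
  fix K assume K: "compact K \<and> K \<subseteq> \<Omega>"
  then have Ks: "K \<in> sets lebesgue" by (simp add: compact_imp_closed)
  have \<Omega>: "\<Omega> \<in> sets lebesgue" using assms(2) by auto
  have "integrable (lebesgue_on \<Omega>) (\<lambda>x. indicator K x + (norm (f x))\<^sup>2)"
  proof (rule Bochner_Integration.integrable_add)
    have "integrable lebesgue (\<lambda>x. if x \<in> \<Omega> then indicator K x else 0 :: real)"
    proof -
      have "integrable lebesgue (indicator K :: _ \<Rightarrow> real)"
        using K lmeasurable_compact[of K] by (simp add: lmeasurable_iff_integrable)
      moreover have "(\<lambda>x. if x \<in> \<Omega> then indicator K x else 0 :: real) = indicator K"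
        by (intro ext) (use K in \<open>auto simp: indicator_def\<close>)
      ultimately show ?thesis by simp
    qed
    then show "integrable (lebesgue_on \<Omega>) (indicator K :: _ \<Rightarrow> real)"
      by (simp only: Lebesgue_Measure.integrable_restrict_UNIV[OF \<Omega>])
  qed (rule sqint_integrable[OF assms(1)])
  then have "integrable (lebesgue_on \<Omega>) (\<lambda>x. indicator K x *\<^sub>R f x)"
  proof (rule Bochner_Integration.integrable_bound)
    have [measurable]: "K \<in> sets (lebesgue_on \<Omega>)" using K Ks \<Omega> by (auto simp: sets_restrict_space_iff)
    show "(\<lambda>x. indicator K x *\<^sub>R f x) \<in> borel_measurable (lebesgue_on \<Omega>)"
      using sqint_measurable[OF assms(1)] by measurable
    have "norm (f x) \<le> 1 + (norm (f x))\<^sup>2" for x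
    proof -
      have "2 * norm (f x) \<le> (norm (f x))\<^sup>2 + 1" using sum_squares_bound[of "norm (f x)" 1] by simp
      then show ?thesis using norm_ge_zero[of "f x"] by linarith
    qed
    then show "AE x in lebesgue_on \<Omega>. norm (indicator K x *\<^sub>R f x) \<le> norm (indicator K x + (norm (f x))\<^sup>2)"
      by (intro AE_I2) (auto simp: indicator_def)
  qed
  then have "integrable lebesgue (\<lambda>x. if x \<in> \<Omega> then indicator K x *\<^sub>R f x else 0)"
    by (simp only: Lebesgue_Measure.integrable_restrict_UNIV[OF \<Omega>])
  also have "(\<lambda>x. if x \<in> \<Omega> then indicator K x *\<^sub>R f x else 0) = (\<lambda>x. if x \<in> K then f x else 0)"
    by (intro ext) (use K in \<open>auto simp: indicator_def\<close>)
  finally show "integrable (lebesgue_on K) f" by (simp only: Lebesgue_Measure.integrable_restrict_UNIV[OF Ks])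
qed

lemma grad_inner_Basis: "i \<in> Basis \<Longrightarrow> grad f x \<bullet> i = frechet_derivative f (at x) i"
  by (simp add: grad_def inner_sum_left inner_Basis if_distrib cong: if_cong)

lemma integration_by_parts:
  assumes "\<phi> \<in> test_functions \<Omega>" "\<psi> \<in> test_functions \<Omega>'"
  shows "(LINT x|lborel. \<phi> x * (grad \<psi> x \<bullet> i)) = - (LINT x|lborel. (grad \<phi> x \<bullet> i) * \<psi> x)"
proof -
  have t: "(\<lambda>x. \<phi> x * \<psi> x) \<in> test_functions \<Omega>'"
    by (rule test_mult[OF assms(2) test_smooth[OF assms(1)]])
  obtain K where K: "compact K" "\<And>x. x \<notin> K \<Longrightarrow> \<phi> x * \<psi> x = 0" "\<And>x. x \<notin> K \<Longrightarrow> grad (\<lambda>x. \<phi> x * \<psi> x) x = 0"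
    using test_support[OF t] by metis
  have "(LINT x|lborel. grad (\<lambda>x. \<phi> x * \<psi> x) x \<bullet> i) = 0"
    using integral_derivative_zero[OF smooth_has_derivative[OF test_smooth[OF t]] test_integrable(4)[OF t] K] .
  also have "(\<lambda>x. grad (\<lambda>x. \<phi> x * \<psi> x) x \<bullet> i) = (\<lambda>x. \<phi> x * (grad \<psi> x \<bullet> i) + (grad \<phi> x \<bullet> i) * \<psi> x)"
    using grad_mult[OF test_smooth[OF assms(1)] test_smooth[OF assms(2)]]
    by (simp add: inner_add_left mult.commute)
  also have "(LINT x|lborel. \<phi> x * (grad \<psi> x \<bullet> i) + (grad \<phi> x \<bullet> i) * \<psi> x) =
      (LINT x|lborel. \<phi> x * (grad \<psi> x \<bullet> i)) + (LINT x|lborel. (grad \<phi> x \<bullet> i) * \<psi> x)"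
    using sqint_integrable_mult[OF test_integrable(6)[OF assms(1)] test_integrable(6)[OF test_grad_inner[OF assms(2), of i]]]
      sqint_integrable_mult[OF test_integrable(6)[OF test_grad_inner[OF assms(1), of i]] test_integrable(6)[OF assms(2)]]
    by (rule Bochner_Integration.integral_add)
  finally show ?thesis by simp
qed

lemma has_weak_gradient_test:
  assumes "\<phi> \<in> test_functions \<Omega>" "open \<Omega>"
  shows "has_weak_gradient \<Omega> \<phi> (grad \<phi>)"
  unfolding has_weak_gradient_def
proof (intro conjI ballI)
  show "locally_integrable_on \<Omega> \<phi>" "locally_integrable_on \<Omega> (grad \<phi>)"
    using sqint_locally_integrable test_sqint assms by blast+
  fix \<psi> and i :: 'a assume \<psi>: "\<psi> \<in> test_functions \<Omega>" and i: "i \<in> Basis"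
  have [measurable]: "\<phi> \<in> borel_measurable borel" "\<psi> \<in> borel_measurable borel"
    "grad \<phi> \<in> borel_measurable borel" "grad \<psi> \<in> borel_measurable borel"
    using test_integrable assms(1) \<psi> by blast+
  have "(LINT x|lebesgue_on \<Omega>. \<phi> x * frechet_derivative \<psi> (at x) i) = (LINT x|lborel. \<phi> x * (grad \<psi> x \<bullet> i))"
    unfolding grad_inner_Basis[OF i, symmetric]
    by (rule lebesgue_on_integral_eq(2)) (use assms test_zero_outside in \<open>auto\<close>)
  also have "\<dots> = - (LINT x|lborel. (grad \<phi> x \<bullet> i) * \<psi> x)"
    by (rule integration_by_parts[OF assms(1) \<psi>])
  also have "(LINT x|lborel. (grad \<phi> x \<bullet> i) * \<psi> x) = (LINT x|lebesgue_on \<Omega>. (grad \<phi> x \<bullet> i) * \<psi> x)"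
    by (rule lebesgue_on_integral_eq(2)[symmetric]) (use assms \<psi> test_zero_outside in \<open>auto\<close>)
  finally show "(LINT x|lebesgue_on \<Omega>. \<phi> x * frechet_derivative \<psi> (at x) i) =
      - (LINT x|lebesgue_on \<Omega>. (grad \<phi> x \<bullet> i) * \<psi> x)" .
qed

lemma integrable_loc_times_test:
  fixes G :: "'a::euclidean_space \<Rightarrow> real"
  assumes "locally_integrable_on \<Omega> G" "\<phi> \<in> test_functions \<Omega>" "open \<Omega>"
  shows "integrable (lebesgue_on \<Omega>) (\<lambda>x. G x * \<phi> x)"
proof -
  obtain K where K: "compact K" "K \<subseteq> \<Omega>" "\<And>x. x \<notin> K \<Longrightarrow> \<phi> x = 0"
    using assms(2) by (meson test_support)
  obtain B where B: "B > 0" "\<And>x. norm (\<phi> x) \<le> B"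
    using compact_support_bounded[OF test_integrable(1)[OF assms(2)] K(1,3)] by blast
  have Ks: "K \<in> sets lebesgue" and \<Omega>: "\<Omega> \<in> sets lebesgue" using K assms(3) by (auto simp: compact_imp_closed)
  have "integrable (lebesgue_on K) (\<lambda>x. G x * \<phi> x)"
  proof (rule Bochner_Integration.integrable_bound)
    have G: "integrable (lebesgue_on K) G" using assms(1) K by (simp add: locally_integrable_on_def)
    then show "integrable (lebesgue_on K) (\<lambda>x. B * G x)" by simp
    show "(\<lambda>x. G x * \<phi> x) \<in> borel_measurable (lebesgue_on K)"
      using borel_measurable_integrable[OF G] borel_measurable_lebesgue_on[OF test_integrable(2)[OF assms(2)]]
      by measurable
    show "AE x in lebesgue_on K. norm (G x * \<phi> x) \<le> norm (B * G x)"
    proof (intro AE_I2)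
      fix x
      have "norm (G x * \<phi> x) \<le> \<bar>G x\<bar> * B" using B(2)[of x] by (simp add: abs_mult mult_left_mono)
      then show "norm (G x * \<phi> x) \<le> norm (B * G x)" using B(1) by (simp add: abs_mult mult.commute)
    qed
  qed
  then have "integrable lebesgue (\<lambda>x. if x \<in> K then G x * \<phi> x else 0)"
    by (simp only: Lebesgue_Measure.integrable_restrict_UNIV[OF Ks])
  also have "(\<lambda>x. if x \<in> K then G x * \<phi> x else 0) = (\<lambda>x. if x \<in> \<Omega> then G x * \<phi> x else 0)"
    by (intro ext) (use K in auto)
  finally show ?thesis by (simp only: Lebesgue_Measure.integrable_restrict_UNIV[OF \<Omega>])
qed

section \<open>Uniqueness and measurability of the weak gradient\<close>

lemma locally_integrable_inner:
  assumes "locally_integrable_on \<Omega> G" shows "locally_integrable_on \<Omega> (\<lambda>x. G x \<bullet> i)"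
  using assms by (auto simp: locally_integrable_on_def)

lemma locally_integrable_diff:
  assumes "locally_integrable_on \<Omega> G" "locally_integrable_on \<Omega> H"
  shows "locally_integrable_on \<Omega> (\<lambda>x. G x - H x)"
  using assms by (auto simp: locally_integrable_on_def)

lemma weak_gradient_unique:
  assumes "open \<Omega>" "has_weak_gradient \<Omega> u G" "has_weak_gradient \<Omega> u H"
  shows "AE x in lebesgue_on \<Omega>. G x = H x"
proof -
  have loc: "locally_integrable_on \<Omega> G" "locally_integrable_on \<Omega> H"
    using assms by (auto simp: has_weak_gradient_def)
  have "AE x in lebesgue_on \<Omega>. G x \<bullet> i - H x \<bullet> i = 0" if i: "i \<in> Basis" for i
  proof (rule fundamental_lemma[OF assms(1)])
    show "locally_integrable_on \<Omega> (\<lambda>x. G x \<bullet> i - H x \<bullet> i)"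
      using loc by (intro locally_integrable_diff locally_integrable_inner)
    fix \<phi> assume \<phi>: "\<phi> \<in> test_functions \<Omega>"
    have "(LINT x|lebesgue_on \<Omega>. (G x \<bullet> i - H x \<bullet> i) * \<phi> x) =
       (LINT x|lebesgue_on \<Omega>. (G x \<bullet> i) * \<phi> x) - (LINT x|lebesgue_on \<Omega>. (H x \<bullet> i) * \<phi> x)"
      unfolding left_diff_distrib
      by (intro Bochner_Integration.integral_diff integrable_loc_times_test locally_integrable_inner loc \<phi> assms(1))
    then show "(LINT x|lebesgue_on \<Omega>. (G x \<bullet> i - H x \<bullet> i) * \<phi> x) = 0"
      using assms(2,3) \<phi> i by (simp add: has_weak_gradient_def)
  qed
  then have "AE x in lebesgue_on \<Omega>. \<forall>i\<in>Basis. G x \<bullet> i - H x \<bullet> i = 0"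
    by (simp add: AE_ball_countable countable_finite)
  then show ?thesis by eventually_elim (auto intro: euclidean_eqI)
qed

lemma wgrad_eq:
  assumes "open \<Omega>" "has_weak_gradient \<Omega> u G"
  shows "has_weak_gradient \<Omega> u (wgrad \<Omega> u)" "AE x in lebesgue_on \<Omega>. wgrad \<Omega> u x = G x"
proof -
  show *: "has_weak_gradient \<Omega> u (wgrad \<Omega> u)"
    unfolding wgrad_def by (rule someI[where P="has_weak_gradient \<Omega> u", OF assms(2)])
  show "AE x in lebesgue_on \<Omega>. wgrad \<Omega> u x = G x"
    by (rule weak_gradient_unique[OF assms(1) * assms(2)])
qed

text \<open>Completeness of Lebesgue measure. It transfers measurability to \<open>wgrad\<close>,
  which is a choice known only up to a null set.\<close>

lemma borel_measurable_lebesgue_on_AE: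
  fixes f g :: "'a::euclidean_space \<Rightarrow> 'b::euclidean_space"
  assumes "f \<in> borel_measurable (lebesgue_on S)" "S \<in> sets lebesgue" "AE x in lebesgue_on S. f x = g x"
  shows "g \<in> borel_measurable (lebesgue_on S)"
proof -
  have "(\<lambda>x. if x \<in> S then g x else 0) \<in> borel_measurable lebesgue"
  proof (rule borel_measurable_AE[OF borel_measurable_if_I[OF assms(1,2)]])
    have "AE x in lebesgue. x \<in> S \<longrightarrow> f x = g x"
      using assms(2,3) by (simp add: AE_restrict_space_iff)
    then show "AE x in lebesgue. (if x \<in> S then f x else 0) = (if x \<in> S then g x else 0)"
      by eventually_elim auto
  qed
  then show ?thesis using borel_measurable_if_D by blast
qed

lemma wgrad_sqint:
  assumes "open \<Omega>" "has_weak_gradient \<Omega> u G" "sqint (lebesgue_on \<Omega>) G"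
  shows "sqint (lebesgue_on \<Omega>) (wgrad \<Omega> u)"
proof -
  have ae: "AE x in lebesgue_on \<Omega>. G x = wgrad \<Omega> u x"
    using wgrad_eq(2)[OF assms(1,2)] by eventually_elim simp
  show ?thesis
    by (rule sqint_cong_AE[OF assms(3) borel_measurable_lebesgue_on_AE[OF sqint_measurable[OF assms(3)] _ ae] ae])
      (use assms(1) in auto)
qed

section \<open>\<open>W012\<close> through approximating test functions\<close>

lemma Lnorm_2: "Lnorm \<Omega> 2 f = l2 (lebesgue_on \<Omega>) f"
  by (simp add: Lnorm_def l2_def powr_half_sqrt integral_nonneg_AE powr_numeral)

lemma in_Lp_2: "in_Lp \<Omega> 2 f \<longleftrightarrow> sqint (lebesgue_on \<Omega>) f"
  by (simp add: in_Lp_def sqint_def powr_numeral)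

lemma has_weak_gradient_diff:
  assumes "open \<Omega>" "has_weak_gradient \<Omega> u G" "has_weak_gradient \<Omega> v H"
  shows "has_weak_gradient \<Omega> (\<lambda>x. u x - v x) (\<lambda>x. G x - H x)"
  unfolding has_weak_gradient_def
proof (intro conjI ballI)
  have loc: "locally_integrable_on \<Omega> u" "locally_integrable_on \<Omega> v"
    "locally_integrable_on \<Omega> G" "locally_integrable_on \<Omega> H"
    using assms by (auto simp: has_weak_gradient_def)
  then show "locally_integrable_on \<Omega> (\<lambda>x. u x - v x)" "locally_integrable_on \<Omega> (\<lambda>x. G x - H x)"
    by (auto intro: locally_integrable_diff)
  fix \<phi> and i :: 'a assume \<phi>: "\<phi> \<in> test_functions \<Omega>" and i: "i \<in> Basis"
  have t: "(\<lambda>x. frechet_derivative \<phi> (at x) i) \<in> test_functions \<Omega>"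
    using test_grad_inner[OF \<phi>, of i] by (simp add: grad_inner_Basis[OF i])
  have "(LINT x|lebesgue_on \<Omega>. (u x - v x) * frechet_derivative \<phi> (at x) i) =
      (LINT x|lebesgue_on \<Omega>. u x * frechet_derivative \<phi> (at x) i) - (LINT x|lebesgue_on \<Omega>. v x * frechet_derivative \<phi> (at x) i)"
    unfolding left_diff_distrib
    by (intro Bochner_Integration.integral_diff integrable_loc_times_test loc t assms(1))
  also have "\<dots> = - ((LINT x|lebesgue_on \<Omega>. (G x \<bullet> i) * \<phi> x) - (LINT x|lebesgue_on \<Omega>. (H x \<bullet> i) * \<phi> x))"
    using assms(2,3) \<phi> i by (simp add: has_weak_gradient_def)
  also have "(LINT x|lebesgue_on \<Omega>. (G x \<bullet> i) * \<phi> x) - (LINT x|lebesgue_on \<Omega>. (H x \<bullet> i) * \<phi> x) =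
      (LINT x|lebesgue_on \<Omega>. ((G x - H x) \<bullet> i) * \<phi> x)"
    unfolding inner_diff_left left_diff_distrib
    by (intro Bochner_Integration.integral_diff[symmetric] integrable_loc_times_test locally_integrable_inner loc \<phi> assms(1))
  finally show "(LINT x|lebesgue_on \<Omega>. (u x - v x) * frechet_derivative \<phi> (at x) i) =
      - (LINT x|lebesgue_on \<Omega>. ((G x - H x) \<bullet> i) * \<phi> x)" .
qed

text \<open>Against a fixed test function both sides of the defining identity are continuous in the
  L^2 distance, so the identity survives the limit.\<close>

lemma has_weak_gradient_limit:
  assumes "open \<Omega>" and \<phi>: "\<And>n. \<phi> n \<in> test_functions \<Omega>"
    and u: "sqint (lebesgue_on \<Omega>) u" and G: "sqint (lebesgue_on \<Omega>) G"
    and lim: "(\<lambda>n. l2 (lebesgue_on \<Omega>) (\<lambda>x. \<phi> n x - u x)) \<longlonglongrightarrow> 0"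
      "(\<lambda>n. l2 (lebesgue_on \<Omega>) (\<lambda>x. grad (\<phi> n) x - G x)) \<longlonglongrightarrow> 0"
  shows "has_weak_gradient \<Omega> u G"
  unfolding has_weak_gradient_def
proof (intro conjI ballI)
  show "locally_integrable_on \<Omega> u" "locally_integrable_on \<Omega> G"
    using sqint_locally_integrable u G \<open>open \<Omega>\<close> by blast+
  fix \<psi> and i :: 'a assume \<psi>: "\<psi> \<in> test_functions \<Omega>" and i: "i \<in> Basis"
  have t: "(\<lambda>x. grad \<psi> x \<bullet> i) \<in> test_functions \<Omega>" by (rule test_grad_inner[OF \<psi>])
  have s: "sqint (lebesgue_on \<Omega>) (\<lambda>x. \<psi> x *\<^sub>R i)"
    using test_sqint(1)[OF \<psi> \<open>open \<Omega>\<close>] by (auto simp: sqint_def i)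
  have "(\<lambda>n. LINT x|lebesgue_on \<Omega>. \<phi> n x \<bullet> (grad \<psi> x \<bullet> i)) \<longlonglongrightarrow> (LINT x|lebesgue_on \<Omega>. u x \<bullet> (grad \<psi> x \<bullet> i))"
    by (rule l2_inner_tendsto[OF test_sqint(1)[OF \<phi> \<open>open \<Omega>\<close>] u test_sqint(1)[OF t \<open>open \<Omega>\<close>] lim(1)])
  moreover have "(\<lambda>n. LINT x|lebesgue_on \<Omega>. grad (\<phi> n) x \<bullet> (\<psi> x *\<^sub>R i)) \<longlonglongrightarrow> (LINT x|lebesgue_on \<Omega>. G x \<bullet> (\<psi> x *\<^sub>R i))"
    by (rule l2_inner_tendsto[OF test_sqint(2)[OF \<phi> \<open>open \<Omega>\<close>] G s lim(2)])
  moreover have "(LINT x|lebesgue_on \<Omega>. \<phi> n x \<bullet> (grad \<psi> x \<bullet> i)) = - (LINT x|lebesgue_on \<Omega>. grad (\<phi> n) x \<bullet> (\<psi> x *\<^sub>R i))" for n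
    using has_weak_gradient_test[OF \<phi>[of n] \<open>open \<Omega>\<close>] \<psi> i
    by (simp add: has_weak_gradient_def grad_inner_Basis mult.commute)
  ultimately have "(LINT x|lebesgue_on \<Omega>. u x \<bullet> (grad \<psi> x \<bullet> i)) = - (LINT x|lebesgue_on \<Omega>. G x \<bullet> (\<psi> x *\<^sub>R i))"
    using LIMSEQ_unique[OF _ tendsto_minus] by (simp only:)
  then show "(LINT x|lebesgue_on \<Omega>. u x * frechet_derivative \<psi> (at x) i) = - (LINT x|lebesgue_on \<Omega>. (G x \<bullet> i) * \<psi> x)"
    by (simp add: grad_inner_Basis[OF i] mult.commute)
qed

lemma W12_norm_diff_test:
  assumes "open \<Omega>" "\<phi> \<in> test_functions \<Omega>" "has_weak_gradient \<Omega> u G" "sqint (lebesgue_on \<Omega>) u" "sqint (lebesgue_on \<Omega>) G"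
  shows "W12_norm \<Omega> (\<lambda>x. u x - \<phi> x) =
    sqrt ((l2 (lebesgue_on \<Omega>) (\<lambda>x. \<phi> x - u x))\<^sup>2 + (l2 (lebesgue_on \<Omega>) (\<lambda>x. grad \<phi> x - G x))\<^sup>2)"
proof -
  have h: "has_weak_gradient \<Omega> (\<lambda>x. u x - \<phi> x) (\<lambda>x. G x - grad \<phi> x)"
    by (rule has_weak_gradient_diff[OF assms(1,3) has_weak_gradient_test[OF assms(2,1)]])
  have s: "sqint (lebesgue_on \<Omega>) (\<lambda>x. G x - grad \<phi> x)"
    using sqint_diff[OF assms(5) test_sqint(2)[OF assms(2,1)]] .
  have "l2 (lebesgue_on \<Omega>) (wgrad \<Omega> (\<lambda>x. u x - \<phi> x)) = l2 (lebesgue_on \<Omega>) (\<lambda>x. G x - grad \<phi> x)"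
    by (intro l2_cong_AE sqint_measurable s wgrad_sqint[OF assms(1) h s] wgrad_eq(2)[OF assms(1) h])
  then show ?thesis
    unfolding W12_norm_def Lnorm_2 by (simp add: l2_minus_commute[of _ u] l2_minus_commute[of _ G])
qed

lemma sqrt_sum_squares_tendsto_0_iff:
  fixes a b :: "nat \<Rightarrow> real"
  assumes "\<And>n. a n \<ge> 0" "\<And>n. b n \<ge> 0"
  shows "(\<lambda>n. sqrt ((a n)\<^sup>2 + (b n)\<^sup>2)) \<longlonglongrightarrow> 0 \<longleftrightarrow> a \<longlonglongrightarrow> 0 \<and> b \<longlonglongrightarrow> 0"
proof (intro iffI conjI)
  assume *: "(\<lambda>n. sqrt ((a n)\<^sup>2 + (b n)\<^sup>2)) \<longlonglongrightarrow> 0"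
  show "a \<longlonglongrightarrow> 0"
    by (rule Lim_null_comparison[OF _ *]) (use assms in \<open>auto intro!: always_eventually real_le_rsqrt\<close>)
  show "b \<longlonglongrightarrow> 0"
    by (rule Lim_null_comparison[OF _ *]) (use assms in \<open>auto intro!: always_eventually real_le_rsqrt\<close>)
next
  assume "a \<longlonglongrightarrow> 0 \<and> b \<longlonglongrightarrow> 0"
  then have "(\<lambda>n. sqrt ((a n)\<^sup>2 + (b n)\<^sup>2)) \<longlonglongrightarrow> sqrt (0\<^sup>2 + 0\<^sup>2)"
    by (intro tendsto_intros) auto
  then show "(\<lambda>n. sqrt ((a n)\<^sup>2 + (b n)\<^sup>2)) \<longlonglongrightarrow> 0" by simp
qed

text \<open>Together with \<open>W012_D\<close> this replaces the definition: membership is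
  witnessed by test functions converging with their gradients, and the limit of the gradients
  identifies \<open>wgrad\<close> a.e.\<close>

lemma W012_I:
  assumes "open \<Omega>" "\<And>n. \<phi> n \<in> test_functions \<Omega>"
    "sqint (lebesgue_on \<Omega>) u" "sqint (lebesgue_on \<Omega>) G"
    "(\<lambda>n. l2 (lebesgue_on \<Omega>) (\<lambda>x. \<phi> n x - u x)) \<longlonglongrightarrow> 0"
    "(\<lambda>n. l2 (lebesgue_on \<Omega>) (\<lambda>x. grad (\<phi> n) x - G x)) \<longlonglongrightarrow> 0"
  shows "u \<in> W012 \<Omega>" "AE x in lebesgue_on \<Omega>. wgrad \<Omega> u x = G x"
proof -
  have h: "has_weak_gradient \<Omega> u G" by (rule has_weak_gradient_limit[OF assms])
  show "AE x in lebesgue_on \<Omega>. wgrad \<Omega> u x = G x" by (rule wgrad_eq(2)[OF assms(1) h])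
  have "u \<in> W12 \<Omega>" using assms(3,4) h by (auto simp: W12_def in_Lp_2)
  moreover have "(\<lambda>n. W12_norm \<Omega> (\<lambda>x. u x - \<phi> n x)) \<longlonglongrightarrow> 0"
    unfolding W12_norm_diff_test[OF assms(1,2) h assms(3,4)]
    using assms(5,6) by (simp add: sqrt_sum_squares_tendsto_0_iff)
  ultimately show "u \<in> W012 \<Omega>" using assms(2) by (auto simp: W012_def)
qed

lemma W012_D:
  assumes "open \<Omega>" "u \<in> W012 \<Omega>"
  shows "sqint (lebesgue_on \<Omega>) u" "sqint (lebesgue_on \<Omega>) (wgrad \<Omega> u)" "has_weak_gradient \<Omega> u (wgrad \<Omega> u)"
    "\<exists>\<phi>. (\<forall>n. \<phi> n \<in> test_functions \<Omega>) \<and> (\<lambda>n. l2 (lebesgue_on \<Omega>) (\<lambda>x. \<phi> n x - u x)) \<longlonglongrightarrow> 0 \<and>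
    (\<lambda>n. l2 (lebesgue_on \<Omega>) (\<lambda>x. grad (\<phi> n) x - wgrad \<Omega> u x)) \<longlonglongrightarrow> 0"
proof -
  have "u \<in> W12 \<Omega> \<and> (\<exists>\<phi>. (\<forall>n::nat. \<phi> n \<in> test_functions \<Omega>) \<and>
     (\<lambda>n. W12_norm \<Omega> (\<lambda>x. u x - \<phi> n x)) \<longlonglongrightarrow> 0)"
    using assms(2) unfolding W012_def by (rule CollectD)
  then obtain \<phi> where \<phi>: "\<forall>n::nat. \<phi> n \<in> test_functions \<Omega>" "(\<lambda>n. W12_norm \<Omega> (\<lambda>x. u x - \<phi> n x)) \<longlonglongrightarrow> 0"
    and "u \<in> W12 \<Omega>" by (elim conjE exE)
  then have "sqint (lebesgue_on \<Omega>) u \<and> (\<exists>G. has_weak_gradient \<Omega> u G \<and> sqint (lebesgue_on \<Omega>) G)"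
    unfolding W12_def in_Lp_2 by simp
  then obtain G where "has_weak_gradient \<Omega> u G" "sqint (lebesgue_on \<Omega>) G" "sqint (lebesgue_on \<Omega>) u"
    by (elim conjE exE)
  with \<phi> have *: "\<And>n. \<phi> n \<in> test_functions \<Omega>" "(\<lambda>n. W12_norm \<Omega> (\<lambda>x. u x - \<phi> n x)) \<longlonglongrightarrow> 0"
    "has_weak_gradient \<Omega> u G" "sqint (lebesgue_on \<Omega>) G" "sqint (lebesgue_on \<Omega>) u" by simp_all
  show u: "sqint (lebesgue_on \<Omega>) u" by (rule *(5))
  show w: "has_weak_gradient \<Omega> u (wgrad \<Omega> u)" by (rule wgrad_eq(1)[OF assms(1) *(3)])
  show G: "sqint (lebesgue_on \<Omega>) (wgrad \<Omega> u)" by (rule wgrad_sqint[OF assms(1) *(3,4)])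
  have "(\<lambda>n. l2 (lebesgue_on \<Omega>) (\<lambda>x. \<phi> n x - u x)) \<longlonglongrightarrow> 0 \<and>
    (\<lambda>n. l2 (lebesgue_on \<Omega>) (\<lambda>x. grad (\<phi> n) x - wgrad \<Omega> u x)) \<longlonglongrightarrow> 0"
    using *(2) unfolding W12_norm_diff_test[OF assms(1) *(1) w u G]
    by (simp add: sqrt_sum_squares_tendsto_0_iff)
  then show "\<exists>\<phi>. (\<forall>n. \<phi> n \<in> test_functions \<Omega>) \<and> (\<lambda>n. l2 (lebesgue_on \<Omega>) (\<lambda>x. \<phi> n x - u x)) \<longlonglongrightarrow> 0 \<and>
    (\<lambda>n. l2 (lebesgue_on \<Omega>) (\<lambda>x. grad (\<phi> n) x - wgrad \<Omega> u x)) \<longlonglongrightarrow> 0"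
    using *(1) by blast
qed

lemma test_W012:
  assumes "open \<Omega>" "\<phi> \<in> test_functions \<Omega>"
  shows "\<phi> \<in> W012 \<Omega>" "AE x in lebesgue_on \<Omega>. wgrad \<Omega> \<phi> x = grad \<phi> x"
  using W012_I[OF assms(1), of "\<lambda>_. \<phi>" \<phi> "grad \<phi>"] test_sqint[OF assms(2,1)] assms(2)
  by (simp_all add: l2_def)

text \<open>One coefficient is enough for differences (\<open>c = - 1\<close>), multiples
  (\<open>u = 0\<close>) and variations in a direction \<open>v\<close>.\<close>

lemma W012_lincomb:
  assumes "open \<Omega>" "u \<in> W012 \<Omega>" "v \<in> W012 \<Omega>"
  shows "(\<lambda>x. u x + c * v x) \<in> W012 \<Omega>"
    "AE x in lebesgue_on \<Omega>. wgrad \<Omega> (\<lambda>x. u x + c * v x) x = wgrad \<Omega> u x + c *\<^sub>R wgrad \<Omega> v x"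
proof -
  let ?M = "lebesgue_on \<Omega>"
  obtain \<phi> where \<phi>: "\<And>n. \<phi> n \<in> test_functions \<Omega>" "(\<lambda>n. l2 ?M (\<lambda>x. \<phi> n x - u x)) \<longlonglongrightarrow> 0"
    "(\<lambda>n. l2 ?M (\<lambda>x. grad (\<phi> n) x - wgrad \<Omega> u x)) \<longlonglongrightarrow> 0"
    using W012_D(4)[OF assms(1,2)] by blast
  obtain \<psi> where \<psi>: "\<And>n. \<psi> n \<in> test_functions \<Omega>" "(\<lambda>n. l2 ?M (\<lambda>x. \<psi> n x - v x)) \<longlonglongrightarrow> 0"
    "(\<lambda>n. l2 ?M (\<lambda>x. grad (\<psi> n) x - wgrad \<Omega> v x)) \<longlonglongrightarrow> 0"
    using W012_D(4)[OF assms(1,3)] by blast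
  note U = W012_D(1,2)[OF assms(1,2)] and V = W012_D(1,2)[OF assms(1,3)]
  let ?f = "\<lambda>n x. \<phi> n x + c * \<psi> n x"
  have t: "?f n \<in> test_functions \<Omega>" for n using \<phi>(1) \<psi>(1) by (intro test_add test_cmult)
  have lim1: "(\<lambda>n. l2 ?M (\<lambda>x. ?f n x - (u x + c * v x))) \<longlonglongrightarrow> 0"
  proof (rule Lim_null_comparison)
    show "(\<lambda>n. l2 ?M (\<lambda>x. \<phi> n x - u x) + \<bar>c\<bar> * l2 ?M (\<lambda>x. \<psi> n x - v x)) \<longlonglongrightarrow> 0"
      using tendsto_add[OF \<phi>(2) tendsto_mult_left[OF \<psi>(2), of "\<bar>c\<bar>"]] by simp
    have "l2 ?M (\<lambda>x. ?f n x - (u x + c * v x)) \<le> l2 ?M (\<lambda>x. \<phi> n x - u x) + \<bar>c\<bar> * l2 ?M (\<lambda>x. \<psi> n x - v x)" for n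
      using l2_triangle[OF sqint_diff[OF test_sqint(1)[OF \<phi>(1)[of n] assms(1)] U(1)]
          sqint_scaleR[OF sqint_diff[OF test_sqint(1)[OF \<psi>(1)[of n] assms(1)] V(1)], of c]]
      unfolding l2_scaleR by (simp add: algebra_simps)
    then show "\<forall>\<^sub>F n in sequentially. norm (l2 ?M (\<lambda>x. ?f n x - (u x + c * v x))) \<le>
        l2 ?M (\<lambda>x. \<phi> n x - u x) + \<bar>c\<bar> * l2 ?M (\<lambda>x. \<psi> n x - v x)" by simp
  qed
  have g: "grad (?f n) x = grad (\<phi> n) x + c *\<^sub>R grad (\<psi> n) x" for n x
    using grad_add[OF test_smooth[OF \<phi>(1)] test_smooth[OF test_cmult[OF \<psi>(1)]]] grad_cmult[OF test_smooth[OF \<psi>(1)]]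
    by simp
  have lim2: "(\<lambda>n. l2 ?M (\<lambda>x. grad (?f n) x - (wgrad \<Omega> u x + c *\<^sub>R wgrad \<Omega> v x))) \<longlonglongrightarrow> 0"
  proof (rule Lim_null_comparison)
    show "(\<lambda>n. l2 ?M (\<lambda>x. grad (\<phi> n) x - wgrad \<Omega> u x) + \<bar>c\<bar> * l2 ?M (\<lambda>x. grad (\<psi> n) x - wgrad \<Omega> v x)) \<longlonglongrightarrow> 0"
      using tendsto_add[OF \<phi>(3) tendsto_mult_left[OF \<psi>(3), of "\<bar>c\<bar>"]] by simp
    have "l2 ?M (\<lambda>x. grad (?f n) x - (wgrad \<Omega> u x + c *\<^sub>R wgrad \<Omega> v x))
        \<le> l2 ?M (\<lambda>x. grad (\<phi> n) x - wgrad \<Omega> u x) + \<bar>c\<bar> * l2 ?M (\<lambda>x. grad (\<psi> n) x - wgrad \<Omega> v x)" for n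
      using l2_triangle[OF sqint_diff[OF test_sqint(2)[OF \<phi>(1)[of n] assms(1)] U(2)]
          sqint_scaleR[OF sqint_diff[OF test_sqint(2)[OF \<psi>(1)[of n] assms(1)] V(2)], of c]]
      unfolding l2_scaleR g by (simp add: algebra_simps)
    then show "\<forall>\<^sub>F n in sequentially. norm (l2 ?M (\<lambda>x. grad (?f n) x - (wgrad \<Omega> u x + c *\<^sub>R wgrad \<Omega> v x))) \<le>
        l2 ?M (\<lambda>x. grad (\<phi> n) x - wgrad \<Omega> u x) + \<bar>c\<bar> * l2 ?M (\<lambda>x. grad (\<psi> n) x - wgrad \<Omega> v x)" by simp
  qed
  have s1: "sqint ?M (\<lambda>x. u x + c * v x)" using sqint_add[OF U(1) sqint_scaleR[OF V(1), of c]] by simp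
  have s2: "sqint ?M (\<lambda>x. wgrad \<Omega> u x + c *\<^sub>R wgrad \<Omega> v x)" by (rule sqint_add[OF U(2) sqint_scaleR[OF V(2)]])
  show "(\<lambda>x. u x + c * v x) \<in> W012 \<Omega>"
    "AE x in ?M. wgrad \<Omega> (\<lambda>x. u x + c * v x) x = wgrad \<Omega> u x + c *\<^sub>R wgrad \<Omega> v x"
    using W012_I[OF assms(1) t s1 s2 lim1 lim2] by auto
qed

subsection \<open>The Sobolev inequality in dimension four\<close>

text \<open>Named coordinates let Tonelli be used one variable at a time.\<close>

definition vec4 :: "real \<Rightarrow> real \<Rightarrow> real \<Rightarrow> real \<Rightarrow> real^4" where
  "vec4 a b c d = a *\<^sub>R axis 1 1 + b *\<^sub>R axis 2 1 + c *\<^sub>R axis 3 1 + d *\<^sub>R axis 4 1"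

lemma vec4_nth [simp]: "vec4 a b c d $ 1 = a" "vec4 a b c d $ 2 = b" "vec4 a b c d $ 3 = c" "vec4 a b c d $ 4 = d"
  by (simp_all add: vec4_def axis_def)

lemma measurable_vec4 [measurable]:
  assumes [measurable]: "a \<in> borel_measurable M" "b \<in> borel_measurable M" "c \<in> borel_measurable M" "d \<in> borel_measurable M"
  shows "(\<lambda>w. vec4 (a w) (b w) (c w) (d w)) \<in> borel_measurable M"
  unfolding vec4_def by measurable

lemma lborel_vec4:
  "(lborel :: (real^4) measure) =
    distr (lborel \<Otimes>\<^sub>M (lborel \<Otimes>\<^sub>M (lborel \<Otimes>\<^sub>M lborel))) borel (\<lambda>(a, b, c, d). vec4 a b c d)"
proof (rule lborel_eqI)
  fix l u :: "real^4"
  assume le: "\<And>b. b \<in> Basis \<Longrightarrow> l \<bullet> b \<le> u \<bullet> b"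
  have le': "l $ i \<le> u $ i" for i using le[of "axis i 1"] by (simp add: inner_axis axis_in_Basis_iff)
  let ?N = "lborel \<Otimes>\<^sub>M (lborel \<Otimes>\<^sub>M (lborel \<Otimes>\<^sub>M (lborel :: real measure))) :: (real \<times> real \<times> real \<times> real) measure"
  have pre: "(\<lambda>(a, b, c, d). vec4 a b c d) -` box l u \<inter> space ?N =
      {l$1<..<u$1} \<times> ({l$2<..<u$2} \<times> ({l$3<..<u$3} \<times> {l$4<..<u$4}))"
    by (auto simp: mem_box_cart forall_4 space_pair_measure)
  have "emeasure (distr ?N borel (\<lambda>(a, b, c, d). vec4 a b c d)) (box l u)
      = emeasure ?N ({l$1<..<u$1} \<times> ({l$2<..<u$2} \<times> ({l$3<..<u$3} \<times> {l$4<..<u$4})))"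
    by (subst emeasure_distr) (auto simp: pre)
  also have "\<dots> = ennreal (u$1 - l$1) * (ennreal (u$2 - l$2) * (ennreal (u$3 - l$3) * ennreal (u$4 - l$4)))"
  proof -
    have s2: "sigma_finite_measure (lborel \<Otimes>\<^sub>M lborel :: (real \<times> real) measure)"
      unfolding lborel_prod by (rule sigma_finite_lborel)
    have s3: "sigma_finite_measure (lborel \<Otimes>\<^sub>M (lborel \<Otimes>\<^sub>M lborel) :: (real \<times> real \<times> real) measure)"
      unfolding lborel_prod by (rule sigma_finite_lborel)
    show ?thesis
      by (simp add: sigma_finite_measure.emeasure_pair_measure_Times[OF s3]
          sigma_finite_measure.emeasure_pair_measure_Times[OF s2] lborel.emeasure_pair_measure_Times le')
  qed
  also have "\<dots> = ennreal (\<Prod>b\<in>Basis. (u - l) \<bullet> b)"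
  proof -
    have "(\<Prod>b\<in>Basis. (u - l) \<bullet> b) = (\<Prod>i\<in>UNIV. (u - l) $ i)"
      unfolding Basis_vec_def
      by (simp add: UNION_singleton_eq_range prod.reindex inj_on_def axis_eq_axis inner_axis)
    also have "\<dots> = (u$1 - l$1) * ((u$2 - l$2) * ((u$3 - l$3) * (u$4 - l$4)))"
      unfolding UNIV_4 by simp
    finally show ?thesis using le' by (simp add: ennreal_mult)
  qed
  finally show "emeasure (distr ?N borel (\<lambda>(a, b, c, d). vec4 a b c d)) (box l u)
      = ennreal (\<Prod>b\<in>Basis. (u - l) \<bullet> b)" .
qed simp

lemma nn_integral_vec4:
  fixes f :: "real^4 \<Rightarrow> ennreal"
  assumes [measurable]: "f \<in> borel_measurable borel"
  shows "(\<integral>\<^sup>+x. f x \<partial>lborel) =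
    (\<integral>\<^sup>+a. \<integral>\<^sup>+b. \<integral>\<^sup>+c. \<integral>\<^sup>+d. f (vec4 a b c d) \<partial>lborel \<partial>lborel \<partial>lborel \<partial>lborel)"
proof -
  have s2: "sigma_finite_measure (lborel \<Otimes>\<^sub>M lborel :: (real \<times> real) measure)"
    unfolding lborel_prod by (rule sigma_finite_lborel)
  have s3: "sigma_finite_measure (lborel \<Otimes>\<^sub>M (lborel \<Otimes>\<^sub>M lborel) :: (real \<times> real \<times> real) measure)"
    unfolding lborel_prod by (rule sigma_finite_lborel)
  have "(\<integral>\<^sup>+x. f x \<partial>lborel) = (\<integral>\<^sup>+(a, b, c, d). f (vec4 a b c d)
      \<partial>(lborel \<Otimes>\<^sub>M (lborel \<Otimes>\<^sub>M (lborel \<Otimes>\<^sub>M lborel))))"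
    by (subst lborel_vec4, subst nn_integral_distr) (auto simp: split_beta')
  then show ?thesis
    by (simp add: sigma_finite_measure.nn_integral_fst[OF s3, symmetric]
        sigma_finite_measure.nn_integral_fst[OF s2, symmetric] lborel.nn_integral_fst[symmetric] case_prod_beta)
qed

text \<open>Total on \<open>ennreal\<close>, so that Hoelder's inequality can be iterated before any
  line integral is known to be finite.\<close>

definition ecbrt :: "ennreal \<Rightarrow> ennreal" where
  "ecbrt x = (if x = \<infinity> then \<infinity> else ennreal (root 3 (enn2real x)))"

lemma measurable_ecbrt [measurable]: "ecbrt \<in> borel_measurable borel"
proof -
  have [measurable]: "root 3 \<in> borel_measurable borel"
    by (intro borel_measurable_continuous_onI continuous_intros continuous_on_real_root)
  show ?thesis unfolding ecbrt_def by measurable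
qed

lemma ecbrt_cube [simp]: "ecbrt x ^ 3 = x"
proof (cases x)
  case (real r)
  then show ?thesis by (simp add: ecbrt_def ennreal_power real_root_pow_pos2)
next
  case top
  then show ?thesis by (simp add: ecbrt_def)
qed

lemma ennreal_power_mono_iff: "(x::ennreal) ^ 3 \<le> y ^ 3 \<longleftrightarrow> x \<le> y"
proof
  assume *: "x ^ 3 \<le> y ^ 3"
  show "x \<le> y"
  proof (cases y)
    case (real r)
    have "x \<noteq> \<infinity>"
    proof
      assume "x = \<infinity>"
      then show False using * real by (simp add: ennreal_power top_unique)
    qed
    then obtain s where s: "x = ennreal s" "s \<ge> 0" by (cases x) auto
    then have "s ^ 3 \<le> r ^ 3" using * real by (simp add: ennreal_power)
    then have "s \<le> r" using power_mono_iff[of s r 3] s real by simp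
    then show ?thesis using s real by (simp add: ennreal_leI)
  qed simp
qed (rule power_mono_ennreal)

lemma ecbrt_mono_cube: "x ^ 3 \<le> y \<Longrightarrow> x \<le> ecbrt y"
  using ennreal_power_mono_iff[of x "ecbrt y"] by simp

lemma real_am_gm3:
  fixes u v w :: real
  assumes "u \<ge> 0" "v \<ge> 0" "w \<ge> 0"
  shows "3 * (u * v * w) \<le> u^3 + v^3 + w^3"
proof -
  have "u^3 + v^3 + w^3 - 3 * (u * v * w) = (u + v + w) * ((u - v)\<^sup>2 + (v - w)\<^sup>2 + (w - u)\<^sup>2) / 2"
    by (simp add: power2_eq_square power3_eq_cube field_simps)
  moreover have "\<dots> \<ge> 0" using assms by (intro divide_nonneg_nonneg mult_nonneg_nonneg) auto
  ultimately show ?thesis by linarith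
qed

text \<open>Hoelder with three exponents equal to 3: the inequality of arithmetic and geometric
  means is applied pointwise after dividing each cube root by that of the integral. Vanishing and
  infinite integrals have to be split off first.\<close>

lemma nn_integral_Holder3:
  assumes [measurable]: "f \<in> borel_measurable M" "g \<in> borel_measurable M" "h \<in> borel_measurable M"
  shows "(\<integral>\<^sup>+x. ecbrt (f x) * ecbrt (g x) * ecbrt (h x) \<partial>M) \<le>
    ecbrt (\<integral>\<^sup>+x. f x \<partial>M) * ecbrt (\<integral>\<^sup>+x. g x \<partial>M) * ecbrt (\<integral>\<^sup>+x. h x \<partial>M)"
proof -
  define F G H where "F = (\<integral>\<^sup>+x. f x \<partial>M)" and "G = (\<integral>\<^sup>+x. g x \<partial>M)" and "H = (\<integral>\<^sup>+x. h x \<partial>M)"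
  have ecbrt_0: "ecbrt y = 0 \<longleftrightarrow> y = 0" for y
    by (metis ecbrt_cube power_eq_0_iff zero_less_numeral zero_neq_numeral power_0_left)
  have zero: ?thesis if "AE x in M. f x = 0 \<or> g x = 0 \<or> h x = 0"
  proof -
    have "(\<integral>\<^sup>+x. ecbrt (f x) * ecbrt (g x) * ecbrt (h x) \<partial>M) = (\<integral>\<^sup>+x. 0 \<partial>M)"
      by (rule nn_integral_cong_AE) (use that in \<open>eventually_elim, auto simp: ecbrt_0\<close>)
    then show ?thesis by simp
  qed
  show ?thesis
  proof (cases "F = 0 \<or> G = 0 \<or> H = 0")
    case True
    then consider "AE x in M. f x = 0" | "AE x in M. g x = 0" | "AE x in M. h x = 0"
      by (auto simp: F_def G_def H_def nn_integral_0_iff_AE)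
    then have "AE x in M. f x = 0 \<or> g x = 0 \<or> h x = 0"
      by cases (auto elim!: eventually_mono)
    then show ?thesis by (rule zero)
  next
    case nz: False
    show ?thesis
    proof (cases "F = \<infinity> \<or> G = \<infinity> \<or> H = \<infinity>")
      case True
      then have "ecbrt F * ecbrt G * ecbrt H = \<infinity>"
        using nz ecbrt_0 by (auto simp: ecbrt_def ennreal_mult_eq_top_iff split: if_splits)
      then show ?thesis by (simp add: F_def G_def H_def)
    next
      case False
      obtain a where a: "ecbrt F = ennreal a" "a > 0"
        using False nz ecbrt_0[of F] by (cases "ecbrt F") (auto simp: ecbrt_def less_le split: if_splits)
      obtain b where b: "ecbrt G = ennreal b" "b > 0"
        using False nz ecbrt_0[of G] by (cases "ecbrt G") (auto simp: ecbrt_def less_le split: if_splits)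
      obtain c where c: "ecbrt H = ennreal c" "c > 0"
        using False nz ecbrt_0[of H] by (cases "ecbrt H") (auto simp: ecbrt_def less_le split: if_splits)
      have FGH: "F = ennreal (a^3)" "G = ennreal (b^3)" "H = ennreal (c^3)"
        using ecbrt_cube[of F] ecbrt_cube[of G] ecbrt_cube[of H] a b c by (simp_all add: ennreal_power)
      \<comment> \<open>These weights come from \<open>real_am_gm3\<close> at \<open>x'/a\<close>,
        \<open>y'/b\<close>, \<open>z'/c\<close>, multiplied by \<open>a * b * c / 3\<close>; each
        weighted integral then equals a third of \<open>a * b * c\<close>.\<close>
      define k1 k2 k3 where "k1 = a * b * c / (3 * a^3)" and "k2 = a * b * c / (3 * b^3)" and "k3 = a * b * c / (3 * c^3)"
      have k: "k1 > 0" "k2 > 0" "k3 > 0" using a b c by (simp_all add: k1_def k2_def k3_def)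
      have pw: "x * y * z \<le> ennreal k1 * x^3 + ennreal k2 * y^3 + ennreal k3 * z^3" for x y z :: ennreal
      proof (cases "x = \<infinity> \<or> y = \<infinity> \<or> z = \<infinity>")
        case True
        then show ?thesis using k by (auto simp: ennreal_mult_top)
      next
        case False
        then obtain x' y' z' where x: "x = ennreal x'" "x' \<ge> 0" and y: "y = ennreal y'" "y' \<ge> 0" and z: "z = ennreal z'" "z' \<ge> 0"
          by (metis ennreal_cases infinity_ennreal_def)
        have "3 * ((x'/a) * (y'/b) * (z'/c)) \<le> (x'/a)^3 + (y'/b)^3 + (z'/c)^3"
          using x y z a b c by (intro real_am_gm3) auto
        then have "(a * b * c / 3) * (3 * ((x'/a) * (y'/b) * (z'/c))) \<le> (a * b * c / 3) * ((x'/a)^3 + (y'/b)^3 + (z'/c)^3)"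
          using a b c by (intro mult_left_mono) auto
        also have "(a * b * c / 3) * (3 * ((x'/a) * (y'/b) * (z'/c))) = x' * y' * z'"
          using a b c by simp
        also have "(a * b * c / 3) * ((x'/a)^3 + (y'/b)^3 + (z'/c)^3) = k1 * x'^3 + k2 * y'^3 + k3 * z'^3"
          by (simp add: k1_def k2_def k3_def power_divide distrib_left)
        finally have "ennreal (x' * y' * z') \<le> ennreal (k1 * x'^3 + k2 * y'^3 + k3 * z'^3)" by (rule ennreal_leI)
        then show ?thesis using x y z k
          by (simp add: ennreal_mult ennreal_power ennreal_plus del: ennreal_leI)
      qed
      have "(\<integral>\<^sup>+x. ecbrt (f x) * ecbrt (g x) * ecbrt (h x) \<partial>M) \<le>
          (\<integral>\<^sup>+x. ennreal k1 * f x + ennreal k2 * g x + ennreal k3 * h x \<partial>M)"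
        by (rule nn_integral_mono) (use pw[of "ecbrt (f _)" "ecbrt (g _)" "ecbrt (h _)"] in simp)
      also have "\<dots> = ennreal k1 * F + ennreal k2 * G + ennreal k3 * H"
        by (simp add: nn_integral_add nn_integral_cmult F_def G_def H_def)
      also have "\<dots> = ennreal (k1 * a^3 + k2 * b^3 + k3 * c^3)"
        using k a b c unfolding FGH by (simp add: ennreal_mult ennreal_plus)
      also have "k1 * a^3 + k2 * b^3 + k3 * c^3 = a * b * c"
        using a b c by (simp add: k1_def k2_def k3_def)
      also have "ennreal (a * b * c) = ecbrt F * ecbrt G * ecbrt H"
        using a b c by (simp add: ennreal_mult)
      finally show ?thesis by (simp add: F_def G_def H_def)
    qed
  qed
qed

lemma nn_integral_swap:
  fixes f :: "real \<Rightarrow> real \<Rightarrow> ennreal"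
  assumes "case_prod f \<in> borel_measurable (borel \<Otimes>\<^sub>M borel)"
  shows "(\<integral>\<^sup>+x. \<integral>\<^sup>+y. f x y \<partial>lborel \<partial>lborel) = (\<integral>\<^sup>+y. \<integral>\<^sup>+x. f x y \<partial>lborel \<partial>lborel)"
  using lborel_pair.Fubini'[of "\<lambda>x y. f x y"] assms by simp

text \<open>Integrate in d, then c, then b, then a: in each of the first three steps one of the four
  factors is constant in the current variable and the other three go into
  \<open>nn_integral_Holder3\<close>. The right-hand side is the power 4/3 of
  \<open>T\<close>.\<close>

lemma Loomis_Whitney4:
  fixes f :: "real^4 \<Rightarrow> ennreal"
  assumes [measurable]: "f \<in> borel_measurable borel"
  defines "T \<equiv> \<integral>\<^sup>+x. f x \<partial>lborel"
  shows "(\<integral>\<^sup>+a. \<integral>\<^sup>+b. \<integral>\<^sup>+c. \<integral>\<^sup>+d.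
      ecbrt (\<integral>\<^sup>+t. f (vec4 t b c d) \<partial>lborel) * ecbrt (\<integral>\<^sup>+t. f (vec4 a t c d) \<partial>lborel) *
      ecbrt (\<integral>\<^sup>+t. f (vec4 a b t d) \<partial>lborel) * ecbrt (\<integral>\<^sup>+t. f (vec4 a b c t) \<partial>lborel)
      \<partial>lborel \<partial>lborel \<partial>lborel \<partial>lborel) \<le> T * ecbrt T"
proof -
  define G1 where "G1 b c d = (\<integral>\<^sup>+t. f (vec4 t b c d) \<partial>lborel)" for b c d
  define G2 where "G2 a c d = (\<integral>\<^sup>+t. f (vec4 a t c d) \<partial>lborel)" for a c d
  define G3 where "G3 a b d = (\<integral>\<^sup>+t. f (vec4 a b t d) \<partial>lborel)" for a b d
  define G4 where "G4 a b c = (\<integral>\<^sup>+t. f (vec4 a b c t) \<partial>lborel)" for a b c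
  have [measurable]:
    "(\<lambda>w. G1 (p w) (q w) (r w)) \<in> borel_measurable N" "(\<lambda>w. G2 (p w) (q w) (r w)) \<in> borel_measurable N"
    "(\<lambda>w. G3 (p w) (q w) (r w)) \<in> borel_measurable N" "(\<lambda>w. G4 (p w) (q w) (r w)) \<in> borel_measurable N"
    if [measurable]: "p \<in> borel_measurable N" "q \<in> borel_measurable N" "r \<in> borel_measurable N"
    for p q r and N :: "'z measure"
    unfolding G1_def G2_def G3_def G4_def by measurable
  have [measurable]: "G1 b c \<in> borel_measurable borel" "G2 a c \<in> borel_measurable borel"
    "G3 a b \<in> borel_measurable borel" "G4 a b \<in> borel_measurable borel" for a b c
    unfolding G1_def[abs_def] G2_def[abs_def] G3_def[abs_def] G4_def[abs_def] by measurable
  \<comment> \<open>The digits name the variables that are integrated out; \<open>e34\<close> and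
    \<open>e234\<close> record that different orders of integration agree.\<close>
  define G14 where "G14 b c = (\<integral>\<^sup>+d. G1 b c d \<partial>lborel)" for b c
  define G24 where "G24 a c = (\<integral>\<^sup>+d. G2 a c d \<partial>lborel)" for a c
  define G34 where "G34 a b = (\<integral>\<^sup>+d. G3 a b d \<partial>lborel)" for a b
  have [measurable]:
    "(\<lambda>w. G14 (p w) (q w)) \<in> borel_measurable N" "(\<lambda>w. G24 (p w) (q w)) \<in> borel_measurable N"
    "(\<lambda>w. G34 (p w) (q w)) \<in> borel_measurable N"
    if [measurable]: "p \<in> borel_measurable N" "q \<in> borel_measurable N"
    for p q and N :: "'z measure"
    unfolding G14_def G24_def G34_def G1_def G2_def G3_def by measurable
  have [measurable]: "G14 b \<in> borel_measurable borel" "G24 a \<in> borel_measurable borel"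
    "G34 a \<in> borel_measurable borel" for a b
    unfolding G14_def[abs_def] G24_def[abs_def] G34_def[abs_def] by measurable
  define G134 where "G134 b = (\<integral>\<^sup>+c. G14 b c \<partial>lborel)" for b
  define G234 where "G234 a = (\<integral>\<^sup>+c. G24 a c \<partial>lborel)" for a
  have [measurable]: "G134 \<in> borel_measurable borel" "G234 \<in> borel_measurable borel"
    unfolding G134_def G234_def G14_def G24_def G1_def G2_def by measurable
  have e34: "(\<integral>\<^sup>+c. G4 a b c \<partial>lborel) = G34 a b" for a b
    unfolding G4_def G34_def G3_def by (rule nn_integral_swap) measurable
  have e234: "(\<integral>\<^sup>+b. G34 a b \<partial>lborel) = G234 a" for a
  proof -
    have "(\<integral>\<^sup>+b. G34 a b \<partial>lborel) = (\<integral>\<^sup>+b. \<integral>\<^sup>+c. G4 a b c \<partial>lborel \<partial>lborel)"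
      by (simp add: e34)
    also have "\<dots> = (\<integral>\<^sup>+c. \<integral>\<^sup>+b. G4 a b c \<partial>lborel \<partial>lborel)" by (rule nn_integral_swap) measurable
    also have "\<dots> = G234 a"
      unfolding G234_def G24_def G2_def G4_def
      by (intro nn_integral_cong nn_integral_swap) measurable
    finally show ?thesis .
  qed
  have eT: "(\<integral>\<^sup>+a. G234 a \<partial>lborel) = T"
    unfolding T_def nn_integral_vec4[OF assms(1)] e234[symmetric] e34[symmetric] G4_def ..
  have e134: "(\<integral>\<^sup>+b. G134 b \<partial>lborel) = T"
  proof -
    have "G134 b = (\<integral>\<^sup>+a. G34 a b \<partial>lborel)" for b
    proof -
      have "G134 b = (\<integral>\<^sup>+c. \<integral>\<^sup>+a. G4 a b c \<partial>lborel \<partial>lborel)"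
        unfolding G134_def G14_def G1_def G4_def by (intro nn_integral_cong nn_integral_swap) measurable
      also have "\<dots> = (\<integral>\<^sup>+a. \<integral>\<^sup>+c. G4 a b c \<partial>lborel \<partial>lborel)" by (rule nn_integral_swap) measurable
      finally show ?thesis by (simp add: e34)
    qed
    then have "(\<integral>\<^sup>+b. G134 b \<partial>lborel) = (\<integral>\<^sup>+b. \<integral>\<^sup>+a. G34 a b \<partial>lborel \<partial>lborel)" by simp
    also have "\<dots> = (\<integral>\<^sup>+a. \<integral>\<^sup>+b. G34 a b \<partial>lborel \<partial>lborel)" by (rule nn_integral_swap) measurable
    finally show ?thesis by (simp add: e234 eT)
  qed
  have s4: "(\<integral>\<^sup>+d. ecbrt (G1 b c d) * ecbrt (G2 a c d) * ecbrt (G3 a b d) * ecbrt (G4 a b c) \<partial>lborel)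
      \<le> ecbrt (G4 a b c) * ecbrt (G14 b c) * ecbrt (G24 a c) * ecbrt (G34 a b)" for a b c
  proof -
    have "(\<integral>\<^sup>+d. ecbrt (G1 b c d) * ecbrt (G2 a c d) * ecbrt (G3 a b d) * ecbrt (G4 a b c) \<partial>lborel)
        = (\<integral>\<^sup>+d. ecbrt (G1 b c d) * ecbrt (G2 a c d) * ecbrt (G3 a b d) \<partial>lborel) * ecbrt (G4 a b c)"
      by (rule nn_integral_multc) measurable
    also have "\<dots> \<le> (ecbrt (G14 b c) * ecbrt (G24 a c) * ecbrt (G34 a b)) * ecbrt (G4 a b c)"
      unfolding G14_def G24_def G34_def by (intro mult_right_mono nn_integral_Holder3) simp_all
    finally show ?thesis by (simp add: mult_ac)
  qed
  have s3: "(\<integral>\<^sup>+c. ecbrt (G4 a b c) * ecbrt (G14 b c) * ecbrt (G24 a c) * ecbrt (G34 a b) \<partial>lborel)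
      \<le> ecbrt (G34 a b) * ecbrt (G34 a b) * ecbrt (G134 b) * ecbrt (G234 a)" for a b
  proof -
    have "(\<integral>\<^sup>+c. ecbrt (G4 a b c) * ecbrt (G14 b c) * ecbrt (G24 a c) * ecbrt (G34 a b) \<partial>lborel)
        = (\<integral>\<^sup>+c. ecbrt (G4 a b c) * ecbrt (G14 b c) * ecbrt (G24 a c) \<partial>lborel) * ecbrt (G34 a b)"
      by (rule nn_integral_multc) measurable
    also have "\<dots> \<le> (ecbrt (G34 a b) * ecbrt (G134 b) * ecbrt (G234 a)) * ecbrt (G34 a b)"
      unfolding e34[symmetric] G134_def G234_def by (intro mult_right_mono nn_integral_Holder3) simp_all
    finally show ?thesis by (simp add: mult_ac)
  qed
  have s2: "(\<integral>\<^sup>+b. ecbrt (G34 a b) * ecbrt (G34 a b) * ecbrt (G134 b) * ecbrt (G234 a) \<partial>lborel) \<le> G234 a * ecbrt T" for a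
  proof -
    have "(\<integral>\<^sup>+b. ecbrt (G34 a b) * ecbrt (G34 a b) * ecbrt (G134 b) * ecbrt (G234 a) \<partial>lborel)
        = (\<integral>\<^sup>+b. ecbrt (G34 a b) * ecbrt (G34 a b) * ecbrt (G134 b) \<partial>lborel) * ecbrt (G234 a)"
      by (rule nn_integral_multc) measurable
    also have "\<dots> \<le> (ecbrt (G234 a) * ecbrt (G234 a) * ecbrt T) * ecbrt (G234 a)"
      unfolding e234[symmetric] e134[symmetric] by (intro mult_right_mono nn_integral_Holder3) simp_all
    also have "\<dots> = ecbrt (G234 a) ^ 3 * ecbrt T" by (simp add: power3_eq_cube mult_ac del: ecbrt_cube)
    finally show ?thesis by simp
  qed
  have "(\<integral>\<^sup>+a. \<integral>\<^sup>+b. \<integral>\<^sup>+c. \<integral>\<^sup>+d. ecbrt (G1 b c d) * ecbrt (G2 a c d) * ecbrt (G3 a b d) * ecbrt (G4 a b c)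
      \<partial>lborel \<partial>lborel \<partial>lborel \<partial>lborel)
    \<le> (\<integral>\<^sup>+a. \<integral>\<^sup>+b. \<integral>\<^sup>+c. ecbrt (G4 a b c) * ecbrt (G14 b c) * ecbrt (G24 a c) * ecbrt (G34 a b)
      \<partial>lborel \<partial>lborel \<partial>lborel)"
    by (intro nn_integral_mono s4)
  also have "\<dots> \<le> (\<integral>\<^sup>+a. \<integral>\<^sup>+b. ecbrt (G34 a b) * ecbrt (G34 a b) * ecbrt (G134 b) * ecbrt (G234 a) \<partial>lborel \<partial>lborel)"
    by (intro nn_integral_mono s3)
  also have "\<dots> \<le> (\<integral>\<^sup>+a. G234 a * ecbrt T \<partial>lborel)"
    by (intro nn_integral_mono s2)
  also have "\<dots> = (\<integral>\<^sup>+a. G234 a \<partial>lborel) * ecbrt T"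
    by (rule nn_integral_multc) measurable
  finally show ?thesis
    unfolding eT G1_def G2_def G3_def G4_def .
qed

text \<open>Integrate the derivative of the cube along a ray that starts outside the support. The
  cube is the right power: in the four axis directions, the product of the cube roots bounds the
  fourth power of \<open>\<phi>\<close>, the integrand of the L^4 norm.\<close>

lemma cube_le_line_integral:
  fixes \<phi> :: "'a::euclidean_space \<Rightarrow> real"
  assumes "\<phi> \<in> test_functions \<Omega>" "norm h = 1"
  shows "ennreal (\<bar>\<phi> x\<bar>) ^ 3 \<le> (\<integral>\<^sup>+t. ennreal (3 * (\<phi> (x + t *\<^sub>R h))\<^sup>2 * norm (grad \<phi> (x + t *\<^sub>R h))) \<partial>lborel)"
proof -
  obtain K where K: "compact K" "\<And>y. y \<notin> K \<Longrightarrow> \<phi> y = 0"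
    using test_support[OF assms(1)] by metis
  obtain R where R: "R > 0" "\<And>y. y \<in> K \<Longrightarrow> norm y \<le> R"
    using K(1) compact_imp_bounded bounded_pos by metis
  \<comment> \<open>At this parameter the point has norm at least \<open>R + 1\<close>, hence lies
    outside \<open>K\<close>.\<close>
  define s where "s = - (R + norm x + 1)"
  have s: "s \<le> 0" using R(1) norm_ge_zero[of x] unfolding s_def by linarith
  have "\<phi> (x + s *\<^sub>R h) = 0"
  proof (rule K(2), rule notI)
    assume "x + s *\<^sub>R h \<in> K"
    then have "norm (x + s *\<^sub>R h) \<le> R" by (rule R(2))
    moreover have "norm (s *\<^sub>R h) \<le> norm (x + s *\<^sub>R h) + norm x"
      using norm_triangle_ineq4[of "x + s *\<^sub>R h" x] by simp
    moreover have "norm (s *\<^sub>R h) = - s" using assms(2) s by simp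
    moreover have "- s = R + norm x + 1" by (simp add: s_def)
    ultimately show False by linarith
  qed
  let ?F = "\<lambda>t. \<phi> (x + t *\<^sub>R h) ^ 3" and ?f = "\<lambda>t. 3 * (\<phi> (x + t *\<^sub>R h))\<^sup>2 * (grad \<phi> (x + t *\<^sub>R h) \<bullet> h)"
  have cont: "continuous_on UNIV \<phi>" "continuous_on UNIV (grad \<phi>)" using test_integrable[OF assms(1)] by blast+
  have contl: "continuous_on UNIV (\<lambda>t. \<phi> (x + t *\<^sub>R h))" "continuous_on UNIV (\<lambda>t. grad \<phi> (x + t *\<^sub>R h))"
    by (auto intro!: continuous_on_compose2[OF cont(1)] continuous_on_compose2[OF cont(2)] continuous_intros)
  then have [measurable]: "(\<lambda>t. \<phi> (x + t *\<^sub>R h)) \<in> borel_measurable borel" "(\<lambda>t. grad \<phi> (x + t *\<^sub>R h)) \<in> borel_measurable borel"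
    by (auto intro: borel_measurable_continuous_onI)
  have contf: "continuous_on UNIV ?f" by (intro continuous_intros contl)
  have der: "(?F has_real_derivative ?f t) (at t)" for t
  proof -
    have lin: "((\<lambda>t. x + t *\<^sub>R h) has_derivative (\<lambda>t. t *\<^sub>R h)) (at t)"
      by (auto intro!: derivative_eq_intros)
    from has_derivative_compose[OF lin smooth_has_derivative[OF test_smooth[OF assms(1)]]]
    have "((\<lambda>t. \<phi> (x + t *\<^sub>R h)) has_derivative (\<lambda>r. grad \<phi> (x + t *\<^sub>R h) \<bullet> (r *\<^sub>R h))) (at t)" .
    then have "((\<lambda>t. \<phi> (x + t *\<^sub>R h)) has_real_derivative (grad \<phi> (x + t *\<^sub>R h) \<bullet> h)) (at t)"
      unfolding has_field_derivative_def by (rule has_derivative_eq_rhs) (auto simp: fun_eq_iff)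
    from DERIV_power[OF this, of 3] show ?thesis by (simp add: mult_ac)
  qed
  have FTC: "(LINT t|lborel. ?f t * indicator {s..0} t) = ?F 0 - ?F s"
    by (rule integral_FTC_Icc_real[OF s]) (use der contf in \<open>auto simp: continuous_on_eq_continuous_at\<close>)
  have int: "integrable lborel (\<lambda>t. ?f t * indicator {s..0} t)"
    using has_bochner_integral_FTC_Icc_real[OF s, of ?F ?f] der contf
    by (auto simp: continuous_on_eq_continuous_at has_bochner_integral_iff)
  have "ennreal (\<bar>\<phi> x\<bar>) ^ 3 = ennreal (norm (LINT t|lborel. ?f t * indicator {s..0} t))"
    unfolding FTC using \<open>\<phi> (x + s *\<^sub>R h) = 0\<close> by (simp add: ennreal_power power_abs)
  also have "\<dots> \<le> (\<integral>\<^sup>+t. norm (?f t * indicator {s..0} t) \<partial>lborel)"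
    by (rule integral_norm_bound_ennreal[OF int])
  also have "\<dots> \<le> (\<integral>\<^sup>+t. ennreal (3 * (\<phi> (x + t *\<^sub>R h))\<^sup>2 * norm (grad \<phi> (x + t *\<^sub>R h))) \<partial>lborel)"
  proof (intro nn_integral_mono ennreal_leI)
    fix t
    have "\<bar>grad \<phi> (x + t *\<^sub>R h) \<bullet> h\<bar> \<le> norm (grad \<phi> (x + t *\<^sub>R h))"
      using Cauchy_Schwarz_ineq2[of "grad \<phi> (x + t *\<^sub>R h)" h] assms(2) by simp
    then show "norm (?f t * indicator {s..0} t) \<le> 3 * (\<phi> (x + t *\<^sub>R h))\<^sup>2 * norm (grad \<phi> (x + t *\<^sub>R h))"
      by (auto simp: abs_mult indicator_def intro!: mult_left_mono)
  qed
  finally show ?thesis .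
qed

text \<open>With \<open>x\<close> the integral of the fourth power and \<open>t\<close> that of
  \<open>3 * (\<phi> y)\<^sup>2 * norm (grad \<phi> y)\<close>, Loomis-Whitney gives
  \<open>x ^ 3 \<le> t ^ 4\<close> and Cauchy-Schwarz \<open>t \<le> 3 * sqrt x * D\<close>. Hence
  \<open>x ^ 3 \<le> 81 * D ^ 4 * x\<^sup>2\<close>, and \<open>x\<^sup>2\<close> cancels because
  \<open>x\<close> is finite.\<close>

lemma test_function_L4_bound:
  fixes \<phi> :: "real^4 \<Rightarrow> real"
  assumes "\<phi> \<in> test_functions \<Omega>"
  shows "integrable lborel (\<lambda>x. \<phi> x ^ 4)" "(LINT x|lborel. \<phi> x ^ 4) \<le> 81 * (l2 lborel (grad \<phi>)) ^ 4"
proof -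
  note m = test_integrable[OF assms]
  obtain K where K: "compact K" "\<And>y. y \<notin> K \<Longrightarrow> \<phi> y = 0"
    using test_support[OF assms] by metis
  have [measurable]: "\<phi> \<in> borel_measurable borel" "grad \<phi> \<in> borel_measurable borel" using m by auto
  show int4: "integrable lborel (\<lambda>x. \<phi> x ^ 4)"
    by (rule integrable_compact_support[OF _ K(1)]) (use m(1) K(2) in \<open>auto intro!: continuous_intros\<close>)
  define x where "x = (LINT x|lborel. \<phi> x ^ 4)"
  have x0: "x \<ge> 0" unfolding x_def by (intro integral_nonneg_AE) auto
  define D where "D = l2 lborel (grad \<phi>)"
  let ?f = "\<lambda>y. ennreal (3 * (\<phi> y)\<^sup>2 * norm (grad \<phi> y))"
  let ?T = "\<integral>\<^sup>+y. ?f y \<partial>lborel"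
  have s2: "sqint lborel (\<lambda>y. (\<phi> y)\<^sup>2)" using int4 by (simp add: sqint_def)
  have l2s: "(l2 lborel (\<lambda>y. (\<phi> y)\<^sup>2))\<^sup>2 = x" by (simp add: l2_sq x_def)
  have sg: "sqint lborel (\<lambda>y. norm (grad \<phi> y))" by (rule sqint_norm[OF m(7)])
  define t where "t = (LINT y|lborel. 3 * (\<phi> y)\<^sup>2 * norm (grad \<phi> y))"
  have ti: "integrable lborel (\<lambda>y. 3 * (\<phi> y)\<^sup>2 * norm (grad \<phi> y))"
    using integrable_mult_right[OF sqint_integrable_mult[OF s2 sg], of 3] by (simp add: mult.assoc)
  have t0: "t \<ge> 0" unfolding t_def by (intro integral_nonneg_AE) auto
  have T: "?T = ennreal t" unfolding t_def by (rule nn_integral_eq_integral[OF ti]) auto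
  have "t = 3 * (LINT y|lborel. (\<phi> y)\<^sup>2 * norm (grad \<phi> y))"
    unfolding t_def mult.assoc by simp
  also have "\<dots> \<le> 3 * (l2 lborel (\<lambda>y. (\<phi> y)\<^sup>2) * D)"
    using l2_Cauchy_Schwarz_mult[OF s2 sg] by (simp add: D_def l2_def)
  finally have tle: "t \<le> 3 * (l2 lborel (\<lambda>y. (\<phi> y)\<^sup>2) * D)" .
  have line: "ennreal \<bar>\<phi> (vec4 a b c d)\<bar> \<le> ecbrt (\<integral>\<^sup>+t. ?f (vec4 t b c d) \<partial>lborel)"
    "ennreal \<bar>\<phi> (vec4 a b c d)\<bar> \<le> ecbrt (\<integral>\<^sup>+t. ?f (vec4 a t c d) \<partial>lborel)"
    "ennreal \<bar>\<phi> (vec4 a b c d)\<bar> \<le> ecbrt (\<integral>\<^sup>+t. ?f (vec4 a b t d) \<partial>lborel)"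
    "ennreal \<bar>\<phi> (vec4 a b c d)\<bar> \<le> ecbrt (\<integral>\<^sup>+t. ?f (vec4 a b c t) \<partial>lborel)" for a b c d
  proof -
    note L = cube_le_line_integral[OF assms, of _ "vec4 a b c d"]
    have n: "norm (axis i (1::real) :: real^4) = 1" for i by (simp add: norm_axis_1)
    have v: "vec4 a b c d + t *\<^sub>R axis 1 1 = vec4 (a + t) b c d" "vec4 a b c d + t *\<^sub>R axis 2 1 = vec4 a (b + t) c d"
      "vec4 a b c d + t *\<^sub>R axis 3 1 = vec4 a b (c + t) d" "vec4 a b c d + t *\<^sub>R axis 4 1 = vec4 a b c (d + t)" for t
      by (simp_all add: vec4_def scaleR_add_left)
    show "ennreal \<bar>\<phi> (vec4 a b c d)\<bar> \<le> ecbrt (\<integral>\<^sup>+t. ?f (vec4 t b c d) \<partial>lborel)"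
      using L[of "axis 1 1"] n nn_integral_translate[of "\<lambda>t. ?f (vec4 t b c d)" a]
      by (intro ecbrt_mono_cube) (simp add: v)
    show "ennreal \<bar>\<phi> (vec4 a b c d)\<bar> \<le> ecbrt (\<integral>\<^sup>+t. ?f (vec4 a t c d) \<partial>lborel)"
      using L[of "axis 2 1"] n nn_integral_translate[of "\<lambda>t. ?f (vec4 a t c d)" b]
      by (intro ecbrt_mono_cube) (simp add: v)
    show "ennreal \<bar>\<phi> (vec4 a b c d)\<bar> \<le> ecbrt (\<integral>\<^sup>+t. ?f (vec4 a b t d) \<partial>lborel)"
      using L[of "axis 3 1"] n nn_integral_translate[of "\<lambda>t. ?f (vec4 a b t d)" c]
      by (intro ecbrt_mono_cube) (simp add: v)
    show "ennreal \<bar>\<phi> (vec4 a b c d)\<bar> \<le> ecbrt (\<integral>\<^sup>+t. ?f (vec4 a b c t) \<partial>lborel)"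
      using L[of "axis 4 1"] n nn_integral_translate[of "\<lambda>t. ?f (vec4 a b c t)" d]
      by (intro ecbrt_mono_cube) (simp add: v)
  qed
  have p4: "ennreal (\<phi> y ^ 4) = ennreal \<bar>\<phi> y\<bar> * ennreal \<bar>\<phi> y\<bar> * ennreal \<bar>\<phi> y\<bar> * ennreal \<bar>\<phi> y\<bar>" for y
    by (simp add: ennreal_mult[symmetric] power4_eq_xxxx flip: abs_mult) (simp add: mult.assoc)
  have "ennreal x = (\<integral>\<^sup>+y. ennreal (\<phi> y ^ 4) \<partial>lborel)"
    unfolding x_def by (rule nn_integral_eq_integral[symmetric, OF int4]) auto
  also have "\<dots> = (\<integral>\<^sup>+a. \<integral>\<^sup>+b. \<integral>\<^sup>+c. \<integral>\<^sup>+d. ennreal (\<phi> (vec4 a b c d) ^ 4) \<partial>lborel \<partial>lborel \<partial>lborel \<partial>lborel)"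
    by (rule nn_integral_vec4) measurable
  also have "\<dots> \<le> ?T * ecbrt ?T"
    by (rule order_trans[OF _ Loomis_Whitney4])
      (measurable, intro nn_integral_mono, unfold p4, intro mult_mono line, auto)
  finally have "ennreal x ^ 3 \<le> (?T * ecbrt ?T) ^ 3" by (rule power_mono_ennreal)
  also have "\<dots> = ?T ^ 3 * ?T" by (simp add: power_mult_distrib)
  also have "\<dots> = ennreal (t ^ 4)" unfolding T using t0
    by (simp add: ennreal_power ennreal_mult[symmetric] flip: power_Suc2)
  finally have "x ^ 3 \<le> t ^ 4" using x0 t0 by (simp add: ennreal_power)
  also have "t ^ 4 \<le> (3 * (l2 lborel (\<lambda>y. (\<phi> y)\<^sup>2) * D)) ^ 4" using tle t0 by (rule power_mono)
  also have "\<dots> = 81 * D ^ 4 * ((l2 lborel (\<lambda>y. (\<phi> y)\<^sup>2))\<^sup>2)\<^sup>2"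
    by (simp add: power_mult_distrib)
  also have "\<dots> = 81 * D ^ 4 * x\<^sup>2" by (simp add: l2s)
  finally have "x * x\<^sup>2 \<le> 81 * D ^ 4 * x\<^sup>2" by (simp add: power3_eq_cube power2_eq_square mult.assoc)
  then show "(LINT x|lborel. \<phi> x ^ 4) \<le> 81 * (l2 lborel (grad \<phi>)) ^ 4"
    unfolding x_def[symmetric] D_def[symmetric] using x0
    by (cases "x = 0") (auto simp: D_def)
qed

lemma indicator_idem:
  fixes x :: 'a
  shows "(indicator A x :: real)\<^sup>2 = indicator A x" "(indicator A x :: real) * indicator A x = indicator A x"
    "(indicator A x :: real) * (indicator A x * c) = indicator A x * c"
    "c * (indicator A x :: real) * indicator A x = c * indicator A x"
  by (auto simp: indicator_def)

lemma W012_L4_bound: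
  fixes \<Omega> :: "(real^4) set"
  assumes "open \<Omega>" "u \<in> W012 \<Omega>"
  shows "integrable (lebesgue_on \<Omega>) (\<lambda>x. u x ^ 4)"
    "(LINT x|lebesgue_on \<Omega>. u x ^ 4) \<le> 81 * Dnorm \<Omega> u ^ 4"
proof -
  let ?M = "lebesgue_on \<Omega>"
  obtain \<phi> where \<phi>: "\<And>n. \<phi> n \<in> test_functions \<Omega>" "(\<lambda>n. l2 ?M (\<lambda>x. \<phi> n x - u x)) \<longlonglongrightarrow> 0"
    "(\<lambda>n. l2 ?M (\<lambda>x. grad (\<phi> n) x - wgrad \<Omega> u x)) \<longlonglongrightarrow> 0"
    using W012_D(4)[OF assms] by blast
  note U = W012_D(1,2)[OF assms]
  obtain r where r: "strict_mono r" "AE x in ?M. (\<lambda>k. \<phi> (r k) x) \<longlonglongrightarrow> u x"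
    using l2_AE_subseq[OF test_sqint(1)[OF \<phi>(1) assms(1)] U(1) \<phi>(2)] by blast
  have lim: "(\<lambda>n. l2 ?M (grad (\<phi> n))) \<longlonglongrightarrow> Dnorm \<Omega> u"
    unfolding Dnorm_def Lnorm_2 by (rule l2_tendsto[OF test_sqint(2)[OF \<phi>(1) assms(1)] U(2) \<phi>(3)])
  have B: "(\<lambda>k. 81 * l2 ?M (grad (\<phi> (r k))) ^ 4) \<longlonglongrightarrow> 81 * Dnorm \<Omega> u ^ 4"
    using LIMSEQ_subseq_LIMSEQ[OF lim r(1)] by (intro tendsto_intros) (simp add: o_def)
  have int: "integrable ?M (\<lambda>x. \<phi> n x ^ 4)" and le: "(LINT x|?M. \<phi> n x ^ 4) \<le> 81 * l2 ?M (grad (\<phi> n)) ^ 4" for n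
  proof -
    have [measurable]: "\<phi> n \<in> borel_measurable borel" using test_integrable(2)[OF \<phi>(1)] .
    have "(\<lambda>x. \<phi> n x ^ 4) \<in> borel_measurable borel" by measurable
    note * = lebesgue_on_integral_eq[OF this borel_open[OF assms(1)]]
    show "integrable ?M (\<lambda>x. \<phi> n x ^ 4)" "(LINT x|?M. \<phi> n x ^ 4) \<le> 81 * l2 ?M (grad (\<phi> n)) ^ 4"
      using * test_function_L4_bound[OF \<phi>(1)[of n]] test_zero_outside[OF \<phi>(1)] test_sqint(4)[OF \<phi>(1) assms(1)]
      by simp_all
  qed
  have ae: "AE x in ?M. (\<lambda>k. \<phi> (r k) x ^ 4) \<longlonglongrightarrow> u x ^ 4"
    using r(2) by eventually_elim (intro tendsto_intros)
  have m: "(\<lambda>x. u x ^ 4) \<in> borel_measurable ?M" using sqint_measurable[OF U(1)] by measurable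
  show "integrable ?M (\<lambda>x. u x ^ 4)" "(LINT x|?M. u x ^ 4) \<le> 81 * Dnorm \<Omega> u ^ 4"
    using Fatou_real[OF int m _ ae le B] by auto
qed

section \<open>The Sobolev constant\<close>

lemma exists_test_function:
  assumes "open \<Omega>" "\<Omega> \<noteq> {}"
  obtains \<phi> x0 where "\<phi> \<in> test_functions \<Omega>" "\<And>x. 0 \<le> \<phi> x" "\<phi> x0 > 0"
proof -
  obtain x0 where "x0 \<in> \<Omega>" using assms(2) by blast
  then obtain a b where ab: "x0 \<in> box a b" "cbox a b \<subseteq> \<Omega>"
    using open_contains_cbox[OF assms(1)] by metis
  have "box_bump a b 0 x0 > 0"
    unfolding box_bump_def using ab(1) by (intro prod_pos) (auto simp: mem_box bump_def)
  then show thesis using that box_bump_test[OF ab(2)] box_bump_bounds(1) by blast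
qed

text \<open>A closed set of full Lebesgue measure is the whole space, so a continuous function that
  vanishes a.e. vanishes everywhere.\<close>

lemma integral_pos_of_continuous:
  fixes f :: "'a::euclidean_space \<Rightarrow> real"
  assumes "continuous_on UNIV f" "integrable lborel f" "\<And>x. 0 \<le> f x" "f x0 > 0"
  shows "(LINT x|lborel. f x) > 0"
proof (rule ccontr)
  assume "\<not> ?thesis"
  then have "(LINT x|lborel. f x) = 0" using integral_nonneg_AE[of f lborel] assms(3) by (simp add: not_less antisym)
  then have "AE x in lborel. f x = 0"
    using integral_nonneg_eq_0_iff_AE[OF assms(2)] assms(3) by simp
  then have "AE x in lborel. x \<in> f -` {0}" by simp
  moreover have "closed (f -` {0})" using assms(1) by (simp add: continuous_closed_vimage continuous_on_eq_continuous_at)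
  ultimately have "x0 \<in> f -` {0}" using mem_closed_if_AE_lebesgue AE_completion by blast
  then show False using assms(4) by simp
qed

lemma Dnorm_cmult:
  assumes "open \<Omega>" "u \<in> W012 \<Omega>"
  shows "(\<lambda>x. c * u x) \<in> W012 \<Omega>" "Dnorm \<Omega> (\<lambda>x. c * u x) = \<bar>c\<bar> * Dnorm \<Omega> u"
proof -
  have z: "(\<lambda>x. 0) \<in> W012 \<Omega>" "AE x in lebesgue_on \<Omega>. wgrad \<Omega> (\<lambda>x. 0) x = 0"
    using test_W012[OF assms(1) test_zero] by (simp_all add: grad_eqI[of "\<lambda>x. 0" 0])
  note l = W012_lincomb[OF assms(1) z(1) assms(2), of c]
  show w: "(\<lambda>x. c * u x) \<in> W012 \<Omega>" using l by simp
  have ae: "AE x in lebesgue_on \<Omega>. wgrad \<Omega> (\<lambda>x. c * u x) x = c *\<^sub>R wgrad \<Omega> u x"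
    using l(2) z(2) by eventually_elim simp
  have "Dnorm \<Omega> (\<lambda>x. c * u x) = l2 (lebesgue_on \<Omega>) (\<lambda>x. c *\<^sub>R wgrad \<Omega> u x)"
    unfolding Dnorm_def Lnorm_2
    by (rule l2_cong_AE[OF _ _ ae])
      (intro sqint_measurable W012_D(2)[OF assms(1) w] sqint_scaleR W012_D(2)[OF assms])+
  then show "Dnorm \<Omega> (\<lambda>x. c * u x) = \<bar>c\<bar> * Dnorm \<Omega> u"
    by (simp add: l2_scaleR Dnorm_def Lnorm_2)
qed

lemma Dnorm_sq: "(LINT x|lebesgue_on \<Omega>. (norm (wgrad \<Omega> u x))\<^sup>2) = (Dnorm \<Omega> u)\<^sup>2"
  by (simp add: Dnorm_def Lnorm_2 l2_sq)

lemma Dnorm_nonneg [simp]: "0 \<le> Dnorm \<Omega> u"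
  by (simp add: Dnorm_def Lnorm_2)

text \<open>\<open>Inf\<close> over the reals is meaningful only for a nonempty set that is bounded
  below: a rescaled test function is an element, and the constant 81 gives the lower bound 1/9,
  hence also positivity.\<close>

lemma Sobolev_const_facts:
  fixes \<Omega> :: "(real^4) set"
  assumes "open \<Omega>" "\<Omega> \<noteq> {}"
  shows "Sobolev_const \<Omega> > 0"
    and "u \<in> W012 \<Omega> \<Longrightarrow> (LINT x|lebesgue_on \<Omega>. u x ^ 4) \<le> Dnorm \<Omega> u ^ 4 / (Sobolev_const \<Omega>)\<^sup>2"
proof -
  let ?M = "lebesgue_on \<Omega>"
  define A where "A = {(LINT x|?M. (norm (wgrad \<Omega> u x))\<^sup>2) | u. u \<in> W012 \<Omega> \<and> (LINT x|?M. u x ^ 4) = 1}"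
  have A: "A = {(Dnorm \<Omega> u)\<^sup>2 | u. u \<in> W012 \<Omega> \<and> (LINT x|?M. u x ^ 4) = 1}"
    by (simp add: A_def Dnorm_sq)
  have S: "Sobolev_const \<Omega> = Inf A" by (simp add: Sobolev_const_def A_def)
  have lower: "1 / 9 \<le> y" if y: "y \<in> A" for y
  proof -
    obtain u where u: "y = (Dnorm \<Omega> u)\<^sup>2" "u \<in> W012 \<Omega>" "(LINT x|?M. u x ^ 4) = 1"
      using y unfolding A by blast
    have "1 \<le> 81 * (Dnorm \<Omega> u)^4" using W012_L4_bound(2)[OF assms(1) u(2)] u(3) by simp
    also have "\<dots> = (9 * y)\<^sup>2" by (simp add: u(1) power_mult_distrib flip: power_mult)
    finally have "1\<^sup>2 \<le> (9 * y)\<^sup>2" by simp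
    then have "1 \<le> 9 * y" by (rule power2_le_imp_le) (simp add: u(1))
    then show ?thesis by simp
  qed
  have norm: "(Dnorm \<Omega> u)\<^sup>2 / sqrt (LINT x|?M. u x ^ 4) \<in> A"
    if u: "u \<in> W012 \<Omega>" and X: "(LINT x|?M. u x ^ 4) > 0" for u
  proof -
    define X where "X = (LINT x|?M. u x ^ 4)"
    \<comment> \<open>\<open>c ^ 4 = 1 / X\<close> normalises the integral of the fourth power to
      1.\<close>
    define c where "c = 1 / sqrt (sqrt X)"
    have X0: "X > 0" using X by (simp add: X_def)
    have c2: "c\<^sup>2 = 1 / sqrt X" using X0 by (simp add: c_def power_divide)
    have "c ^ 4 = (c\<^sup>2)\<^sup>2" by simp
    then have c4: "c ^ 4 * X = 1" using X0 by (simp only: c2) (simp add: power_divide)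
    have "(LINT x|?M. (c * u x) ^ 4) = 1"
      using c4 by (simp add: power_mult_distrib X_def)
    moreover have "(Dnorm \<Omega> (\<lambda>x. c * u x))\<^sup>2 = (Dnorm \<Omega> u)\<^sup>2 / sqrt X"
      by (simp add: Dnorm_cmult(2)[OF assms(1) u] power_mult_distrib c2)
    ultimately show ?thesis
      unfolding A X_def[symmetric] using Dnorm_cmult(1)[OF assms(1) u, of c]
      by (intro CollectI exI[of _ "\<lambda>x. c * u x"]) simp
  qed
  obtain \<phi> x0 where \<phi>: "\<phi> \<in> test_functions \<Omega>" "\<And>x. 0 \<le> \<phi> x" "\<phi> x0 > 0"
    using exists_test_function[OF assms] by blast
  have "(LINT x|lborel. \<phi> x ^ 4) > 0"
    by (rule integral_pos_of_continuous[of _ x0])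
      (use \<phi> test_integrable(1)[OF \<phi>(1)] test_function_L4_bound(1)[OF \<phi>(1)] in \<open>auto intro!: continuous_intros\<close>)
  moreover have "(LINT x|?M. \<phi> x ^ 4) = (LINT x|lborel. \<phi> x ^ 4)"
    by (rule lebesgue_on_integral_eq(2)) (use assms test_integrable(2)[OF \<phi>(1)] test_zero_outside[OF \<phi>(1)] in auto)
  ultimately have "A \<noteq> {}" using norm[OF test_W012(1)[OF assms(1) \<phi>(1)]] by auto
  then have "1 / 9 \<le> Inf A" using lower by (rule cInf_greatest)
  then show pos: "Sobolev_const \<Omega> > 0" using S by simp
  have bdd: "bdd_below A" using lower by (rule bdd_belowI)
  show "(LINT x|?M. u x ^ 4) \<le> Dnorm \<Omega> u ^ 4 / (Sobolev_const \<Omega>)\<^sup>2" if u: "u \<in> W012 \<Omega>"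
  proof (cases "(LINT x|?M. u x ^ 4) > 0")
    case True
    define X where "X = (LINT x|?M. u x ^ 4)"
    have X0: "X > 0" using True by (simp add: X_def)
    have "Sobolev_const \<Omega> \<le> (Dnorm \<Omega> u)\<^sup>2 / sqrt X"
      unfolding S X_def by (rule cInf_lower[OF norm[OF u True] bdd])
    then have "Sobolev_const \<Omega> * sqrt X \<le> (Dnorm \<Omega> u)\<^sup>2" using X0 by (simp add: field_simps)
    then have "(Sobolev_const \<Omega> * sqrt X)\<^sup>2 \<le> ((Dnorm \<Omega> u)\<^sup>2)\<^sup>2"
      using pos X0 by (intro power_mono) auto
    then have "(Sobolev_const \<Omega>)\<^sup>2 * X \<le> Dnorm \<Omega> u ^ 4"
      using X0 by (simp add: power_mult_distrib flip: power_mult)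
    then show ?thesis using pos by (simp add: X_def field_simps)
  next
    case False
    then show ?thesis by (simp add: not_less order_trans[where y=0])
  qed
qed

subsection \<open>Compactness\<close>

text \<open>The difference is the integral of a directional derivative over a segment;
  Cauchy-Schwarz on the unit interval, Tonelli and translation invariance do the rest. Working with
  \<open>nn_integral\<close> spares the integrability of the double integral.\<close>

lemma test_translation_estimate:
  fixes \<phi> :: "'a::euclidean_space \<Rightarrow> real"
  assumes "\<phi> \<in> test_functions \<Omega>"
  shows "(\<integral>\<^sup>+x. ennreal ((\<phi> (h + x) - \<phi> x)\<^sup>2) \<partial>lborel) \<le> ennreal ((norm h * l2 lborel (grad \<phi>))\<^sup>2)"
proof -
  have cont: "continuous_on UNIV \<phi>" "continuous_on UNIV (grad \<phi>)" using test_integrable[OF assms(1)] by blast+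
  have [measurable]: "\<phi> \<in> borel_measurable borel" "grad \<phi> \<in> borel_measurable borel"
    using test_integrable[OF assms(1)] by blast+
  let ?g = "\<lambda>x t. grad \<phi> (t *\<^sub>R h + x) \<bullet> h"
  have pw: "ennreal ((\<phi> (h + x) - \<phi> x)\<^sup>2) \<le>
      (\<integral>\<^sup>+t. ennreal ((norm h)\<^sup>2 * (norm (grad \<phi> (t *\<^sub>R h + x)))\<^sup>2) * indicator {0..1} t \<partial>lborel)" for x
  proof -
    have contg: "continuous_on UNIV (?g x)"
      by (auto intro!: continuous_on_compose2[OF cont(2)] continuous_intros)
    have der: "((\<lambda>t. \<phi> (t *\<^sub>R h + x)) has_real_derivative ?g x t) (at t)" for t
    proof -
      have lin: "((\<lambda>t. t *\<^sub>R h + x) has_derivative (\<lambda>t. t *\<^sub>R h)) (at t)"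
        by (auto intro!: derivative_eq_intros)
      from has_derivative_compose[OF lin smooth_has_derivative[OF test_smooth[OF assms(1)]]]
      have "((\<lambda>t. \<phi> (t *\<^sub>R h + x)) has_derivative (\<lambda>r. grad \<phi> (t *\<^sub>R h + x) \<bullet> (r *\<^sub>R h))) (at t)" .
      then show ?thesis
        unfolding has_field_derivative_def by (rule has_derivative_eq_rhs) (auto simp: fun_eq_iff)
    qed
    have FTC: "(LINT t|lborel. ?g x t * indicator {0..1} t) = \<phi> (h + x) - \<phi> x"
      using integral_FTC_Icc_real[of 0 1 "\<lambda>t. \<phi> (t *\<^sub>R h + x)" "?g x"] der contg
      by (auto simp: continuous_on_eq_continuous_at)
    have si: "sqint lborel (indicator {0..1} :: real \<Rightarrow> real)"
      by (simp add: sqint_def indicator_idem)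
    have "integrable lborel (\<lambda>t. indicator {0..1} t *\<^sub>R (?g x t)\<^sup>2)"
      by (rule borel_integrable_compact[OF compact_Icc]) (intro continuous_on_power continuous_on_subset[OF contg], auto)
    moreover have "(?g x t * indicator {0..1} t)\<^sup>2 = indicator {0..1} t *\<^sub>R (?g x t)\<^sup>2" for t
      by (simp add: indicator_def)
    moreover have "(\<lambda>t. ?g x t * indicator {0..1} t) \<in> borel_measurable borel"
      using borel_measurable_continuous_onI[OF contg] by measurable
    ultimately have sg: "sqint lborel (\<lambda>t. ?g x t * indicator {0..1} t)"
      by (simp add: sqint_def)
    have "(\<phi> (h + x) - \<phi> x)\<^sup>2 = (LINT t|lborel. (?g x t * indicator {0..1} t) * indicator {0..1} t)\<^sup>2"
      unfolding FTC[symmetric] by (simp add: mult.assoc indicator_idem)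
    also have "\<dots> = \<bar>LINT t|lborel. (?g x t * indicator {0..1} t) * indicator {0..1} t\<bar>\<^sup>2" by simp
    also have "\<dots> \<le> (l2 lborel (\<lambda>t. ?g x t * indicator {0..1} t) * l2 lborel (indicator {0..1} :: real \<Rightarrow> real))\<^sup>2"
      by (intro power_mono l2_Cauchy_Schwarz_mult sg si) simp
    also have "l2 lborel (indicator {0..1} :: real \<Rightarrow> real) = 1"
      by (simp add: l2_def indicator_idem)
    finally have "(\<phi> (h + x) - \<phi> x)\<^sup>2 \<le> (LINT t|lborel. (?g x t * indicator {0..1} t)\<^sup>2)"
      by (simp add: l2_sq)
    then have "ennreal ((\<phi> (h + x) - \<phi> x)\<^sup>2) \<le> ennreal (LINT t|lborel. (?g x t * indicator {0..1} t)\<^sup>2)"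
      by (rule ennreal_leI)
    also have "\<dots> = (\<integral>\<^sup>+t. ennreal ((?g x t * indicator {0..1} t)\<^sup>2) \<partial>lborel)"
      using sqint_integrable[OF sg] by (intro nn_integral_eq_integral[symmetric]) auto
    also have "\<dots> \<le> (\<integral>\<^sup>+t. ennreal ((norm h)\<^sup>2 * (norm (grad \<phi> (t *\<^sub>R h + x)))\<^sup>2) * indicator {0..1} t \<partial>lborel)"
    proof (intro nn_integral_mono)
      fix t :: real
      have "\<bar>?g x t\<bar> \<le> norm (grad \<phi> (t *\<^sub>R h + x)) * norm h" by (rule Cauchy_Schwarz_ineq2)
      then have "\<bar>?g x t\<bar>\<^sup>2 \<le> (norm (grad \<phi> (t *\<^sub>R h + x)) * norm h)\<^sup>2" by (intro power_mono) auto
      then have "(?g x t)\<^sup>2 \<le> (norm h)\<^sup>2 * (norm (grad \<phi> (t *\<^sub>R h + x)))\<^sup>2"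
        by (simp add: power_mult_distrib mult.commute)
      then show "ennreal ((?g x t * indicator {0..1} t)\<^sup>2) \<le>
          ennreal ((norm h)\<^sup>2 * (norm (grad \<phi> (t *\<^sub>R h + x)))\<^sup>2) * indicator {0..1} t"
        by (auto simp: indicator_def intro: ennreal_leI)
    qed
    finally show ?thesis .
  qed
  have "(\<integral>\<^sup>+x. ennreal ((\<phi> (h + x) - \<phi> x)\<^sup>2) \<partial>lborel) \<le>
      (\<integral>\<^sup>+x. \<integral>\<^sup>+t. ennreal ((norm h)\<^sup>2 * (norm (grad \<phi> (t *\<^sub>R h + x)))\<^sup>2) * indicator {0..1} t \<partial>lborel \<partial>lborel)"
    by (intro nn_integral_mono pw)
  also have "\<dots> = (\<integral>\<^sup>+t. \<integral>\<^sup>+x. ennreal ((norm h)\<^sup>2 * (norm (grad \<phi> (t *\<^sub>R h + x)))\<^sup>2) * indicator {0..1} t \<partial>lborel \<partial>lborel)"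
    by (rule lborel_pair.Fubini'[symmetric]) measurable
  also have "\<dots> = (\<integral>\<^sup>+t. ennreal ((norm h * l2 lborel (grad \<phi>))\<^sup>2) * indicator {0..1} (t::real) \<partial>lborel)"
  proof (intro nn_integral_cong)
    fix t :: real
    have "(\<integral>\<^sup>+x. ennreal ((norm h)\<^sup>2 * (norm (grad \<phi> (t *\<^sub>R h + x)))\<^sup>2) * indicator {0..1} t \<partial>lborel)
       = (\<integral>\<^sup>+x. ennreal ((norm h)\<^sup>2 * (norm (grad \<phi> (t *\<^sub>R h + x)))\<^sup>2) \<partial>lborel) * indicator {0..1} t"
      by (rule nn_integral_multc) measurable
    also have "(\<integral>\<^sup>+x. ennreal ((norm h)\<^sup>2 * (norm (grad \<phi> (t *\<^sub>R h + x)))\<^sup>2) \<partial>lborel)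
        = (\<integral>\<^sup>+x. ennreal ((norm h)\<^sup>2 * (norm (grad \<phi> x))\<^sup>2) \<partial>lborel)"
      by (rule nn_integral_translate[where f="\<lambda>x. ennreal ((norm h)\<^sup>2 * (norm (grad \<phi> x))\<^sup>2)"]) measurable
    also have "\<dots> = ennreal (LINT x|lborel. (norm h)\<^sup>2 * (norm (grad \<phi> x))\<^sup>2)"
      using sqint_integrable[OF test_integrable(7)[OF assms]] by (intro nn_integral_eq_integral) auto
    also have "(LINT x|lborel. (norm h)\<^sup>2 * (norm (grad \<phi> x))\<^sup>2) = (norm h * l2 lborel (grad \<phi>))\<^sup>2"
      by (simp add: power_mult_distrib l2_sq)
    finally show "(\<integral>\<^sup>+x. ennreal ((norm h)\<^sup>2 * (norm (grad \<phi> (t *\<^sub>R h + x)))\<^sup>2) * indicator {0..1} t \<partial>lborel)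
        = ennreal ((norm h * l2 lborel (grad \<phi>))\<^sup>2) * indicator {0..1} t" .
  qed
  also have "\<dots> = ennreal ((norm h * l2 lborel (grad \<phi>))\<^sup>2)"
    by (simp add: nn_integral_cmult)
  finally show ?thesis .
qed

text \<open>For \<open>l > 0\<close> these are half-open cubes of side \<open>l\<close>, so they
  partition the space without overlapping on faces.\<close>

definition cell :: "real \<Rightarrow> int^4 \<Rightarrow> (real^4) set" where
  "cell l z = {x. \<forall>i. \<lfloor>x $ i / l\<rfloor> = z $ i}"

lemma cell_borel [measurable]: "cell l z \<in> sets borel"
proof -
  have "{x \<in> space borel. \<forall>i. \<lfloor>(x::real^4) $ i / l\<rfloor> = z $ i} \<in> sets borel" by measurable
  then show ?thesis by (simp add: cell_def)
qed

lemma cell_disjoint: "x \<in> cell l z \<Longrightarrow> x \<in> cell l z' \<Longrightarrow> z = z'"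
  by (simp add: cell_def vec_eq_iff)

lemma cell_iff:
  assumes "l > 0"
  shows "x \<in> cell l z \<longleftrightarrow> (\<forall>i. of_int (z $ i) * l \<le> x $ i \<and> x $ i < (of_int (z $ i) + 1) * l)"
  using assms by (auto simp: cell_def floor_eq_iff field_simps)

lemma cell_measure:
  assumes "l > 0"
  shows "emeasure lborel (cell l z) < \<infinity>" "l ^ 4 \<le> measure lborel (cell l z)"
proof -
  define a b :: "real^4" where "a = (\<chi> i. of_int (z $ i) * l)" and "b = (\<chi> i. (of_int (z $ i) + 1) * l)"
  have sub: "cell l z \<subseteq> cbox a b" "box a b \<subseteq> cell l z"
    by (auto simp: cell_iff[OF assms] mem_box_cart a_def b_def less_imp_le)
  then show fin: "emeasure lborel (cell l z) < \<infinity>"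
    using emeasure_mono[OF sub(1), of lborel] emeasure_lborel_cbox_finite[of a b] by (auto intro: le_less_trans)
  have "l ^ 4 = (\<Prod>i\<in>(UNIV::4 set). b $ i - a $ i)"
    by (simp add: a_def b_def left_diff_distrib[symmetric])
  also have "\<dots> = (\<Prod>c\<in>Basis. (b - a) \<bullet> c)"
    unfolding Basis_vec_def
    by (simp add: UNION_singleton_eq_range prod.reindex inj_on_def axis_eq_axis inner_axis)
  also have "\<dots> = measure lborel (box a b)"
  proof -
    have "a \<bullet> c \<le> b \<bullet> c" if "c \<in> Basis" for c
      using that assms unfolding Basis_vec_def by (auto simp: inner_axis a_def b_def algebra_simps)
    then show ?thesis by (simp add: measure_lborel_box_eq)
  qed
  also have "\<dots> \<le> measure lborel (cell l z)"
    by (rule measure_mono_fmeasurable[OF sub(2)]) (use fin in \<open>auto intro: fmeasurableI\<close>)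
  finally show "l ^ 4 \<le> measure lborel (cell l z)" .
qed

lemma emeasure_cube4:
  assumes "l > 0"
  shows "emeasure lborel (cbox (\<chi> i. - l) (\<chi> i. l) :: (real^4) set) = ennreal (16 * l ^ 4)"
proof -
  have "(\<Prod>c\<in>Basis. ((\<chi> i. l) - (\<chi> i. - l) :: real^4) \<bullet> c) = (\<Prod>i\<in>(UNIV::4 set). 2 * l)"
    unfolding Basis_vec_def
    by (simp add: UNION_singleton_eq_range prod.reindex inj_on_def axis_eq_axis inner_axis)
  also have "\<dots> = 16 * l ^ 4" by (simp add: power_mult_distrib)
  finally have p: "(\<Prod>c\<in>Basis. ((\<chi> i. l) - (\<chi> i. - l) :: real^4) \<bullet> c) = 16 * l ^ 4" .
  have "(\<chi> i. - l :: real^4) \<bullet> c \<le> (\<chi> i. l) \<bullet> c" if "c \<in> Basis" for c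
    using that assms unfolding Basis_vec_def by (auto simp: inner_axis)
  then show ?thesis by (simp add: emeasure_lborel_cbox_eq p)
qed

text \<open>Expand the double integral of \<open>(\<phi> x - \<phi> y)\<^sup>2\<close> over each cube, and bound the sum of these by the translation estimate.\<close>

lemma grid_Poincare:
  fixes \<phi> :: "real^4 \<Rightarrow> real"
  assumes "\<phi> \<in> test_functions \<Omega>" "l > 0" "finite Z" "\<Omega> \<subseteq> (\<Union>z\<in>Z. cell l z)"
  shows "(l2 lborel \<phi>)\<^sup>2 \<le> (\<Sum>z\<in>Z. (LINT x|lborel. indicator (cell l z) x * \<phi> x)\<^sup>2) / l ^ 4
    + 128 * l\<^sup>2 * (l2 lborel (grad \<phi>))\<^sup>2"
proof -
  have [measurable]: "\<phi> \<in> borel_measurable borel" using test_integrable(2)[OF assms(1)] .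
  define D where "D = l2 lborel (grad \<phi>)"
  let ?I = "\<lambda>z x. indicator (cell l z) x :: real"
  define s where "s z = (LINT x|lborel. ?I z x * (\<phi> x)\<^sup>2)" for z
  define a where "a z = (LINT x|lborel. ?I z x * \<phi> x)" for z
  define m where "m z = measure lborel (cell l z)" for z
  have iI: "integrable lborel (?I z)" for z
    using cell_measure(1)[OF assms(2), of z] by (intro integrable_real_indicator) auto
  have ia: "integrable lborel (\<lambda>x. ?I z x * \<phi> x)" for z
    by (rule Bochner_Integration.integrable_bound[OF test_integrable(3)[OF assms(1)]])
      (auto simp: indicator_def)
  have isq: "integrable lborel (\<lambda>x. (\<phi> x)\<^sup>2)"
    using sqint_integrable[OF test_integrable(6)[OF assms(1)]] by simp
  have isx: "integrable lborel (\<lambda>x. ?I z x * (\<phi> x)\<^sup>2)" for z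
    by (rule Bochner_Integration.integrable_bound[OF isq]) (auto simp: indicator_def)
  have s0: "s z \<ge> 0" for z unfolding s_def by (intro integral_nonneg_AE) auto
  define J where "J z = (\<integral>\<^sup>+x. \<integral>\<^sup>+y. ennreal (?I z x * ?I z y * (\<phi> x - \<phi> y)\<^sup>2) \<partial>lborel \<partial>lborel)" for z
  have J: "J z = ennreal (2 * m z * s z - 2 * (a z)\<^sup>2)" for z
  proof -
    have inner: "(\<integral>\<^sup>+y. ennreal (?I z x * ?I z y * (\<phi> x - \<phi> y)\<^sup>2) \<partial>lborel)
        = ennreal (?I z x * (m z * (\<phi> x)\<^sup>2 - 2 * \<phi> x * a z + s z))"
      and nonneg: "0 \<le> ?I z x * (m z * (\<phi> x)\<^sup>2 - 2 * \<phi> x * a z + s z)" for x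
    proof -
      have eq: "?I z x * ?I z y * (\<phi> x - \<phi> y)\<^sup>2 =
          ?I z x * ((\<phi> x)\<^sup>2 * ?I z y - (2 * \<phi> x) * (?I z y * \<phi> y) + ?I z y * (\<phi> y)\<^sup>2)" for y
        by (simp add: power2_eq_square algebra_simps)
      have int: "integrable lborel (\<lambda>y. ?I z x * ?I z y * (\<phi> x - \<phi> y)\<^sup>2)"
        unfolding eq using iI ia isx by auto
      have val: "(LINT y|lborel. ?I z x * ?I z y * (\<phi> x - \<phi> y)\<^sup>2) = ?I z x * (m z * (\<phi> x)\<^sup>2 - 2 * \<phi> x * a z + s z)"
        unfolding eq using iI[of z] ia[of z] isx[of z]
        by (simp add: m_def a_def s_def mult.commute)
      show "(\<integral>\<^sup>+y. ennreal (?I z x * ?I z y * (\<phi> x - \<phi> y)\<^sup>2) \<partial>lborel)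
        = ennreal (?I z x * (m z * (\<phi> x)\<^sup>2 - 2 * \<phi> x * a z + s z))"
        unfolding val[symmetric] by (rule nn_integral_eq_integral[OF int]) auto
      show "0 \<le> ?I z x * (m z * (\<phi> x)\<^sup>2 - 2 * \<phi> x * a z + s z)"
        unfolding val[symmetric] by (intro integral_nonneg_AE) auto
    qed
    have eq: "?I z x * (m z * (\<phi> x)\<^sup>2 - 2 * \<phi> x * a z + s z) =
        m z * (?I z x * (\<phi> x)\<^sup>2) - (2 * a z) * (?I z x * \<phi> x) + s z * ?I z x" for x
      by (simp add: algebra_simps)
    have int: "integrable lborel (\<lambda>x. ?I z x * (m z * (\<phi> x)\<^sup>2 - 2 * \<phi> x * a z + s z))"
      unfolding eq using iI ia isx by auto
    have "J z = (\<integral>\<^sup>+x. ennreal (?I z x * (m z * (\<phi> x)\<^sup>2 - 2 * \<phi> x * a z + s z)) \<partial>lborel)"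
      unfolding J_def inner ..
    also have "\<dots> = ennreal (LINT x|lborel. ?I z x * (m z * (\<phi> x)\<^sup>2 - 2 * \<phi> x * a z + s z))"
      by (rule nn_integral_eq_integral[OF int]) (use nonneg in auto)
    also have "(LINT x|lborel. ?I z x * (m z * (\<phi> x)\<^sup>2 - 2 * \<phi> x * a z + s z)) = 2 * m z * s z - 2 * (a z)\<^sup>2"
      unfolding eq using iI[of z] ia[of z] isx[of z]
      by (simp flip: a_def s_def m_def) (simp add: power2_eq_square)
    finally show ?thesis .
  qed
  define B :: "(real^4) set" where "B = cbox (\<chi> i. - l) (\<chi> i. l)"
  have [measurable]: "B \<in> sets borel" by (simp add: B_def)
  have mB: "emeasure lborel B = ennreal (16 * l ^ 4)"
    unfolding B_def by (rule emeasure_cube4[OF assms(2)])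
  have normB: "norm h \<le> 4 * l" if "h \<in> B" for h
  proof -
    have "norm h \<le> (\<Sum>i\<in>UNIV. \<bar>h $ i\<bar>)" by (rule norm_le_l1_cart)
    also have "\<dots> \<le> (\<Sum>i\<in>(UNIV::4 set). l)"
    proof (rule sum_mono)
      fix i
      have "- l \<le> h $ i \<and> h $ i \<le> l" using that by (simp add: B_def mem_box_cart)
      then show "\<bar>h $ i\<bar> \<le> l" by linarith
    qed
    finally show ?thesis by simp
  qed
  \<comment> \<open>A pair of points lies in at most one common cell, and then its difference lies
    in the cube \<open>B\<close>; this trades the sum over cells for an integral over
    shifts.\<close>
  have cells: "(\<Sum>z\<in>Z. ?I z x * ?I z y) \<le> indicator B (y - x)" for x y
  proof (cases "\<exists>z\<in>Z. x \<in> cell l z \<and> y \<in> cell l z")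
    case True
    then obtain z where z: "z \<in> Z" "x \<in> cell l z" "y \<in> cell l z" by blast
    have "x \<notin> cell l z'" if "z' \<noteq> z" for z'
      using that z(2) cell_disjoint by blast
    then have "(\<Sum>z\<in>Z. ?I z x * ?I z y) = (\<Sum>z'\<in>{z}. ?I z' x * ?I z' y)"
      using z(1) assms(3) by (intro sum.mono_neutral_right) auto
    also have "\<dots> = 1" using z by simp
    also have "y - x \<in> B"
    proof -
      have "- l \<le> (y - x) $ i \<and> (y - x) $ i \<le> l" for i
      proof -
        define q where "q = of_int (z $ i) * l"
        have "q \<le> x $ i" "x $ i < q + l" "q \<le> y $ i" "y $ i < q + l"
          using z(2,3) by (simp_all add: cell_iff[OF assms(2)] q_def distrib_right)
        then show ?thesis by simp
      qed
      then show ?thesis unfolding B_def mem_box_cart by simp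
    qed
    then have "1 = (indicator B (y - x) :: real)" by simp
    finally show ?thesis by simp
  next
    case False
    then have "(\<Sum>z\<in>Z. ?I z x * ?I z y) = 0" by (intro sum.neutral) (auto simp: indicator_def)
    then show ?thesis by simp
  qed
  have "(\<Sum>z\<in>Z. J z) = (\<integral>\<^sup>+x. \<integral>\<^sup>+y. (\<Sum>z\<in>Z. ennreal (?I z x * ?I z y * (\<phi> x - \<phi> y)\<^sup>2)) \<partial>lborel \<partial>lborel)"
    unfolding J_def by (simp add: nn_integral_sum del: sum_ennreal)
  also have "\<dots> \<le> (\<integral>\<^sup>+x. \<integral>\<^sup>+y. ennreal (indicator B (y - x) * (\<phi> x - \<phi> y)\<^sup>2) \<partial>lborel \<partial>lborel)"
  proof (intro nn_integral_mono)
    fix x y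
    have "(\<Sum>z\<in>Z. ennreal (?I z x * ?I z y * (\<phi> x - \<phi> y)\<^sup>2)) = ennreal ((\<Sum>z\<in>Z. ?I z x * ?I z y) * (\<phi> x - \<phi> y)\<^sup>2)"
      by (subst sum_ennreal) (auto simp: sum_distrib_right)
    also have "\<dots> \<le> ennreal (indicator B (y - x) * (\<phi> x - \<phi> y)\<^sup>2)"
      using cells[of x y] by (intro ennreal_leI mult_right_mono) auto
    finally show "(\<Sum>z\<in>Z. ennreal (?I z x * ?I z y * (\<phi> x - \<phi> y)\<^sup>2)) \<le> ennreal (indicator B (y - x) * (\<phi> x - \<phi> y)\<^sup>2)" .
  qed
  also have "\<dots> = (\<integral>\<^sup>+x. \<integral>\<^sup>+h. ennreal (indicator B h * (\<phi> (h + x) - \<phi> x)\<^sup>2) \<partial>lborel \<partial>lborel)"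
  proof (rule nn_integral_cong)
    fix x
    have "(\<integral>\<^sup>+y. ennreal (indicator B (y - x) * (\<phi> x - \<phi> y)\<^sup>2) \<partial>lborel)
        = (\<integral>\<^sup>+h. ennreal (indicator B ((x + h) - x) * (\<phi> x - \<phi> (x + h))\<^sup>2) \<partial>lborel)"
      by (rule nn_integral_translate[symmetric, of "\<lambda>y. ennreal (indicator B (y - x) * (\<phi> x - \<phi> y)\<^sup>2)" x]) measurable
    then show "(\<integral>\<^sup>+y. ennreal (indicator B (y - x) * (\<phi> x - \<phi> y)\<^sup>2) \<partial>lborel)
        = (\<integral>\<^sup>+h. ennreal (indicator B h * (\<phi> (h + x) - \<phi> x)\<^sup>2) \<partial>lborel)"
      by (simp add: add.commute power2_commute)
  qed
  also have "\<dots> = (\<integral>\<^sup>+h. \<integral>\<^sup>+x. ennreal (indicator B h * (\<phi> (h + x) - \<phi> x)\<^sup>2) \<partial>lborel \<partial>lborel)"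
    by (rule lborel_pair.Fubini'[symmetric]) measurable
  \<comment> \<open>Shifts in \<open>B\<close> have norm at most \<open>4 * l\<close>, and
    \<open>B\<close> has volume \<open>16 * l ^ 4\<close>: this is the origin of 256 below and,
    after halving, of 128.\<close>
  also have "\<dots> \<le> (\<integral>\<^sup>+h. ennreal ((4 * l * D)\<^sup>2) * indicator B h \<partial>lborel)"
  proof (intro nn_integral_mono)
    fix h
    show "(\<integral>\<^sup>+x. ennreal (indicator B h * (\<phi> (h + x) - \<phi> x)\<^sup>2) \<partial>lborel) \<le> ennreal ((4 * l * D)\<^sup>2) * indicator B h"
    proof (cases "h \<in> B")
      case True
      have "(\<integral>\<^sup>+x. ennreal ((\<phi> (h + x) - \<phi> x)\<^sup>2) \<partial>lborel) \<le> ennreal ((norm h * D)\<^sup>2)"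
        unfolding D_def by (rule test_translation_estimate[OF assms(1)])
      also have "\<dots> \<le> ennreal ((4 * l * D)\<^sup>2)"
        using normB[OF True] by (intro ennreal_leI power_mono mult_right_mono) (auto simp: D_def)
      finally show ?thesis using True by simp
    qed simp
  qed
  also have "\<dots> = ennreal ((4 * l * D)\<^sup>2) * ennreal (16 * l ^ 4)"
    by (simp add: nn_integral_cmult_indicator mB)
  also have "\<dots> = ennreal (256 * l\<^sup>2 * D\<^sup>2 * l ^ 4)"
    using assms(2) by (simp add: ennreal_mult[symmetric] power_mult_distrib mult_ac)
  finally have "(\<Sum>z\<in>Z. ennreal (2 * m z * s z - 2 * (a z)\<^sup>2)) \<le> ennreal (256 * l\<^sup>2 * D\<^sup>2 * l ^ 4)"
    unfolding J .
  \<comment> \<open>Needed to leave \<open>ennreal\<close>, where a negative term would have been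
    cut off to 0.\<close>
  moreover have nonneg: "2 * m z * s z - 2 * (a z)\<^sup>2 \<ge> 0" for z
  proof -
    have si: "sqint lborel (?I z)"
      using iI[of z] by (simp add: sqint_def indicator_idem)
    have sf: "sqint lborel (\<lambda>x. ?I z x * \<phi> x)"
      using isx[of z] by (simp add: sqint_def power_mult_distrib indicator_idem)
    have "a z = (LINT x|lborel. ?I z x * (?I z x * \<phi> x))"
      unfolding a_def by (simp add: mult.assoc[symmetric] indicator_idem)
    then have "\<bar>a z\<bar> \<le> l2 lborel (?I z) * l2 lborel (\<lambda>x. ?I z x * \<phi> x)"
      using l2_Cauchy_Schwarz_mult[OF si sf] by simp
    then have "\<bar>a z\<bar>\<^sup>2 \<le> (l2 lborel (?I z) * l2 lborel (\<lambda>x. ?I z x * \<phi> x))\<^sup>2"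
      by (rule power_mono) simp
    also have "\<dots> = m z * s z"
      by (simp add: power_mult_distrib l2_sq m_def s_def indicator_idem)
    finally show ?thesis by simp
  qed
  ultimately have "(\<Sum>z\<in>Z. 2 * m z * s z - 2 * (a z)\<^sup>2) \<le> 256 * l\<^sup>2 * D\<^sup>2 * l ^ 4"
    using assms(2) by (simp add: sum_ennreal ennreal_le_iff)
  moreover have "(\<Sum>z\<in>Z. 2 * l ^ 4 * s z - 2 * (a z)\<^sup>2) \<le> (\<Sum>z\<in>Z. 2 * m z * s z - 2 * (a z)\<^sup>2)"
    using cell_measure(2)[OF assms(2)] s0 by (intro sum_mono diff_right_mono mult_right_mono) (auto simp: m_def)
  ultimately have "2 * l ^ 4 * (\<Sum>z\<in>Z. s z) - 2 * (\<Sum>z\<in>Z. (a z)\<^sup>2) \<le> 256 * l\<^sup>2 * D\<^sup>2 * l ^ 4"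
    by (simp add: sum_subtractf sum_distrib_left)
  moreover have "(l2 lborel \<phi>)\<^sup>2 = (\<Sum>z\<in>Z. s z)"
  proof -
    have "(\<phi> x)\<^sup>2 = (\<Sum>z\<in>Z. ?I z x * (\<phi> x)\<^sup>2)" for x
    proof (cases "x \<in> \<Omega>")
      case True
      then obtain z where z: "z \<in> Z" "x \<in> cell l z" using assms(4) by blast
      have "x \<notin> cell l z'" if "z' \<noteq> z" for z'
        using that z(2) cell_disjoint by blast
      then have "(\<Sum>z\<in>Z. ?I z x * (\<phi> x)\<^sup>2) = (\<Sum>z'\<in>{z}. ?I z' x * (\<phi> x)\<^sup>2)"
        using z(1) assms(3) by (intro sum.mono_neutral_right) auto
      then show ?thesis using z by simp
    next
      case False
      then show ?thesis using test_zero_outside[OF assms(1)] by simp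
    qed
    then have "(l2 lborel \<phi>)\<^sup>2 = (LINT x|lborel. (\<Sum>z\<in>Z. ?I z x * (\<phi> x)\<^sup>2))" unfolding l2_sq by simp
    also have "\<dots> = (\<Sum>z\<in>Z. s z)" unfolding s_def using isx by (intro Bochner_Integration.integral_sum)
    finally show ?thesis .
  qed
  ultimately have "l ^ 4 * (l2 lborel \<phi>)\<^sup>2 \<le> (\<Sum>z\<in>Z. (a z)\<^sup>2) + 128 * l\<^sup>2 * D\<^sup>2 * l ^ 4" by simp
  then show ?thesis
    using assms(2) unfolding a_def D_def by (simp add: field_simps)
qed

section \<open>Rellich's theorem\<close>

lemma finite_cell_cover:
  assumes "bounded \<Omega>" "l > 0"
  obtains Z where "finite Z" "\<Omega> \<subseteq> (\<Union>z\<in>Z. cell l z)"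
proof -
  obtain R where R: "\<And>x. x \<in> \<Omega> \<Longrightarrow> norm x \<le> R" using assms(1) bounded_iff by blast
  define N where "N = \<lceil>R / l\<rceil>"
  let ?Z = "{z :: int^4. \<forall>i. z $ i \<in> {-N-1..N}}"
  have "finite ?Z"
  proof -
    have "finite {f. \<forall>i. (f :: 4 \<Rightarrow> int) i \<in> {-N-1..N}}"
      using finite_PiE[of "UNIV :: 4 set" "\<lambda>_. {-N-1..N}"] by (simp add: PiE_UNIV_domain Pi_def)
    moreover have "?Z \<subseteq> vec_lambda ` {f. \<forall>i. (f :: 4 \<Rightarrow> int) i \<in> {-N-1..N}}"
    proof
      fix z assume "z \<in> ?Z"
      then show "z \<in> vec_lambda ` {f. \<forall>i. (f :: 4 \<Rightarrow> int) i \<in> {-N-1..N}}"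
        by (intro image_eqI[of _ _ "vec_nth z"]) auto
    qed
    ultimately show ?thesis by (rule finite_surj)
  qed
  moreover have "\<Omega> \<subseteq> (\<Union>z\<in>?Z. cell l z)"
  proof
    fix x assume "x \<in> \<Omega>"
    have "\<lfloor>x $ i / l\<rfloor> \<in> {-N-1..N}" for i
    proof -
      have "\<bar>x $ i\<bar> \<le> R" using R[OF \<open>x \<in> \<Omega>\<close>] component_le_norm_cart order_trans by blast
      then have "\<bar>x $ i / l\<bar> \<le> R / l" using assms(2) by (simp add: divide_right_mono)
      also have "\<dots> \<le> N" unfolding N_def by simp
      finally have "\<bar>x $ i / l\<bar> \<le> of_int N" .
      then have "x $ i / l \<le> of_int N" "- of_int N \<le> x $ i / l" by linarith+
      then show ?thesis by (auto simp: floor_le_iff le_floor_iff)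
    qed
    then have "(\<chi> i. \<lfloor>x $ i / l\<rfloor>) \<in> ?Z" by simp
    moreover have "x \<in> cell l (\<chi> i. \<lfloor>x $ i / l\<rfloor>)" by (simp add: cell_def)
    ultimately show "x \<in> (\<Union>z\<in>?Z. cell l z)" by blast
  qed
  ultimately show thesis by (rule that)
qed

text \<open>Tychonoff in place of a diagonal argument: a product of compact intervals over a
  countable index type is compact and metrizable, hence sequentially compact.\<close>

lemma bounded_functions_convergent_subseq:
  fixes f :: "nat \<Rightarrow> 'b::countable \<Rightarrow> real"
  assumes "\<And>n x. \<bar>f n x\<bar> \<le> B"
  obtains r where "strict_mono r" "\<And>x. \<exists>L. (\<lambda>n. f (r n) x) \<longlonglongrightarrow> L"
proof -
  let ?K = "PiE UNIV (\<lambda>_::'b. {-B..B})"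
  have "compactin (product_topology (\<lambda>_. euclidean) UNIV) ?K"
    by (simp add: compactin_PiE)
  then have "compact ?K"
    by (simp add: euclidean_product_topology)
  moreover have "f n \<in> ?K" for n
    using assms[of n] by (auto simp: abs_le_iff) (metis minus_le_iff)
  ultimately obtain L r where "strict_mono (r :: nat \<Rightarrow> nat)" "(f \<circ> r) \<longlonglongrightarrow> L"
    unfolding compact_def by metis
  moreover have "isCont (\<lambda>g. g x) L" for x
    using iffD1[OF continuous_on_eq_continuous_at[OF open_UNIV] continuous_on_product_coordinates] by blast
  ultimately have "(\<lambda>n. f (r n) x) \<longlonglongrightarrow> L x" for x
    using isCont_tendsto_compose[of L "\<lambda>g. g x" "f \<circ> r"] by (simp add: o_def)
  then show thesis
    using that[of r] \<open>strict_mono r\<close> by blast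
qed

text \<open>The integrals over all cells of side \<open>1 / Suc k\<close> form a countable family of
  bounded numbers, so one subsequence makes all of them converge. At a fixed small mesh,
  \<open>grid_Poincare\<close> bounds the distance of two members by finitely many of these
  integrals plus a multiple of \<open>l\<^sup>2\<close>.\<close>

lemma Rellich:
  fixes \<phi> :: "nat \<Rightarrow> real^4 \<Rightarrow> real"
  assumes "open \<Omega>" "bounded \<Omega>" and \<phi>: "\<And>n. \<phi> n \<in> test_functions \<Omega>"
    and M: "\<And>n. l2 lborel (\<phi> n) \<le> M" "\<And>n. l2 lborel (grad (\<phi> n)) \<le> M"
  obtains r :: "nat \<Rightarrow> nat" where "strict_mono r"
    "\<And>e. e > 0 \<Longrightarrow> \<exists>N. \<forall>m\<ge>N. \<forall>n\<ge>N. l2 lborel (\<lambda>x. \<phi> (r m) x - \<phi> (r n) x) < e"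
proof -
  have M0: "M \<ge> 0" using order_trans[OF l2_nonneg M(1)[of 0]] .
  have \<Omega>fin: "emeasure lborel \<Omega> < \<infinity>" by (rule emeasure_bounded_finite[OF assms(2)])
  define a where "a n kz = (LINT x|lborel. indicator (cell (1 / real (Suc (fst kz))) (snd kz)) x * \<phi> n x)"
    for n and kz :: "nat \<times> (int^4)"
  define V where "V = l2 lborel (indicator \<Omega> :: real^4 \<Rightarrow> real)"
  have si: "sqint lborel (indicator \<Omega> :: real^4 \<Rightarrow> real)"
    using assms(1) \<Omega>fin by (simp add: sqint_def indicator_idem integrable_real_indicator)
  have bound: "\<bar>a n kz\<bar> \<le> V * M" for n kz
  proof -
    obtain k z where kz: "kz = (k, z)" by force
    have [measurable]: "\<phi> n \<in> borel_measurable borel" using test_integrable(2)[OF \<phi>] .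
    have "\<bar>a n kz\<bar> \<le> (LINT x|lborel. norm (indicator (cell (1 / real (Suc k)) z) x * \<phi> n x))"
      unfolding kz a_def fst_conv snd_conv real_norm_def[symmetric] by (rule integral_norm_bound)
    also have "\<dots> \<le> (LINT x|lborel. indicator \<Omega> x * \<bar>\<phi> n x\<bar>)"
    proof (rule integral_mono_AE)
      show "integrable lborel (\<lambda>x. indicator \<Omega> x * \<bar>\<phi> n x\<bar>)"
        using sqint_integrable_mult[OF si sqint_norm[OF test_integrable(6)[OF \<phi>[of n]]]] by simp
      show "integrable lborel (\<lambda>x. norm (indicator (cell (1 / real (Suc k)) z) x * \<phi> n x))"
        by (rule Bochner_Integration.integrable_bound[OF integrable_norm[OF test_integrable(3)[OF \<phi>[of n]]]])
          (auto simp: indicator_def)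
      show "AE x in lborel. norm (indicator (cell (1 / real (Suc k)) z) x * \<phi> n x) \<le> indicator \<Omega> x * \<bar>\<phi> n x\<bar>"
        using test_zero_outside[OF \<phi>[of n]] by (intro AE_I2) (auto simp: indicator_def)
    qed
    also have "\<dots> \<le> V * l2 lborel (\<phi> n)"
      using l2_Cauchy_Schwarz_mult[OF si sqint_norm[OF test_integrable(6)[OF \<phi>[of n]]]]
      by (simp add: V_def l2_def)
    also have "\<dots> \<le> V * M" using M(1) by (intro mult_left_mono) (auto simp: V_def)
    finally show ?thesis .
  qed
  obtain r where r: "strict_mono r" "\<And>kz. \<exists>L. (\<lambda>n. a (r n) kz) \<longlonglongrightarrow> L"
    using bounded_functions_convergent_subseq[of a "V * M", OF bound] by blast
  then have "\<forall>kz. \<exists>L. (\<lambda>n. a (r n) kz) \<longlonglongrightarrow> L" by simp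
  from choice[OF this] obtain L where L: "\<And>kz. (\<lambda>n. a (r n) kz) \<longlonglongrightarrow> L kz" by blast
  show thesis
  proof (rule that[OF r(1)])
    fix e :: real assume e: "e > 0"
    \<comment> \<open>The mesh is chosen so that the gradient term
      \<open>128 * l\<^sup>2 * (2 * M)\<^sup>2\<close> takes at most half of
      \<open>e\<^sup>2\<close>.\<close>
    obtain k where "16 * (2 * M + 1) / e < real k" using reals_Archimedean2 by blast
    then have k: "16 * (2 * M + 1) / e < real (Suc k)" by simp
    define l where "l = 1 / real (Suc k)"
    have l: "l > 0" by (simp add: l_def)
    have "16 * (2 * M + 1) * l < e"
      using k e by (simp add: l_def field_simps del: of_nat_Suc)
    then have "(16 * (2 * M + 1) * l)\<^sup>2 < e\<^sup>2" using l M0 by (intro power_strict_mono) auto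
    moreover have "(2 * M)\<^sup>2 \<le> (2 * M + 1)\<^sup>2" using M0 by (intro power_mono) auto
    then have "l\<^sup>2 * (2 * M)\<^sup>2 \<le> l\<^sup>2 * (2 * M + 1)\<^sup>2" by (intro mult_left_mono) auto
    moreover have "(16 * (2 * M + 1) * l)\<^sup>2 = 256 * (l\<^sup>2 * (2 * M + 1)\<^sup>2)"
      unfolding power_mult_distrib by simp
    moreover have "128 * l\<^sup>2 * (2 * M)\<^sup>2 = 128 * (l\<^sup>2 * (2 * M)\<^sup>2)" by (rule mult.assoc)
    ultimately have small: "128 * l\<^sup>2 * (2 * M)\<^sup>2 \<le> e\<^sup>2 / 2" by linarith
    obtain Z where Z: "finite Z" "\<Omega> \<subseteq> (\<Union>z\<in>Z. cell l z)" using finite_cell_cover[OF assms(2) l] .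
    define b where "b n = (\<Sum>z\<in>Z. (a (r n) (k, z) - L (k, z))\<^sup>2)" for n
    have "b \<longlonglongrightarrow> (\<Sum>z\<in>Z. (L (k, z) - L (k, z))\<^sup>2)"
      unfolding b_def by (intro tendsto_intros L)
    then have "b \<longlonglongrightarrow> 0" by simp
    \<comment> \<open>Two such errors, each doubled and divided by \<open>l ^ 4\<close>, use up the
      other half of \<open>e\<^sup>2\<close>.\<close>
    moreover have "e\<^sup>2 * l ^ 4 / 8 > 0" using e l by simp
    ultimately obtain N where "\<forall>n\<ge>N. norm (b n - 0) < e\<^sup>2 * l ^ 4 / 8"
      using LIMSEQ_D by blast
    then have N: "b n < e\<^sup>2 * l ^ 4 / 8" if "n \<ge> N" for n
      using that by (auto simp: abs_less_iff)
    have "l2 lborel (\<lambda>x. \<phi> (r m) x - \<phi> (r n) x) < e" if mn: "m \<ge> N" "n \<ge> N" for m n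
    proof -
      let ?w = "\<lambda>x. \<phi> (r m) x - \<phi> (r n) x"
      have w: "?w \<in> test_functions \<Omega>" by (intro test_diff \<phi>)
      have ii: "integrable lborel (\<lambda>x. indicator (cell l z) x * \<phi> j x)" for j z
      proof (rule Bochner_Integration.integrable_bound[OF test_integrable(3)[OF \<phi>[of j]]])
        have [measurable]: "\<phi> j \<in> borel_measurable borel" using test_integrable(2)[OF \<phi>] .
        show "(\<lambda>x. indicator (cell l z) x * \<phi> j x) \<in> borel_measurable lborel" by measurable
      qed (auto simp: indicator_def)
      have "(\<Sum>z\<in>Z. (LINT x|lborel. indicator (cell l z) x * ?w x)\<^sup>2) \<le> 2 * b m + 2 * b n"
      proof -
        have "(LINT x|lborel. indicator (cell l z) x * ?w x)\<^sup>2
          \<le> 2 * (a (r m) (k, z) - L (k, z))\<^sup>2 + 2 * (a (r n) (k, z) - L (k, z))\<^sup>2" for z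
        proof -
          have eq: "(LINT x|lborel. indicator (cell l z) x * ?w x) = a (r m) (k, z) - a (r n) (k, z)"
            using ii unfolding a_def fst_conv snd_conv l_def[symmetric] by (simp add: right_diff_distrib)
          have "(x - y)\<^sup>2 \<le> 2 * (x - L0)\<^sup>2 + 2 * (y - L0)\<^sup>2" for x y L0 :: real
          proof -
            have "0 \<le> ((x - L0) + (y - L0))\<^sup>2" by simp
            then show ?thesis by (simp add: power2_eq_square algebra_simps)
          qed
          then show ?thesis unfolding eq .
        qed
        then have "(\<Sum>z\<in>Z. (LINT x|lborel. indicator (cell l z) x * ?w x)\<^sup>2)
          \<le> (\<Sum>z\<in>Z. 2 * (a (r m) (k, z) - L (k, z))\<^sup>2 + 2 * (a (r n) (k, z) - L (k, z))\<^sup>2)"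
          by (rule sum_mono)
        also have "\<dots> = 2 * b m + 2 * b n"
          unfolding b_def sum.distrib sum_distrib_left ..
        finally show ?thesis .
      qed
      also have "\<dots> < e\<^sup>2 / 2 * l ^ 4" using N[OF mn(1)] N[OF mn(2)] by simp
      finally have A: "(\<Sum>z\<in>Z. (LINT x|lborel. indicator (cell l z) x * ?w x)\<^sup>2) / l ^ 4 < e\<^sup>2 / 2"
        using l by (simp add: divide_less_eq)
      have "l2 lborel (grad ?w) \<le> 2 * M"
      proof -
        have g: "grad ?w = (\<lambda>x. grad (\<phi> (r m)) x - grad (\<phi> (r n)) x)"
          by (intro ext grad_diff test_smooth[OF \<phi>])
        have "l2 lborel (grad ?w) \<le> l2 lborel (grad (\<phi> (r m))) + l2 lborel (grad (\<phi> (r n)))"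
          unfolding g using l2_triangle_diff[OF test_integrable(7)[OF \<phi>[of "r m"]] sqint_zero test_integrable(7)[OF \<phi>[of "r n"]]]
          by simp
        then show ?thesis using M(2)[of "r m"] M(2)[of "r n"] by linarith
      qed
      then have "(l2 lborel (grad ?w))\<^sup>2 \<le> (2 * M)\<^sup>2" by (rule power_mono) simp
      then have "128 * l\<^sup>2 * (l2 lborel (grad ?w))\<^sup>2 \<le> 128 * l\<^sup>2 * (2 * M)\<^sup>2" by (intro mult_left_mono) auto
      then have "(l2 lborel ?w)\<^sup>2 < e\<^sup>2"
        using grid_Poincare[OF w l Z] A small by linarith
      then show ?thesis using e by (simp add: power2_less_imp_less)
    qed
    then show "\<exists>N. \<forall>m\<ge>N. \<forall>n\<ge>N. l2 lborel (\<lambda>x. \<phi> (r m) x - \<phi> (r n) x) < e" by blast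
  qed
qed

section \<open>The Laplacian and weak limits of gradients\<close>

definition lap :: "('a::euclidean_space \<Rightarrow> real) \<Rightarrow> 'a \<Rightarrow> real" where
  "lap \<psi> x = (\<Sum>i\<in>Basis. grad (\<lambda>x. grad \<psi> x \<bullet> i) x \<bullet> i)"

lemma test_sum:
  assumes "finite I" "\<And>i. i \<in> I \<Longrightarrow> f i \<in> test_functions \<Omega>"
  shows "(\<lambda>x. \<Sum>i\<in>I. f i x) \<in> test_functions \<Omega>"
  using assms by (induction I rule: finite_induct) (auto intro: test_add test_zero)

lemma test_lap: "\<psi> \<in> test_functions \<Omega> \<Longrightarrow> lap \<psi> \<in> test_functions \<Omega>"
  unfolding lap_def[abs_def] by (intro test_sum test_grad_inner) auto

text \<open>Each partial derivative of a test function is again a test function, so the defining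
  identity of the weak gradient applies to it, component by component.\<close>

lemma weak_gradient_lap:
  assumes "open \<Omega>" "has_weak_gradient \<Omega> u G" "sqint (lebesgue_on \<Omega>) u" "sqint (lebesgue_on \<Omega>) G"
    and \<psi>: "\<psi> \<in> test_functions \<Omega>"
  shows "(LINT x|lebesgue_on \<Omega>. G x \<bullet> grad \<psi> x) = - (LINT x|lebesgue_on \<Omega>. u x * lap \<psi> x)"
proof -
  let ?M = "lebesgue_on \<Omega>"
  have t: "(\<lambda>x. grad \<psi> x \<bullet> i) \<in> test_functions \<Omega>" for i by (rule test_grad_inner[OF \<psi>])
  have t2: "(\<lambda>x. grad (\<lambda>x. grad \<psi> x \<bullet> i) x \<bullet> j) \<in> test_functions \<Omega>" for i j by (rule test_grad_inner[OF t])
  have i1: "integrable ?M (\<lambda>x. (G x \<bullet> i) * (grad \<psi> x \<bullet> i))" if "i \<in> Basis" for i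
  proof (rule sqint_integrable_mult)
    show "sqint ?M (\<lambda>x. G x \<bullet> i)"
    proof (rule sqint_dominated[OF _ sqint_integrable[OF assms(4)]])
      show "(\<lambda>x. G x \<bullet> i) \<in> borel_measurable ?M" using sqint_measurable[OF assms(4)] by measurable
      show "(norm (G x \<bullet> i))\<^sup>2 \<le> (norm (G x))\<^sup>2" for x
        using Basis_le_norm[OF that, of "G x"] by (intro power_mono) auto
    qed
  qed (rule test_sqint(1)[OF t assms(1)])
  have i2: "integrable ?M (\<lambda>x. u x * (grad (\<lambda>x. grad \<psi> x \<bullet> i) x \<bullet> i))" for i
    by (rule sqint_integrable_mult[OF assms(3) test_sqint(1)[OF t2 assms(1)]])
  have "(LINT x|?M. G x \<bullet> grad \<psi> x) = (LINT x|?M. (\<Sum>i\<in>Basis. (G x \<bullet> i) * (grad \<psi> x \<bullet> i)))"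
    by (intro Bochner_Integration.integral_cong refl euclidean_inner)
  also have "\<dots> = (\<Sum>i\<in>Basis. LINT x|?M. (G x \<bullet> i) * (grad \<psi> x \<bullet> i))"
    by (rule Bochner_Integration.integral_sum[OF i1])
  also have "\<dots> = (\<Sum>i\<in>Basis. - (LINT x|?M. u x * (grad (\<lambda>x. grad \<psi> x \<bullet> i) x \<bullet> i)))"
  proof (rule sum.cong[OF refl])
    fix i :: 'a assume i: "i \<in> Basis"
    show "(LINT x|?M. (G x \<bullet> i) * (grad \<psi> x \<bullet> i)) = - (LINT x|?M. u x * (grad (\<lambda>x. grad \<psi> x \<bullet> i) x \<bullet> i))"
      using assms(2) t[of i] i by (simp add: has_weak_gradient_def grad_inner_Basis)
  qed
  also have "\<dots> = - (LINT x|?M. (\<Sum>i\<in>Basis. u x * (grad (\<lambda>x. grad \<psi> x \<bullet> i) x \<bullet> i)))"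
    by (subst Bochner_Integration.integral_sum[OF i2]) (simp add: sum_negf)
  also have "\<dots> = - (LINT x|?M. u x * lap \<psi> x)"
    by (simp add: lap_def sum_distrib_left)
  finally show ?thesis .
qed

lemma l2_parallelogram:
  assumes "sqint M f" "sqint M g"
  shows "(l2 M (\<lambda>x. (1/2) *\<^sub>R f x + (1/2) *\<^sub>R g x))\<^sup>2 + (l2 M (\<lambda>x. f x - g x))\<^sup>2 / 4
    = (l2 M f)\<^sup>2 / 2 + (l2 M g)\<^sup>2 / 2"
proof -
  have "(l2 M (\<lambda>x. (1/2) *\<^sub>R f x + (1/2) *\<^sub>R g x))\<^sup>2 = (l2 M (\<lambda>x. (1/2) *\<^sub>R (f x + 1 *\<^sub>R g x)))\<^sup>2"
    by (simp add: scaleR_add_right)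
  also have "\<dots> = (l2 M (\<lambda>x. f x + 1 *\<^sub>R g x))\<^sup>2 / 4"
    unfolding l2_scaleR by (simp add: power_divide)
  finally have "4 * (l2 M (\<lambda>x. (1/2) *\<^sub>R f x + (1/2) *\<^sub>R g x))\<^sup>2 = (l2 M (\<lambda>x. f x + 1 *\<^sub>R g x))\<^sup>2"
    by simp
  moreover have "(l2 M (\<lambda>x. f x + 1 *\<^sub>R g x))\<^sup>2 = (l2 M f)\<^sup>2 + 2 * (LINT x|M. f x \<bullet> g x) + (l2 M g)\<^sup>2"
    using l2_sq_add[OF assms, of 1] by simp
  moreover have "(l2 M (\<lambda>x. f x - g x))\<^sup>2 = (l2 M f)\<^sup>2 - 2 * (LINT x|M. f x \<bullet> g x) + (l2 M g)\<^sup>2"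
    using l2_sq_add[OF assms, of "-1"] by simp
  ultimately show ?thesis by linarith
qed

text \<open>The weak limit is found without weak compactness: near-minimisers of
  \<open>v \<mapsto> |\<nabla>v|\<^sup>2 + k |v - u|\<^sup>2\<close> over test functions have Cauchy gradients by the parallelogram law.\<close>

lemma bounded_limit_in_W012:
  fixes u :: "'a::euclidean_space \<Rightarrow> real"
  assumes "open \<Omega>" and \<phi>: "\<And>n. \<phi> n \<in> test_functions \<Omega>"
    and M: "\<And>n. l2 (lebesgue_on \<Omega>) (grad (\<phi> n)) \<le> M"
    and u: "sqint (lebesgue_on \<Omega>) u" and lim: "(\<lambda>n. l2 (lebesgue_on \<Omega>) (\<lambda>x. \<phi> n x - u x)) \<longlonglongrightarrow> 0"
  shows "u \<in> W012 \<Omega>"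
proof -
  let ?M = "lebesgue_on \<Omega>" and ?T = "test_functions \<Omega>"
  note ts = test_sqint(1,2)[OF _ assms(1)]
  define F where "F k v = (l2 ?M (grad v))\<^sup>2 + real k * (l2 ?M (\<lambda>x. v x - u x))\<^sup>2" for k v
  define m where "m k = Inf (F k ` ?T)" for k
  have F0: "0 \<le> F k v" for k v by (simp add: F_def)
  have bdd: "bdd_below (F k ` ?T)" for k by (rule bdd_belowI[of _ 0]) (auto simp: F0)
  have ne: "F k ` ?T \<noteq> {}" for k using \<phi> by blast
  have Fmono: "F k v \<le> F j v" if "k \<le> j" for k j v
    using that by (simp add: F_def mult_right_mono)
  have m_le: "m k \<le> F k v" if "v \<in> ?T" for k v
    unfolding m_def using that by (intro cInf_lower bdd) auto
  have mmono: "m k \<le> m j" if "k \<le> j" for k j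
    unfolding m_def[of j] using Fmono[OF that] m_le[of _ k] by (intro cInf_greatest ne) (auto intro: order_trans)
  \<comment> \<open>The given sequence keeps the infimum below \<open>M\<^sup>2\<close> for every
    penalty, because its penalty term tends to 0.\<close>
  have mM: "m k \<le> M\<^sup>2" for k
  proof -
    have "(\<lambda>n. M\<^sup>2 + real k * (l2 ?M (\<lambda>x. \<phi> n x - u x))\<^sup>2) \<longlonglongrightarrow> M\<^sup>2 + real k * 0\<^sup>2"
      by (intro tendsto_intros lim)
    moreover have "m k \<le> M\<^sup>2 + real k * (l2 ?M (\<lambda>x. \<phi> n x - u x))\<^sup>2" for n
      using m_le[OF \<phi>[of n], of k] power_mono[OF M[of n], of 2] by (simp add: F_def)
    ultimately show ?thesis by (intro LIMSEQ_le_const) auto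
  qed
  have "\<exists>v\<in>?T. F k v < m k + 1 / real (Suc k)" for k
  proof -
    have "Inf (F k ` ?T) < m k + 1 / real (Suc k)" by (simp add: m_def)
    then show ?thesis using cInf_lessD[OF ne[of k]] by blast
  qed
  then obtain v where v: "\<And>k. v k \<in> ?T" "\<And>k. F k (v k) < m k + 1 / real (Suc k)" by metis
  have vlim: "(\<lambda>k. l2 ?M (\<lambda>x. v k x - u x)) \<longlonglongrightarrow> 0"
  proof -
    \<comment> \<open>The bound \<open>M\<^sup>2 + 1\<close> on the penalised functional forces
      \<open>v\<close> towards \<open>u\<close> as the penalty grows.\<close>
    have le: "(l2 ?M (\<lambda>x. v (Suc k) x - u x))\<^sup>2 \<le> (M\<^sup>2 + 1) * inverse (real (Suc k))" for k
    proof -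
      have "real (Suc k) * (l2 ?M (\<lambda>x. v (Suc k) x - u x))\<^sup>2 \<le> F (Suc k) (v (Suc k))"
        by (simp add: F_def)
      also have "\<dots> \<le> M\<^sup>2 + 1" 
      proof -
        have "1 / real (Suc (Suc k)) \<le> 1" by simp
        then show ?thesis using v(2)[of "Suc k"] mM[of "Suc k"] by linarith
      qed
      finally show ?thesis by (simp add: field_simps)
    qed
    have "(\<lambda>k. (l2 ?M (\<lambda>x. v (Suc k) x - u x))\<^sup>2) \<longlonglongrightarrow> 0"
    proof (rule Lim_null_comparison)
      show "\<forall>\<^sub>F k in sequentially. norm ((l2 ?M (\<lambda>x. v (Suc k) x - u x))\<^sup>2) \<le> (M\<^sup>2 + 1) * inverse (real (Suc k))"
        using le by simp
      show "(\<lambda>k. (M\<^sup>2 + 1) * inverse (real (Suc k))) \<longlonglongrightarrow> 0"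
        by (rule tendsto_mult_right_zero[OF LIMSEQ_inverse_real_of_nat])
    qed
    from tendsto_real_sqrt[OF this] show ?thesis
      by (subst filterlim_sequentially_Suc[symmetric]) simp
  qed
  have gcauchy: "(l2 ?M (\<lambda>x. grad (v k) x - grad (v j) x))\<^sup>2 \<le> 2 * (m j - m k) + 4 / real (Suc k)" if "k \<le> j" for k j
  proof -
    \<comment> \<open>The midpoint competes in the infimum \<open>m k\<close>; by the parallelogram
      law what it gains over the two endpoints is the distance of their gradients.\<close>
    let ?w = "\<lambda>x. (1/2) * v k x + (1/2) * v j x"
    have w: "?w \<in> ?T" by (intro test_add test_cmult v)
    have gw: "grad ?w = (\<lambda>x. (1/2) *\<^sub>R grad (v k) x + (1/2) *\<^sub>R grad (v j) x)"
    proof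
      fix x
      have "grad ?w x = grad (\<lambda>x. (1/2) * v k x) x + grad (\<lambda>x. (1/2) * v j x) x"
        by (rule grad_add[OF test_smooth[OF test_cmult[OF v(1)]] test_smooth[OF test_cmult[OF v(1)]]])
      then show "grad ?w x = (1/2) *\<^sub>R grad (v k) x + (1/2) *\<^sub>R grad (v j) x"
        by (simp only: grad_cmult[OF test_smooth[OF v(1)]])
    qed
    have p1: "(l2 ?M (grad ?w))\<^sup>2 + (l2 ?M (\<lambda>x. grad (v k) x - grad (v j) x))\<^sup>2 / 4
      = (l2 ?M (grad (v k)))\<^sup>2 / 2 + (l2 ?M (grad (v j)))\<^sup>2 / 2"
      unfolding gw by (rule l2_parallelogram[OF ts(2)[OF v(1)] ts(2)[OF v(1)]])
    have wu: "(\<lambda>x. ?w x - u x) = (\<lambda>x. (1/2) *\<^sub>R (v k x - u x) + (1/2) *\<^sub>R (v j x - u x))"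
      by (auto simp: fun_eq_iff field_simps)
    have p2: "(l2 ?M (\<lambda>x. ?w x - u x))\<^sup>2 \<le> (l2 ?M (\<lambda>x. v k x - u x))\<^sup>2 / 2 + (l2 ?M (\<lambda>x. v j x - u x))\<^sup>2 / 2"
      unfolding wu l2_parallelogram[OF sqint_diff[OF ts(1)[OF v(1)] u] sqint_diff[OF ts(1)[OF v(1)] u], symmetric]
      by simp
    have "m k \<le> F k ?w" by (rule m_le[OF w])
    also have "\<dots> \<le> F k (v k) / 2 + F k (v j) / 2 - (l2 ?M (\<lambda>x. grad (v k) x - grad (v j) x))\<^sup>2 / 4"
    proof -
      have "real k * (l2 ?M (\<lambda>x. ?w x - u x))\<^sup>2 \<le>
          real k * (l2 ?M (\<lambda>x. v k x - u x))\<^sup>2 / 2 + real k * (l2 ?M (\<lambda>x. v j x - u x))\<^sup>2 / 2"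
        using mult_left_mono[OF p2, of "real k"] by (simp only: distrib_left times_divide_eq_right of_nat_0_le_iff)
      moreover have "x1 + y1 \<le> (x2 + y2) / 2 + (x3 + y3) / 2 - z / 4"
        if "x1 + z / 4 = x2 / 2 + x3 / 2" "y1 \<le> y2 / 2 + y3 / 2" for x1 x2 x3 y1 y2 y3 z :: real
        using that by (simp add: field_simps)
      ultimately show ?thesis unfolding F_def using p1 by blast
    qed
    finally have "(l2 ?M (\<lambda>x. grad (v k) x - grad (v j) x))\<^sup>2 \<le> 2 * F k (v k) + 2 * F k (v j) - 4 * m k" by simp
    moreover have "F k (v j) \<le> m j + 1 / real (Suc k)"
    proof -
      have "1 / real (Suc j) \<le> 1 / real (Suc k)" using that by (simp add: frac_le)
      then show ?thesis using Fmono[OF that, of "v j"] v(2)[of j] by linarith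
    qed
    ultimately show ?thesis using v(2)[of k] by simp
  qed
  \<comment> \<open>\<open>m\<close> is increasing and bounded, so \<open>m j - m k\<close> is
    eventually small, and with it the distance of the gradients.\<close>
  have "convergent m"
  proof (rule Bseq_mono_convergent)
    have "0 \<le> m k" for k unfolding m_def by (intro cInf_greatest ne) (auto simp: F0)
    then show "Bseq m" using mM by (intro BseqI'[where K="M\<^sup>2"]) simp
  qed (use mmono in auto)
  then have "Cauchy m" by (rule convergent_Cauchy)
  have cau: "\<exists>N. \<forall>k\<ge>N. \<forall>j\<ge>N. l2 ?M (\<lambda>x. grad (v k) x - grad (v j) x) < e" if "e > 0" for e
  proof -
    have "e\<^sup>2 / 4 > 0" using that by simp
    from CauchyD[OF \<open>Cauchy m\<close> this]
    obtain N1 where N1: "\<And>k j. k \<ge> N1 \<Longrightarrow> j \<ge> N1 \<Longrightarrow> norm (m k - m j) < e\<^sup>2 / 4" by blast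
    obtain N2 :: nat where N2: "8 / e\<^sup>2 < real N2" using reals_Archimedean2 by blast
    have half: "l2 ?M (\<lambda>x. grad (v k) x - grad (v j) x) < e" if "k \<ge> max N1 N2" "k \<le> j" for k j
    proof -
      have "8 / e\<^sup>2 < real (Suc k)" using N2 that by simp
      then have "4 / real (Suc k) < e\<^sup>2 / 2" using \<open>e > 0\<close> by (simp add: field_simps)
      moreover have "m j - m k < e\<^sup>2 / 4"
      proof -
        have "\<bar>m j - m k\<bar> < e\<^sup>2 / 4" using N1[of j k] that by (simp only: real_norm_def)
        then show ?thesis by linarith
      qed
      ultimately have "(l2 ?M (\<lambda>x. grad (v k) x - grad (v j) x))\<^sup>2 < e\<^sup>2"
      proof -
        have "x < E" if "x \<le> 2 * y + q" "q < E / 2" "y < E / 4" for x y q E :: real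
          using that by linarith
        then show ?thesis using gcauchy[OF that(2)] \<open>4 / real (Suc k) < e\<^sup>2 / 2\<close> \<open>m j - m k < e\<^sup>2 / 4\<close> by blast
      qed
      then show ?thesis using \<open>e > 0\<close> by (simp add: power2_less_imp_less)
    qed
    have "l2 ?M (\<lambda>x. grad (v k) x - grad (v j) x) < e" if "k \<ge> max N1 N2" "j \<ge> max N1 N2" for k j
      using half[of k j] half[of j k] that l2_minus_commute[of ?M "grad (v k)" "grad (v j)"]
      by (cases "k \<le> j") auto
    then show ?thesis by blast
  qed
  obtain G where "sqint ?M G" "(\<lambda>k. l2 ?M (\<lambda>x. grad (v k) x - G x)) \<longlonglongrightarrow> 0"
    using l2_complete[of ?M "\<lambda>k. grad (v k)", OF ts(2)[OF v(1)] cau] by blast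
  then show ?thesis using W012_I(1)[OF assms(1) v(1) u _ vlim] by blast
qed

text \<open>Weak convergence is tested only against the gradient of \<open>u\<close> itself. That
  gradient is replaced by one of a test function, at a uniform cost thanks to the bound
  \<open>M\<close>; then the Laplacian takes the derivatives off \<open>\<phi> n\<close>, which
  converges strongly.\<close>

lemma weak_convergence_of_gradients:
  fixes u :: "'a::euclidean_space \<Rightarrow> real"
  assumes "open \<Omega>" and \<phi>: "\<And>n. \<phi> n \<in> test_functions \<Omega>"
    and M: "\<And>n. l2 (lebesgue_on \<Omega>) (grad (\<phi> n)) \<le> M"
    and u: "u \<in> W012 \<Omega>" and lim: "(\<lambda>n. l2 (lebesgue_on \<Omega>) (\<lambda>x. \<phi> n x - u x)) \<longlonglongrightarrow> 0"
  shows "(\<lambda>n. LINT x|lebesgue_on \<Omega>. grad (\<phi> n) x \<bullet> wgrad \<Omega> u x) \<longlonglongrightarrow> (Dnorm \<Omega> u)\<^sup>2"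
proof (rule LIMSEQ_I)
  let ?M = "lebesgue_on \<Omega>" and ?G = "wgrad \<Omega> u"
  note ts = test_sqint(1,2)[OF _ assms(1)]
  note U = W012_D(1,2,3)[OF assms(1) u]
  have M0: "M \<ge> 0" using order_trans[OF l2_nonneg M[of 0]] .
  fix e :: real assume e: "e > 0"
  obtain \<psi> where \<psi>: "\<And>k. \<psi> k \<in> test_functions \<Omega>" "(\<lambda>k. l2 ?M (\<lambda>x. grad (\<psi> k) x - ?G x)) \<longlonglongrightarrow> 0"
    using W012_D(4)[OF assms(1) u] by blast
  define D where "D = Dnorm \<Omega> u"
  have D0: "D \<ge> 0" by (simp add: D_def)
  have Dl: "D = l2 ?M ?G" by (simp add: D_def Dnorm_def Lnorm_2)
  \<comment> \<open>Both replacement errors together are at most \<open>M + D\<close> times this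
    distance, hence at most \<open>e / 2\<close>.\<close>
  obtain k where k: "l2 ?M (\<lambda>x. grad (\<psi> k) x - ?G x) < e / (2 * (M + D + 1))"
    using LIMSEQ_D[OF \<psi>(2), of "e / (2 * (M + D + 1))"] e M0 D0 by fastforce
  let ?g = "grad (\<psi> k)"
  have "(\<lambda>n. - (LINT x|?M. \<phi> n x \<bullet> lap (\<psi> k) x)) \<longlonglongrightarrow> - (LINT x|?M. u x \<bullet> lap (\<psi> k) x)"
    by (intro tendsto_minus l2_inner_tendsto[OF ts(1)[OF \<phi>] U(1) ts(1)[OF test_lap[OF \<psi>(1)]] lim])
  moreover have "(LINT x|?M. grad (\<phi> n) x \<bullet> ?g x) = - (LINT x|?M. \<phi> n x \<bullet> lap (\<psi> k) x)" for n
    using weak_gradient_lap[OF assms(1) has_weak_gradient_test[OF \<phi> assms(1)] ts(1)[OF \<phi>] ts(2)[OF \<phi>] \<psi>(1)] by simp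
  moreover have "(LINT x|?M. ?G x \<bullet> ?g x) = - (LINT x|?M. u x \<bullet> lap (\<psi> k) x)"
    using weak_gradient_lap[OF assms(1) U(3,1,2) \<psi>(1)] by simp
  ultimately have "(\<lambda>n. LINT x|?M. grad (\<phi> n) x \<bullet> ?g x) \<longlonglongrightarrow> (LINT x|?M. ?G x \<bullet> ?g x)" by simp
  from LIMSEQ_D[OF this, of "e/2"] e obtain N where
    N: "\<And>n. n \<ge> N \<Longrightarrow> norm ((LINT x|?M. grad (\<phi> n) x \<bullet> ?g x) - (LINT x|?M. ?G x \<bullet> ?g x)) < e / 2" by auto
  have "norm ((LINT x|?M. grad (\<phi> n) x \<bullet> ?G x) - D\<^sup>2) < e" if "n \<ge> N" for n
  proof -
    let ?d = "\<lambda>x. ?g x - ?G x"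
    have sd: "sqint ?M ?d" by (rule sqint_diff[OF ts(2)[OF \<psi>(1)] U(2)])
    have split: "(LINT x|?M. H x \<bullet> ?g x) = (LINT x|?M. H x \<bullet> ?G x) + (LINT x|?M. H x \<bullet> ?d x)" if "sqint ?M H" for H
      using sqint_integrable_inner[OF that sd] sqint_integrable_inner[OF that U(2)]
      by (simp add: inner_diff_right flip: Bochner_Integration.integral_add)
    have DD: "(LINT x|?M. ?G x \<bullet> ?G x) = D\<^sup>2"
      unfolding Dl l2_sq by (simp add: power2_norm_eq_inner)
    have "\<bar>LINT x|?M. grad (\<phi> n) x \<bullet> ?d x\<bar> \<le> M * l2 ?M ?d"
      using l2_Cauchy_Schwarz[OF ts(2)[OF \<phi>[of n]] sd] mult_right_mono[OF M[of n] l2_nonneg[of ?M ?d]] by linarith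
    moreover have "\<bar>LINT x|?M. ?G x \<bullet> ?d x\<bar> \<le> D * l2 ?M ?d"
      using l2_Cauchy_Schwarz[OF U(2) sd] by (simp add: Dl)
    moreover have "M * l2 ?M ?d + D * l2 ?M ?d \<le> e / 2"
    proof -
      have "(M + D + 1) * l2 ?M ?d \<le> (M + D + 1) * (e / (2 * (M + D + 1)))"
        using k M0 D0 by (intro mult_left_mono) auto
      also have "(M + D + 1) * (e / (2 * (M + D + 1))) = e / 2" using M0 D0 by (simp add: field_simps)
      also have "(M + D + 1) * l2 ?M ?d = M * l2 ?M ?d + D * l2 ?M ?d + l2 ?M ?d"
        by (simp add: algebra_simps)
      finally show ?thesis using l2_nonneg[of ?M ?d] by linarith
    qed
    ultimately show ?thesis
      using N[OF that] split[OF ts(2)[OF \<phi>[of n]]] split[OF U(2)] DD unfolding real_norm_def by linarith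
  qed
  then show "\<exists>N. \<forall>n\<ge>N. norm ((LINT x|?M. grad (\<phi> n) x \<bullet> ?G x) - (Dnorm \<Omega> u)\<^sup>2) < e"
    unfolding D_def by blast
qed

subsection \<open>Minimization of the energy\<close>

lemma powr_le_one_plus:
  fixes t q :: real
  assumes "0 \<le> q" "q \<le> 4"
  shows "\<bar>t\<bar> powr q \<le> 1 + t ^ 4"
proof (cases "\<bar>t\<bar> \<le> 1")
  case True
  have "\<bar>t\<bar> powr q \<le> 1 powr q" using True assms by (intro powr_mono2) auto
  then show ?thesis by (simp add: add_increasing2)
next
  case False
  then have "\<bar>t\<bar> powr q \<le> \<bar>t\<bar> powr 4" using assms by (intro powr_mono) auto
  also have "\<dots> = t ^ 4" using False by (simp add: powr_numeral)
  finally show ?thesis by simp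
qed

lemma powr_le_epsilon_quartic:
  fixes p c e :: real
  assumes "0 < p" "p < 4" "c > 0" "e > 0"
  shows "\<exists>C\<ge>0. \<forall>t. c * \<bar>t\<bar> powr p \<le> e * t ^ 4 + C"
proof -
  \<comment> \<open>At \<open>\<bar>t\<bar> = T\<close> the values
    \<open>c * \<bar>t\<bar> powr p\<close> and \<open>e * t ^ 4\<close> coincide; beyond it the
    quartic dominates.\<close>
  define T where "T = (c / e) powr (1 / (4 - p))"
  have T: "T > 0" using assms by (simp add: T_def)
  have Tp: "T powr (4 - p) = c / e" using assms by (simp add: T_def powr_powr)
  have "c * \<bar>t\<bar> powr p \<le> e * t ^ 4 + c * T powr p" for t
  proof (cases "\<bar>t\<bar> \<le> T")
    case True
    then have "c * \<bar>t\<bar> powr p \<le> c * T powr p" using assms by (intro mult_left_mono powr_mono2) auto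
    then show ?thesis using assms by (simp add: add_increasing)
  next
    case False
    then have t: "\<bar>t\<bar> > 0" using T by linarith
    have "c / e \<le> \<bar>t\<bar> powr (4 - p)"
      unfolding Tp[symmetric] using False T assms by (intro powr_mono2) auto
    then have "c \<le> e * \<bar>t\<bar> powr (4 - p)" using assms by (simp add: field_simps)
    then have "c * \<bar>t\<bar> powr p \<le> e * \<bar>t\<bar> powr (4 - p) * \<bar>t\<bar> powr p" by (rule mult_right_mono) simp
    also have "\<dots> = e * \<bar>t\<bar> powr 4" by (simp add: mult.assoc flip: powr_add)
    also have "\<bar>t\<bar> powr 4 = t ^ 4" using t by (simp add: powr_numeral)
    finally show ?thesis using assms by (simp add: add_increasing2)
  qed
  then show ?thesis using assms by (intro exI[of _ "c * T powr p"]) auto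
qed

text \<open>A weighted inequality for the square of a sum, applied twice. The coefficient of
  \<open>w ^ 4\<close> can be brought as close to 1 as desired, at the price of a large one for
  \<open>u ^ 4\<close>.\<close>

lemma quartic_sum_bound:
  fixes w u h :: real
  assumes "h > 0"
  shows "(w + u) ^ 4 \<le> (1 + h) ^ 3 * w ^ 4 + (1 + 1 / h) ^ 3 * u ^ 4"
proof -
  have *: "(x + y)\<^sup>2 \<le> (1 + h) * x\<^sup>2 + (1 + 1 / h) * y\<^sup>2" for x y :: real
  proof -
    have "0 \<le> (h * x - y)\<^sup>2 / h" using assms by simp
    also have "\<dots> = h * x\<^sup>2 - 2 * x * y + y\<^sup>2 / h"
      using assms by (simp add: power2_eq_square field_simps)
    finally show ?thesis by (simp add: power2_eq_square algebra_simps)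
  qed
  have "(w + u) ^ 4 = ((w + u)\<^sup>2)\<^sup>2" by simp
  also have "\<dots> \<le> ((1 + h) * w\<^sup>2 + (1 + 1 / h) * u\<^sup>2)\<^sup>2"
    by (intro power_mono *) simp
  also have "\<dots> \<le> (1 + h) * ((1 + h) * w\<^sup>2)\<^sup>2 + (1 + 1 / h) * ((1 + 1 / h) * u\<^sup>2)\<^sup>2"
    by (rule *)
  also have "\<dots> = (1 + h) ^ 3 * w ^ 4 + (1 + 1 / h) ^ 3 * u ^ 4"
    by (simp add: power_mult_distrib power3_eq_cube power2_eq_square[of "1 + h"] power2_eq_square[of "1 + 1 / h"] mult.assoc)
  finally show ?thesis .
qed

section \<open>The functional, its growth and its minimum\<close>

locale critical_kirchhoff =
  fixes \<Omega> :: "(real^4) set" and a b p :: real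
  assumes open_domain: "open \<Omega>" and bounded_domain: "bounded \<Omega>" and nonempty_domain: "\<Omega> \<noteq> {}"
    and a_pos: "a > 0" and p_gt: "2 < p" and p_lt: "p < 4" and b_large: "b > 1 / (Sobolev_const \<Omega>)\<^sup>2"
begin

abbreviation "M \<equiv> lebesgue_on \<Omega>"
abbreviation "S \<equiv> Sobolev_const \<Omega>"
abbreviation "D \<equiv> Dnorm \<Omega>"

definition X :: "(real^4 \<Rightarrow> real) \<Rightarrow> real" where "X u = (LINT x|M. u x ^ 4)"
definition P :: "real \<Rightarrow> (real^4 \<Rightarrow> real) \<Rightarrow> real" where "P q u = (LINT x|M. \<bar>u x\<bar> powr q)"
definition vol :: real where "vol = measure M (space M)"

lemma b_pos: "b > 0"
  using b_large by (meson divide_nonneg_nonneg le_less_trans zero_le_one zero_le_power2)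

lemma S_pos: "S > 0"
  by (rule Sobolev_const_facts(1)[OF open_domain nonempty_domain])

lemma X_le: "u \<in> W012 \<Omega> \<Longrightarrow> X u \<le> D u ^ 4 / S\<^sup>2"
  unfolding X_def by (rule Sobolev_const_facts(2)[OF open_domain nonempty_domain])

lemma X_nonneg [simp]: "0 \<le> X u"
  unfolding X_def by (intro integral_nonneg_AE) auto

lemma P_nonneg [simp]: "0 \<le> P q u"
  unfolding P_def by (intro integral_nonneg_AE) auto

sublocale fm: finite_measure M
  by (intro finite_measure_lebesgue_on lmeasurable_open bounded_domain open_domain)

lemma vol_nonneg [simp]: "0 \<le> vol" by (simp add: vol_def)

lemma W012_measurable: "u \<in> W012 \<Omega> \<Longrightarrow> u \<in> borel_measurable M"
  using sqint_measurable[OF W012_D(1)[OF open_domain]] .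

lemma X_integrable: "u \<in> W012 \<Omega> \<Longrightarrow> integrable M (\<lambda>x. u x ^ 4)"
  by (rule W012_L4_bound(1)[OF open_domain])

lemma P_integrable_of_X:
  fixes u :: "real^4 \<Rightarrow> real"
  assumes "u \<in> borel_measurable M" "integrable M (\<lambda>x. u x ^ 4)" "0 \<le> q" "q \<le> 4"
  shows "integrable M (\<lambda>x. \<bar>u x\<bar> powr q)"
proof (rule Bochner_Integration.integrable_bound)
  show "integrable M (\<lambda>x. 1 + u x ^ 4)" using assms by auto
  show "(\<lambda>x. \<bar>u x\<bar> powr q) \<in> borel_measurable M"
    by (rule measurable_abs_powr[OF assms(1)])
  show "AE x in M. norm (\<bar>u x\<bar> powr q) \<le> norm (1 + u x ^ 4)"
    using powr_le_one_plus[OF assms(3,4)] by (intro AE_I2) (simp add: abs_of_nonneg)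
qed

lemma P_integrable: "u \<in> W012 \<Omega> \<Longrightarrow> 0 \<le> q \<Longrightarrow> q \<le> 4 \<Longrightarrow> integrable M (\<lambda>x. \<bar>u x\<bar> powr q)"
  using P_integrable_of_X W012_measurable X_integrable by blast

lemma Lnorm_powr: "q > 0 \<Longrightarrow> Lnorm \<Omega> q u powr q = P q u"
proof -
  assume q: "q > 0"
  have "0 \<le> (LINT x|M. \<bar>u x\<bar> powr q)" by (intro integral_nonneg_AE) auto
  then show ?thesis using q by (simp add: Lnorm_def P_def powr_powr)
qed

lemma Lnorm_4: "Lnorm \<Omega> 4 u ^ 4 = X u"
proof -
  have "Lnorm \<Omega> 4 u ^ 4 = Lnorm \<Omega> 4 u powr 4"
    by (subst powr_numeral) (auto simp: Lnorm_def)
  also have "\<dots> = P 4 u" by (rule Lnorm_powr) simp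
  also have "\<dots> = X u" unfolding P_def X_def
    by (intro Bochner_Integration.integral_cong refl) (simp add: powr_numeral)
  finally show ?thesis .
qed

lemma energy_eq:
  "energy \<Omega> a b p lam u = a / 2 * D u ^ 2 + b / 4 * D u ^ 4 - X u / 4 - lam / p * P p u"
  using p_gt by (simp add: energy_def Lnorm_4 Lnorm_powr)

lemma test_D: "\<phi> \<in> test_functions \<Omega> \<Longrightarrow> D \<phi> = l2 M (grad \<phi>)"
proof -
  assume \<phi>: "\<phi> \<in> test_functions \<Omega>"
  show ?thesis unfolding Dnorm_def Lnorm_2
    by (intro l2_cong_AE sqint_measurable test_sqint(2)[OF \<phi> open_domain]
        W012_D(2)[OF open_domain] test_W012[OF open_domain \<phi>])
qed

lemmas test_W = test_W012(1)[OF open_domain]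

lemma kappa_exists:
  obtains h where "h > 0" "(1 + h) ^ 3 / S\<^sup>2 \<le> b"
proof -
  have S2: "S\<^sup>2 > 0" using S_pos by simp
  have "b * S\<^sup>2 > 1" using b_large S2 by (simp add: field_simps)
  \<comment> \<open>For \<open>0 < h \<le> 1\<close> one has
    \<open>(1 + h) ^ 3 \<le> 1 + 7 * h\<close>.\<close>
  define h where "h = min 1 ((b * S\<^sup>2 - 1) / 7)"
  have h: "h > 0" "h \<le> 1" using \<open>b * S\<^sup>2 > 1\<close> by (auto simp: h_def)
  have "h \<le> (b * S\<^sup>2 - 1) / 7" unfolding h_def by (rule min.cobounded2)
  note h = h this
  have "h * h \<le> h" "h * h * h \<le> h" using h by (simp_all add: mult_le_one mult_left_le_one_le)
  moreover have "(1 + h) ^ 3 = 1 + 3 * h + 3 * (h * h) + h * h * h"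
    by (simp add: power3_eq_cube algebra_simps)
  moreover have "x \<le> B" if "q \<le> h" "r \<le> h" "x = 1 + 3 * h + 3 * q + r" "h \<le> (B - 1) / 7" for x B q r :: real
    using that by (simp add: field_simps)
  ultimately have "(1 + h) ^ 3 \<le> b * S\<^sup>2" using h(3) by blast
  then show thesis using that h S2 by (simp add: field_simps)
qed

lemma integral_growth:
  assumes "u \<in> W012 \<Omega>" and "\<forall>t. c * \<bar>t\<bar> powr p \<le> e * t ^ 4 + C"
  shows "c * P p u \<le> e * X u + C * vol"
proof -
  have "c * P p u = (LINT x|M. c * \<bar>u x\<bar> powr p)" by (simp add: P_def)
  also have "\<dots> \<le> (LINT x|M. e * u x ^ 4 + C)"
  proof (rule integral_mono)
    show "integrable M (\<lambda>x. c * \<bar>u x\<bar> powr p)" "integrable M (\<lambda>x. e * u x ^ 4 + C)"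
      using P_integrable[OF assms(1), of p] X_integrable[OF assms(1)] p_gt p_lt by simp_all
  qed (use assms(2) in blast)
  also have "\<dots> = e * X u + C * vol"
    using X_integrable[OF assms(1)] by (simp add: X_def vol_def)
  finally show ?thesis .
qed

lemma energy_coercive:
  assumes "lam > 0"
  obtains C where "\<And>u. u \<in> W012 \<Omega> \<Longrightarrow> a / 2 * D u ^ 2 \<le> energy \<Omega> a b p lam u + C"
proof -
  have S2: "S\<^sup>2 > 0" using S_pos by simp
  \<comment> \<open>This value makes \<open>(1 / 4 + e) / S\<^sup>2 = b / 4\<close>: the nonlocal
    term is spent entirely on the quartic integrals, and the quadratic term is left for
    coercivity.\<close>
  define e where "e = (b * S\<^sup>2 - 1) / 4"
  have e: "e > 0" using b_large S2 by (simp add: e_def field_simps)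
  obtain C where C: "\<forall>t. (lam / p) * \<bar>t\<bar> powr p \<le> e * t ^ 4 + C"
    using powr_le_epsilon_quartic[of p "lam / p" e] assms p_gt p_lt e by auto
  have "a / 2 * D u ^ 2 \<le> energy \<Omega> a b p lam u + C * vol" if u: "u \<in> W012 \<Omega>" for u
  proof -
    have "lam / p * P p u \<le> e * X u + C * vol" by (rule integral_growth[OF u C])
    moreover have "(1 / 4 + e) * X u \<le> (1 / 4 + e) * (D u ^ 4 / S\<^sup>2)"
      using X_le[OF u] e by (intro mult_left_mono) auto
    moreover have "(1 / 4 + e) * (D u ^ 4 / S\<^sup>2) = b / 4 * D u ^ 4"
      using S2 by (simp add: e_def field_simps)
    moreover have "(1 / 4 + e) * X u = X u / 4 + e * X u" by (simp add: distrib_right)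
    moreover have "d \<le> d + q - x / 4 - l + c"
      if "l \<le> ex + c" "k \<le> k'" "k' = q" "k = x / 4 + ex" for d q x l c ex k k' :: real
      using that by linarith
    ultimately show ?thesis unfolding energy_eq by blast
  qed
  then show thesis by (rule that)
qed

text \<open>On \<open>t \<ge> 0\<close> this is the primitive of the right-hand side of the
  equation. For \<open>lam > 0\<close> it is nonnegative, so Fatou's lemma applies to it.\<close>

definition Nl :: "real \<Rightarrow> real \<Rightarrow> real" where "Nl lam t = t ^ 4 / 4 + lam / p * \<bar>t\<bar> powr p"

lemma Nl_integrable: "u \<in> W012 \<Omega> \<Longrightarrow> integrable M (\<lambda>x. Nl lam (u x))"
  unfolding Nl_def using p_gt p_lt
  by (intro Bochner_Integration.integrable_add integrable_divide integrable_mult_right X_integrable P_integrable) auto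

lemma Nl_integral: "u \<in> W012 \<Omega> \<Longrightarrow> (LINT x|M. Nl lam (u x)) = X u / 4 + lam / p * P p u"
proof -
  assume u: "u \<in> W012 \<Omega>"
  have "integrable M (\<lambda>x. u x ^ 4 / 4)" "integrable M (\<lambda>x. lam / p * \<bar>u x\<bar> powr p)"
    using p_gt p_lt by (intro integrable_divide integrable_mult_right X_integrable P_integrable u; simp)+
  from Bochner_Integration.integral_add[OF this] show ?thesis
    unfolding Nl_def X_def P_def by simp
qed

lemma Nl_nonneg: "lam > 0 \<Longrightarrow> 0 \<le> Nl lam t"
  using p_gt by (simp add: Nl_def)

lemma powr_abs_tendsto: "f \<longlonglongrightarrow> (t::real) \<Longrightarrow> q > 0 \<Longrightarrow> (\<lambda>n. \<bar>f n\<bar> powr q) \<longlonglongrightarrow> \<bar>t\<bar> powr q"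
  by (rule tendsto_powr2) (auto intro!: tendsto_intros always_eventually)

lemma Nl_tendsto: "f \<longlonglongrightarrow> t \<Longrightarrow> (\<lambda>n. Nl lam (f n)) \<longlonglongrightarrow> Nl lam t"
  unfolding Nl_def using p_gt by (intro tendsto_intros powr_abs_tendsto) auto

lemma energy_Nl: "u \<in> W012 \<Omega> \<Longrightarrow>
    energy \<Omega> a b p lam u = a / 2 * D u ^ 2 + b / 4 * D u ^ 4 - (LINT x|M. Nl lam (u x))"
  by (simp add: energy_eq Nl_integral)

text \<open>Along test functions converging with their gradients the \<open>D\<close>-terms
  converge, and for the subtracted \<open>Nl\<close>-term the inequality of Fatou's lemma points the
  right way. So test functions already see the infimum over \<open>W012\<close>.\<close>

lemma energy_lower_from_tests:
  assumes lam: "lam > 0" and m: "\<And>\<phi>. \<phi> \<in> test_functions \<Omega> \<Longrightarrow> m \<le> energy \<Omega> a b p lam \<phi>" and v: "v \<in> W012 \<Omega>"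
  shows "m \<le> energy \<Omega> a b p lam v"
proof -
  obtain \<phi> where \<phi>: "\<And>n. \<phi> n \<in> test_functions \<Omega>" "(\<lambda>n. l2 M (\<lambda>x. \<phi> n x - v x)) \<longlonglongrightarrow> 0"
    "(\<lambda>n. l2 M (\<lambda>x. grad (\<phi> n) x - wgrad \<Omega> v x)) \<longlonglongrightarrow> 0"
    using W012_D(4)[OF open_domain v] by blast
  note V = W012_D(1,2)[OF open_domain v]
  obtain r where r: "strict_mono r" "AE x in M. (\<lambda>k. \<phi> (r k) x) \<longlonglongrightarrow> v x"
    using l2_AE_subseq[OF test_sqint(1)[OF \<phi>(1) open_domain] V(1) \<phi>(2)] by blast
  have "(\<lambda>n. l2 M (grad (\<phi> n))) \<longlonglongrightarrow> D v"
    unfolding Dnorm_def Lnorm_2 by (rule l2_tendsto[OF test_sqint(2)[OF \<phi>(1) open_domain] V(2) \<phi>(3)])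
  then have "(\<lambda>n. D (\<phi> n)) \<longlonglongrightarrow> D v" by (simp add: test_D[OF \<phi>(1)])
  from LIMSEQ_subseq_LIMSEQ[OF this r(1)] have Dlim: "(\<lambda>k. D (\<phi> (r k))) \<longlonglongrightarrow> D v" by (simp add: o_def)
  have le: "(LINT x|M. Nl lam (\<phi> (r k) x)) \<le> a / 2 * D (\<phi> (r k)) ^ 2 + b / 4 * D (\<phi> (r k)) ^ 4 - m" for k
    using m[OF \<phi>(1)[of "r k"]] energy_Nl[OF test_W[OF \<phi>(1)[of "r k"]], of lam] by simp
  have B: "(\<lambda>k. a / 2 * D (\<phi> (r k)) ^ 2 + b / 4 * D (\<phi> (r k)) ^ 4 - m) \<longlonglongrightarrow> a / 2 * D v ^ 2 + b / 4 * D v ^ 4 - m"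
    by (intro tendsto_intros Dlim)
  have ae: "AE x in M. (\<lambda>k. Nl lam (\<phi> (r k) x)) \<longlonglongrightarrow> Nl lam (v x)"
    using r(2) by eventually_elim (rule Nl_tendsto)
  have "(LINT x|M. Nl lam (v x)) \<le> a / 2 * D v ^ 2 + b / 4 * D v ^ 4 - m"
    using Fatou_real(2)[OF Nl_integrable[OF test_W[OF \<phi>(1)]] borel_measurable_integrable[OF Nl_integrable[OF v]] _ ae le B]
      Nl_nonneg[OF lam] by auto
  then show ?thesis using energy_Nl[OF v, of lam] by simp
qed

text \<open>A smooth substitute for the absolute value. Subtracting \<open>e\<close> restores
  compact support, and the gradient is \<open>grad \<phi> x\<close> times
  \<open>\<phi> x / sqrt ((\<phi> x)\<^sup>2 + e\<^sup>2)\<close>, a factor of modulus at most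
  1.\<close>

lemma smooth_abs_test:
  assumes "\<phi> \<in> test_functions \<Omega>" "e > 0"
  defines "\<psi> \<equiv> \<lambda>x. ((\<phi> x)\<^sup>2 + e\<^sup>2) powr (1/2) - e"
  shows "\<psi> \<in> test_functions \<Omega>" "0 \<le> \<psi> x" "norm (grad \<psi> x) \<le> norm (grad \<phi> x)"
proof -
  note sm = test_smooth[OF assms(1)]
  have pos: "(\<phi> x)\<^sup>2 + e\<^sup>2 > 0" for x using assms(2) by (simp add: add_nonneg_pos)
  have ep: "e\<^sup>2 powr (1/2) = e" using assms(2) by (simp add: powr_half_sqrt)
  obtain K where K: "compact K" "K \<subseteq> \<Omega>" "\<And>x. x \<notin> K \<Longrightarrow> \<phi> x = 0"
    using test_support[OF assms(1)] by metis
  have "smooth \<psi>"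
    unfolding \<psi>_def by (intro smooth_diff smooth_const smooth_powr_comp smooth_add smooth_power sm pos)
  moreover have "\<psi> x = 0" if "x \<notin> K" for x using K(3)[OF that] ep by (simp add: \<psi>_def)
  ultimately show "\<psi> \<in> test_functions \<Omega>" unfolding test_functions_def using K by blast
  show "0 \<le> \<psi> x"
  proof -
    have "e\<^sup>2 powr (1/2) \<le> ((\<phi> x)\<^sup>2 + e\<^sup>2) powr (1/2)" by (intro powr_mono2) auto
    then show ?thesis using ep by (simp add: \<psi>_def)
  qed
  define c where "c = \<phi> x * ((\<phi> x)\<^sup>2 + e\<^sup>2) powr (1/2 - 1)"
  have "((\<lambda>y. y powr (1/2)) has_derivative (\<lambda>h. (1/2) * ((\<phi> x)\<^sup>2 + e\<^sup>2) powr (1/2 - 1) * h)) (at ((\<phi> x)\<^sup>2 + e\<^sup>2))"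
    using has_real_derivative_powr[OF pos[of x], of "1/2"] unfolding has_field_derivative_def
    by (rule has_derivative_eq_rhs) (auto simp: fun_eq_iff)
  moreover have "((\<lambda>x. (\<phi> x)\<^sup>2 + e\<^sup>2) has_derivative (\<lambda>v. 2 * \<phi> x * (grad \<phi> x \<bullet> v))) (at x)"
    by (auto intro!: derivative_eq_intros smooth_has_derivative[OF sm])
  ultimately have "((\<lambda>x. ((\<phi> x)\<^sup>2 + e\<^sup>2) powr (1/2)) has_derivative
      (\<lambda>v. (1/2) * ((\<phi> x)\<^sup>2 + e\<^sup>2) powr (1/2 - 1) * (2 * \<phi> x * (grad \<phi> x \<bullet> v)))) (at x)"
    by (rule has_derivative_compose[rotated])
  then have "(\<psi> has_derivative (\<lambda>v. (1/2) * ((\<phi> x)\<^sup>2 + e\<^sup>2) powr (1/2 - 1) * (2 * \<phi> x * (grad \<phi> x \<bullet> v)) - 0)) (at x)"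
    unfolding \<psi>_def by (rule has_derivative_diff) (rule has_derivative_const)
  then have "(\<psi> has_derivative (\<lambda>v. (c *\<^sub>R grad \<phi> x) \<bullet> v)) (at x)"
    by (rule has_derivative_eq_rhs) (auto simp: c_def fun_eq_iff)
  then have g: "grad \<psi> x = c *\<^sub>R grad \<phi> x" by (rule grad_eqI)
  have "\<bar>c\<bar> \<le> 1"
  proof -
    have "\<bar>\<phi> x\<bar> = (\<phi> x)\<^sup>2 powr (1/2)" by (simp add: powr_half_sqrt)
    also have "\<dots> \<le> ((\<phi> x)\<^sup>2 + e\<^sup>2) powr (1/2)" by (intro powr_mono2) auto
    finally have "\<bar>\<phi> x\<bar> * ((\<phi> x)\<^sup>2 + e\<^sup>2) powr (- (1/2)) \<le> ((\<phi> x)\<^sup>2 + e\<^sup>2) powr (1/2) * ((\<phi> x)\<^sup>2 + e\<^sup>2) powr (- (1/2))"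
      by (rule mult_right_mono) simp
    also have "\<dots> = 1" using pos[of x] assms(2) by (simp flip: powr_add)
    finally show ?thesis by (simp add: c_def abs_mult)
  qed
  then show "norm (grad \<psi> x) \<le> norm (grad \<phi> x)"
    unfolding g by (simp add: mult_left_le_one_le)
qed

text \<open>The smoothed absolute value does not increase the gradient terms. So if every smoothing
  parameter failed, all the \<open>Nl\<close>-integrals would fall short of that of
  \<open>\<phi>\<close> by \<open>d\<close>, contrary to Fatou's lemma.\<close>

lemma nonneg_test_energy:
  assumes lam: "lam > 0" and \<phi>: "\<phi> \<in> test_functions \<Omega>" and d: "d > 0"
  shows "\<exists>\<psi>\<in>test_functions \<Omega>. (\<forall>x. 0 \<le> \<psi> x) \<and> energy \<Omega> a b p lam \<psi> \<le> energy \<Omega> a b p lam \<phi> + d"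
proof (rule ccontr)
  assume neg: "\<not> ?thesis"
  define e where "e k = inverse (real (Suc k))" for k
  have e: "e k > 0" for k by (simp add: e_def)
  define \<psi> where "\<psi> k = (\<lambda>x. ((\<phi> x)\<^sup>2 + (e k)\<^sup>2) powr (1/2) - e k)" for k
  have T: "\<psi> k \<in> test_functions \<Omega>" "0 \<le> \<psi> k x" "norm (grad (\<psi> k) x) \<le> norm (grad \<phi> x)" for k x
    unfolding \<psi>_def by (rule smooth_abs_test[OF \<phi> e])+
  have big: "energy \<Omega> a b p lam \<phi> + d < energy \<Omega> a b p lam (\<psi> k)" for k
    using neg T(1)[of k] T(2)[of k] by (meson not_le)
  have Dle: "D (\<psi> k) \<le> D \<phi>" for k
    unfolding test_D[OF T(1)] test_D[OF \<phi>] l2_def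
    using T(3) sqint_integrable[OF test_sqint(2)[OF T(1) open_domain]] sqint_integrable[OF test_sqint(2)[OF \<phi> open_domain]]
    by (intro real_sqrt_le_mono integral_mono) (auto intro: power_mono)
  have le: "(LINT x|M. Nl lam (\<psi> k x)) \<le> (LINT x|M. Nl lam (\<phi> x)) - d" for k
  proof -
    have "a / 2 * D (\<psi> k) ^ 2 + b / 4 * D (\<psi> k) ^ 4 \<le> a / 2 * D \<phi> ^ 2 + b / 4 * D \<phi> ^ 4"
      using Dle[of k] a_pos b_pos by (intro add_mono mult_left_mono power_mono) auto
    then show ?thesis
      using big[of k] energy_Nl[OF test_W[OF T(1)[of k]], of lam] energy_Nl[OF test_W[OF \<phi>], of lam] by linarith
  qed
  have lim: "(\<lambda>k. \<psi> k x) \<longlonglongrightarrow> \<bar>\<phi> x\<bar>" for x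
  proof -
    have e0: "e \<longlonglongrightarrow> 0" unfolding e_def by (rule LIMSEQ_inverse_real_of_nat)
    have "(\<lambda>k. sqrt ((\<phi> x)\<^sup>2 + (e k)\<^sup>2) - e k) \<longlonglongrightarrow> sqrt ((\<phi> x)\<^sup>2 + 0\<^sup>2) - 0"
      by (intro tendsto_intros e0)
    then show ?thesis by (simp add: \<psi>_def powr_half_sqrt)
  qed
  have ae: "AE x in M. (\<lambda>k. Nl lam (\<psi> k x)) \<longlonglongrightarrow> Nl lam (\<phi> x)"
  proof (intro AE_I2)
    fix x
    have "Nl lam \<bar>\<phi> x\<bar> = Nl lam (\<phi> x)" by (simp add: Nl_def power4_eq_xxxx abs_mult[symmetric] mult.assoc)
    then show "(\<lambda>k. Nl lam (\<psi> k x)) \<longlonglongrightarrow> Nl lam (\<phi> x)" using Nl_tendsto[OF lim[of x], of lam] by simp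
  qed
  have "(LINT x|M. Nl lam (\<phi> x)) \<le> (LINT x|M. Nl lam (\<phi> x)) - d"
    using Fatou_real(2)[OF Nl_integrable[OF test_W[OF T(1)]] borel_measurable_integrable[OF Nl_integrable[OF test_W[OF \<phi>]]] _ ae le tendsto_const]
      Nl_nonneg[OF lam] by auto
  then show False using d by simp
qed

text \<open>Write \<open>\<phi>\<^sub>n\<^sup>4 \<le> \<kappa> (\<phi>\<^sub>n - u)\<^sup>4 + C u\<^sup>4\<close> with \<open>\<kappa> > 1\<close> so small that \<open>\<kappa> / S\<^sup>2 \<le> b\<close>: the nonlocal term absorbs
  \<open>\<kappa> (\<phi>\<^sub>n - u)\<^sup>4\<close>, and Fatou's lemma applies to the difference of the two sides.\<close>

lemma energy_lsc:
  assumes lam: "lam > 0" and \<phi>: "\<And>n. \<phi> n \<in> test_functions \<Omega>" and K: "\<And>n. D (\<phi> n) \<le> K"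
    and u: "u \<in> W012 \<Omega>" and lim: "(\<lambda>n. l2 M (\<lambda>x. \<phi> n x - u x)) \<longlonglongrightarrow> 0"
    and AElim: "AE x in M. (\<lambda>n. \<phi> n x) \<longlonglongrightarrow> u x"
    and E: "\<And>n. energy \<Omega> a b p lam (\<phi> n) \<le> E n" "E \<longlonglongrightarrow> E0"
  shows "energy \<Omega> a b p lam u \<le> E0"
proof -
  obtain h where h: "h > 0" "(1 + h) ^ 3 / S\<^sup>2 \<le> b" by (rule kappa_exists)
  define \<kappa> C where "\<kappa> = (1 + h) ^ 3" and "C = (1 + 1 / h) ^ 3"
  have \<kappa>0: "\<kappa> > 0" using h by (simp add: \<kappa>_def)
  \<comment> \<open>\<open>t n\<close> and \<open>s n\<close> split the squared gradient norm of
    \<open>\<phi> n\<close>: \<open>t n\<close> may be lost in the limit, while \<open>s n\<close>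
    converges to the squared norm of \<open>u\<close>.\<close>
  define s where "s n = 2 * (LINT x|M. grad (\<phi> n) x \<bullet> wgrad \<Omega> u x) - (D u)\<^sup>2" for n
  define t where "t n = (D (\<lambda>x. \<phi> n x - u x))\<^sup>2" for n
  have K0: "K \<ge> 0" using order_trans[OF Dnorm_nonneg K[of 0]] .
  have slim: "s \<longlonglongrightarrow> (D u)\<^sup>2"
  proof -
    have "s \<longlonglongrightarrow> 2 * (D u)\<^sup>2 - (D u)\<^sup>2"
      unfolding s_def
      by (intro tendsto_intros weak_convergence_of_gradients[OF open_domain \<phi> _ u lim, of K])
        (use K test_D[OF \<phi>] in simp)
    then show ?thesis by simp
  qed
  have wW: "(\<lambda>x. \<phi> n x - u x) \<in> W012 \<Omega>" for n
    using W012_lincomb(1)[OF open_domain test_W[OF \<phi>] u, of n "-1"] by simp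
  have Dsq: "(D (\<phi> n))\<^sup>2 = t n + s n" for n
  proof -
    note sg = test_sqint(2)[OF \<phi>[of n] open_domain] and su = W012_D(2)[OF open_domain u]
    have "AE x in M. wgrad \<Omega> (\<lambda>x. \<phi> n x - u x) x = grad (\<phi> n) x + (-1) *\<^sub>R wgrad \<Omega> u x"
      using W012_lincomb(2)[OF open_domain test_W[OF \<phi>] u, of n "-1"] test_W012(2)[OF open_domain \<phi>[of n]]
      by eventually_elim simp
    then have "D (\<lambda>x. \<phi> n x - u x) = l2 M (\<lambda>x. grad (\<phi> n) x + (-1) *\<^sub>R wgrad \<Omega> u x)"
      unfolding Dnorm_def Lnorm_2
      by (intro l2_cong_AE sqint_measurable W012_D(2)[OF open_domain wW] sqint_add sg sqint_scaleR su)
    then have "t n = (D (\<phi> n))\<^sup>2 - 2 * (LINT x|M. grad (\<phi> n) x \<bullet> wgrad \<Omega> u x) + (D u)\<^sup>2"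
      unfolding t_def using l2_sq_add[OF sg su, of "-1"] by (simp add: test_D[OF \<phi>] Dnorm_def[of \<Omega> u] Lnorm_2)
    then show ?thesis by (simp add: s_def)
  qed
  have t0: "t n \<ge> 0" for n by (simp add: t_def)
  have key: "energy \<Omega> a b p lam u \<le> E0 + e * (81 * K ^ 4)" if e: "e > 0" for e
  proof -
    obtain Ce where Ce: "\<forall>t. (lam / p) * \<bar>t\<bar> powr p \<le> e * t ^ 4 + Ce"
      using powr_le_epsilon_quartic[of p "lam / p" e] lam p_gt p_lt e by auto
    \<comment> \<open>Both brackets are nonnegative, the first by \<open>quartic_sum_bound\<close>,
      the second by the choice of \<open>Ce\<close>; the term with \<open>\<kappa>\<close>
      disappears in the pointwise limit \<open>F0\<close>.\<close>
    define F where "F n x = (\<kappa> * (\<phi> n x - u x) ^ 4 + C * u x ^ 4 - \<phi> n x ^ 4) / 4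
        + (e * \<phi> n x ^ 4 + Ce - lam / p * \<bar>\<phi> n x\<bar> powr p)" for n x
    define F0 where "F0 x = (C * u x ^ 4 - u x ^ 4) / 4 + (e * u x ^ 4 + Ce - lam / p * \<bar>u x\<bar> powr p)" for x
    note iX = X_integrable[OF test_W[OF \<phi>]] X_integrable[OF wW] X_integrable[OF u]
    have iP: "integrable M (\<lambda>x. \<bar>\<phi> n x\<bar> powr p)" "integrable M (\<lambda>x. \<bar>u x\<bar> powr p)" for n
      using P_integrable[OF test_W[OF \<phi>]] P_integrable[OF u] p_gt p_lt by auto
    have Fint: "integrable M (F n)" for n unfolding F_def using iX iP by simp
    have Fval: "(LINT x|M. F n x) = (\<kappa> * X (\<lambda>x. \<phi> n x - u x) + C * X u - X (\<phi> n)) / 4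
        + (e * X (\<phi> n) + Ce * vol - lam / p * P p (\<phi> n))" for n
      unfolding F_def X_def P_def vol_def using iX iP by simp
    have F0int: "integrable M F0" unfolding F0_def using iX iP by simp
    have F0val: "(LINT x|M. F0 x) = (C * X u - X u) / 4 + (e * X u + Ce * vol - lam / p * P p u)"
      unfolding F0_def X_def P_def vol_def using iX iP by simp
    have Fnn: "0 \<le> F n x" for n x
    proof -
      have "\<phi> n x ^ 4 \<le> \<kappa> * (\<phi> n x - u x) ^ 4 + C * u x ^ 4"
        using quartic_sum_bound[OF h(1), of "\<phi> n x - u x" "u x"] by (simp add: \<kappa>_def C_def)
      moreover have "lam / p * \<bar>\<phi> n x\<bar> powr p \<le> e * \<phi> n x ^ 4 + Ce" using Ce by blast
      ultimately show ?thesis unfolding F_def by simp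
    qed
    have Flim: "AE x in M. (\<lambda>n. F n x) \<longlonglongrightarrow> F0 x"
      using AElim
    proof eventually_elim
      case (elim x)
      have "(\<lambda>n. F n x) \<longlonglongrightarrow> (\<kappa> * (u x - u x) ^ 4 + C * u x ^ 4 - u x ^ 4) / 4
        + (e * u x ^ 4 + Ce - lam / p * \<bar>u x\<bar> powr p)"
        unfolding F_def using p_gt by (intro tendsto_intros powr_abs_tendsto elim) auto
      then show ?case by (simp add: F0_def)
    qed
    \<comment> \<open>The terms \<open>b / 4 * (t n)\<^sup>2\<close> from the energy and from the
      Sobolev bound on the \<open>\<kappa>\<close>-term cancel, so \<open>B\<close> contains only
      quantities with known limits.\<close>
    define B where "B n = C * X u / 4 + e * (81 * K ^ 4) + Ce * vol + E n - a / 2 * s n - b / 4 * (s n)\<^sup>2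
        + b / 2 * ((K\<^sup>2 + \<bar>s n\<bar>) * \<bar>s n - (D u)\<^sup>2\<bar>)" for n
    have le: "(LINT x|M. F n x) \<le> B n" for n
    proof -
      have "\<kappa> * X (\<lambda>x. \<phi> n x - u x) \<le> \<kappa> * (D (\<lambda>x. \<phi> n x - u x) ^ 4 / S\<^sup>2)"
        using X_le[OF wW] \<kappa>0 by (intro mult_left_mono) auto
      also have "\<dots> = \<kappa> / S\<^sup>2 * (t n)\<^sup>2" by (simp add: t_def flip: power_mult)
      also have "\<dots> \<le> b * (t n)\<^sup>2" using h(2) by (intro mult_right_mono) (auto simp: \<kappa>_def)
      finally have 1: "\<kappa> * X (\<lambda>x. \<phi> n x - u x) \<le> b * (t n)\<^sup>2" .
      have 2: "e * X (\<phi> n) \<le> e * (81 * K ^ 4)"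
      proof -
        have "X (\<phi> n) \<le> 81 * D (\<phi> n) ^ 4" unfolding X_def by (rule W012_L4_bound(2)[OF open_domain test_W[OF \<phi>]])
        also have "\<dots> \<le> 81 * K ^ 4" using K[of n] by (intro mult_left_mono power_mono) auto
        finally show ?thesis using e by (intro mult_left_mono) auto
      qed
      have D4: "D (\<phi> n) ^ 4 = (t n + s n)\<^sup>2"
        unfolding Dsq[symmetric] by (simp flip: power_mult)
      have 3: "a / 2 * t n + a / 2 * s n + b / 4 * (t n + s n)\<^sup>2 - X (\<phi> n) / 4 - lam / p * P p (\<phi> n) \<le> E n"
        using E(1)[of n] unfolding energy_eq D4 Dsq distrib_left[of "a / 2"] .
      \<comment> \<open>For finite n the number \<open>s n\<close> may be negative, so the mixed
        term \<open>t n * s n\<close> is bounded below only up to an error that vanishes with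
        \<open>s n - (D u)\<^sup>2\<close>.\<close>
      have 4: "- (t n * s n) \<le> (K\<^sup>2 + \<bar>s n\<bar>) * \<bar>s n - (D u)\<^sup>2\<bar>"
      proof -
        have "t n \<le> K\<^sup>2 + \<bar>s n\<bar>" using Dsq[of n] power_mono[OF K[of n], of 2] by simp
        then have "t n * \<bar>s n - (D u)\<^sup>2\<bar> \<le> (K\<^sup>2 + \<bar>s n\<bar>) * \<bar>s n - (D u)\<^sup>2\<bar>" by (rule mult_right_mono) simp
        moreover have "t n * ((D u)\<^sup>2 - s n) \<le> t n * \<bar>s n - (D u)\<^sup>2\<bar>" using t0 by (intro mult_left_mono) auto
        moreover have "0 \<le> t n * (D u)\<^sup>2" using t0 by simp
        ultimately show ?thesis by (simp add: right_diff_distrib)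
      qed
      have 5: "- (b / 2 * (t n * s n)) \<le> b / 2 * ((K\<^sup>2 + \<bar>s n\<bar>) * \<bar>s n - (D u)\<^sup>2\<bar>)"
        unfolding mult_minus_right[symmetric] using 4 b_pos by (intro mult_left_mono) auto
      have 6: "b / 4 * (t n + s n)\<^sup>2 = b / 4 * (t n)\<^sup>2 + b / 2 * (t n * s n) + b / 4 * (s n)\<^sup>2"
        by (simp add: power2_eq_square algebra_simps)
      have 7: "0 \<le> a / 2 * t n" using a_pos t0 by simp
      show ?thesis
      proof -
        have "(kx + cx - xn) / 4 + (ex + cv - l) \<le> cx / 4 + ek + cv + en - as - bs + bq"
          if "kx \<le> bt" "ex \<le> ek" "ta + as + bts - xn / 4 - l \<le> en" "- bm \<le> bq"
            "bts = b4t + bm + bs" "b4t = bt / 4" "0 \<le> ta"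
          for kx cx xn ex cv l ek en as bs bq bt ta bts bm b4t :: real
          using that by (simp add: field_simps)
        note * = this[OF 1 2 3 5 6 _ 7]
        show ?thesis unfolding Fval B_def by (rule *) simp
      qed
    qed
    have "B \<longlonglongrightarrow> C * X u / 4 + e * (81 * K ^ 4) + Ce * vol + E0 - a / 2 * (D u)\<^sup>2 - b / 4 * ((D u)\<^sup>2)\<^sup>2
        + b / 2 * ((K\<^sup>2 + \<bar>(D u)\<^sup>2\<bar>) * \<bar>(D u)\<^sup>2 - (D u)\<^sup>2\<bar>)"
      unfolding B_def by (intro tendsto_intros slim E(2))
    then have Bl: "B \<longlonglongrightarrow> C * X u / 4 + e * (81 * K ^ 4) + Ce * vol + E0 - a / 2 * (D u)\<^sup>2 - b / 4 * D u ^ 4"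
      by (simp flip: power_mult)
    have "(LINT x|M. F0 x) \<le> C * X u / 4 + e * (81 * K ^ 4) + Ce * vol + E0 - a / 2 * (D u)\<^sup>2 - b / 4 * D u ^ 4"
      using Fatou_real(2)[OF Fint borel_measurable_integrable[OF F0int] _ Flim le Bl] Fnn by auto
    then have "energy \<Omega> a b p lam u \<le> E0 + e * (81 * K ^ 4) - e * X u"
      unfolding F0val energy_eq by (simp add: diff_divide_distrib)
    moreover have "0 \<le> e * X u" using e by simp
    ultimately show ?thesis by linarith
  qed
  show ?thesis
  proof (rule field_le_epsilon)
    fix d :: real assume d: "d > 0"
    \<comment> \<open>The slack \<open>e\<close> costs \<open>e * (81 * K ^ 4)\<close>; the added 1
      in the denominator covers \<open>K = 0\<close>.\<close>
    have "energy \<Omega> a b p lam u \<le> E0 + d / (81 * K ^ 4 + 1) * (81 * K ^ 4)"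
      using K0 d by (intro key) (auto intro!: divide_pos_pos add_nonneg_pos)
    also have "d / (81 * K ^ 4 + 1) * (81 * K ^ 4) \<le> d"
      using K0 d by (simp add: divide_le_eq add_nonneg_pos distrib_left)
    finally show "energy \<Omega> a b p lam u \<le> E0 + d" by simp
  qed
qed

text \<open>A Poincare inequality: Cauchy-Schwarz against the constant 1 passes from the second to
  the fourth power, where \<open>W012_L4_bound\<close> applies; 9 is the square root of 81.\<close>

lemma test_l2_bound: "\<phi> \<in> test_functions \<Omega> \<Longrightarrow> l2 lborel \<phi> \<le> sqrt (9 * sqrt vol) * D \<phi>"
proof -
  assume \<phi>: "\<phi> \<in> test_functions \<Omega>"
  have iX: "integrable M (\<lambda>x. \<phi> x ^ 4)" by (rule X_integrable[OF test_W[OF \<phi>]])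
  have [measurable]: "\<phi> \<in> borel_measurable M" by (rule W012_measurable[OF test_W[OF \<phi>]])
  have s1: "sqint M (\<lambda>x. (\<phi> x)\<^sup>2)" using iX by (simp add: sqint_def)
  have s2: "sqint M (\<lambda>x. 1::real)" by (simp add: sqint_def)
  have "(l2 M \<phi>)\<^sup>2 = (LINT x|M. (\<phi> x)\<^sup>2 * 1)" by (simp add: l2_sq)
  also have "\<dots> \<le> l2 M (\<lambda>x. (\<phi> x)\<^sup>2) * l2 M (\<lambda>x. 1::real)"
    using l2_Cauchy_Schwarz_mult[OF s1 s2] by linarith
  also have "\<dots> = sqrt (X \<phi>) * sqrt vol" by (simp add: l2_def X_def vol_def)
  also have "\<dots> \<le> (9 * (D \<phi>)\<^sup>2) * sqrt vol"
  proof (intro mult_right_mono)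
    have "X \<phi> \<le> (9 * (D \<phi>)\<^sup>2)\<^sup>2"
      using W012_L4_bound(2)[OF open_domain test_W[OF \<phi>]] by (simp add: X_def power_mult_distrib flip: power_mult)
    then show "sqrt (X \<phi>) \<le> 9 * (D \<phi>)\<^sup>2" by (intro real_le_lsqrt) auto
  qed simp
  also have "\<dots> = (sqrt (9 * sqrt vol) * D \<phi>)\<^sup>2" by (simp add: power_mult_distrib)
  finally have "l2 M \<phi> \<le> sqrt (9 * sqrt vol) * D \<phi>" by (rule power2_le_imp_le) simp
  then show ?thesis using test_sqint(3)[OF \<phi> open_domain] by simp
qed

text \<open>The minimizer is delivered as a Borel function with the right sign and zero values at
  every point, because the later translations and averages run over the whole space.\<close>

theorem minimizer_exists:
  assumes lam: "lam > 0"
  obtains u where "u \<in> W012 \<Omega>" "u \<in> borel_measurable borel" "\<And>x. 0 \<le> u x" "\<And>x. x \<notin> \<Omega> \<Longrightarrow> u x = 0"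
    "\<And>v. v \<in> W012 \<Omega> \<Longrightarrow> energy \<Omega> a b p lam u \<le> energy \<Omega> a b p lam v"
proof -
  let ?T = "test_functions \<Omega>" and ?I = "energy \<Omega> a b p lam"
  obtain C where C: "\<And>u. u \<in> W012 \<Omega> \<Longrightarrow> a / 2 * D u ^ 2 \<le> ?I u + C"
    using energy_coercive[OF lam] by blast
  have lower: "- C \<le> ?I u" if "u \<in> W012 \<Omega>" for u
  proof -
    have "0 \<le> a / 2 * D u ^ 2" using a_pos by simp
    then show ?thesis using C[OF that] by linarith
  qed
  define m where "m = Inf (?I ` ?T)"
  have bdd: "bdd_below (?I ` ?T)" by (rule bdd_belowI[of _ "- C"]) (use lower test_W in auto)
  have ne: "?I ` ?T \<noteq> {}" using test_zero by blast
  have m_le: "m \<le> ?I \<phi>" if "\<phi> \<in> ?T" for \<phi> unfolding m_def using that by (intro cInf_lower bdd) auto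
  have m_le': "m \<le> ?I v" if "v \<in> W012 \<Omega>" for v by (rule energy_lower_from_tests[OF lam m_le that])
  \<comment> \<open>Two errors of size \<open>inverse (real (Suc n))\<close>: one for
    near-minimality, one for passing to a nonnegative function.\<close>
  have "\<exists>\<psi>\<in>?T. (\<forall>x. 0 \<le> \<psi> x) \<and> ?I \<psi> \<le> m + 2 * inverse (real (Suc n))" for n
  proof -
    have "Inf (?I ` ?T) < m + inverse (real (Suc n))" by (simp add: m_def)
    then obtain \<phi> where "\<phi> \<in> ?T" "?I \<phi> < m + inverse (real (Suc n))" using cInf_lessD[OF ne] by blast
    moreover obtain \<psi> where "\<psi> \<in> ?T" "\<forall>x. 0 \<le> \<psi> x" "?I \<psi> \<le> ?I \<phi> + inverse (real (Suc n))"
      using nonneg_test_energy[OF lam \<open>\<phi> \<in> ?T\<close>, of "inverse (real (Suc n))"] by auto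
    ultimately show ?thesis by (intro bexI[of _ \<psi>]) auto
  qed
  then obtain \<phi> where \<phi>: "\<And>n. \<phi> n \<in> ?T" "\<And>n x. 0 \<le> \<phi> n x" "\<And>n. ?I (\<phi> n) \<le> m + 2 * inverse (real (Suc n))"
    by metis
  define K where "K = sqrt (2 / a * (m + 2 + C))"
  have DK: "D (\<phi> n) \<le> K" for n
  proof -
    have "inverse (real (Suc n)) \<le> 1" by (simp add: inverse_le_1_iff)
    then have "a / 2 * D (\<phi> n) ^ 2 \<le> m + 2 + C" using C[OF test_W[OF \<phi>(1)[of n]]] \<phi>(3)[of n] by linarith
    then have "D (\<phi> n) ^ 2 \<le> 2 / a * (m + 2 + C)" using a_pos by (simp add: field_simps)
    then show ?thesis unfolding K_def by (rule real_le_rsqrt)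
  qed
  define L where "L = max K (sqrt (9 * sqrt vol) * K)"
  have L: "l2 lborel (\<phi> n) \<le> L" "l2 lborel (grad (\<phi> n)) \<le> L" for n
  proof -
    have "sqrt (9 * sqrt vol) * D (\<phi> n) \<le> sqrt (9 * sqrt vol) * K" by (intro mult_left_mono DK) simp
    then show "l2 lborel (\<phi> n) \<le> L" using test_l2_bound[OF \<phi>(1)[of n]] by (simp add: L_def)
    show "l2 lborel (grad (\<phi> n)) \<le> L"
      using DK[of n] test_D[OF \<phi>(1)[of n]] test_sqint(4)[OF \<phi>(1)[of n] open_domain] by (simp add: L_def)
  qed
  obtain r1 :: "nat \<Rightarrow> nat" where r1: "strict_mono r1"
    and cau: "\<And>e. e > 0 \<Longrightarrow> \<exists>N. \<forall>m\<ge>N. \<forall>n\<ge>N. l2 lborel (\<lambda>x. \<phi> (r1 m) x - \<phi> (r1 n) x) < e"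
    by (rule Rellich[OF open_domain bounded_domain \<phi>(1) L]) (rule that)
  obtain g r2 where r2: "strict_mono (r2 :: nat \<Rightarrow> nat)" and g: "sqint lborel g"
    and gAE: "AE x in lborel. (\<lambda>k. \<phi> (r1 (r2 k)) x) \<longlonglongrightarrow> g x"
    and glim: "(\<lambda>n. l2 lborel (\<lambda>x. \<phi> (r1 n) x - g x)) \<longlonglongrightarrow> 0"
    using l2_complete[of lborel "\<lambda>n. \<phi> (r1 n)", OF test_integrable(6)[OF \<phi>(1)] cau] by blast
  \<comment> \<open>\<open>g\<close> already has these properties a.e.; the cut-off enforces them at
    every point.\<close>
  define u where "u x = indicator \<Omega> x * max 0 (g x)" for x
  have gm [measurable]: "g \<in> borel_measurable borel" using sqint_measurable[OF g] by simp
  have [measurable]: "\<Omega> \<in> sets borel" using open_domain by simp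
  have um: "u \<in> borel_measurable borel" unfolding u_def by measurable
  have u0: "0 \<le> u x" for x by (simp add: u_def)
  have uout: "u x = 0" if "x \<notin> \<Omega>" for x using that by (simp add: u_def)
  have gu: "AE x in lborel. g x = u x"
    using gAE
  proof eventually_elim
    case (elim x)
    have "0 \<le> g x" by (rule LIMSEQ_le_const[OF elim]) (use \<phi>(2) in auto)
    moreover have "g x = 0" if "x \<notin> \<Omega>"
      using elim test_zero_outside[OF \<phi>(1) that] LIMSEQ_unique[OF tendsto_const] by fastforce
    ultimately show ?case by (auto simp: u_def indicator_def)
  qed
  have su: "sqint lborel u" by (rule sqint_cong_AE[OF g _ gu]) (use um in simp)
  define \<psi> where "\<psi> k = \<phi> (r1 (r2 k))" for k
  have \<psi>: "\<psi> k \<in> ?T" for k using \<phi>(1) by (simp add: \<psi>_def)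
  have suM: "sqint M u" using sqint_lebesgue_on_eq(1)[OF um _ uout] su by simp
  have limM: "(\<lambda>k. l2 M (\<lambda>x. \<psi> k x - u x)) \<longlonglongrightarrow> 0"
  proof -
    have "l2 M (\<lambda>x. \<psi> k x - u x) = l2 lborel (\<lambda>x. \<phi> (r1 (r2 k)) x - g x)" for k
    proof -
      have [measurable]: "\<psi> k \<in> borel_measurable borel" "\<phi> (r1 (r2 k)) \<in> borel_measurable borel"
        using test_integrable(2) \<phi>(1) \<psi> by blast+
      have "l2 M (\<lambda>x. \<psi> k x - u x) = l2 lborel (\<lambda>x. \<psi> k x - u x)"
        by (rule sqint_lebesgue_on_eq(2)) (use um test_zero_outside[OF \<psi>] uout in auto)
      also have "\<dots> = l2 lborel (\<lambda>x. \<phi> (r1 (r2 k)) x - g x)"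
        by (rule l2_cong_AE) (use um gu in \<open>auto simp: \<psi>_def\<close>)
      finally show ?thesis .
    qed
    then show ?thesis using LIMSEQ_subseq_LIMSEQ[OF glim r2] by (simp add: o_def)
  qed
  have D\<psi>: "l2 M (grad (\<psi> k)) \<le> K" for k
    using DK[of "r1 (r2 k)"] test_D[OF \<psi>[of k]] by (simp add: \<psi>_def)
  have uW: "u \<in> W012 \<Omega>" by (rule bounded_limit_in_W012[OF open_domain \<psi> D\<psi> suM limM])
  have "AE x in lborel. x \<in> \<Omega> \<longrightarrow> (\<lambda>k. \<psi> k x) \<longlonglongrightarrow> u x"
    using gAE gu by eventually_elim (simp add: \<psi>_def)
  then have "AE x in lebesgue. x \<in> \<Omega> \<longrightarrow> (\<lambda>k. \<psi> k x) \<longlonglongrightarrow> u x" by (rule AE_completion)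
  then have AElim: "AE x in M. (\<lambda>k. \<psi> k x) \<longlonglongrightarrow> u x"
    using open_domain by (simp add: AE_restrict_space_iff)
  have El: "(\<lambda>k. m + 2 * inverse (real (Suc (r1 (r2 k))))) \<longlonglongrightarrow> m + 2 * 0"
  proof (intro tendsto_intros)
    show "(\<lambda>k. inverse (real (Suc (r1 (r2 k))))) \<longlonglongrightarrow> 0"
      using LIMSEQ_subseq_LIMSEQ[OF LIMSEQ_inverse_real_of_nat strict_mono_o[OF r1 r2]] by (simp add: o_def)
  qed
  have "?I u \<le> m + 2 * 0"
    by (rule energy_lsc[OF lam \<psi> _ uW limM AElim _ El, of K])
      (use DK \<phi>(3) in \<open>simp_all add: \<psi>_def\<close>)
  then show thesis using that[OF uW um u0 uout] m_le' by force
qed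

subsection \<open>Negative energy and the Euler--Lagrange equation\<close>

text \<open>Young's inequality with exponents \<open>4 / q\<close> and \<open>4 / (4 - q)\<close>.
  The weight \<open>d\<close> will be the gradient norm in \<open>P_bound_D\<close>, and 1 where the
  exponent q is compared with 4.\<close>

lemma weighted_Young:
  fixes t d q :: real
  assumes "0 < q" "q < 4" "d > 0"
  shows "\<bar>t\<bar> powr q * d powr (4 - q) \<le> (q / 4) * t ^ 4 + ((4 - q) / 4) * d ^ 4"
proof (cases "t = 0")
  case True
  then show ?thesis using assms by simp
next
  case False
  have "(\<bar>t\<bar> powr 4) powr (q / 4) * (d powr 4) powr ((4 - q) / 4) \<le> (q / 4) * (\<bar>t\<bar> powr 4) + ((4 - q) / 4) * (d powr 4)"
    using assms False by (intro Youngs_inequality_0) (auto simp: field_simps)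
  moreover have "(\<bar>t\<bar> powr 4) powr (q / 4) = \<bar>t\<bar> powr q" "(d powr 4) powr ((4 - q) / 4) = d powr (4 - q)"
    by (subst powr_powr, simp add: diff_divide_distrib)+
  moreover have "\<bar>t\<bar> powr 4 = t ^ 4" "d powr 4 = d ^ 4" using assms False by (simp_all add: powr_numeral)
  ultimately show ?thesis by (simp only:)
qed

lemma P_weighted_bound:
  assumes u: "u \<in> W012 \<Omega>" and q: "0 < q" "q < 4" and d: "d > 0"
  shows "P q u * d powr (4 - q) \<le> (q / 4) * X u + ((4 - q) / 4) * d ^ 4 * vol"
proof -
  have iP: "integrable M (\<lambda>x. \<bar>u x\<bar> powr q)" using P_integrable[OF u] q by simp
  have "P q u * d powr (4 - q) = (LINT x|M. \<bar>u x\<bar> powr q * d powr (4 - q))" by (simp add: P_def)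
  also have "\<dots> \<le> (LINT x|M. (q / 4) * u x ^ 4 + ((4 - q) / 4) * d ^ 4)"
  proof (rule integral_mono)
    show "integrable M (\<lambda>x. \<bar>u x\<bar> powr q * d powr (4 - q))" using iP by simp
    show "integrable M (\<lambda>x. (q / 4) * u x ^ 4 + ((4 - q) / 4) * d ^ 4)" using X_integrable[OF u] by simp
  qed (rule weighted_Young[OF q d])
  also have "\<dots> = (q / 4) * X u + ((4 - q) / 4) * d ^ 4 * vol"
    using X_integrable[OF u] by (simp add: X_def vol_def)
  finally show ?thesis .
qed

text \<open>The weight \<open>D u\<close> makes the bound homogeneous, and its constant tends to
  \<open>1 / S\<^sup>2\<close> as \<open>q\<close> tends to 4; a coarser constant would not match
  the condition on \<open>b\<close>.\<close>

lemma P_bound_D: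
  assumes u: "u \<in> W012 \<Omega>" and q: "0 < q" "q < 4" and d: "D u > 0"
  shows "P q u \<le> D u powr q * ((q / 4) / S\<^sup>2 + ((4 - q) / 4) * vol)"
proof -
  have d4: "D u ^ 4 = D u powr q * D u powr (4 - q)"
    using d by (simp add: powr_numeral flip: powr_add)
  have "P q u * D u powr (4 - q) \<le> (q / 4) * X u + ((4 - q) / 4) * D u ^ 4 * vol"
    by (rule P_weighted_bound[OF u q d])
  also have "\<dots> \<le> (q / 4) * (D u ^ 4 / S\<^sup>2) + ((4 - q) / 4) * D u ^ 4 * vol"
    using X_le[OF u] q by (intro add_right_mono mult_left_mono) auto
  also have "\<dots> = (D u powr q * ((q / 4) / S\<^sup>2 + ((4 - q) / 4) * vol)) * D u powr (4 - q)"
    unfolding d4 by (simp add: algebra_simps)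
  finally show ?thesis using d by (simp add: mult_le_cancel_right)
qed

section \<open>From the approximating functionals to a negative energy\<close>

lemma energy_approx_eq:
  assumes "0 < \<sigma> n" "\<sigma> n < 4 - p"
  shows "energy_approx \<Omega> a b p \<sigma> lam n u = a / 2 * D u ^ 2 + b / (4 - \<sigma> n) * D u powr (4 - \<sigma> n)
     - 1 / (4 - \<sigma> n) * P (4 - \<sigma> n) u - lam / p * P p u"
  using assms p_gt by (simp add: energy_approx_def Lnorm_powr)

lemma exists_threshold:
  fixes \<sigma> :: "nat \<Rightarrow> real"
  assumes \<sigma>: "\<And>n. 0 < \<sigma> n \<and> \<sigma> n < 4 - p"
  shows "\<exists>lam0. negative_threshold \<Omega> a b p \<sigma> lam0"
proof -
  obtain \<phi> x0 where \<phi>: "\<phi> \<in> test_functions \<Omega>" "\<And>x. 0 \<le> \<phi> x" "\<phi> x0 > 0"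
    using exists_test_function[OF open_domain nonempty_domain] by blast
  have W: "\<phi> \<in> W012 \<Omega>" by (rule test_W[OF \<phi>(1)])
  have [measurable]: "\<phi> \<in> borel_measurable borel" by (rule test_integrable(2)[OF \<phi>(1)])
  have m: "(\<lambda>x. \<bar>\<phi> x\<bar> powr p) \<in> borel_measurable borel" by measurable
  have z: "\<bar>\<phi> x\<bar> powr p = 0" if "x \<notin> \<Omega>" for x using test_zero_outside[OF \<phi>(1) that] by simp
  note eq = lebesgue_on_integral_eq[OF m borel_open[OF open_domain] z]
  define Q where "Q = P p \<phi>"
  have "Q = (LINT x|lborel. \<bar>\<phi> x\<bar> powr p)" unfolding Q_def P_def by (rule eq(2))
  also have "\<dots> > 0"
  proof (rule integral_pos_of_continuous[of _ x0])
    show "continuous_on UNIV (\<lambda>x. \<bar>\<phi> x\<bar> powr p)"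
      using test_integrable(1)[OF \<phi>(1)] p_gt
      by (intro continuous_on_powr' continuous_on_rabs continuous_on_const) auto
    show "integrable lborel (\<lambda>x. \<bar>\<phi> x\<bar> powr p)"
      using eq(1) P_integrable[OF W, of p] p_gt p_lt by simp
    show "0 < \<bar>\<phi> x0\<bar> powr p" using \<phi>(3) by simp
  qed simp
  finally have Q: "Q > 0" .
  define C where "C = a / 2 * D \<phi> ^ 2 + b / 2 * (1 + D \<phi> ^ 4)"
  have C0: "C \<ge> 0" using a_pos b_pos by (simp add: C_def)
  \<comment> \<open>Above this value the term with \<open>P p \<phi>\<close> is at least
    \<open>C + 1\<close>, while \<open>C\<close> bounds the positive terms for all n at
    once.\<close>
  define lam0 where "lam0 = p / Q * (C + 1)"
  have le: "energy_approx \<Omega> a b p \<sigma> lam n \<phi> \<le> - 1" if lam: "lam > lam0" for lam n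
  proof -
    have s: "0 < \<sigma> n" "\<sigma> n < 4 - p" using \<sigma> by auto
    have q: "2 \<le> 4 - \<sigma> n" "4 - \<sigma> n \<le> 4" using s p_gt by auto
    have "b / (4 - \<sigma> n) * D \<phi> powr (4 - \<sigma> n) \<le> b / 2 * (1 + D \<phi> ^ 4)"
    proof (rule mult_mono)
      show "b / (4 - \<sigma> n) \<le> b / 2" using q b_pos by (intro divide_left_mono) auto
      show "D \<phi> powr (4 - \<sigma> n) \<le> 1 + D \<phi> ^ 4"
        using powr_le_one_plus[of "4 - \<sigma> n" "D \<phi>"] q by simp
    qed (use b_pos in auto)
    moreover have "0 \<le> 1 / (4 - \<sigma> n) * P (4 - \<sigma> n) \<phi>" using q by simp
    moreover have "C + 1 \<le> lam / p * Q"
    proof -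
      have "(p / Q * (C + 1)) * (Q / p) \<le> lam * (Q / p)"
        using lam Q p_gt unfolding lam0_def by (intro mult_right_mono) auto
      then show ?thesis using Q p_gt by simp
    qed
    ultimately show ?thesis
      unfolding energy_approx_eq[of \<sigma> n, OF s] Q_def C_def by linarith
  qed
  have "negative_threshold \<Omega> a b p \<sigma> lam0"
    unfolding negative_threshold_def
  proof (intro conjI allI impI)
    show "0 < lam0" using Q p_gt C0 by (simp add: lam0_def)
    fix lam assume lam: "lam0 < lam"
    have "(SUP n. INF u\<in>W012 \<Omega>. ereal (energy_approx \<Omega> a b p \<sigma> lam n u)) \<le> ereal (- 1)"
    proof (rule SUP_least)
      fix n
      have "(INF u\<in>W012 \<Omega>. ereal (energy_approx \<Omega> a b p \<sigma> lam n u)) \<le> ereal (energy_approx \<Omega> a b p \<sigma> lam n \<phi>)"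
        by (rule INF_lower[OF W])
      also have "\<dots> \<le> ereal (- 1)" using le[OF lam, of n] by simp
      finally show "(INF u\<in>W012 \<Omega>. ereal (energy_approx \<Omega> a b p \<sigma> lam n u)) \<le> ereal (- 1)" .
    qed
    also have "\<dots> < 0" by simp
    finally show "(SUP n. INF u\<in>W012 \<Omega>. ereal (energy_approx \<Omega> a b p \<sigma> lam n u)) < 0" .
  qed
  then show ?thesis by blast
qed

text \<open>No limit of the functions \<open>u n\<close> is taken. All have approximate energy below
  one \<open>z < 0\<close>; for exponents near 4 their gradient norms stay below a fixed
  \<open>R\<close>, and on that range the change of exponent costs less than the gap
  \<open>- z\<close>. A single late \<open>u n\<close> then has negative energy.\<close>

lemma negative_energy:
  fixes \<sigma> :: "nat \<Rightarrow> real"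
  assumes \<sigma>: "\<And>n. 0 < \<sigma> n \<and> \<sigma> n < 4 - p" and lim: "\<sigma> \<longlonglongrightarrow> 0"
    and thr: "negative_threshold \<Omega> a b p \<sigma> lam0" and lam: "lam > lam0"
  shows "\<exists>v\<in>W012 \<Omega>. energy \<Omega> a b p lam v < 0"
proof -
  have S2: "S\<^sup>2 > 0" using S_pos by simp
  have lam_pos: "lam > 0" using thr lam by (auto simp: negative_threshold_def)
  have "(SUP n. INF u\<in>W012 \<Omega>. ereal (energy_approx \<Omega> a b p \<sigma> lam n u)) < 0"
    using thr lam by (simp add: negative_threshold_def)
  \<comment> \<open>\<open>z\<close> leaves a gap below 0 that is uniform in n.\<close>
  then obtain z where z: "(SUP n. INF u\<in>W012 \<Omega>. ereal (energy_approx \<Omega> a b p \<sigma> lam n u)) < ereal z" "ereal z < 0"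
    using ereal_dense2 by blast
  have z0: "z < 0" using z(2) by simp
  have "\<exists>u\<in>W012 \<Omega>. energy_approx \<Omega> a b p \<sigma> lam n u < z" for n
  proof -
    have "(INF u\<in>W012 \<Omega>. ereal (energy_approx \<Omega> a b p \<sigma> lam n u)) < ereal z"
      by (rule le_less_trans[OF SUP_upper z(1)]) simp
    then show ?thesis unfolding INF_less_iff by simp
  qed
  then obtain u where u: "\<And>n. u n \<in> W012 \<Omega>" "\<And>n. energy_approx \<Omega> a b p \<sigma> lam n (u n) < z" by metis
  \<comment> \<open>The margin \<open>b / 4 - 1 / (4 * S\<^sup>2)\<close> of the nonlocal term. Half
    of it pays for \<open>\<sigma> n * vol\<close>; the other half, against the power p, yields
    \<open>d powr \<eta> \<le> 2 * C / \<delta>\<close> and hence \<open>R\<close>.\<close>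
  define \<delta> where "\<delta> = (b - 1 / S\<^sup>2) / 4"
  have \<delta>: "\<delta> > 0" using b_large by (simp add: \<delta>_def)
  define C where "C = lam / p * (1 / S\<^sup>2 + vol)"
  \<comment> \<open>Once \<open>\<sigma> n < \<eta>\<close>, the exponents
    \<open>4 - \<sigma> n\<close> and \<open>p\<close> are at least \<open>\<eta>\<close>
    apart.\<close>
  define \<eta> where "\<eta> = (4 - p) / 2"
  have \<eta>: "\<eta> > 0" using p_lt by (simp add: \<eta>_def)
  define R where "R = max 1 ((2 * C / \<delta>) powr (1 / \<eta>))"
  have R1: "R \<ge> 1" by (simp add: R_def)
  have "\<forall>\<^sub>F n in sequentially. \<sigma> n * vol < \<delta> / 2 \<and> \<sigma> n < \<eta> \<and>
      z + b / 4 * (R ^ 4 * (R powr \<sigma> n - 1)) + \<sigma> n * vol < 0"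
  proof (intro eventually_conj)
    have "(\<lambda>n. \<sigma> n * vol) \<longlonglongrightarrow> 0 * vol" by (intro tendsto_intros lim)
    then show "\<forall>\<^sub>F n in sequentially. \<sigma> n * vol < \<delta> / 2" by (rule order_tendstoD) (use \<delta> in simp)
    show "\<forall>\<^sub>F n in sequentially. \<sigma> n < \<eta>" by (rule order_tendstoD(2)[OF lim \<eta>])
    have "(\<lambda>n. z + b / 4 * (R ^ 4 * (R powr \<sigma> n - 1)) + \<sigma> n * vol) \<longlonglongrightarrow> z + b / 4 * (R ^ 4 * (R powr 0 - 1)) + 0 * vol"
      using R1 by (intro tendsto_intros lim) auto
    then show "\<forall>\<^sub>F n in sequentially. z + b / 4 * (R ^ 4 * (R powr \<sigma> n - 1)) + \<sigma> n * vol < 0"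
      by (rule order_tendstoD) (use z0 R1 in simp)
  qed
  then obtain n where n: "\<sigma> n * vol < \<delta> / 2" "\<sigma> n < \<eta>"
      "z + b / 4 * (R ^ 4 * (R powr \<sigma> n - 1)) + \<sigma> n * vol < 0"
    unfolding eventually_sequentially by blast
  have s: "0 < \<sigma> n" "\<sigma> n < 4 - p" using \<sigma> by auto
  define q where "q = 4 - \<sigma> n"
  define d where "d = D (u n)"
  have q: "0 < q" "q < 4" "2 < q" "p < q" "\<eta> \<le> q - p" "4 - q = \<sigma> n" using s p_gt n(2) by (auto simp: q_def \<eta>_def)
  have I: "a / 2 * d ^ 2 + b / q * d powr q - 1 / q * P q (u n) - lam / p * P p (u n) < z"
    using u(2)[of n] unfolding energy_approx_eq[of \<sigma> n, OF s] q_def d_def .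
  have d0: "d \<ge> 0" by (simp add: d_def)
  have bq: "b / 4 \<le> b / q" using q b_pos by (intro divide_left_mono) auto
  have dR: "d \<le> R"
  proof (cases "d \<le> 1")
    case True
    then show ?thesis using R1 by simp
  next
    case False
    then have d1: "d > 1" by simp
    have dp: "D (u n) > 0" using d1 by (simp add: d_def)
    have Pq: "1 / q * P q (u n) \<le> d powr q * (1 / (4 * S\<^sup>2) + \<sigma> n * vol)"
    proof -
      have "1 / q * P q (u n) \<le> 1 / q * (d powr q * ((q / 4) / S\<^sup>2 + ((4 - q) / 4) * vol))"
        unfolding d_def using P_bound_D[OF u(1) q(1,2) dp] q by (intro mult_left_mono) auto
      also have "\<dots> = d powr q * (1 / (4 * S\<^sup>2) + \<sigma> n * vol * (1 / (4 * q)))"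
        unfolding q(6) using q(1) S2 by (simp add: distrib_left)
      also have "\<dots> \<le> d powr q * (1 / (4 * S\<^sup>2) + \<sigma> n * vol)"
        using q s by (intro mult_left_mono add_left_mono mult_right_le_one_le) auto
      finally show ?thesis .
    qed
    have Pp: "lam / p * P p (u n) \<le> C * d powr p"
    proof -
      have pp: "0 < p" using p_gt by simp
      have "P p (u n) \<le> d powr p * ((p / 4) / S\<^sup>2 + ((4 - p) / 4) * vol)"
        unfolding d_def by (rule P_bound_D[OF u(1) pp p_lt dp])
      also have "\<dots> \<le> d powr p * (1 / S\<^sup>2 + vol)"
      proof (intro mult_left_mono add_mono)
        show "(p / 4) / S\<^sup>2 \<le> 1 / S\<^sup>2" using p_lt S2 by (intro divide_right_mono) auto
        show "((4 - p) / 4) * vol \<le> vol" using p_gt p_lt by (intro mult_left_le_one_le) auto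
      qed simp
      finally have "lam / p * P p (u n) \<le> lam / p * (d powr p * (1 / S\<^sup>2 + vol))"
        using lam_pos p_gt by (intro mult_left_mono) auto
      then show ?thesis by (simp add: C_def mult_ac)
    qed
    have "b / 4 * d powr q \<le> b / q * d powr q" using bq by (rule mult_right_mono) simp
    moreover have "0 \<le> a / 2 * d ^ 2" using a_pos by simp
    moreover have "d powr q * (1 / (4 * S\<^sup>2) + \<sigma> n * vol) \<le> d powr q * (1 / (4 * S\<^sup>2) + \<delta> / 2)"
      using n(1) by (intro mult_left_mono) auto
    ultimately have "b / 4 * d powr q \<le> d powr q * (1 / (4 * S\<^sup>2) + \<delta> / 2) + C * d powr p"
      using I Pq Pp z0 by linarith
    then have "d powr q * (b / 4 - 1 / (4 * S\<^sup>2) - \<delta> / 2) \<le> C * d powr p"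
      by (simp add: algebra_simps)
    also have "b / 4 - 1 / (4 * S\<^sup>2) - \<delta> / 2 = \<delta> / 2" using S2 by (simp add: \<delta>_def field_simps)
    finally have "d powr q * (\<delta> / 2) \<le> C * d powr p" .
    moreover have "d powr q = d powr p * d powr (q - p)" by (simp flip: powr_add)
    ultimately have "d powr p * (d powr (q - p) * (\<delta> / 2)) \<le> d powr p * C" by (simp add: mult_ac)
    then have "d powr (q - p) * (\<delta> / 2) \<le> C" using d1 by (simp add: mult_le_cancel_left)
    then have "d powr (q - p) \<le> 2 * C / \<delta>" using \<delta> by (simp add: field_simps)
    moreover have "d powr \<eta> \<le> d powr (q - p)" using d1 q by (intro powr_mono) auto
    ultimately have "d powr \<eta> \<le> 2 * C / \<delta>" by simp
    then have "(d powr \<eta>) powr (1 / \<eta>) \<le> (2 * C / \<delta>) powr (1 / \<eta>)"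
      using \<eta> by (intro powr_mono2) auto
    then have "d \<le> (2 * C / \<delta>) powr (1 / \<eta>)" using \<eta> d1 by (simp add: powr_powr)
    then show ?thesis by (simp add: R_def)
  qed
  \<comment> \<open>The cost of replacing the exponent \<open>q\<close> by 4 in the nonlocal term;
    it tends to 0 because \<open>R powr \<sigma> n\<close> tends to 1.\<close>
  have dq: "d ^ 4 / 4 - d powr q / q \<le> R ^ 4 * (R powr \<sigma> n - 1) / 4"
  proof -
    have "d powr q / 4 \<le> d powr q / q" using q by (intro divide_left_mono) auto
    moreover have "d ^ 4 - d powr q \<le> R ^ 4 * (R powr \<sigma> n - 1)"
    proof (cases "d = 0")
      case True
      have "1 \<le> R powr \<sigma> n" using R1 s by (intro ge_one_powr_ge_zero) auto
      then show ?thesis using True R1 by simp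
    next
      case False
      then have dp: "d > 0" using d0 by simp
      have "d ^ 4 = d powr q * d powr \<sigma> n"
        using dp by (simp add: q_def powr_numeral flip: powr_add)
      then have "d ^ 4 - d powr q = d powr q * (d powr \<sigma> n - 1)" by (simp add: algebra_simps)
      also have "\<dots> \<le> d powr q * (R powr \<sigma> n - 1)"
        using dR d0 s by (intro mult_left_mono diff_right_mono powr_mono2) auto
      also have "\<dots> \<le> R ^ 4 * (R powr \<sigma> n - 1)"
      proof (rule mult_right_mono)
        have "d powr q \<le> R powr q" using dR d0 q by (intro powr_mono2) auto
        also have "\<dots> \<le> R powr 4" using R1 q by (intro powr_mono) auto
        also have "\<dots> = R ^ 4" using R1 by (simp add: powr_numeral)
        finally show "d powr q \<le> R ^ 4" .
        show "0 \<le> R powr \<sigma> n - 1" using R1 s ge_one_powr_ge_zero[of R "\<sigma> n"] by simp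
      qed
      finally show ?thesis .
    qed
    ultimately show ?thesis by simp
  qed
  \<comment> \<open>The same replacement in the critical term, by Young's inequality with weight
    1.\<close>
  have Pq1: "1 / q * P q (u n) \<le> X (u n) / 4 + \<sigma> n * vol"
  proof -
    have "P q (u n) \<le> (q / 4) * X (u n) + (\<sigma> n / 4) * vol"
      using P_weighted_bound[OF u(1)[of n] q(1,2), of 1] q(6) by simp
    then have "1 / q * P q (u n) \<le> 1 / q * ((q / 4) * X (u n) + (\<sigma> n / 4) * vol)"
      using q by (intro mult_left_mono) auto
    also have "\<dots> = X (u n) / 4 + \<sigma> n * vol * (1 / (4 * q))" using q by (simp add: field_simps)
    also have "\<dots> \<le> X (u n) / 4 + \<sigma> n * vol"
      using q s by (intro add_left_mono mult_right_le_one_le) auto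
    finally show ?thesis .
  qed
  have b1: "b / 4 * d ^ 4 - b / q * d powr q \<le> b / 4 * (R ^ 4 * (R powr \<sigma> n - 1))"
  proof -
    have "b / 4 * d ^ 4 - b / q * d powr q = b * (d ^ 4 / 4 - d powr q / q)"
      by (simp add: right_diff_distrib)
    also have "\<dots> \<le> b * (R ^ 4 * (R powr \<sigma> n - 1) / 4)"
      using dq b_pos by (intro mult_left_mono) auto
    also have "\<dots> = b / 4 * (R ^ 4 * (R powr \<sigma> n - 1))"
      by simp
    finally show ?thesis .
  qed
  have "energy \<Omega> a b p lam (u n) = a / 2 * d ^ 2 + b / 4 * d ^ 4 - X (u n) / 4 - lam / p * P p (u n)"
    by (simp add: energy_eq d_def)
  also have "\<dots> < 0"
    using I Pq1 b1 n(3) by linarith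
  finally show ?thesis using u(1) by blast
qed

section \<open>Tangent inequalities and the first variation\<close>

lemma quartic_tangent: "(t::real) ^ 4 + 4 * t ^ 3 * s \<le> (t + s) ^ 4"
proof -
  have "(t + s) ^ 4 - (t ^ 4 + 4 * t ^ 3 * s) = s\<^sup>2 * ((2 * t + s)\<^sup>2 + 2 * t\<^sup>2)"
    by (simp add: power2_eq_square power3_eq_cube power4_eq_xxxx algebra_simps)
  moreover have "\<dots> \<ge> 0" by simp
  ultimately show ?thesis by linarith
qed

text \<open>Convexity of the power: the left side is the tangent at \<open>t\<close>. It follows
  from Young's inequality for the product of \<open>t powr (r - 1)\<close> and
  \<open>\<bar>t + s\<bar>\<close>.\<close>

lemma powr_tangent:
  fixes t s r :: real
  assumes "t \<ge> 0" "r > 1"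
  shows "t powr r + r * (t powr (r - 1) * s) \<le> \<bar>t + s\<bar> powr r"
proof (cases "t = 0")
  case True
  then show ?thesis using assms by simp
next
  case False
  then have t: "t > 0" using assms by simp
  define y where "y = \<bar>t + s\<bar>"
  have tt: "t powr (r - 1) * t = t powr r"
    using t powr_mult_base[of t "r - 1"] by (simp add: mult.commute)
  have Y: "r * (t powr (r - 1) * y) \<le> (r - 1) * t powr r + y powr r"
  proof (cases "y = 0")
    case True
    then show ?thesis using assms by simp
  next
    case False
    then have "y > 0" by (simp add: y_def)
    then have "(t powr r) powr ((r - 1) / r) * (y powr r) powr (1 / r) \<le> ((r - 1) / r) * t powr r + (1 / r) * y powr r"
      using assms t by (intro Youngs_inequality_0) (auto simp: field_simps)
    then have "t powr (r - 1) * y \<le> ((r - 1) / r) * t powr r + (1 / r) * y powr r"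
      using assms \<open>y > 0\<close> by (simp add: powr_powr)
    then have "r * (t powr (r - 1) * y) \<le> r * (((r - 1) / r) * t powr r + (1 / r) * y powr r)"
      using assms by (intro mult_left_mono) auto
    also have "\<dots> = (r - 1) * t powr r + y powr r" using assms by (simp add: distrib_left)
    finally show ?thesis .
  qed
  have "r * (t powr (r - 1) * (t + s)) \<le> r * (t powr (r - 1) * y)"
    using assms by (intro mult_left_mono) (auto simp: y_def)
  moreover have "r * (t powr (r - 1) * (t + s)) = r * t powr r + r * (t powr (r - 1) * s)"
    unfolding distrib_left tt ..
  ultimately show ?thesis using Y unfolding y_def[symmetric] left_diff_distrib by linarith
qed

lemma mixed_product_le:
  fixes x y r s :: real
  assumes "x \<ge> 0" "y \<ge> 0" "r \<ge> 0"
  shows "x powr r * y \<le> x powr (r + 1) + y powr (r + 1)"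
proof (cases "x \<le> y")
  case True
  have "x powr r * y \<le> y powr r * y" using assms True by (intro mult_right_mono powr_mono2) auto
  also have "\<dots> = y powr (r + 1)" using assms powr_mult_base[of y r] by (simp add: mult.commute add.commute)
  finally show ?thesis by (simp add: add_increasing)
next
  case False
  have "x powr r * y \<le> x powr r * x" using assms False by (intro mult_left_mono) auto
  also have "\<dots> = x powr (r + 1)" using assms powr_mult_base[of x r] by (simp add: mult.commute add.commute)
  finally show ?thesis by (simp add: add_increasing2)
qed

lemma integrable_mixed:
  assumes u: "u \<in> W012 \<Omega>" "\<And>x. 0 \<le> u x" and v: "v \<in> W012 \<Omega>" and r: "0 \<le> r" "r \<le> 3"
  shows "integrable M (\<lambda>x. u x powr r * v x)"
proof (rule Bochner_Integration.integrable_bound)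
  show "integrable M (\<lambda>x. \<bar>u x\<bar> powr (r + 1) + \<bar>v x\<bar> powr (r + 1))"
    using r by (intro Bochner_Integration.integrable_add P_integrable u v) auto
  have [measurable]: "u \<in> borel_measurable M" "v \<in> borel_measurable M"
    using W012_measurable u v by auto
  show "(\<lambda>x. u x powr r * v x) \<in> borel_measurable M" by measurable
  show "AE x in M. norm (u x powr r * v x) \<le> norm (\<bar>u x\<bar> powr (r + 1) + \<bar>v x\<bar> powr (r + 1))"
  proof (intro AE_I2)
    fix x
    show "norm (u x powr r * v x) \<le> norm (\<bar>u x\<bar> powr (r + 1) + \<bar>v x\<bar> powr (r + 1))"
      using mixed_product_le[OF u(2)[of x] abs_ge_zero[of "v x"] r(1)] u(2)[of x] by (simp add: abs_mult)
  qed
qed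

text \<open>The nonlinear terms are convex and enter with a minus sign, so their tangents bound the
  energy of \<open>u + t v\<close> by a polynomial \<open>Q t\<close>, with equality at 0. As
  \<open>u\<close> minimizes, 0 is a minimum point of \<open>Q\<close>, and the derivative of
  \<open>Q\<close> there is the equation; no derivative is taken under an integral.\<close>

lemma Euler_Lagrange:
  assumes lam: "lam > 0" and u: "u \<in> W012 \<Omega>" "\<And>x. 0 \<le> u x"
    and min: "\<And>v. v \<in> W012 \<Omega> \<Longrightarrow> energy \<Omega> a b p lam u \<le> energy \<Omega> a b p lam v"
    and v: "v \<in> W012 \<Omega>"
  shows "(a + b * (D u)\<^sup>2) * (LINT x|M. wgrad \<Omega> u x \<bullet> wgrad \<Omega> v x)
    - (LINT x|M. u x ^ 3 * v x) - lam * (LINT x|M. u x powr (p - 1) * v x) = 0"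
proof -
  define g where "g = (LINT x|M. wgrad \<Omega> u x \<bullet> wgrad \<Omega> v x)"
  define A where "A = (LINT x|M. u x ^ 3 * v x)"
  define B where "B = (LINT x|M. u x powr (p - 1) * v x)"
  have pw3: "u x ^ 3 = u x powr 3" for x using u(2)[of x] by (simp add: powr_numeral)
  have iA: "integrable M (\<lambda>x. u x ^ 3 * v x)" unfolding pw3 by (rule integrable_mixed[OF u v]) auto
  have iB: "integrable M (\<lambda>x. u x powr (p - 1) * v x)" using p_gt p_lt by (intro integrable_mixed[OF u v]) auto
  define N where "N t = (D u)\<^sup>2 + 2 * t * g + t\<^sup>2 * (D v)\<^sup>2" for t
  define Q where "Q t = a / 2 * N t + b / 4 * (N t)\<^sup>2 - (X u + 4 * t * A) / 4 - lam / p * (P p u + p * (t * B))" for t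
  have le: "energy \<Omega> a b p lam (\<lambda>x. u x + t * v x) \<le> Q t" for t
  proof -
    let ?w = "\<lambda>x. u x + t * v x"
    have W: "?w \<in> W012 \<Omega>" by (rule W012_lincomb(1)[OF open_domain u(1) v])
    have "D ?w = l2 M (\<lambda>x. wgrad \<Omega> u x + t *\<^sub>R wgrad \<Omega> v x)"
      unfolding Dnorm_def Lnorm_2
      by (intro l2_cong_AE sqint_measurable W012_D(2)[OF open_domain] W sqint_add sqint_scaleR u(1) v
          W012_lincomb(2)[OF open_domain u(1) v])
    then have DN: "(D ?w)\<^sup>2 = N t"
      using l2_sq_add[OF W012_D(2)[OF open_domain u(1)] W012_D(2)[OF open_domain v], of t]
      by (simp add: N_def g_def Dnorm_def Lnorm_2)
    have D4: "D ?w ^ 4 = (N t)\<^sup>2" unfolding DN[symmetric] by (simp flip: power_mult)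
    have X: "X u + 4 * t * A \<le> X ?w"
    proof -
      have "X u + 4 * t * A = (LINT x|M. u x ^ 4 + 4 * t * (u x ^ 3 * v x))"
        using iA X_integrable[OF u(1)] by (simp add: X_def A_def)
      also have "\<dots> \<le> X ?w" unfolding X_def
      proof (rule integral_mono)
        show "integrable M (\<lambda>x. u x ^ 4 + 4 * t * (u x ^ 3 * v x))" using iA X_integrable[OF u(1)] by simp
        show "integrable M (\<lambda>x. ?w x ^ 4)" by (rule X_integrable[OF W])
        show "u x ^ 4 + 4 * t * (u x ^ 3 * v x) \<le> ?w x ^ 4" for x
          using quartic_tangent[of "u x" "t * v x"] by (simp add: mult_ac)
      qed
      finally show ?thesis .
    qed
    have P: "P p u + p * (t * B) \<le> P p ?w"
    proof -
      have iP: "integrable M (\<lambda>x. \<bar>u x\<bar> powr p)" using P_integrable[OF u(1), of p] p_gt p_lt by simp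
      have "P p u + p * (t * B) = (LINT x|M. \<bar>u x\<bar> powr p + p * (t * (u x powr (p - 1) * v x)))"
        using iB iP by (simp add: P_def B_def)
      also have "\<dots> \<le> P p ?w" unfolding P_def
      proof (rule integral_mono)
        show "integrable M (\<lambda>x. \<bar>u x\<bar> powr p + p * (t * (u x powr (p - 1) * v x)))" using iB iP by simp
        show "integrable M (\<lambda>x. \<bar>?w x\<bar> powr p)" using P_integrable[OF W, of p] p_gt p_lt by simp
        show "\<bar>u x\<bar> powr p + p * (t * (u x powr (p - 1) * v x)) \<le> \<bar>?w x\<bar> powr p" for x
          using powr_tangent[OF u(2)[of x], of p "t * v x"] u(2)[of x] p_gt by (simp add: mult_ac)
      qed
      finally show ?thesis .
    qed
    have "lam / p * (P p u + p * (t * B)) \<le> lam / p * P p ?w"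
      using P lam p_gt by (intro mult_left_mono) auto
    then show ?thesis unfolding energy_eq DN D4 Q_def using X
      by (intro diff_mono divide_right_mono order_refl) auto
  qed
  have "Q 0 = energy \<Omega> a b p lam u"
    unfolding Q_def N_def energy_eq by (simp flip: power_mult)
  then have "Q 0 \<le> Q t" for t
    using min[OF W012_lincomb(1)[OF open_domain u(1) v, of t]] le[of t] by linarith
  moreover have "(Q has_real_derivative (a / 2 * (2 * g) + b / 4 * (2 * (D u)\<^sup>2 * (2 * g)) - A - lam / p * (p * B))) (at 0)"
    unfolding Q_def N_def by (auto intro!: derivative_eq_intros simp: power2_eq_square)
  ultimately have "a / 2 * (2 * g) + b / 4 * (2 * (D u)\<^sup>2 * (2 * g)) - A - lam / p * (p * B) = 0"
    by (intro DERIV_local_min[of Q _ 0 1]) auto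
  moreover have "lam / p * (p * B) = lam * B" using p_gt by simp
  ultimately show ?thesis
    unfolding g_def[symmetric] A_def[symmetric] B_def[symmetric] by (simp add: algebra_simps)
qed

end

subsection \<open>Positivity of the minimizer\<close>

lemma emeasure_cball4_le:
  assumes "l > 0" shows "emeasure lborel (cball 0 l :: (real^4) set) \<le> ennreal (16 * l ^ 4)"
proof -
  have "cball 0 l \<subseteq> (cbox (\<chi> i. - l) (\<chi> i. l) :: (real^4) set)"
  proof
    fix x :: "real^4" assume "x \<in> cball 0 l"
    then have "\<bar>x $ i\<bar> \<le> l" for i using component_le_norm_cart[of x i] by simp
    then show "x \<in> cbox (\<chi> i. - l) (\<chi> i. l)" by (auto simp: mem_box_cart abs_le_iff minus_le_iff)
  qed
  from emeasure_mono[OF this, of lborel] show ?thesis by (simp add: emeasure_cube4[OF assms])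
qed

lemma sqint_translate:
  fixes f :: "'a::euclidean_space \<Rightarrow> 'b::euclidean_space"
  assumes "sqint lborel f"
  shows "sqint lborel (\<lambda>x. f (h + x))" "l2 lborel (\<lambda>x. f (h + x)) = l2 lborel f"
proof -
  have [measurable]: "f \<in> borel_measurable borel" using sqint_measurable[OF assms] by simp
  show "sqint lborel (\<lambda>x. f (h + x))"
    unfolding sqint_def
    using integrable_translate[OF sqint_integrable[OF assms], of h] by simp
  have "(LINT x|lborel. (norm (f (h + x)))\<^sup>2) = (LINT x|lborel. (norm (f x))\<^sup>2)"
    by (rule integral_translate[of "\<lambda>x. (norm (f x))\<^sup>2"]) measurable
  then show "l2 lborel (\<lambda>x. f (h + x)) = l2 lborel f" by (simp add: l2_def)
qed

text \<open>Approximation by test functions: the error enters once at \<open>x\<close> and once at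
  the shifted point, hence the factor 2 in the proof.\<close>

lemma W012_translation:
  assumes "open \<Omega>" "u \<in> W012 \<Omega>" and um: "u \<in> borel_measurable borel" and out: "\<And>x. x \<notin> \<Omega> \<Longrightarrow> u x = 0"
  shows "sqint lborel u" "l2 lborel (\<lambda>x. u (h + x) - u x) \<le> norm h * Dnorm \<Omega> u"
proof -
  let ?M = "lebesgue_on \<Omega>"
  note [measurable] = um
  have \<Omega>: "\<Omega> \<in> sets borel" using assms(1) by simp
  show su: "sqint lborel u"
    using sqint_lebesgue_on_eq(1)[OF um \<Omega> out] W012_D(1)[OF assms(1,2)] by simp
  obtain \<phi> where \<phi>: "\<And>n. \<phi> n \<in> test_functions \<Omega>" "(\<lambda>n. l2 ?M (\<lambda>x. \<phi> n x - u x)) \<longlonglongrightarrow> 0"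
    "(\<lambda>n. l2 ?M (\<lambda>x. grad (\<phi> n) x - wgrad \<Omega> u x)) \<longlonglongrightarrow> 0"
    using W012_D(4)[OF assms(1,2)] by blast
  have e: "l2 ?M (\<lambda>x. \<phi> n x - u x) = l2 lborel (\<lambda>x. \<phi> n x - u x)" for n
  proof -
    have [measurable]: "\<phi> n \<in> borel_measurable borel" using test_integrable(2)[OF \<phi>(1)] .
    show ?thesis by (rule sqint_lebesgue_on_eq(2)) (use \<Omega> test_zero_outside[OF \<phi>(1)] out in auto)
  qed
  have "(\<lambda>n. l2 ?M (grad (\<phi> n))) \<longlonglongrightarrow> Dnorm \<Omega> u"
    unfolding Dnorm_def Lnorm_2
    by (rule l2_tendsto[OF test_sqint(2)[OF \<phi>(1) assms(1)] W012_D(2)[OF assms(1,2)] \<phi>(3)])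
  then have lim: "(\<lambda>n. 2 * l2 lborel (\<lambda>x. \<phi> n x - u x) + norm h * l2 ?M (grad (\<phi> n))) \<longlonglongrightarrow> 2 * 0 + norm h * Dnorm \<Omega> u"
    using \<phi>(2) unfolding e by (intro tendsto_intros)
  have le: "l2 lborel (\<lambda>x. u (h + x) - u x) \<le> 2 * l2 lborel (\<lambda>x. \<phi> n x - u x) + norm h * l2 ?M (grad (\<phi> n))" for n
  proof -
    have s\<phi>: "sqint lborel (\<phi> n)" using test_integrable(6)[OF \<phi>(1)] .
    have d: "l2 lborel (\<lambda>x. \<phi> n (h + x) - \<phi> n x) \<le> norm h * l2 lborel (grad (\<phi> n))"
    proof -
      have i: "integrable lborel (\<lambda>x. (norm (\<phi> n (h + x) - \<phi> n x))\<^sup>2)"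
        by (rule sqint_integrable[OF sqint_diff[OF sqint_translate(1)[OF s\<phi>] s\<phi>]])
      have "ennreal ((l2 lborel (\<lambda>x. \<phi> n (h + x) - \<phi> n x))\<^sup>2) = (\<integral>\<^sup>+x. ennreal ((\<phi> n (h + x) - \<phi> n x)\<^sup>2) \<partial>lborel)"
        unfolding l2_sq using nn_integral_eq_integral[OF i] by simp
      also have "\<dots> \<le> ennreal ((norm h * l2 lborel (grad (\<phi> n)))\<^sup>2)"
        by (rule test_translation_estimate[OF \<phi>(1)])
      finally have "(l2 lborel (\<lambda>x. \<phi> n (h + x) - \<phi> n x))\<^sup>2 \<le> (norm h * l2 lborel (grad (\<phi> n)))\<^sup>2"
        by (simp add: ennreal_le_iff)
      then show ?thesis by (rule power2_le_imp_le) simp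
    qed
    have "l2 lborel (\<lambda>x. u (h + x) - u x) \<le> l2 lborel (\<lambda>x. u (h + x) - \<phi> n (h + x)) + l2 lborel (\<lambda>x. \<phi> n (h + x) - u x)"
      by (rule l2_triangle_diff[OF sqint_translate(1)[OF su] sqint_translate(1)[OF s\<phi>] su])
    also have "l2 lborel (\<lambda>x. \<phi> n (h + x) - u x) \<le> l2 lborel (\<lambda>x. \<phi> n (h + x) - \<phi> n x) + l2 lborel (\<lambda>x. \<phi> n x - u x)"
      by (rule l2_triangle_diff[OF sqint_translate(1)[OF s\<phi>] s\<phi> su])
    also have "l2 lborel (\<lambda>x. u (h + x) - \<phi> n (h + x)) = l2 lborel (\<lambda>x. \<phi> n x - u x)"
      using sqint_translate(2)[OF sqint_diff[OF su s\<phi>], of h] by (simp add: l2_minus_commute[of lborel u])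
    finally show ?thesis using d test_sqint(4)[OF \<phi>(1)[of n] assms(1)] by simp
  qed
  show "l2 lborel (\<lambda>x. u (h + x) - u x) \<le> norm h * Dnorm \<Omega> u"
    using LIMSEQ_le_const[OF lim] le by simp
qed

text \<open>\<open>s\<close> stands for a squared distance. Division by \<open>r ^ 4\<close> makes
  the total mass in four dimensions independent of \<open>r\<close>, and \<open>bump 2\<close> is
  the derivative of \<open>bump 0\<close>, which links \<open>kern'\<close> to the Laplacian in
  \<open>radial_bump\<close>.\<close>

definition kern :: "real \<Rightarrow> real \<Rightarrow> real" where
  "kern r s = bump 2 (1 - s / r\<^sup>2) / r ^ 4"

definition kern' :: "real \<Rightarrow> real \<Rightarrow> real" where
  "kern' r s = (bump 4 (1 - s / r\<^sup>2) - 2 * bump 3 (1 - s / r\<^sup>2)) * (2 * s / r ^ 3) / r ^ 4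
    - 4 * bump 2 (1 - s / r\<^sup>2) / r ^ 5"

lemma kern_nonneg: "r > 0 \<Longrightarrow> 0 \<le> kern r s"
  by (simp add: kern_def)

lemma kern_le: "r > 0 \<Longrightarrow> kern r s \<le> 2 / r ^ 4"
  using bump_le_fact[of 2] by (simp add: kern_def divide_right_mono numeral_2_eq_2)

lemma kern_outside: "r > 0 \<Longrightarrow> r\<^sup>2 < s \<Longrightarrow> kern r s = 0"
  by (simp add: kern_def bump_def)

lemma kern_pos: "r > 0 \<Longrightarrow> s < r\<^sup>2 \<Longrightarrow> 0 < kern r s"
  by (simp add: kern_def bump_def)

lemma kern_has_derivative:
  assumes "r > 0"
  shows "((\<lambda>r. kern r s) has_real_derivative kern' r s) (at r)"
proof -
  have 1: "((\<lambda>r. 1 - s / r\<^sup>2) has_real_derivative (2 * s / r ^ 3)) (at r)"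
    using assms by (auto intro!: derivative_eq_intros simp: power2_eq_square power3_eq_cube field_simps)
  have "(bump 2 has_field_derivative (bump 4 t - 2 * bump 3 t)) (at t)" for t
    using bump_has_derivative[of 2 t] by simp
  from DERIV_chain2[OF this 1]
  have "((\<lambda>r. bump 2 (1 - s / r\<^sup>2)) has_real_derivative
      (bump 4 (1 - s / r\<^sup>2) - 2 * bump 3 (1 - s / r\<^sup>2)) * (2 * s / r ^ 3)) (at r)" .
  then have "((\<lambda>r. bump 2 (1 - s / r\<^sup>2) / r ^ 4) has_real_derivative
      ((bump 4 (1 - s / r\<^sup>2) - 2 * bump 3 (1 - s / r\<^sup>2)) * (2 * s / r ^ 3) * r ^ 4
        - bump 2 (1 - s / r\<^sup>2) * (4 * r ^ 3)) / (r ^ 4 * r ^ 4)) (at r)"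
    using assms by (auto intro!: derivative_eq_intros)
  moreover have "((bump 4 (1 - s / r\<^sup>2) - 2 * bump 3 (1 - s / r\<^sup>2)) * (2 * s / r ^ 3) * r ^ 4
        - bump 2 (1 - s / r\<^sup>2) * (4 * r ^ 3)) / (r ^ 4 * r ^ 4) = kern' r s"
  proof -
    have "(A * r ^ 4 - C * (4 * r ^ 3)) / (r ^ 4 * r ^ 4) = A / r ^ 4 - 4 * C / r ^ 5" for A C
      using assms by (simp add: field_simps eval_nat_numeral)
    then show ?thesis unfolding kern'_def by blast
  qed
  ultimately show ?thesis unfolding kern_def by simp
qed

lemma kern'_bound:
  assumes "r > 0" "s \<ge> 0" shows "\<bar>kern' r s\<bar> \<le> 80 / r ^ 5"
proof (cases "s \<le> r\<^sup>2")
  case True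
  \<comment> \<open>Bounds by factorials: 24 + 2 * 6 = 36 and 4 * 2 = 8. With
    \<open>s \<le> r\<^sup>2\<close> they add up to 2 * 36 + 8 = 80.\<close>
  have B: "\<bar>bump 4 t - 2 * bump 3 t\<bar> \<le> 36" "\<bar>4 * bump 2 t\<bar> \<le> 8" for t
  proof -
    have "bump 4 t \<le> 24" "bump 3 t \<le> 6" "bump 2 t \<le> 2"
      using bump_le_fact[of 4 t] bump_le_fact[of 3 t] bump_le_fact[of 2 t] by (simp_all add: fact_numeral)
    then show "\<bar>bump 4 t - 2 * bump 3 t\<bar> \<le> 36" "\<bar>4 * bump 2 t\<bar> \<le> 8"
      using bump_nonneg[of 4 t] bump_nonneg[of 3 t] bump_nonneg[of 2 t] by linarith+
  qed
  have "2 * s / r ^ 3 \<le> 2 / r"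
    using True assms by (simp add: divide_le_eq power2_eq_square power3_eq_cube)
  then have "\<bar>(bump 4 (1 - s / r\<^sup>2) - 2 * bump 3 (1 - s / r\<^sup>2)) * (2 * s / r ^ 3)\<bar> \<le> 36 * (2 / r)"
    unfolding abs_mult using B(1) assms by (intro mult_mono) auto
  moreover define A where "A = (bump 4 (1 - s / r\<^sup>2) - 2 * bump 3 (1 - s / r\<^sup>2)) * (2 * s / r ^ 3)"
  ultimately have "\<bar>A\<bar> / r ^ 4 \<le> 36 * (2 / r) / r ^ 4"
    using assms by (intro divide_right_mono) auto
  also have "\<dots> = 72 / r ^ 5" using assms by (simp add: eval_nat_numeral)
  also have "\<bar>A\<bar> / r ^ 4 = \<bar>A / r ^ 4\<bar>" using assms by simp
  finally have 1: "\<bar>(bump 4 (1 - s / r\<^sup>2) - 2 * bump 3 (1 - s / r\<^sup>2)) * (2 * s / r ^ 3) / r ^ 4\<bar> \<le> 72 / r ^ 5"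
    unfolding A_def .
  have 2: "\<bar>4 * bump 2 (1 - s / r\<^sup>2) / r ^ 5\<bar> \<le> 8 / r ^ 5"
    unfolding abs_divide using B(2) assms by (simp add: divide_right_mono)
  have "72 / r ^ 5 + 8 / r ^ 5 = 80 / r ^ 5" by (simp flip: add_divide_distrib)
  then show ?thesis
    unfolding kern'_def using order_trans[OF abs_triangle_ineq4 add_mono[OF 1 2]] by (simp only:)
next
  case False
  then have "\<not> 1 - s / r\<^sup>2 > 0" using assms by (simp add: field_simps)
  then show ?thesis using assms by (simp add: kern'_def bump_def)
qed

lemma grad_inner_of_derivative:
  assumes "(f has_derivative f') (at x)" "i \<in> Basis"
  shows "grad f x \<bullet> i = f' i"
  using grad_inner_Basis[OF assms(2)] frechet_derivative_at[OF assms(1)] by metis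

text \<open>By scaling, \<open>kern' r\<close> is \<open>- 1 / r\<close> times the divergence of the
  vector field given by \<open>y - x\<close> times the kernel, and the gradient of
  \<open>\<psi>\<close> is \<open>- 2 * r\<^sup>2\<close> times that same field.\<close>

lemma radial_bump:
  fixes x :: "real^4"
  assumes r: "r > 0"
  defines "\<psi> \<equiv> \<lambda>y. bump 0 (1 - (norm (y - x))\<^sup>2 / r\<^sup>2)"
  shows "cball x r \<subseteq> \<Omega> \<Longrightarrow> \<psi> \<in> test_functions \<Omega>"
    and "lap \<psi> y = 2 * r ^ 3 * kern' r ((norm (y - x))\<^sup>2)"
proof -
  let ?th = "\<lambda>y. 1 - (norm (y - x))\<^sup>2 / r\<^sup>2"
  have sm: "smooth \<psi>"
  proof -
    have "smooth (\<lambda>y. 1 - (1 / r\<^sup>2) * (norm (y - x))\<^sup>2)"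
      by (intro smooth_diff smooth_const smooth_cmult smooth_norm_sq)
    then show ?thesis unfolding \<psi>_def by (intro smooth_bump_comp) simp
  qed
  show "\<psi> \<in> test_functions \<Omega>" if "cball x r \<subseteq> \<Omega>"
  proof -
    have "\<psi> y = 0" if "y \<notin> cball x r" for y
    proof -
      have "r < norm (y - x)" using that by (simp add: dist_norm norm_minus_commute)
      then have "r\<^sup>2 < (norm (y - x))\<^sup>2" using r by (intro power_strict_mono) auto
      then show ?thesis using r by (simp add: \<psi>_def bump_def)
    qed
    then show ?thesis unfolding test_functions_def using sm that compact_cball[of x r] by blast
  qed
  have th: "(?th has_derivative (\<lambda>v. (-2 / r\<^sup>2) * ((y - x) \<bullet> v))) (at y)" for y
  proof -
    have "((\<lambda>y. (y - x) \<bullet> (y - x)) has_derivative (\<lambda>v. 2 * ((y - x) \<bullet> v))) (at y)"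
      by (auto intro!: derivative_eq_intros simp: inner_commute)
    then have "((\<lambda>y. 1 - (1 / r\<^sup>2) * ((y - x) \<bullet> (y - x))) has_derivative (\<lambda>v. 0 - (1 / r\<^sup>2) * (2 * ((y - x) \<bullet> v)))) (at y)"
      by (intro has_derivative_diff has_derivative_const has_derivative_mult_right)
    moreover have "?th = (\<lambda>y. 1 - (1 / r\<^sup>2) * ((y - x) \<bullet> (y - x)))" by (simp add: power2_norm_eq_inner)
    ultimately show ?thesis by (simp only:) (rule has_derivative_eq_rhs, auto)
  qed
  have bt: "((\<lambda>y. bump n (?th y)) has_derivative
      (\<lambda>v. (bump (n+2) (?th y) - real n * bump (n+1) (?th y)) * ((-2 / r\<^sup>2) * ((y - x) \<bullet> v)))) (at y)" for n y
    using has_derivative_compose[OF th bump_has_derivative[of n, unfolded has_field_derivative_def]] .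
  have g1: "grad \<psi> y \<bullet> i = (-2 / r\<^sup>2) * (bump 2 (?th y) * ((y - x) \<bullet> i))" if "i \<in> Basis" for y i
    using grad_inner_of_derivative[OF bt[of 0 y] that] by (simp add: \<psi>_def numeral_2_eq_2)
  have g2: "grad (\<lambda>y. grad \<psi> y \<bullet> i) y \<bullet> i =
      (-2 / r\<^sup>2) * (bump 2 (?th y) + (bump 4 (?th y) - 2 * bump 3 (?th y)) * (-2 / r\<^sup>2) * ((y - x) \<bullet> i)\<^sup>2)"
    if i: "i \<in> Basis" for i
  proof -
    have lin: "((\<lambda>y. (y - x) \<bullet> i) has_derivative (\<lambda>v. v \<bullet> i)) (at y)"
      by (auto intro!: derivative_eq_intros)
    have "((\<lambda>y. (-2 / r\<^sup>2) * (bump 2 (?th y) * ((y - x) \<bullet> i))) has_derivative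
        (\<lambda>v. (-2 / r\<^sup>2) * (bump 2 (?th y) * (v \<bullet> i) +
          (bump (2+2) (?th y) - real 2 * bump (2+1) (?th y)) * ((-2 / r\<^sup>2) * ((y - x) \<bullet> v)) * ((y - x) \<bullet> i)))) (at y)"
      by (rule has_derivative_mult_right[OF has_derivative_mult[OF bt[of 2 y] lin]])
    from grad_inner_of_derivative[OF this i] show ?thesis
      unfolding g1[OF i] using i by (simp add: inner_Basis power2_eq_square mult.assoc)
  qed
  have s: "(\<Sum>i\<in>Basis. ((y - x) \<bullet> i)\<^sup>2) = (norm (y - x))\<^sup>2"
    unfolding power2_norm_eq_inner euclidean_inner[of "y - x" "y - x"] by (simp add: power2_eq_square)
  define \<beta> where "\<beta> = bump 4 (?th y) - 2 * bump 3 (?th y)"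
  have "lap \<psi> y = (\<Sum>i\<in>Basis. (-2 / r\<^sup>2) * bump 2 (?th y) + (-2 / r\<^sup>2) * (\<beta> * (-2 / r\<^sup>2)) * ((y - x) \<bullet> i)\<^sup>2)"
    unfolding lap_def \<beta>_def by (rule sum.cong[OF refl]) (simp only: g2 distrib_left mult.assoc)
  also have "\<dots> = 4 * ((-2 / r\<^sup>2) * bump 2 (?th y)) + (-2 / r\<^sup>2) * (\<beta> * (-2 / r\<^sup>2)) * (norm (y - x))\<^sup>2"
    unfolding sum.distrib sum_distrib_left[symmetric] s by simp
  also have "\<dots> = 2 * r ^ 3 * kern' r ((norm (y - x))\<^sup>2)"
    unfolding kern'_def \<beta>_def[symmetric] using r by (simp add: field_simps eval_nat_numeral)
  finally show "lap \<psi> y = 2 * r ^ 3 * kern' r ((norm (y - x))\<^sup>2)" .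
qed

lemma DERIV_under_integral:
  fixes K K' :: "real \<Rightarrow> 'a \<Rightarrow> real"
  assumes u: "integrable M u" and e: "e > 0"
    and int: "\<And>r. \<bar>r - r0\<bar> < e \<Longrightarrow> integrable M (\<lambda>y. u y * K r y)"
    and der: "\<And>r y. \<bar>r - r0\<bar> < e \<Longrightarrow> ((\<lambda>r. K r y) has_real_derivative K' r y) (at r)"
    and bd: "\<And>r y. \<bar>r - r0\<bar> < e \<Longrightarrow> \<bar>K' r y\<bar> \<le> C"
    and m: "K' r0 \<in> borel_measurable M"
  shows "((\<lambda>r. LINT y|M. u y * K r y) has_real_derivative (LINT y|M. u y * K' r0 y)) (at r0)"
  unfolding DERIV_def tendsto_at_iff_sequentially
proof (intro allI impI)
  fix X :: "nat \<Rightarrow> real" assume X: "\<forall>i. X i \<in> UNIV - {0}" "X \<longlonglongrightarrow> 0"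
  have [measurable]: "u \<in> borel_measurable M" "K' r0 \<in> borel_measurable M"
    using borel_measurable_integrable[OF u] m by auto
  obtain N where N: "\<And>n. n \<ge> N \<Longrightarrow> \<bar>X n\<bar> < e" using LIMSEQ_D[OF X(2) e] by auto
  \<comment> \<open>Dropping the first terms keeps every increment inside the interval where the
    hypotheses hold.\<close>
  define Y where "Y n = X (n + N)" for n
  have Y: "Y n \<noteq> 0" "\<bar>Y n\<bar> < e" for n using X(1) N by (auto simp: Y_def)
  have Ylim: "Y \<longlonglongrightarrow> 0" unfolding Y_def by (rule LIMSEQ_ignore_initial_segment[OF X(2)])
  have i0: "integrable M (\<lambda>y. u y * K r0 y)" using int[of r0] e by simp
  have iY: "integrable M (\<lambda>y. u y * K (r0 + Y n) y)" for n using int[of "r0 + Y n"] Y by simp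
  let ?q = "\<lambda>n y. (u y * K (r0 + Y n) y - u y * K r0 y) / Y n"
  have "(\<lambda>n. LINT y|M. ?q n y) \<longlonglongrightarrow> (LINT y|M. u y * K' r0 y)"
  proof (rule integral_dominated_convergence[where w="\<lambda>y. C * \<bar>u y\<bar>"])
    show "integrable M (\<lambda>y. C * \<bar>u y\<bar>)" using u by simp
    show "(\<lambda>y. u y * K' r0 y) \<in> borel_measurable M" by measurable
    show "?q n \<in> borel_measurable M" for n
      using borel_measurable_integrable[OF iY[of n]] borel_measurable_integrable[OF i0] by measurable
    show "AE y in M. (\<lambda>n. ?q n y) \<longlonglongrightarrow> u y * K' r0 y"
    proof (intro AE_I2)
      fix y
      have "((\<lambda>h. (K (r0 + h) y - K r0 y) / h) \<longlongrightarrow> K' r0 y) (at 0)"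
        using der[of r0 y] e by (simp add: DERIV_def)
      moreover have "filterlim Y (at 0) sequentially" unfolding filterlim_at using Ylim Y by simp
      ultimately have "(\<lambda>n. (K (r0 + Y n) y - K r0 y) / Y n) \<longlonglongrightarrow> K' r0 y" by (rule filterlim_compose)
      then have "(\<lambda>n. u y * ((K (r0 + Y n) y - K r0 y) / Y n)) \<longlonglongrightarrow> u y * K' r0 y" by (intro tendsto_intros)
      then show "(\<lambda>n. ?q n y) \<longlonglongrightarrow> u y * K' r0 y" by (simp add: right_diff_distrib)
    qed
    show "AE y in M. norm (?q n y) \<le> C * \<bar>u y\<bar>" for n
    proof (intro AE_I2)
      fix y
      have "norm (K (r0 + Y n) y - K r0 y) \<le> C * norm (r0 + Y n - r0)"
      proof (rule field_differentiable_bound[where S="ball r0 e" and f'="\<lambda>r. K' r y"])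
        fix r assume "r \<in> ball r0 e"
        then have r: "\<bar>r - r0\<bar> < e" by (simp add: dist_real_def abs_minus_commute)
        show "((\<lambda>r. K r y) has_field_derivative K' r y) (at r within ball r0 e)"
          using der[OF r] by (rule has_field_derivative_at_within)
        show "norm (K' r y) \<le> C" using bd[OF r] by simp
      qed (use Y e in \<open>auto simp: dist_real_def\<close>)
      then have "\<bar>K (r0 + Y n) y - K r0 y\<bar> / \<bar>Y n\<bar> \<le> C" using Y(1)[of n] by (simp add: divide_le_eq)
      then have "\<bar>u y\<bar> * (\<bar>K (r0 + Y n) y - K r0 y\<bar> / \<bar>Y n\<bar>) \<le> \<bar>u y\<bar> * C" by (rule mult_left_mono) simp
      then show "norm (?q n y) \<le> C * \<bar>u y\<bar>"
        by (simp add: right_diff_distrib[symmetric] abs_mult mult.commute)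
    qed
  qed
  moreover have "(LINT y|M. ?q n y) = ((LINT y|M. u y * K (r0 + Y n) y) - (LINT y|M. u y * K r0 y)) / Y n" for n
    using iY i0 by simp
  ultimately have "(\<lambda>n. ((LINT y|M. u y * K (r0 + Y n) y) - (LINT y|M. u y * K r0 y)) / Y n) \<longlonglongrightarrow> (LINT y|M. u y * K' r0 y)"
    by (simp only:)
  then have "(\<lambda>n. ((LINT y|M. u y * K (r0 + X (n + N)) y) - (LINT y|M. u y * K r0 y)) / X (n + N)) \<longlonglongrightarrow> (LINT y|M. u y * K' r0 y)"
    by (simp only: Y_def)
  from LIMSEQ_offset[OF this]
  show "((\<lambda>h. ((LINT y|M. u y * K (r0 + h) y) - (LINT y|M. u y * K r0 y)) / h) \<circ> X) \<longlonglongrightarrow> (LINT y|M. u y * K' r0 y)"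
    by (simp add: o_def)
qed

text \<open>By Lindelof's theorem countably many of the balls suffice, so their null sets can be
  united.\<close>

lemma locally_AE_imp_AE:
  fixes \<Omega> :: "'a::euclidean_space set"
  assumes "\<And>x. x \<in> \<Omega> \<Longrightarrow> \<exists>r>0. AE y in lborel. y \<in> ball x r \<longrightarrow> Q y"
  shows "AE y in lborel. y \<in> \<Omega> \<longrightarrow> Q y"
proof -
  define F where "F = {ball x r | x r. AE y in lborel. y \<in> ball x r \<longrightarrow> Q y}"
  obtain F' where F': "F' \<subseteq> F" "countable F'" "\<Union>F' = \<Union>F"
    by (rule Lindelof[of F]) (auto simp: F_def)
  have "AE y in lborel. \<forall>B\<in>F'. y \<in> B \<longrightarrow> Q y"
    unfolding AE_ball_countable[OF F'(2)] using F'(1) by (auto simp: F_def)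
  moreover have "\<Omega> \<subseteq> \<Union>F'"
  proof
    fix x assume "x \<in> \<Omega>"
    then obtain r where "r > 0" "AE y in lborel. y \<in> ball x r \<longrightarrow> Q y" using assms by blast
    then have "ball x r \<in> F" "x \<in> ball x r" by (auto simp: F_def)
    then show "x \<in> \<Union>F'" unfolding F'(3) by blast
  qed
  ultimately show ?thesis by (auto elim!: eventually_mono)
qed

text \<open>The averages of \<open>u\<close> against the kernels \<open>kern r (|y - x|\<^sup>2)\<close> decrease in \<open>r\<close>, because the \<open>r\<close>-derivative of the kernel is a positive
  multiple of the Laplacian of a nonnegative bump.\<close>

locale superharmonic =
  fixes \<Omega> :: "(real^4) set" and u :: "real^4 \<Rightarrow> real"
  assumes opn: "open \<Omega>" and bdd: "bounded \<Omega>" and conn: "connected \<Omega>"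
    and um [measurable]: "u \<in> borel_measurable borel" and nonneg: "\<And>x. 0 \<le> u x"
    and out: "\<And>x. x \<notin> \<Omega> \<Longrightarrow> u x = 0" and W: "u \<in> W012 \<Omega>"
    and super: "\<And>\<psi>. \<psi> \<in> test_functions \<Omega> \<Longrightarrow> (\<And>x. 0 \<le> \<psi> x) \<Longrightarrow> (LINT x|lborel. u x * lap \<psi> x) \<le> 0"
begin

section \<open>Averages of superharmonic functions and positivity\<close>

definition avg :: "real^4 \<Rightarrow> real \<Rightarrow> real" where
  "avg x r = (LINT y|lborel. u y * kern r ((norm (y - x))\<^sup>2))"

lemma u_sqint: "sqint lborel u"
  by (rule W012_translation(1)[OF opn W um out])

lemma u_integrable: "integrable lborel u"
proof (rule Bochner_Integration.integrable_bound)
  have "emeasure lborel \<Omega> < \<infinity>" by (rule emeasure_bounded_finite[OF bdd])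
  then show "integrable lborel (\<lambda>x. indicator \<Omega> x + (norm (u x))\<^sup>2)"
    using opn sqint_integrable[OF u_sqint] by (intro Bochner_Integration.integrable_add integrable_real_indicator) auto
  show "AE x in lborel. norm (u x) \<le> norm (indicator \<Omega> x + (norm (u x))\<^sup>2)"
  proof (intro AE_I2)
    fix x
    have "2 * norm (u x) * 1 \<le> (norm (u x))\<^sup>2 + 1\<^sup>2" by (rule sum_squares_bound)
    then have "norm (u x) \<le> 1 + (norm (u x))\<^sup>2" using norm_ge_zero[of "u x"] by (simp only: mult_1_right power_one)
    then show "norm (u x) \<le> norm (indicator \<Omega> x + (norm (u x))\<^sup>2)"
      using out[of x] by (cases "x \<in> \<Omega>") auto
  qed
qed simp

lemma kern_measurable [measurable]: "kern r \<in> borel_measurable borel"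
  unfolding kern_def[abs_def] divide_inverse
  by (intro borel_measurable_continuous_onI continuous_intros continuous_on_compose2[OF continuous_bump[of UNIV]]) auto

lemma kern'_measurable [measurable]: "kern' r \<in> borel_measurable borel"
  unfolding kern'_def[abs_def] divide_inverse
  by (intro borel_measurable_continuous_onI continuous_intros continuous_on_compose2[OF continuous_bump[of UNIV]]) auto

lemma avg_integrable:
  assumes "r > 0" shows "integrable lborel (\<lambda>y. u y * kern r ((norm (y - x))\<^sup>2))"
proof (rule Bochner_Integration.integrable_bound)
  show "integrable lborel (\<lambda>y. u y * (2 / r ^ 4))" using u_integrable by simp
  show "AE y in lborel. norm (u y * kern r ((norm (y - x))\<^sup>2)) \<le> norm (u y * (2 / r ^ 4))"
    using kern_le[OF assms] kern_nonneg[OF assms] assms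
    by (intro AE_I2) (simp add: abs_mult mult_left_mono del: times_divide_eq_right)
qed measurable

lemma avg_nonneg: "r > 0 \<Longrightarrow> 0 \<le> avg x r"
  unfolding avg_def using nonneg kern_nonneg by (intro integral_nonneg_AE) auto

lemma avg_mono:
  assumes "0 < r" "r \<le> R" "cball x R \<subseteq> \<Omega>"
  shows "avg x R \<le> avg x r"
proof (rule DERIV_nonpos_imp_nonincreasing[OF assms(2)])
  fix t assume t: "r \<le> t" "t \<le> R"
  then have t0: "t > 0" using assms(1) by simp
  have "((\<lambda>r. LINT y|lborel. u y * kern r ((norm (y - x))\<^sup>2)) has_real_derivative
      (LINT y|lborel. u y * kern' t ((norm (y - x))\<^sup>2))) (at t)"
  \<comment> \<open>Within \<open>t / 2\<close> of \<open>t\<close> the radius stays above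
    \<open>t / 2\<close>, which makes the bound on the derivative uniform.\<close>
  proof (rule DERIV_under_integral[OF u_integrable, where e="t / 2" and C="80 / (t / 2) ^ 5"])
    fix r y assume "\<bar>r - t\<bar> < t / 2"
    then have r: "t / 2 < r" by linarith
    then have r0: "r > 0" using t0 by linarith
    show "integrable lborel (\<lambda>y. u y * kern r ((norm (y - x))\<^sup>2))" by (rule avg_integrable[OF r0])
    show "((\<lambda>r. kern r ((norm (y - x))\<^sup>2)) has_real_derivative kern' r ((norm (y - x))\<^sup>2)) (at r)"
      by (rule kern_has_derivative[OF r0])
    have "\<bar>kern' r ((norm (y - x))\<^sup>2)\<bar> \<le> 80 / r ^ 5" by (rule kern'_bound[OF r0]) simp
    also have "\<dots> \<le> 80 / (t / 2) ^ 5" using r t0 by (intro divide_left_mono power_mono mult_pos_pos zero_less_power) auto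
    finally show "\<bar>kern' r ((norm (y - x))\<^sup>2)\<bar> \<le> 80 / (t / 2) ^ 5" .
  qed (use t0 in \<open>simp, measurable\<close>)
  moreover have "(LINT y|lborel. u y * kern' t ((norm (y - x))\<^sup>2)) \<le> 0"
  proof -
    let ?\<psi> = "\<lambda>y. bump 0 (1 - (norm (y - x))\<^sup>2 / t\<^sup>2)"
    have "cball x t \<subseteq> \<Omega>" using assms(3) t by auto
    then have "(LINT y|lborel. u y * lap ?\<psi> y) \<le> 0"
      using radial_bump(1)[OF t0] by (intro super) auto
    also have "(LINT y|lborel. u y * lap ?\<psi> y) = (LINT y|lborel. 2 * t ^ 3 * (u y * kern' t ((norm (y - x))\<^sup>2)))"
      unfolding radial_bump(2)[OF t0] by (simp add: mult_ac)
    also have "\<dots> = 2 * t ^ 3 * (LINT y|lborel. u y * kern' t ((norm (y - x))\<^sup>2))" by simp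
    finally show ?thesis using t0 by (simp add: mult_le_0_iff)
  qed
  ultimately show "\<exists>d. DERIV (avg x) t :> d \<and> d \<le> 0" unfolding avg_def[abs_def] by blast
qed

lemma avg_nn:
  assumes "r > 0"
  shows "ennreal (avg x r) = (\<integral>\<^sup>+z. ennreal (u (z + x) * kern r ((norm z)\<^sup>2)) \<partial>lborel)"
proof -
  have "ennreal (avg x r) = (\<integral>\<^sup>+y. ennreal (u y * kern r ((norm (y - x))\<^sup>2)) \<partial>lborel)"
    unfolding avg_def using nonneg kern_nonneg[OF assms]
    by (intro nn_integral_eq_integral[symmetric] avg_integrable[OF assms]) auto
  also have "\<dots> = (\<integral>\<^sup>+z. ennreal (u (x + z) * kern r ((norm (x + z - x))\<^sup>2)) \<partial>lborel)"
    by (rule nn_integral_translate[symmetric, of "\<lambda>y. ennreal (u y * kern r ((norm (y - x))\<^sup>2))"]) measurable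
  finally show ?thesis by (simp add: add.commute)
qed

text \<open>On \<open>Z\<close> the function vanishes, so \<open>u (z + x)\<close> is its own
  increment and the translation estimate applies. The kernel lives on shifts of norm at most
  \<open>r\<close> and is at most \<open>2 / r ^ 4\<close>, and the ball has volume at most
  \<open>16 * r ^ 4\<close>: together \<open>32 * r\<close>.\<close>

lemma zero_set_average:
  assumes [measurable]: "Z \<in> sets borel" and Z: "emeasure lborel Z < \<infinity>" "\<And>x. x \<in> Z \<Longrightarrow> u x = 0" and r: "r > 0"
  shows "(\<integral>\<^sup>+x. indicator Z x * ennreal (avg x r) \<partial>lborel) \<le>
    ennreal (32 * (l2 lborel (indicator Z :: real^4 \<Rightarrow> real) * Dnorm \<Omega> u) * r)"
proof -
  define c where "c = l2 lborel (indicator Z :: real^4 \<Rightarrow> real) * Dnorm \<Omega> u"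
  have c0: "c \<ge> 0" by (simp add: c_def)
  have sZ: "sqint lborel (indicator Z :: real^4 \<Rightarrow> real)"
    using Z(1) by (simp add: sqint_def indicator_idem integrable_real_indicator)
  have inner: "(\<integral>\<^sup>+x. ennreal (indicator Z x * u (z + x)) \<partial>lborel) \<le> ennreal (c * norm z)" for z
  proof -
    have sd: "sqint lborel (\<lambda>x. \<bar>u (z + x) - u x\<bar>)"
      using sqint_norm[OF sqint_diff[OF sqint_translate(1)[OF u_sqint] u_sqint], of z] by simp
    have i: "integrable lborel (\<lambda>x. indicator Z x * \<bar>u (z + x) - u x\<bar>)" by (rule sqint_integrable_mult[OF sZ sd])
    have "(\<integral>\<^sup>+x. ennreal (indicator Z x * u (z + x)) \<partial>lborel) \<le> (\<integral>\<^sup>+x. ennreal (indicator Z x * \<bar>u (z + x) - u x\<bar>) \<partial>lborel)"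
      using Z(2) nonneg by (intro nn_integral_mono ennreal_leI) (auto simp: indicator_def)
    also have "\<dots> = ennreal (LINT x|lborel. indicator Z x * \<bar>u (z + x) - u x\<bar>)"
      by (rule nn_integral_eq_integral[OF i]) auto
    also have "\<dots> \<le> ennreal (c * norm z)"
    proof (rule ennreal_leI)
      have "(LINT x|lborel. indicator Z x * \<bar>u (z + x) - u x\<bar>) \<le> l2 lborel (indicator Z :: real^4 \<Rightarrow> real) * l2 lborel (\<lambda>x. \<bar>u (z + x) - u x\<bar>)"
        using l2_Cauchy_Schwarz_mult[OF sZ sd] by linarith
      also have "l2 lborel (\<lambda>x. \<bar>u (z + x) - u x\<bar>) = l2 lborel (\<lambda>x. u (z + x) - u x)" by (simp add: l2_def)
      also have "l2 lborel (indicator Z :: real^4 \<Rightarrow> real) * l2 lborel (\<lambda>x. u (z + x) - u x)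
          \<le> l2 lborel (indicator Z :: real^4 \<Rightarrow> real) * (norm z * Dnorm \<Omega> u)"
        by (intro mult_left_mono W012_translation(2)[OF opn W um out]) auto
      finally show "(LINT x|lborel. indicator Z x * \<bar>u (z + x) - u x\<bar>) \<le> c * norm z" by (simp add: c_def mult_ac)
    qed
    finally show ?thesis .
  qed
  have "(\<integral>\<^sup>+x. indicator Z x * ennreal (avg x r) \<partial>lborel) =
      (\<integral>\<^sup>+x. \<integral>\<^sup>+z. ennreal (kern r ((norm z)\<^sup>2)) * ennreal (indicator Z x * u (z + x)) \<partial>lborel \<partial>lborel)"
  proof (rule nn_integral_cong)
    fix x
    have "indicator Z x * ennreal (avg x r) = (\<integral>\<^sup>+z. indicator Z x * ennreal (u (z + x) * kern r ((norm z)\<^sup>2)) \<partial>lborel)"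
      unfolding avg_nn[OF r] by (rule nn_integral_cmult[symmetric]) measurable
    also have "\<dots> = (\<integral>\<^sup>+z. ennreal (kern r ((norm z)\<^sup>2)) * ennreal (indicator Z x * u (z + x)) \<partial>lborel)"
      using nonneg kern_nonneg[OF r]
      by (intro nn_integral_cong) (auto simp: indicator_def ennreal_mult mult.commute)
    finally show "indicator Z x * ennreal (avg x r) =
      (\<integral>\<^sup>+z. ennreal (kern r ((norm z)\<^sup>2)) * ennreal (indicator Z x * u (z + x)) \<partial>lborel)" .
  qed
  also have "\<dots> = (\<integral>\<^sup>+z. \<integral>\<^sup>+x. ennreal (kern r ((norm z)\<^sup>2)) * ennreal (indicator Z x * u (z + x)) \<partial>lborel \<partial>lborel)"
    by (rule lborel_pair.Fubini'[symmetric]) measurable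
  also have "\<dots> = (\<integral>\<^sup>+z. ennreal (kern r ((norm z)\<^sup>2)) * (\<integral>\<^sup>+x. ennreal (indicator Z x * u (z + x)) \<partial>lborel) \<partial>lborel)"
    by (intro nn_integral_cong nn_integral_cmult) measurable
  also have "\<dots> \<le> (\<integral>\<^sup>+z. ennreal (2 / r ^ 4 * (c * r)) * indicator (cball 0 r) (z :: real^4) \<partial>lborel)"
  proof (intro nn_integral_mono)
    fix z :: "real^4"
    show "ennreal (kern r ((norm z)\<^sup>2)) * (\<integral>\<^sup>+x. ennreal (indicator Z x * u (z + x)) \<partial>lborel) \<le>
        ennreal (2 / r ^ 4 * (c * r)) * indicator (cball 0 r) z"
    proof (cases "norm z \<le> r")
      case True
      have "ennreal (kern r ((norm z)\<^sup>2)) * (\<integral>\<^sup>+x. ennreal (indicator Z x * u (z + x)) \<partial>lborel) \<le>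
          ennreal (2 / r ^ 4) * ennreal (c * r)"
      proof (intro mult_mono ennreal_leI kern_le[OF r])
        show "(\<integral>\<^sup>+x. ennreal (indicator Z x * u (z + x)) \<partial>lborel) \<le> ennreal (c * r)"
          by (rule order_trans[OF inner]) (use True c0 in \<open>auto intro!: ennreal_leI mult_left_mono\<close>)
      qed auto
      also have "\<dots> = ennreal (2 / r ^ 4 * (c * r))" using r c0 by (intro ennreal_mult[symmetric]) auto
      finally show ?thesis using True by simp
    next
      case False
      then have "r\<^sup>2 < (norm z)\<^sup>2" using r by (intro power_strict_mono) auto
      then show ?thesis using kern_outside[OF r] by simp
    qed
  qed
  also have "\<dots> = ennreal (2 / r ^ 4 * (c * r)) * emeasure lborel (cball 0 r :: (real^4) set)"
    by (rule nn_integral_cmult_indicator) simp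
  also have "\<dots> \<le> ennreal (2 / r ^ 4 * (c * r)) * ennreal (16 * r ^ 4)"
    by (intro mult_left_mono emeasure_cball4_le r) simp
  also have "\<dots> = ennreal (32 * c * r)"
    using r c0 by (simp add: ennreal_mult[symmetric])
  finally show ?thesis unfolding c_def by simp
qed

text \<open>The integral of \<open>avg x R\<close> over the zero set \<open>Z\<close> is at most
  that of \<open>avg x r\<close> for smaller \<open>r\<close>, which is of order \<open>r\<close>;
  so it vanishes. As \<open>Z\<close> has positive measure, some point of \<open>Z\<close> has
  average 0, and the ball of radius \<open>R\<close> about it contains \<open>x0\<close>. The radius
  \<open>2 * R\<close> keeps all these balls inside \<open>\<Omega>\<close>.\<close>

lemma vanishes_near_zero_set:
  assumes R: "R > 0" and sub: "cball x0 (2 * R) \<subseteq> \<Omega>"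
    and nz: "\<not> (AE x in lborel. x \<in> ball x0 R \<longrightarrow> u x \<noteq> 0)"
  shows "\<exists>r>0. AE y in lborel. y \<in> ball x0 r \<longrightarrow> u y = 0"
proof -
  define Z where "Z = {x \<in> ball x0 R. u x = 0}"
  have [measurable]: "Z \<in> sets borel"
  proof -
    have "Z = ball x0 R \<inter> {x \<in> space borel. u x = 0}" by (auto simp: Z_def)
    also have "\<dots> \<in> sets borel" by measurable
    finally show ?thesis .
  qed
  have "emeasure lborel Z \<le> emeasure lborel (ball x0 R)" by (rule emeasure_mono) (auto simp: Z_def)
  then have Zfin: "emeasure lborel Z < \<infinity>" using emeasure_lborel_ball_finite[of x0 R] by (auto intro: le_less_trans)
  have cb: "cball x R \<subseteq> \<Omega>" if "x \<in> Z" for x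
  proof
    fix y assume "y \<in> cball x R"
    then have "dist x0 y \<le> 2 * R" using that dist_triangle[of x0 y x] by (auto simp: Z_def)
    then show "y \<in> \<Omega>" using sub by auto
  qed
  define c where "c = l2 lborel (indicator Z :: real^4 \<Rightarrow> real) * Dnorm \<Omega> u"
  let ?W = "\<integral>\<^sup>+x. indicator Z x * ennreal (avg x R) \<partial>lborel"
  have le: "?W \<le> ennreal (32 * c * r)" if "0 < r" "r \<le> R" for r
  proof -
    have "?W \<le> (\<integral>\<^sup>+x. indicator Z x * ennreal (avg x r) \<partial>lborel)"
      using avg_mono[OF that cb] by (intro nn_integral_mono) (auto simp: indicator_def intro: ennreal_leI)
    also have "\<dots> \<le> ennreal (32 * c * r)"
      unfolding c_def by (rule zero_set_average) (use Zfin that in \<open>auto simp: Z_def[symmetric]\<close>, simp add: Z_def)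
    finally show ?thesis .
  qed
  have "?W \<le> 0"
  proof -
    have "(\<lambda>n. ennreal (32 * c * (R * inverse (real (Suc n))))) \<longlonglongrightarrow> ennreal (32 * c * (R * 0))"
      by (intro tendsto_intros LIMSEQ_inverse_real_of_nat)
    moreover have "?W \<le> ennreal (32 * c * (R * inverse (real (Suc n))))" for n
      using R by (intro le) (auto simp: field_simps)
    ultimately show ?thesis using LIMSEQ_le_const by fastforce
  qed
  then have "AE x in lborel. indicator Z x * ennreal (avg x R) = 0"
    by (subst nn_integral_0_iff_AE[symmetric]) (simp_all add: avg_nn[OF R])
  moreover have "\<not> (AE x in lborel. x \<notin> Z)"
  proof
    assume "AE x in lborel. x \<notin> Z"
    then have "AE x in lborel. x \<in> ball x0 R \<longrightarrow> u x \<noteq> 0" by eventually_elim (auto simp: Z_def)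
    with nz show False by blast
  qed
  ultimately have "\<exists>x\<in>Z. ennreal (avg x R) = 0"
  proof -
    assume ae: "AE x in lborel. indicator Z x * ennreal (avg x R) = 0" and nn: "\<not> (AE x in lborel. x \<notin> Z)"
    show ?thesis
    proof (rule ccontr)
      assume neg: "\<not> ?thesis"
      have "AE x in lborel. x \<notin> Z"
        using ae by eventually_elim (use neg in \<open>auto simp: indicator_def\<close>)
      with nn show False by blast
    qed
  qed
  then obtain x where x: "x \<in> Z" "ennreal (avg x R) = 0" by blast
  then have "avg x R = 0" using avg_nonneg[OF R, of x] by simp
  then have "AE y in lborel. u y * kern R ((norm (y - x))\<^sup>2) = 0"
    unfolding avg_def using integral_nonneg_eq_0_iff_AE[OF avg_integrable[OF R, of x]] nonneg kern_nonneg[OF R] by auto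
  then have ae: "AE y in lborel. y \<in> ball x R \<longrightarrow> u y = 0"
  proof eventually_elim
    case (elim y)
    show ?case
    proof
      assume "y \<in> ball x R"
      then have "(norm (y - x))\<^sup>2 < R\<^sup>2" by (intro power_strict_mono) (auto simp: dist_norm norm_minus_commute)
      then show "u y = 0" using elim kern_pos[OF R] by fastforce
    qed
  qed
  have "x0 \<in> ball x R" using x(1) by (simp add: Z_def dist_commute)
  then obtain r where "r > 0" "ball x0 r \<subseteq> ball x R" using open_ball open_contains_ball by metis
  then show ?thesis using ae by (intro exI[of _ r]) (auto elim!: eventually_mono)
qed

text \<open>Around each point of \<open>\<Omega>\<close> the function either vanishes a.e. or is
  positive a.e.; both alternatives describe open sets, and connectedness leaves only one of
  them.\<close>

theorem strong_maximum_principle: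
  assumes nz: "\<not> (AE x in lborel. u x = 0)"
  shows "AE x in lborel. x \<in> \<Omega> \<longrightarrow> u x > 0"
proof -
  define A where "A = {x \<in> \<Omega>. \<exists>r>0. AE y in lborel. y \<in> ball x r \<longrightarrow> u y = 0}"
  define B where "B = {x \<in> \<Omega>. \<exists>r>0. AE y in lborel. y \<in> ball x r \<longrightarrow> u y > 0}"
  have op: "open {x \<in> \<Omega>. \<exists>r>0. AE y in lborel. y \<in> ball x r \<longrightarrow> Q (u y)}" for Q
  proof (subst open_contains_ball, intro ballI)
    fix x assume "x \<in> {x \<in> \<Omega>. \<exists>r>0. AE y in lborel. y \<in> ball x r \<longrightarrow> Q (u y)}"
    then obtain r where r: "x \<in> \<Omega>" "r > 0" "AE y in lborel. y \<in> ball x r \<longrightarrow> Q (u y)" by blast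
    obtain s where s: "s > 0" "ball x s \<subseteq> \<Omega>" using opn r(1) open_contains_ball by blast
    have "z \<in> \<Omega> \<and> (\<exists>r>0. AE y in lborel. y \<in> ball z r \<longrightarrow> Q (u y))" if z: "z \<in> ball x (min r s)" for z
    proof -
      have "z \<in> ball x r" using z by simp
      then obtain t where "t > 0" "ball z t \<subseteq> ball x r" using open_ball open_contains_ball by metis
      then have "AE y in lborel. y \<in> ball z t \<longrightarrow> Q (u y)" using r(3) by (auto elim!: eventually_mono)
      then show ?thesis using \<open>t > 0\<close> z s(2) by auto
    qed
    then show "\<exists>e>0. ball x e \<subseteq> {x \<in> \<Omega>. \<exists>r>0. AE y in lborel. y \<in> ball x r \<longrightarrow> Q (u y)}"
      using r(2) s(1) by (intro exI[of _ "min r s"]) auto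
  qed
  have oA: "open A" unfolding A_def by (rule op)
  have oB: "open B" unfolding B_def by (rule op)
  have disj: "A \<inter> B \<inter> \<Omega> = {}"
  proof (rule ccontr)
    assume "A \<inter> B \<inter> \<Omega> \<noteq> {}"
    then obtain x where "x \<in> A" "x \<in> B" by blast
    then obtain r s where r: "r > 0" "AE y in lborel. y \<in> ball x r \<longrightarrow> u y = 0"
      and s: "s > 0" "AE y in lborel. y \<in> ball x s \<longrightarrow> u y > 0" unfolding A_def B_def by blast
    have "AE y in lborel. y \<in> - ball x (min r s)"
      using r(2) s(2) by eventually_elim auto
    then have "AE y in lebesgue. y \<in> - ball x (min r s)" by (rule AE_completion)
    then have "x \<in> - ball x (min r s)" by (intro mem_closed_if_AE_lebesgue) auto
    then show False using r(1) s(1) by simp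
  qed
  have cov: "\<Omega> \<subseteq> A \<union> B"
  proof
    fix x assume x: "x \<in> \<Omega>"
    then obtain e where e: "e > 0" "cball x e \<subseteq> \<Omega>" using opn open_contains_cball by blast
    show "x \<in> A \<union> B"
    proof (cases "AE y in lborel. y \<in> ball x (e / 2) \<longrightarrow> u y \<noteq> 0")
      case True
      then have "AE y in lborel. y \<in> ball x (e / 2) \<longrightarrow> u y > 0"
        by eventually_elim (use nonneg in \<open>auto simp: less_le\<close>)
      then have "x \<in> B" using x e(1) half_gt_zero unfolding B_def by blast
      then show ?thesis by blast
    next
      case False
      then have "x \<in> A" using vanishes_near_zero_set[of "e / 2" x] e x unfolding A_def by simp
      then show ?thesis by blast
    qed
  qed
  have "A \<inter> \<Omega> = {} \<or> B \<inter> \<Omega> = {}"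
    by (rule connectedD[OF conn oA oB disj cov])
  then show ?thesis
  proof
    assume "A \<inter> \<Omega> = {}"
    then have "x \<in> B" if "x \<in> \<Omega>" for x using cov that by blast
    then show ?thesis unfolding B_def by (intro locally_AE_imp_AE) blast
  next
    assume "B \<inter> \<Omega> = {}"
    then have "x \<in> A" if "x \<in> \<Omega>" for x using cov that by blast
    then have "AE x in lborel. x \<in> \<Omega> \<longrightarrow> u x = 0" unfolding A_def by (intro locally_AE_imp_AE) blast
    then have "AE x in lborel. u x = 0" by eventually_elim (use out in blast)
    with nz show ?thesis by blast
  qed
qed

end

theorem theorem4:
  fixes \<Omega> :: "(real^4) set" and a b p :: real and \<sigma> :: "nat \<Rightarrow> real"
  assumes "smooth_bounded_domain \<Omega>"
    and "a > 0" and "2 < p" and "p < 4"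
    and "b > 1 / (Sobolev_const \<Omega>)\<^sup>2"
    and "\<And>n. 0 < \<sigma> n \<and> \<sigma> n < 4 - p"
    and "\<sigma> \<longlonglongrightarrow> 0"
  shows "(\<exists>lam0. negative_threshold \<Omega> a b p \<sigma> lam0) \<and>
    (\<forall>lam0. negative_threshold \<Omega> a b p \<sigma> lam0 \<longrightarrow>
      (\<forall>lam>lam0. \<exists>u. weak_solution \<Omega> a b p lam u \<and>
        (\<forall>v\<in>W012 \<Omega>. energy \<Omega> a b p lam u \<le> energy \<Omega> a b p lam v)))"
proof -
  have dom: "open \<Omega>" "bounded \<Omega>" "\<Omega> \<noteq> {}" "connected \<Omega>"
    using assms(1) by (auto simp: smooth_bounded_domain_def)
  interpret critical_kirchhoff \<Omega> a b p
    using dom assms by unfold_locales auto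
  have "\<exists>u. weak_solution \<Omega> a b p lam u \<and>
        (\<forall>v\<in>W012 \<Omega>. energy \<Omega> a b p lam u \<le> energy \<Omega> a b p lam v)"
    if thr: "negative_threshold \<Omega> a b p \<sigma> lam0" and lam: "lam > lam0" for lam0 lam
  proof -
    have lam_pos: "lam > 0" using thr lam by (auto simp: negative_threshold_def)
    obtain u where u: "u \<in> W012 \<Omega>" "u \<in> borel_measurable borel" "\<And>x. 0 \<le> u x" "\<And>x. x \<notin> \<Omega> \<Longrightarrow> u x = 0"
      "\<And>v. v \<in> W012 \<Omega> \<Longrightarrow> energy \<Omega> a b p lam u \<le> energy \<Omega> a b p lam v"
      using minimizer_exists[OF lam_pos] by metis
    have EL: "(a + b * (D u)\<^sup>2) * (LINT x|M. wgrad \<Omega> u x \<bullet> wgrad \<Omega> v x)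
        - (LINT x|M. u x ^ 3 * v x) - lam * (LINT x|M. u x powr (p - 1) * v x) = 0" if "v \<in> W012 \<Omega>" for v
      by (rule Euler_Lagrange[OF lam_pos u(1,3) _ that]) (rule u(5))
    obtain v where "v \<in> W012 \<Omega>" "energy \<Omega> a b p lam v < 0"
      using negative_energy[OF assms(6,7) thr lam] by blast
    then have neg: "energy \<Omega> a b p lam u < 0" using u(5) by (meson le_less_trans)
    \<comment> \<open>For a function vanishing a.e. the integrals \<open>X\<close> and
      \<open>P\<close> are 0, and the remaining \<open>D\<close>-terms are nonnegative, against
      \<open>neg\<close>.\<close>
    have nz: "\<not> (AE x in lborel. u x = 0)"
    proof
      assume "AE x in lborel. u x = 0"
      then have "AE x in lebesgue. u x = 0" by (rule AE_completion)
      then have ae: "AE x in M. u x = 0" using dom(1) by (auto simp: AE_restrict_space_iff elim: eventually_mono)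
      have um: "u \<in> borel_measurable M" by (rule W012_measurable[OF u(1)])
      have "X u = (LINT x|M. 0)" unfolding X_def
        by (rule integral_cong_AE) (use um ae in \<open>auto elim: eventually_mono\<close>)
      moreover have "P p u = (LINT x|M. 0)" unfolding P_def
        by (rule integral_cong_AE) (use um ae in \<open>auto elim: eventually_mono\<close>)
      ultimately have "energy \<Omega> a b p lam u \<ge> 0" unfolding energy_eq using a_pos b_pos by simp
      with neg show False by simp
    qed
    have super: "(LINT x|lborel. u x * lap \<psi> x) \<le> 0" if \<psi>: "\<psi> \<in> test_functions \<Omega>" "\<And>x. 0 \<le> \<psi> x" for \<psi>
    proof -
      have W\<psi>: "\<psi> \<in> W012 \<Omega>" by (rule test_W[OF \<psi>(1)])
      have "0 \<le> (LINT x|M. u x ^ 3 * \<psi> x)" "0 \<le> (LINT x|M. u x powr (p - 1) * \<psi> x)"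
        using u(3) \<psi>(2) by (auto intro!: integral_nonneg_AE)
      \<comment> \<open>Against a nonnegative test function the source terms are nonnegative, so the
        equation makes the gradient side nonnegative too: \<open>u\<close> is weakly
        superharmonic.\<close>
      then have "0 \<le> (a + b * (D u)\<^sup>2) * (LINT x|M. wgrad \<Omega> u x \<bullet> wgrad \<Omega> \<psi> x)"
        using EL[OF W\<psi>] lam_pos by (smt (verit) mult_nonneg_nonneg)
      moreover have "a + b * (D u)\<^sup>2 > 0" using a_pos b_pos by (simp add: add_pos_nonneg)
      ultimately have "0 \<le> (LINT x|M. wgrad \<Omega> u x \<bullet> wgrad \<Omega> \<psi> x)" by (simp add: zero_le_mult_iff)
      also have "(LINT x|M. wgrad \<Omega> u x \<bullet> wgrad \<Omega> \<psi> x) = (LINT x|M. wgrad \<Omega> u x \<bullet> grad \<psi> x)"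
      proof (rule integral_cong_AE)
        have [measurable]: "wgrad \<Omega> u \<in> borel_measurable M" "wgrad \<Omega> \<psi> \<in> borel_measurable M" "grad \<psi> \<in> borel_measurable M"
          using sqint_measurable W012_D(2)[OF dom(1)] u(1) W\<psi> test_sqint(2)[OF \<psi>(1) dom(1)] by blast+
        show "(\<lambda>x. wgrad \<Omega> u x \<bullet> wgrad \<Omega> \<psi> x) \<in> borel_measurable M" "(\<lambda>x. wgrad \<Omega> u x \<bullet> grad \<psi> x) \<in> borel_measurable M"
          by measurable
        show "AE x in M. wgrad \<Omega> u x \<bullet> wgrad \<Omega> \<psi> x = wgrad \<Omega> u x \<bullet> grad \<psi> x"
          using test_W012(2)[OF dom(1) \<psi>(1)] by eventually_elim simp
      qed
      also have "\<dots> = - (LINT x|M. u x * lap \<psi> x)"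
        by (rule weak_gradient_lap[OF dom(1) W012_D(3,1,2)[OF dom(1) u(1)] \<psi>(1)])
      also have "(LINT x|M. u x * lap \<psi> x) = (LINT x|lborel. u x * lap \<psi> x)"
        by (rule lebesgue_on_integral_eq(2)) (use u(2,4) dom(1) test_integrable(2)[OF test_lap[OF \<psi>(1)]] in auto)
      finally show ?thesis by simp
    qed
    interpret superharmonic \<Omega> u
      using dom u super by unfold_locales auto
    have "AE x in lborel. x \<in> \<Omega> \<longrightarrow> u x > 0" by (rule strong_maximum_principle[OF nz])
    then have "AE x in lebesgue. x \<in> \<Omega> \<longrightarrow> u x > 0" by (rule AE_completion)
    then have "AE x in M. u x > 0" using dom(1) by (simp add: AE_restrict_space_iff)
    then have "weak_solution \<Omega> a b p lam u"
      unfolding weak_solution_def Dnorm_sq using u(1) EL by blast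
    then show ?thesis using u(5) by blast
  qed
  then show ?thesis using exists_threshold[of \<sigma>, OF assms(6)] by blast
qed

end
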